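(* Let $n\ge 1$. Let $\mathsf{D}_{\mathrm{Sp}(2n)}$ be the specialisation of the Brauer category at $\delta=-2n$, let $\mathsf{T}_{\mathrm{Sp}(2n)}$ be the category of invariant tensors of the defining representation $V$ of $\mathrm{Sp}(2n)$, and let $\mathrm{Pf}^{(n)}$ be the ideal of $\mathsf{D}_{\mathrm{Sp}(2n)}$ of diagrammatic Pfaffians of order $2(n+1)$, i.e. the ideal generated by the sum $\mathrm{Pf}\in \mathrm{Hom}_{\mathsf{D}_{\mathrm{Sp}(2n)}}(0,2(n+1))$ of all perfect matchings of $\{1,\dots,2(n+1)\}$, as described in the context. Then the categories $\mathsf{D}_{\mathrm{Sp}(2n)}/\mathrm{Pf}^{(n)}$ and $\mathsf{T}_{\mathrm{Sp}(2n)}$ are isomorphic. Moreover, for every $r\ge 0$, the set $X(r,n)$ of $(n+1)$-noncrossing perfect matchings of $\{1,\dots,2r\}$ is (via the images in the quotient) a basis of $\mathrm{Hom}_{\mathsf{D}_{\mathrm{Sp}(2n)}/\mathrm{Pf}^{(n)}}(0,2r)$.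
   Context: Brauer category. For $r,s\in\mathbb{N}=\{0,1,2,\dots\}$ let $D(r,s)$ be the set of perfect matchings of $[r]\amalg[s]$ (called diagrams), drawn as $(r+s)/2$ strands in a rectangle with $r$ endpoints on the top edge and $s$ endpoints on the bottom edge; $D(r,s)=\emptyset$ if $r+s$ is odd. For $x\in D(r,s)$, $y\in D(s,t)$, identify the points on the bottom edge of $x$ with the points on the top edge of $y$; let $c(x,y)$ be the number of closed loops in the resulting picture and $x\circ y\in D(r,t)$ the perfect matching obtained by removing all closed loops. The category $\mathsf{D}_{\mathrm{Sp}(2n)}$ has objects $\mathbb{N}$, $\mathrm{Hom}_{\mathsf{D}_{\mathrm{Sp}(2n)}}(r,s)$ is the complex vector space with basis $D(r,s)$, and composition is the bilinear extension of $x\cdot y=\delta^{c(x,y)}\,x\circ y$ with $\delta=-2n$. An element of $D(0,2r)$ is the same thing as a perfect matching of $\{1,\dots,2r\}$. Category of invariant tensors. $V$ is a $2n$-dimensional complex vector space with a non-degenerate skew-symmetric bilinear form and $\mathrm{Sp}(2n)=\mathrm{Sp}(V)$ is the group of linear maps preserving it. $\mathsf{T}_{\mathrm{Sp}(2n)}$ has objects $\mathbb{N}$, and $\mathrm{Hom}_{\mathsf{T}_{\mathrm{Sp}(2n)}}(r,s)=\mathrm{Hom}_{\mathrm{Sp}(2n)}(V^{\otimes r},V^{\otimes s})$, the space of $\mathrm{Sp}(2n)$-equivariant linear maps (the group acting diagonally), with the usual composition, the morphism $r\to s\to t$ being "first $r\to s$, then $s\to t$". The ideal $\mathrm{Pf}^{(n)}$.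 For a subset $S\subseteq[r]\amalg[s]$ with $2(n+1)$ elements and a perfect matching $f$ of $([r]\amalg[s])\setminus S$, the diagrammatic Pfaffian of order $2(n+1)$ corresponding to $f$ is $\mathrm{Pf}(f)=\sum_{m}(m\cup f)\in\mathrm{Hom}_{\mathsf{D}_{\mathrm{Sp}(2n)}}(r,s)$, where $m$ runs over all perfect matchings of $S$. The component $\mathrm{Pf}^{(n)}(r,s)\subseteq\mathrm{Hom}_{\mathsf{D}_{\mathrm{Sp}(2n)}}(r,s)$ of the ideal $\mathrm{Pf}^{(n)}$ is the linear span of all $\mathrm{Pf}(f)$, where $f$ is a perfect matching of a subset of $[r]\amalg[s]$ of cardinality $r+s-2(n+1)$ (so it is zero if there are no such $f$). The quotient category $\mathsf{D}_{\mathrm{Sp}(2n)}/\mathrm{Pf}^{(n)}$ has objects $\mathbb{N}$ and morphism spaces $\mathrm{Hom}_{\mathsf{D}_{\mathrm{Sp}(2n)}}(r,s)/\mathrm{Pf}^{(n)}(r,s)$. A perfect matching of $\{1,\dots,2r\}$ is $(n+1)$-noncrossing if it does not contain $n+1$ pairs $(a_1,b_1),\dots,(a_{n+1},b_{n+1})$ with $a_1<\dots<a_{n+1}<b_1<\dots<b_{n+1}$. *)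

theory Defs
  imports
    Complex_Main
    "HOL-Library.Disjoint_Sets"
    "HOL-Library.FuncSet"
    "HOL-Algebra.AbelCoset"
    "Jordan_Normal_Form.VS_Connect"
begin

section \<open>Complex vector spaces, free vector spaces and quotients\<close>

text \<open>
  Vector spaces are \<open>module\<close> records over the field of complex numbers. Such a record extends a ring
  record; its fields \<open>mult\<close> and \<open>one\<close> play no role in the module axioms.
\<close>

abbreviation complex_ring :: "complex ring" where
  "complex_ring \<equiv> class_ring"

abbreviation vspan :: "(complex, 'a) module \<Rightarrow> 'a set \<Rightarrow> 'a set" where
  "vspan M S \<equiv> LinearCombinations.module.span complex_ring M S"

abbreviation linear_maps ::
    "(complex, 'a) module \<Rightarrow> (complex, 'b) module \<Rightarrow> ('a \<Rightarrow> 'b) set" where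
  "linear_maps M N \<equiv> LinearCombinations.module_hom complex_ring M N"

definition free_space :: "'b set \<Rightarrow> (complex, 'b \<Rightarrow> complex) module" where
  "free_space X =
    \<lparr>carrier = {f. finite {x. f x \<noteq> 0} \<and> {x. f x \<noteq> 0} \<subseteq> X},
     mult = undefined, one = undefined,
     zero = (\<lambda>_. 0), add = (\<lambda>f g x. f x + g x), smult = (\<lambda>c f x. c * f x)\<rparr>"

definition single :: "'b \<Rightarrow> 'b \<Rightarrow> complex" where
  "single x = (\<lambda>y. if y = x then 1 else 0)"

text \<open>The value at \<open>f\<close> of the linear extension to a free space of a map \<open>\<phi>\<close> on its basis.\<close>

definition lin_ext :: "(complex, 'a) module \<Rightarrow> ('b \<Rightarrow> 'a) \<Rightarrow> ('b \<Rightarrow> complex) \<Rightarrow> 'a" where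
  "lin_ext M \<phi> f = (\<Oplus>\<^bsub>M\<^esub>x\<in>{x. f x \<noteq> 0}. f x \<odot>\<^bsub>M\<^esub> \<phi> x)"

text \<open>
  For a subspace \<open>U\<close> and a coset \<open>A\<close>, all members of the union in the scalar multiplication coincide.
  (The image of \<open>A\<close> under multiplication by \<open>c\<close> would be wrong for \<open>c = 0\<close>.)
\<close>

definition quot_space :: "(complex, 'a) module \<Rightarrow> 'a set \<Rightarrow> (complex, 'a set) module" where
  "quot_space M U =
    \<lparr>carrier = a_rcosets\<^bsub>M\<^esub> U,
     mult = undefined, one = undefined,
     zero = U, add = set_add M, smult = (\<lambda>c A. \<Union>a\<in>A. U +>\<^bsub>M\<^esub> (c \<odot>\<^bsub>M\<^esub> a))\<rparr>"


section \<open>Linear categories\<close>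

text \<open>Every element of the type \<open>'o\<close> is an object. \<open>Comp C r s t f g\<close> is ``first \<open>f : r \<rightarrow> s\<close>, then
  \<open>g : s \<rightarrow> t\<close>''.\<close>

record ('o, 'm) lincat =
  Hom :: "'o \<Rightarrow> 'o \<Rightarrow> (complex, 'm) module"
  Comp :: "'o \<Rightarrow> 'o \<Rightarrow> 'o \<Rightarrow> 'm \<Rightarrow> 'm \<Rightarrow> 'm"
  Ident :: "'o \<Rightarrow> 'm"

locale linear_category =
  fixes C :: "('o, 'm) lincat"
  assumes Hom_vectorspace: "vectorspace complex_ring (Hom C r s)"
    and Comp_linear_left:
      "g \<in> carrier (Hom C s t) \<Longrightarrow>
        (\<lambda>f. Comp C r s t f g) \<in> linear_maps (Hom C r s) (Hom C r t)"
    and Comp_linear_right: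
      "f \<in> carrier (Hom C r s) \<Longrightarrow>
        (\<lambda>g. Comp C r s t f g) \<in> linear_maps (Hom C s t) (Hom C r t)"
    and Comp_assoc:
      "\<lbrakk>f \<in> carrier (Hom C r s); g \<in> carrier (Hom C s t); h \<in> carrier (Hom C t u)\<rbrakk> \<Longrightarrow>
        Comp C r t u (Comp C r s t f g) h = Comp C r s u f (Comp C s t u g h)"
    and Ident_closed: "Ident C r \<in> carrier (Hom C r r)"
    and Ident_left: "f \<in> carrier (Hom C r s) \<Longrightarrow> Comp C r r s (Ident C r) f = f"
    and Ident_right: "f \<in> carrier (Hom C r s) \<Longrightarrow> Comp C r s s f (Ident C s) = f"

definition isomorphic_lincat :: "('o, 'm) lincat \<Rightarrow> ('p, 'k) lincat \<Rightarrow> bool" where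
  "isomorphic_lincat C D \<longleftrightarrow>
    linear_category C \<and> linear_category D \<and>
    (\<exists>(F\<^sub>0 :: 'o \<Rightarrow> 'p) (F :: 'o \<Rightarrow> 'o \<Rightarrow> 'm \<Rightarrow> 'k).
      bij F\<^sub>0 \<and>
      (\<forall>r s. F r s \<in> linear_maps (Hom C r s) (Hom D (F\<^sub>0 r) (F\<^sub>0 s)) \<and>
             bij_betw (F r s) (carrier (Hom C r s)) (carrier (Hom D (F\<^sub>0 r) (F\<^sub>0 s)))) \<and>
      (\<forall>r. F r r (Ident C r) = Ident D (F\<^sub>0 r)) \<and>
      (\<forall>r s t. \<forall>f\<in>carrier (Hom C r s). \<forall>g\<in>carrier (Hom C s t).
        F r t (Comp C r s t f g) = Comp D (F\<^sub>0 r) (F\<^sub>0 s) (F\<^sub>0 t) (F r s f) (F s t g)))"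

definition quot_cat :: "('o, 'm) lincat \<Rightarrow> ('o \<Rightarrow> 'o \<Rightarrow> 'm set) \<Rightarrow> ('o, 'm set) lincat" where
  "quot_cat C I =
    \<lparr>Hom = (\<lambda>r s. quot_space (Hom C r s) (I r s)),
     Comp = (\<lambda>r s t A B. \<Union>f\<in>A. \<Union>g\<in>B. I r t +>\<^bsub>Hom C r t\<^esub> Comp C r s t f g),
     Ident = (\<lambda>r. I r r +>\<^bsub>Hom C r r\<^esub> Ident C r)\<rparr>"


section \<open>The Brauer category\<close>

definition perfect_matching :: "'a set \<Rightarrow> 'a set set \<Rightarrow> bool" where
  "perfect_matching S m \<longleftrightarrow> partition_on S m \<and> (\<forall>e\<in>m. card e = 2)"

text \<open>\<open>Inl i\<close> is the \<open>i\<close>-th point on the top edge, \<open>Inr j\<close> the \<open>j\<close>-th point on the bottom edge.\<close>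

type_synonym diagram = "(nat + nat) set set"

definition points :: "nat \<Rightarrow> nat \<Rightarrow> (nat + nat) set" where
  "points r s = Inl ` {1..r} \<union> Inr ` {1..s}"

definition diagrams :: "nat \<Rightarrow> nat \<Rightarrow> diagram set" where
  "diagrams r s = {x. perfect_matching (points r s) x}"

datatype stacked_point = Top nat | Mid nat | Bot nat

definition stack :: "diagram \<Rightarrow> diagram \<Rightarrow> stacked_point set set" where
  "stack x y = (`) (case_sum Top Mid) ` x \<union> (`) (case_sum Mid Bot) ` y"

definition stack_components :: "diagram \<Rightarrow> diagram \<Rightarrow> stacked_point set set" where
  "stack_components x y =
    (let E = stack x y in \<Union>E // (Restr ({(p, q). {p, q} \<in> E}\<^sup>*) (\<Union>E)))"

text \<open>
  In the stacked picture every middle point lies on one strand from above and one from below, and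
  every outer point on exactly one strand. So a connected component either contains exactly two
  outer points, which it joins, or consists of middle points only and is a closed loop.
\<close>

definition loops :: "diagram \<Rightarrow> diagram \<Rightarrow> nat" where
  "loops x y = card {K \<in> stack_components x y. K \<subseteq> range Mid}"

definition diagram_comp :: "diagram \<Rightarrow> diagram \<Rightarrow> diagram" where
  "diagram_comp x y = {case_sum Top Bot -` K | K. K \<in> stack_components x y \<and> \<not> K \<subseteq> range Mid}"

definition diagram_id :: "nat \<Rightarrow> diagram" where
  "diagram_id r = {{Inl i, Inr i} | i. i \<in> {1..r}}"

definition brauer_category :: "complex \<Rightarrow> (nat, diagram \<Rightarrow> complex) lincat" where
  "brauer_category \<delta> =
    \<lparr>Hom = (\<lambda>r s. free_space (diagrams r s)),
     Comp = (\<lambda>r s t f g.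
       let H = free_space (diagrams r t) in
       lin_ext H (\<lambda>x. lin_ext H (\<lambda>y. \<delta> ^ loops x y \<odot>\<^bsub>H\<^esub> single (diagram_comp x y)) g) f),
     Ident = (\<lambda>r. single (diagram_id r))\<rparr>"

definition D_Sp :: "nat \<Rightarrow> (nat, diagram \<Rightarrow> complex) lincat" where
  "D_Sp n = brauer_category (- of_nat (2 * n))"

definition pfaffian :: "nat \<Rightarrow> nat \<Rightarrow> (nat + nat) set \<Rightarrow> diagram \<Rightarrow> (diagram \<Rightarrow> complex)" where
  "pfaffian r s S f =
    (\<Oplus>\<^bsub>free_space (diagrams r s)\<^esub>m\<in>{m. perfect_matching S m}. single (m \<union> f))"

definition pfaffian_ideal :: "nat \<Rightarrow> nat \<Rightarrow> nat \<Rightarrow> (diagram \<Rightarrow> complex) set" where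
  "pfaffian_ideal n r s =
    vspan (free_space (diagrams r s))
      {pfaffian r s S f | S f. S \<subseteq> points r s \<and> card S = 2 * (n + 1) \<and>
                               perfect_matching (points r s - S) f}"


section \<open>The category of invariant tensors\<close>

definition nondegenerate_skew_form :: "(complex, 'v) module \<Rightarrow> ('v \<Rightarrow> 'v \<Rightarrow> complex) \<Rightarrow> bool" where
  "nondegenerate_skew_form V \<omega> \<longleftrightarrow>
    (\<forall>x\<in>carrier V. \<forall>y\<in>carrier V. \<forall>z\<in>carrier V. \<forall>c.
       \<omega> (x \<oplus>\<^bsub>V\<^esub> y) z = \<omega> x z + \<omega> y z \<and> \<omega> (c \<odot>\<^bsub>V\<^esub> x) z = c * \<omega> x z \<and>
       \<omega> x (y \<oplus>\<^bsub>V\<^esub> z) = \<omega> x y + \<omega> x z \<and> \<omega> x (c \<odot>\<^bsub>V\<^esub> z) = c * \<omega> x z) \<and>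
    (\<forall>x\<in>carrier V. \<forall>y\<in>carrier V. \<omega> x y = - \<omega> y x) \<and>
    (\<forall>x\<in>carrier V. (\<forall>y\<in>carrier V. \<omega> x y = 0) \<longrightarrow> x = \<zero>\<^bsub>V\<^esub>)"

definition Sp :: "(complex, 'v) module \<Rightarrow> ('v \<Rightarrow> 'v \<Rightarrow> complex) \<Rightarrow> ('v \<Rightarrow> 'v) set" where
  "Sp V \<omega> = {g \<in> linear_maps V V. bij_betw g (carrier V) (carrier V) \<and>
               (\<forall>x\<in>carrier V. \<forall>y\<in>carrier V. \<omega> (g x) (g y) = \<omega> x y)}"

text \<open>
  The \<open>r\<close>-th tensor power is the free space on the \<open>r\<close>-tuples of vectors modulo multilinearity;
  \<open>tensor V [v\<^sub>1, \<dots>, v\<^sub>r]\<close> is the pure tensor of the \<open>v\<^sub>i\<close>.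
\<close>

definition tuples :: "(complex, 'v) module \<Rightarrow> nat \<Rightarrow> 'v list set" where
  "tuples V r = {vs. length vs = r \<and> set vs \<subseteq> carrier V}"

definition tensor_relations :: "(complex, 'v) module \<Rightarrow> nat \<Rightarrow> ('v list \<Rightarrow> complex) set" where
  "tensor_relations V r = (let F = free_space (tuples V r) in vspan F
    ({single (us @ [x \<oplus>\<^bsub>V\<^esub> y] @ ws) \<ominus>\<^bsub>F\<^esub> (single (us @ [x] @ ws) \<oplus>\<^bsub>F\<^esub> single (us @ [y] @ ws)) | us x y ws.
        us @ [x] @ ws \<in> tuples V r \<and> y \<in> carrier V} \<union>
     {single (us @ [c \<odot>\<^bsub>V\<^esub> x] @ ws) \<ominus>\<^bsub>F\<^esub> c \<odot>\<^bsub>F\<^esub> single (us @ [x] @ ws) | us c x ws.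
        us @ [x] @ ws \<in> tuples V r}))"

definition tensor_power :: "(complex, 'v) module \<Rightarrow> nat \<Rightarrow> (complex, ('v list \<Rightarrow> complex) set) module" where
  "tensor_power V r = quot_space (free_space (tuples V r)) (tensor_relations V r)"

definition tensor :: "(complex, 'v) module \<Rightarrow> 'v list \<Rightarrow> ('v list \<Rightarrow> complex) set" where
  "tensor V vs = (let r = length vs in
     tensor_relations V r +>\<^bsub>free_space (tuples V r)\<^esub> single vs)"

text \<open>\<open>g\<^sup>\<otimes>\<^sup>r\<close>, sending \<open>tensor V vs\<close> to \<open>tensor V (map g vs)\<close>: the linear extension to the free space
  is constant on cosets of the multilinearity relations.\<close>

definition tensor_map :: "(complex, 'v) module \<Rightarrow> nat \<Rightarrow> ('v \<Rightarrow> 'v) \<Rightarrow>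
    ('v list \<Rightarrow> complex) set \<Rightarrow> ('v list \<Rightarrow> complex) set" where
  "tensor_map V r g A = the_elem (lin_ext (tensor_power V r) (\<lambda>vs. tensor V (map g vs)) ` A)"

definition equivariant_maps :: "(complex, 'v) module \<Rightarrow> ('v \<Rightarrow> 'v \<Rightarrow> complex) \<Rightarrow> nat \<Rightarrow> nat \<Rightarrow>
    (('v list \<Rightarrow> complex) set \<Rightarrow> ('v list \<Rightarrow> complex) set) set" where
  "equivariant_maps V \<omega> r s =
    {\<phi> \<in> linear_maps (tensor_power V r) (tensor_power V s).
       \<phi> \<in> extensional (carrier (tensor_power V r)) \<and>
       (\<forall>g\<in>Sp V \<omega>. \<forall>t\<in>carrier (tensor_power V r). \<phi> (tensor_map V r g t) = tensor_map V s g (\<phi> t))}"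

definition T_Sp :: "(complex, 'v) module \<Rightarrow> ('v \<Rightarrow> 'v \<Rightarrow> complex) \<Rightarrow>
    (nat, ('v list \<Rightarrow> complex) set \<Rightarrow> ('v list \<Rightarrow> complex) set) lincat" where
  "T_Sp V \<omega> =
    \<lparr>Hom = (\<lambda>r s.
       \<lparr>carrier = equivariant_maps V \<omega> r s, mult = undefined, one = undefined,
        zero = (\<lambda>t\<in>carrier (tensor_power V r). \<zero>\<^bsub>tensor_power V s\<^esub>),
        add = (\<lambda>\<phi> \<psi>. \<lambda>t\<in>carrier (tensor_power V r). \<phi> t \<oplus>\<^bsub>tensor_power V s\<^esub> \<psi> t),
        smult = (\<lambda>c \<phi>. \<lambda>t\<in>carrier (tensor_power V r). c \<odot>\<^bsub>tensor_power V s\<^esub> \<phi> t)\<rparr>),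
     Comp = (\<lambda>r s t \<phi> \<psi>. compose (carrier (tensor_power V r)) \<psi> \<phi>),
     Ident = (\<lambda>r. \<lambda>t\<in>carrier (tensor_power V r). t)\<rparr>"


section \<open>Noncrossing perfect matchings\<close>

definition noncrossing :: "nat \<Rightarrow> nat set set \<Rightarrow> bool" where
  "noncrossing k m \<longleftrightarrow>
    \<not> (\<exists>a b :: nat \<Rightarrow> nat. strict_mono_on {1..k} a \<and> strict_mono_on {1..k} b \<and> a k < b 1 \<and>
         (\<forall>i\<in>{1..k}. {a i, b i} \<in> m))"

definition noncrossing_matchings :: "nat \<Rightarrow> nat \<Rightarrow> nat set set set" where
  "noncrossing_matchings r n = {m. perfect_matching {1..2 * r} m \<and> noncrossing (n + 1) m}"

text \<open>The image in \<open>D_Sp n / Pf\<close> of the diagram \<open>0 \<rightarrow> 2r\<close> given by a perfect matching of \<open>{1..2r}\<close>.\<close>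

definition matching_class :: "nat \<Rightarrow> nat \<Rightarrow> nat set set \<Rightarrow> (diagram \<Rightarrow> complex) set" where
  "matching_class n r m =
    pfaffian_ideal n 0 (2 * r) +>\<^bsub>Hom (D_Sp n) 0 (2 * r)\<^esub> single ((`) Inr ` m)"

end

theory Submission
  imports Defs "HOL-Library.Function_Algebras"
begin

text \<open>
  Fix a hyperbolic basis and let \<open>J\<close> be the form in this basis. A diagram with \<open>r\<close> upper and \<open>s\<close> lower
  points is sent to the tensor with \<open>s + r\<close> indices that is the signed product of \<open>J\<close> over the strands.
  Gluing diagrams contracts tensors with the inverse of \<open>J\<close> and a loop contributes \<open>-2n\<close>, so this is a functor.
  Pfaffians go to zero: among \<open>2(n + 1)\<close> letters two coincide, and exchanging them reverses all signs.

  A full crossing of \<open>n + 1\<close> arcs is the unique maximum of a cost function among the matchings of its end points,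
  so modulo Pfaffians every matching is a combination of noncrossing ones.

  An invariant tensor has weight zero and is killed by the lowering operators. The leading word of a tensor of
  dominant weight killed by them is a dominant lattice path, and conversely products of arcs and determinants
  realise every dominant path as a leading word. So the tensors of matchings span all invariants, and their span
  has dimension at least the number of closed dominant paths. A local version of the Robinson-Schensted-Knuth
  correspondence maps the noncrossing matchings injectively to such paths. Since noncrossing matchings span, they
  are therefore linearly independent, and the Pfaffians generate the whole kernel of the functor.
\<close>

section \<open>Matchings as signed products of a bilinear form\<close>

text \<open>A skew form gives an unoriented strand a value only up to sign. Here the sign is fixed
  by a linear order of the end points, and contraction is then free of signs between neighbouring
  points. This dictates the numbering of the points of a diagram around its boundary: after
  stacking, the glued pairs are nested around the seam and become neighbours one after the other.
  Independence rests on a cycle of inequalities, and no dimension is computed: noncrossing matchings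
  inject into closed dominant paths, distinct leading words bound the number of these paths by the
  size of any finite spanning set, and the noncrossing tensors are such a set. That composition
  descends to the quotient is read off from the functor, whose kernel turns out to be the Pfaffian
  span, and not from a diagrammatic proof of the ideal property. Positivity of a Hermitian norm
  stands in for the classification of highest weights.\<close>

definition osgn :: "nat \<Rightarrow> nat \<Rightarrow> complex" where
  "osgn x y = (if y < x then - 1 else 1)"

text \<open>For distinct entries, the sign of the permutation that sorts the list.\<close>

primrec lsgn :: "nat list \<Rightarrow> complex" where
  "lsgn [] = 1"
| "lsgn (x # xs) = (\<Prod>y\<leftarrow>xs. osgn x y) * lsgn xs"

definition csgn :: "nat list \<Rightarrow> nat list \<Rightarrow> complex" where
  "csgn xs ys = (\<Prod>x\<leftarrow>xs. \<Prod>y\<leftarrow>ys. osgn x y)"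

lemma csgn_simps [simp]:
  "csgn [] ys = 1" "csgn (x # xs) ys = (\<Prod>y\<leftarrow>ys. osgn x y) * csgn xs ys" "csgn xs [] = 1"
  by (auto simp: csgn_def) (induction xs, auto)

lemma csgn_append_left: "csgn (xs @ xs') ys = csgn xs ys * csgn xs' ys"
  by (simp add: csgn_def)

lemma csgn_append_right: "csgn xs (ys @ ys') = csgn xs ys * csgn xs ys'"
  by (induction xs) (auto simp: mult_ac)

lemma lsgn_append: "lsgn (xs @ ys) = lsgn xs * lsgn ys * csgn xs ys"
  by (induction xs) (auto simp: mult_ac)

lemma osgn_swap: "x \<noteq> y \<Longrightarrow> osgn y x = - osgn x y"
  by (auto simp: osgn_def)

lemma osgn_sq [simp]: "osgn x y * osgn x y = 1"
  by (auto simp: osgn_def)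

lemma csgn_swap:
  assumes "set xs \<inter> set ys = {}"
  shows "csgn ys xs = (- 1) ^ (length xs * length ys) * csgn xs ys"
  using assms
proof (induction xs)
  case (Cons x xs)
  have 1: "csgn ys [x] = (- 1) ^ length ys * (\<Prod>y\<leftarrow>ys. osgn x y)" if "x \<notin> set ys" for ys
    using that by (induction ys) (auto simp: osgn_swap[of x] mult_ac)
  have "csgn ys (x # xs) = csgn ys [x] * csgn ys xs"
    using csgn_append_right[of ys "[x]" xs] by simp
  also have "\<dots> = (- 1) ^ length ys * (\<Prod>y\<leftarrow>ys. osgn x y) * ((- 1) ^ (length xs * length ys) * csgn xs ys)"
    using Cons 1 by simp
  finally show ?case by (simp add: power_add mult_ac)
qed simp

primrec flat :: "('a \<times> 'a) list \<Rightarrow> 'a list" where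
  "flat [] = []"
| "flat (e # l) = fst e # snd e # flat l"

lemma flat_append [simp]: "flat (xs @ ys) = flat xs @ flat ys"
  by (induction xs) auto

lemma even_length_flat [simp]: "even (length (flat l))"
  by (induction l) auto

lemma flat_map: "flat (map (map_prod f f) l) = map f (flat l)"
  by (induction l) auto

text \<open>One term of a Pfaffian expansion: a permutation sign times a product of matrix
  entries.\<close>

definition pval :: "('l \<Rightarrow> 'l \<Rightarrow> complex) \<Rightarrow> (nat \<times> nat) list \<Rightarrow> (nat \<Rightarrow> 'l) \<Rightarrow> complex" where
  "pval J l w = lsgn (flat l) * (\<Prod>e\<leftarrow>l. J (w (fst e)) (w (snd e)))"

definition match_of :: "('a \<times> 'a) list \<Rightarrow> 'a set set" where
  "match_of l = (\<lambda>e. {fst e, snd e}) ` set l"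

text \<open>The signed product of \<open>J\<close> over the arcs of \<open>m\<close>: listing the arcs in a different order or
  orientation changes nothing when \<open>J\<close> is antisymmetric.\<close>

definition P :: "('l \<Rightarrow> 'l \<Rightarrow> complex) \<Rightarrow> nat set set \<Rightarrow> (nat \<Rightarrow> 'l) \<Rightarrow> complex" where
  "P J m w = pval J (SOME l. distinct (flat l) \<and> match_of l = m) w"

lemma match_of_simps [simp]:
  "match_of [] = {}" "match_of (e # l) = insert {fst e, snd e} (match_of l)"
  "match_of (l @ l') = match_of l \<union> match_of l'"
  by (auto simp: match_of_def)

lemma set_flat: "set (flat l) = \<Union> (match_of l)"
  by (induction l) auto

lemma match_of_map: "match_of (map (map_prod f f) l) = (`) f ` match_of l"
  by (induction l) auto

text \<open>An arc has two end points, so moving it past other arcs takes an even number of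
  transpositions.\<close>

lemma pval_move_front:
  assumes "distinct (flat (as @ e # bs))"
  shows "pval J (as @ e # bs) w = pval J (e # as @ bs) w"
proof -
  let ?e = "[fst e, snd e]"
  have "set (flat as) \<inter> set ?e = {}" using assms by auto
  from csgn_swap[OF this] have sw: "csgn ?e (flat as) = csgn (flat as) ?e"
    by simp
  have "lsgn (flat (as @ e # bs)) = lsgn (flat as @ ?e @ flat bs)" by simp
  also have "\<dots> = lsgn (?e @ flat as @ flat bs)"
    unfolding lsgn_append csgn_append_left csgn_append_right sw by (simp only: mult_ac)
  also have "\<dots> = lsgn (flat (e # as @ bs))" by simp
  finally show ?thesis unfolding pval_def by (simp add: mult_ac)
qed

text \<open>Reversing one arc changes both the sign of the listing and the sign of one factor
  \<open>J\<close>.\<close>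

lemma pval_flip:
  assumes J: "\<And>a b. J a b = - J b a" and "a \<noteq> b"
  shows "pval J ((a, b) # l) w = pval J ((b, a) # l) w"
  using assms(2) osgn_swap[of a b] J[of "w a" "w b"] by (simp add: pval_def mult_ac)

lemma prod_list_set: "distinct xs \<Longrightarrow> (\<Prod>x\<leftarrow>xs. f x) = prod (f :: _ \<Rightarrow> complex) (set xs)"
  by (simp add: prod.distinct_set_conv_list)

text \<open>As the points are distinct, the sign between head and tail depends only on the set of
  points of the tail.\<close>

lemma pval_Cons_cong:
  assumes "pval J l w = pval J l' w" "distinct (flat l)" "distinct (flat l')"
    and "set (flat l) = set (flat l')"
  shows "pval J (e # l) w = pval J (e # l') w"
proof -
  have "(\<Prod>y\<leftarrow>flat l. osgn x y) = (\<Prod>y\<leftarrow>flat l'. osgn x y)" for x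
    using assms(2-4) by (simp add: prod_list_set)
  then show ?thesis using assms(1) by (simp add: pval_def mult_ac)
qed

lemma match_of_rest:
  assumes "distinct (flat (e # l))"
  shows "match_of l = match_of (e # l) - {{fst e, snd e}}"
proof -
  have "fst e \<notin> \<Union> (match_of l)" using assms by (auto simp flip: set_flat)
  then have "{fst e, snd e} \<notin> match_of l" by auto
  then show ?thesis by auto
qed

text \<open>The first arc of one list is found in the other, moved to the front and flipped if
  necessary; the tails then list the same arcs.\<close>

lemma pval_match:
  assumes J: "\<And>a b. J a b = - J b a"
  shows "distinct (flat l) \<Longrightarrow> distinct (flat l') \<Longrightarrow> match_of l = match_of l' \<Longrightarrow> pval J l w = pval J l' w"
proof (induction l arbitrary: l')
  case Nil
  then have "l' = []" by (cases l') auto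
  then show ?case by simp
next
  case (Cons e l)
  obtain a b where e: "e = (a, b)" by force
  have "{a, b} \<in> match_of l'" using Cons.prems(3) e by (metis fst_conv insertI1 match_of_simps(2) snd_conv)
  then obtain e' where e': "e' \<in> set l'" "{fst e', snd e'} = {a, b}" by (auto simp: match_of_def)
  then obtain as bs where l': "l' = as @ e' # bs" by (meson split_list)
  have ab: "a \<noteq> b" using Cons.prems(1) e by simp
  have d': "distinct (flat (e' # as @ bs))" using Cons.prems(2) l' by auto
  have e2: "e' = (a, b) \<or> e' = (b, a)" using e'(2) by (metis doubleton_eq_iff prod.collapse)
  have d2: "distinct (flat (e # as @ bs))" using d' e2 e by auto
  have "match_of l = match_of (e # l) - {{fst e, snd e}}" by (rule match_of_rest[OF Cons.prems(1)])
  also have "match_of (e # l) = match_of (e # as @ bs)" using Cons.prems(3) l' e' e by auto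
  also have "\<dots> - {{fst e, snd e}} = match_of (as @ bs)" by (rule match_of_rest[OF d2, symmetric])
  finally have m: "match_of l = match_of (as @ bs)" .
  have "pval J l' w = pval J (e' # as @ bs) w"
    unfolding l' by (rule pval_move_front) (use Cons.prems(2) l' in simp)
  also have "\<dots> = pval J (e # as @ bs) w" using e2 e ab pval_flip[where J=J, OF J] by metis
  also have "\<dots> = pval J (e # l) w"
  proof (rule pval_Cons_cong)
    show "pval J (as @ bs) w = pval J l w" using Cons.IH[of "as @ bs"] Cons.prems(1) d' m by simp
    show "set (flat (as @ bs)) = set (flat l)" unfolding set_flat m ..
  qed (use d' Cons.prems(1) in auto)
  finally show ?case by simp
qed

lemma P_eq:
  assumes "\<And>a b. J a b = - J b a" "distinct (flat l)" "m = match_of l"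
  shows "P J m w = pval J l w"
proof -
  have "distinct (flat (SOME l. distinct (flat l) \<and> match_of l = m)) \<and> match_of (SOME l. distinct (flat l) \<and> match_of l = m) = m"
    by (rule someI[of _ l]) (use assms in auto)
  then show ?thesis unfolding P_def using pval_match[of J, OF assms(1)] assms(2,3) by metis
qed

section \<open>Perfect matchings and lists of their arcs\<close>

lemma perfect_matching_finite: "finite S \<Longrightarrow> perfect_matching S m \<Longrightarrow> finite m"
  unfolding perfect_matching_def using finite_elements by blast

lemma perfect_matching_Union: "perfect_matching S m \<Longrightarrow> \<Union> m = S"
  unfolding perfect_matching_def partition_on_def by simp

lemma perfect_matching_disjoint:
  "perfect_matching S m \<Longrightarrow> e \<in> m \<Longrightarrow> e' \<in> m \<Longrightarrow> x \<in> e \<Longrightarrow> x \<in> e' \<Longrightarrow> e = e'"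
  unfolding perfect_matching_def partition_on_def disjoint_def by blast

lemma perfect_matchingI:
  assumes "\<Union> m = S" "\<And>e. e \<in> m \<Longrightarrow> card e = 2" "\<And>e e' x. e \<in> m \<Longrightarrow> e' \<in> m \<Longrightarrow> x \<in> e \<Longrightarrow> x \<in> e' \<Longrightarrow> e = e'"
  shows "perfect_matching S m"
  unfolding perfect_matching_def partition_on_def disjoint_def using assms by force

lemma perfect_matching_edge:
  assumes "perfect_matching S m" "p \<in> S"
  obtains q where "{p, q} \<in> m" "q \<noteq> p" "q \<in> S"
proof -
  obtain e where e: "e \<in> m" "p \<in> e" using assms perfect_matching_Union by blast
  then have "card e = 2" using assms by (auto simp: perfect_matching_def)
  then obtain q where "e = {p, q}" "q \<noteq> p" using e(2) by (metis card_2_iff insert_iff insert_commute singletonD)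
  then show ?thesis using that e perfect_matching_Union[OF assms(1)] by blast
qed

lemma perfect_matching_Diff:
  assumes "perfect_matching S m" "F \<subseteq> m"
  shows "perfect_matching (S - \<Union> F) (m - F)"
proof (rule perfect_matchingI)
  show "\<Union> (m - F) = S - \<Union> F"
    using perfect_matching_Union[OF assms(1)] perfect_matching_disjoint[OF assms(1)] assms(2) by blast
qed (use assms in \<open>auto simp: perfect_matching_def dest: perfect_matching_disjoint[OF assms(1)]\<close>)

lemma perfect_matching_Un:
  assumes "perfect_matching S m" "perfect_matching T f" "S \<inter> T = {}"
  shows "perfect_matching (S \<union> T) (m \<union> f)"
proof (rule perfect_matchingI)
  show "\<Union> (m \<union> f) = S \<union> T"
    using perfect_matching_Union[OF assms(1)] perfect_matching_Union[OF assms(2)] by auto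
next
  fix e e' x assume "e \<in> m \<union> f" "e' \<in> m \<union> f" "x \<in> e" "x \<in> e'"
  then show "e = e'"
    using assms(3) perfect_matching_Union[OF assms(1)] perfect_matching_Union[OF assms(2)]
     perfect_matching_disjoint[OF assms(1)] perfect_matching_disjoint[OF assms(2)] by blast
qed (use assms in \<open>auto simp: perfect_matching_def\<close>)

lemma perfect_matching_pair: "a \<noteq> b \<Longrightarrow> perfect_matching {a, b} {{a, b}}"
  by (rule perfect_matchingI) auto

lemma perfect_matching_image:
  assumes "perfect_matching S m" "inj_on f S"
  shows "perfect_matching (f ` S) ((`) f ` m)"
proof (rule perfect_matchingI)
  have U: "\<Union> m = S" by (rule perfect_matching_Union[OF assms(1)])
  show "\<Union> ((`) f ` m) = f ` S" using U by blast
  fix e assume "e \<in> (`) f ` m"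
  then obtain d where d: "d \<in> m" "e = f ` d" by auto
  then have "inj_on f d" using assms(2) U by (meson Union_upper inj_on_subset)
  then show "card e = 2" using d assms(1) by (simp add: card_image perfect_matching_def)
next
  have U: "\<Union> m = S" by (rule perfect_matching_Union[OF assms(1)])
  fix e e' x assume "e \<in> (`) f ` m" "e' \<in> (`) f ` m" "x \<in> e" "x \<in> e'"
  then obtain d d' y y' where "d \<in> m" "d' \<in> m" "e = f ` d" "e' = f ` d'" "y \<in> d" "y' \<in> d'" "f y = f y'" by auto
  moreover then have "y = y'" using assms(2) U by (auto simp: inj_on_def)
  ultimately show "e = e'" using perfect_matching_disjoint[OF assms(1)] by blast
qed

lemma perfect_matching_match_of:
  "distinct (flat l) \<Longrightarrow> perfect_matching (set (flat l)) (match_of l)"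
proof (induction l)
  case (Cons e l)
  have "perfect_matching ({fst e, snd e} \<union> set (flat l)) ({{fst e, snd e}} \<union> match_of l)"
    by (rule perfect_matching_Un) (use Cons in \<open>auto intro!: perfect_matching_pair\<close>)
  then show ?case by simp
qed (auto intro!: perfect_matchingI)

lemma perfect_matching_list:
  assumes "finite S" "perfect_matching S m"
  obtains l where "distinct (flat l)" "match_of l = m" "set (flat l) = S"
proof -
  have "finite m" using perfect_matching_finite assms by blast
  then have "perfect_matching S m \<Longrightarrow> \<exists>l. distinct (flat l) \<and> match_of l = m" for S
  proof (induction m arbitrary: S rule: finite_induct)
    case empty
    then show ?case by (intro exI[of _ "[]"]) auto
  next
    case (insert e m)
    have "perfect_matching (S - \<Union> {e}) (insert e m - {e})"
      by (rule perfect_matching_Diff) (use insert in auto)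
    then have pm: "perfect_matching (S - e) m" using insert.hyps by simp
    then obtain l where l: "distinct (flat l)" "match_of l = m" using insert.IH by blast
    have "card e = 2" using insert.prems by (simp add: perfect_matching_def)
    then obtain a b where e: "e = {a, b}" "a \<noteq> b" by (auto simp: card_2_iff)
    have "set (flat l) = S - e" using l(2) perfect_matching_Union[OF pm] by (simp add: set_flat)
    then show ?case using l e by (intro exI[of _ "(a, b) # l"]) auto
  qed
  then show ?thesis using assms(2) that perfect_matching_Union[OF assms(2)] set_flat by metis
qed

section \<open>Contraction of neighbouring slots\<close>

lemma prod_list_osgn_adjacent:
  assumes "\<And>y. y \<in> set ys \<Longrightarrow> (y < p) = (y < q)"
  shows "(\<Prod>y\<leftarrow>ys. osgn p y) * (\<Prod>y\<leftarrow>ys. osgn q y) = 1"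
  using assms by (induction ys) (auto simp: osgn_def)

text \<open>By \<open>adj\<close> no other point lies between \<open>p\<close> and \<open>q\<close>.
  Both compare alike with every other point, their signs cancel, and the arc splits off with its
  factor \<open>J\<close> alone.\<close>

lemma P_contract_loop:
  assumes J: "\<And>a b. J a b = - J b a" and Z: "finite Z" "perfect_matching Z z"
    and pq: "p < q" "{p, q} \<in> z" and adj: "\<And>y. y \<in> Z \<Longrightarrow> y \<noteq> p \<Longrightarrow> y \<noteq> q \<Longrightarrow> (y < p) = (y < q)"
  shows "P J z w = J (w p) (w q) * P J (z - {{p, q}}) w"
proof -
  have "perfect_matching (Z - \<Union> {{p, q}}) (z - {{p, q}})"
    by (rule perfect_matching_Diff) (use assms in auto)
  then obtain l where l: "distinct (flat l)" "match_of l = z - {{p, q}}" "set (flat l) = Z - {p, q}"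
    using perfect_matching_list[of "Z - {p, q}"] Z by auto
  have d: "distinct (flat ((p, q) # l))" using l pq by simp
  have m: "z = match_of ((p, q) # l)" using l(2) pq by auto
  have "P J z w = pval J ((p, q) # l) w" using P_eq[of J, OF J d m] by simp
  also have "\<dots> = osgn p q * ((\<Prod>y\<leftarrow>flat l. osgn p y) * (\<Prod>y\<leftarrow>flat l. osgn q y)) * J (w p) (w q) * pval J l w"
    by (simp add: pval_def mult_ac)
  also have "(\<Prod>y\<leftarrow>flat l. osgn p y) * (\<Prod>y\<leftarrow>flat l. osgn q y) = 1"
    by (rule prod_list_osgn_adjacent) (use l(3) adj in auto)
  also have "pval J l w = P J (z - {{p, q}}) w" using P_eq[of J, OF J l(1)] l(2) by metis
  finally show ?thesis using pq(1) by (simp add: osgn_def)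
qed

text \<open>The arcs at \<open>p\<close> and \<open>q\<close> are replaced by one arc between their
  partners. The number \<open>c\<close> collects the sign and all other arcs; it is the same before
  and after and does not see the letters at \<open>p\<close> and \<open>q\<close>, so a sum over
  these letters concerns two factors \<open>J\<close> only.\<close>

lemma P_contract_join:
  assumes J: "\<And>a b. J a b = - J b a" and Z: "finite Z" "perfect_matching Z z"
    and pq: "p < q" "{p', p} \<in> z" "{q, q'} \<in> z" "p' \<noteq> q" "q' \<noteq> p"
    and adj: "\<And>y. y \<in> Z \<Longrightarrow> y \<noteq> p \<Longrightarrow> y \<noteq> q \<Longrightarrow> (y < p) = (y < q)"
  shows "\<exists>c. (\<forall>w'. (\<forall>y \<in> Z - {p, q}. w' y = w y) \<longrightarrow> P J z w' = J (w' p') (w' p) * J (w' q) (w' q') * c) \<and>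
      P J (z - {{p', p}, {q, q'}} \<union> {{p', q'}}) w = J (w p') (w q') * c"
proof -
  have ne: "p' \<noteq> p" "q \<noteq> q'" using Z(2) pq by (auto simp: perfect_matching_def)
  have ne2: "{p', p} \<noteq> {q, q'}" using pq by auto
  have ne3: "p' \<noteq> q'" using perfect_matching_disjoint[OF Z(2) pq(2,3)] ne2 by auto
  have Zp: "p' \<in> Z" "q' \<in> Z" "p \<in> Z" "q \<in> Z" using perfect_matching_Union[OF Z(2)] pq by auto
  have "perfect_matching (Z - \<Union> {{p', p}, {q, q'}}) (z - {{p', p}, {q, q'}})"
    by (rule perfect_matching_Diff) (use assms in auto)
  then obtain l where l: "distinct (flat l)" "match_of l = z - {{p', p}, {q, q'}}" "set (flat l) = Z - {p', p, q, q'}"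
    using perfect_matching_list[of "Z - {p', p, q, q'}"] Z by (auto simp: insert_commute)
  have d: "distinct (flat ((p', p) # (q, q') # l))" "distinct (flat ((p', q') # l))" using l pq ne ne3 by auto
  have m: "z = match_of ((p', p) # (q, q') # l)" using l(2) pq by auto
  have m2: "z - {{p', p}, {q, q'}} \<union> {{p', q'}} = match_of ((p', q') # l)" using l(2) by auto
  \<comment> \<open>The sign of the short list \<open>(p', q') # l\<close>; the long list turns out
    to have the same one.\<close>
  define A where "A = (\<Prod>y\<leftarrow>flat l. osgn p' y) * (\<Prod>y\<leftarrow>flat l. osgn q' y) * osgn p' q' * lsgn (flat l)"
  \<comment> \<open>Neighbouring points compare alike with \<open>p'\<close> and \<open>q'\<close>,
    so the four signs that involve these points cancel in pairs.\<close>
  have o: "osgn p' p = osgn p' q" "osgn p q' = osgn q q'" "osgn p q = 1"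
    using adj[of p'] adj[of q'] Zp ne pq(1,4,5) by (auto simp: osgn_def)
  have s: "lsgn (flat ((p', p) # (q, q') # l)) = A"
  proof -
    have "lsgn (flat ((p', p) # (q, q') # l)) = (osgn p' p * osgn p' q) * (osgn p q' * osgn q q') * osgn p q *
      ((\<Prod>y\<leftarrow>flat l. osgn p y) * (\<Prod>y\<leftarrow>flat l. osgn q y)) * A" by (simp add: A_def mult_ac)
    also have "(\<Prod>y\<leftarrow>flat l. osgn p y) * (\<Prod>y\<leftarrow>flat l. osgn q y) = 1"
      by (rule prod_list_osgn_adjacent) (use l(3) adj in auto)
    finally show ?thesis by (simp add: o)
  qed
  have s2: "lsgn (flat ((p', q') # l)) = A" by (simp add: A_def mult_ac)
  define c where "c = A * (\<Prod>e\<leftarrow>l. J (w (fst e)) (w (snd e)))"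
  show ?thesis
  proof (intro exI[of _ c] conjI allI impI)
    fix w' assume w': "\<forall>y \<in> Z - {p, q}. w' y = w y"
    have "w' (fst e) = w (fst e) \<and> w' (snd e) = w (snd e)" if "e \<in> set l" for e
    proof -
      have "{fst e, snd e} \<subseteq> \<Union> (match_of l)" using that by (auto simp: match_of_def)
      also have "\<dots> = Z - {p', p, q, q'}" using l(3) by (simp add: set_flat)
      finally show ?thesis using w' by auto
    qed
    then have "(\<Prod>e\<leftarrow>l. J (w' (fst e)) (w' (snd e))) = (\<Prod>e\<leftarrow>l. J (w (fst e)) (w (snd e)))"
      by (intro arg_cong[where f=prod_list] map_cong) auto
    then show "P J z w' = J (w' p') (w' p) * J (w' q) (w' q') * c"
      using P_eq[of J, OF J d(1) m, of w'] s by (simp add: pval_def c_def mult_ac)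
  next
    show "P J (z - {{p', p}, {q, q'}} \<union> {{p', q'}}) w = J (w p') (w q') * c"
      using P_eq[of J, OF J d(2) m2, of w] s2 by (simp add: pval_def c_def mult_ac)
  qed
qed

lemma P_cong:
  assumes J: "\<And>a b. J a b = - J b a" and Z: "finite Z" "perfect_matching Z z" "\<And>p. p \<in> Z \<Longrightarrow> w p = w' p"
  shows "P J z w = P J z w'"
proof -
  obtain l where l: "distinct (flat l)" "match_of l = z" "set (flat l) = Z"
    using perfect_matching_list Z by metis
  have "w' (fst e) = w (fst e) \<and> w' (snd e) = w (snd e)" if "e \<in> set l" for e
  proof -
    have "{fst e, snd e} \<subseteq> \<Union> (match_of l)" using that by (auto simp: match_of_def)
    also have "\<dots> = Z" using l(3) by (simp add: set_flat)
    finally show ?thesis using Z(3) by auto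
  qed
  then have "(\<Prod>e\<leftarrow>l. J (w' (fst e)) (w' (snd e))) = (\<Prod>e\<leftarrow>l. J (w (fst e)) (w (snd e)))"
    by (intro arg_cong[where f=prod_list] map_cong) auto
  then show ?thesis using P_eq[of J, OF J l(1)] l(2) by (metis pval_def)
qed

text \<open>\<open>C\<close> and \<open>d\<close> encode the bilinear form inverse to \<open>J\<close>.\<close>

lemma P_contract:
  assumes J: "\<And>a b. J a b = - J b a" and inv: "\<And>a b. (\<Sum>l\<in>Ls. C l * J a l * J (d l) b) = J a b"
    and Z: "finite Z" "perfect_matching Z z"
    and pq: "p < q" "p \<in> Z" "q \<in> Z" and adj: "\<And>y. y \<in> Z \<Longrightarrow> y \<noteq> p \<Longrightarrow> y \<noteq> q \<Longrightarrow> (y < p) = (y < q)"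
  shows "(\<Sum>l\<in>Ls. C l * P J z (w(p := l, q := d l))) =
    (if {p, q} \<in> z then (\<Sum>l\<in>Ls. C l * J l (d l)) * P J (z - {{p, q}}) w
     else P J ({e \<in> z. p \<notin> e \<and> q \<notin> e} \<union> {\<Union> {e \<in> z. p \<in> e \<or> q \<in> e} - {p, q}}) w)"
proof (cases "{p, q} \<in> z")
  case True
  have pm: "perfect_matching (Z - \<Union> {{p, q}}) (z - {{p, q}})"
    by (rule perfect_matching_Diff) (use True Z in auto)
  have "P J (z - {{p, q}}) (w(p := l, q := d l)) = P J (z - {{p, q}}) w" for l
    by (rule P_cong[where J=J, OF J _ pm]) (use Z in auto)
  then have "P J z (w(p := l, q := d l)) = J l (d l) * P J (z - {{p, q}}) w" for l
    using P_contract_loop[where J=J, OF J Z pq(1) True adj, of "w(p := l, q := d l)"] pq(1) by simp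
  then show ?thesis using True by (simp add: sum_distrib_right mult.assoc)
next
  case False
  obtain p' where p': "{p', p} \<in> z" "p' \<noteq> p" "p' \<in> Z"
    using perfect_matching_edge[OF Z(2) pq(2)] by (metis insert_commute)
  obtain q' where q': "{q, q'} \<in> z" "q' \<noteq> q" "q' \<in> Z"
    using perfect_matching_edge[OF Z(2) pq(3)] by metis
  have ne: "p' \<noteq> q" "q' \<noteq> p" using False p' q' by (auto simp: insert_commute)
  have ne3: "p' \<noteq> q'" using perfect_matching_disjoint[OF Z(2) p'(1) q'(1), of p'] q' ne pq(1) by (auto simp: doubleton_eq_iff)
  have p1: "e = {p', p}" if "e \<in> z" "p \<in> e" for e using perfect_matching_disjoint[OF Z(2) that(1) p'(1) that(2)] by simp
  have q1: "e = {q, q'}" if "e \<in> z" "q \<in> e" for e using perfect_matching_disjoint[OF Z(2) that(1) q'(1) that(2)] by simp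
  have E: "{e \<in> z. p \<in> e \<or> q \<in> e} = {{p', p}, {q, q'}}"
  proof (intro equalityI subsetI)
    fix e assume "e \<in> {e \<in> z. p \<in> e \<or> q \<in> e}"
    then show "e \<in> {{p', p}, {q, q'}}" using p1 q1 by blast
  next
    fix e assume "e \<in> {{p', p}, {q, q'}}"
    then show "e \<in> {e \<in> z. p \<in> e \<or> q \<in> e}" using p'(1) q'(1) by blast
  qed
  then have E2: "{e \<in> z. p \<notin> e \<and> q \<notin> e} = z - {{p', p}, {q, q'}}" by blast
  have E3: "\<Union> {{p', p}, {q, q'}} - {p, q} = {p', q'}" using p' q' ne by auto
  obtain c where c: "\<forall>w'. (\<forall>y \<in> Z - {p, q}. w' y = w y) \<longrightarrow> P J z w' = J (w' p') (w' p) * J (w' q) (w' q') * c"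
    "P J (z - {{p', p}, {q, q'}} \<union> {{p', q'}}) w = J (w p') (w q') * c"
    using P_contract_join[where J=J, OF J Z pq(1) p'(1) q'(1) ne adj, of w] by blast
  have "P J z (w(p := l, q := d l)) = J (w p') l * J (d l) (w q') * c" for l
    using c(1)[rule_format, of "w(p := l, q := d l)"] p'(2) q'(2) ne pq(1) by auto
  then have "(\<Sum>l\<in>Ls. C l * P J z (w(p := l, q := d l))) = (\<Sum>l\<in>Ls. C l * J (w p') l * J (d l) (w q')) * c"
    by (simp add: sum_distrib_left sum_distrib_right mult_ac)
  also have "\<dots> = P J (z - {{p', p}, {q, q'}} \<union> {{p', q'}}) w" using c(2) inv by simp
  finally show ?thesis using False E E2 E3 by simp
qed

text \<open>All points of \<open>Z\<close> precede those of \<open>Z'\<close>, so there is no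
  inversion between the two blocks.\<close>

lemma P_Un:
  assumes J: "\<And>a b. J a b = - J b a" and 1: "finite Z" "perfect_matching Z z" and 2: "finite Z'" "perfect_matching Z' z'"
    and lt: "\<And>x y. x \<in> Z \<Longrightarrow> y \<in> Z' \<Longrightarrow> x < y"
  shows "P J (z \<union> z') w = P J z w * P J z' w"
proof -
  obtain l where l: "distinct (flat l)" "match_of l = z" "set (flat l) = Z"
    using perfect_matching_list 1 by metis
  obtain l' where l': "distinct (flat l')" "match_of l' = z'" "set (flat l') = Z'"
    using perfect_matching_list 2 by metis
  have "(\<Prod>y\<leftarrow>ys. osgn x y) = 1" if "\<forall>y \<in> set ys. x < y" for x ys
    using that by (induction ys) (auto simp: osgn_def)
  then have "csgn xs ys = 1" if "\<forall>x \<in> set xs. \<forall>y \<in> set ys. x < y" for xs ys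
    using that by (induction xs) auto
  then have "csgn (flat l) (flat l') = 1" using lt l(3) l'(3) by simp
  then have "pval J (l @ l') w = pval J l w * pval J l' w" by (simp add: pval_def lsgn_append mult_ac)
  moreover have "distinct (flat (l @ l'))" using l l' lt by force
  ultimately show ?thesis using P_eq[of J, OF J] l l' by (metis match_of_simps(3))
qed

lemma P_relabel:
  assumes J: "\<And>a b. J a b = - J b a" and Z: "finite Z" "perfect_matching Z z" and f: "strict_mono_on Z f"
  shows "P J ((`) f ` z) w = P J z (\<lambda>p. w (f p))"
proof -
  obtain l where l: "distinct (flat l)" "match_of l = z" "set (flat l) = Z"
    using perfect_matching_list Z by metis
  have o: "osgn (f x) (f y) = osgn x y" if "x \<in> Z" "y \<in> Z" for x y
    using f that strict_mono_on_less[OF f] by (simp add: osgn_def)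
  have "lsgn (map f xs) = lsgn xs" if "set xs \<subseteq> Z" for xs
    using that
  proof (induction xs)
    case (Cons x xs)
    have "map (osgn (f x)) (map f xs) = map (osgn x) xs"
      unfolding map_map by (rule map_cong) (use o Cons.prems in auto)
    then show ?case using Cons by (simp del: map_map)
  qed simp
  then have "lsgn (map f (flat l)) = lsgn (flat l)" using l by simp
  then have "pval J (map (map_prod f f) l) w = pval J l (\<lambda>p. w (f p))"
    by (simp add: pval_def flat_map comp_def)
  moreover have "distinct (flat (map (map_prod f f) l))"
    using l f by (simp add: flat_map distinct_map strict_mono_on_imp_inj_on)
  ultimately show ?thesis using P_eq[of J, OF J] l match_of_map by metis
qed

text \<open>Two points of \<open>S\<close> carry the same letter, and exchanging them reverses the sign of every term.\<close>

lemma P_pfaffian_zero: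
  assumes J: "\<And>a b. J a b = - J b a" and S: "finite S" "finite T" "S \<inter> T = {}" and f: "perfect_matching T f"
    and w: "w ` S \<subseteq> Ls" "finite Ls" "card Ls < card S"
  shows "(\<Sum>m\<in>{m. perfect_matching S m}. P J (m \<union> f) w) = 0"
proof -
  have "\<not> inj_on w S" using w card_inj_on_le[of w S Ls] by auto
  then obtain s t where st: "s \<in> S" "t \<in> S" "s \<noteq> t" "w s = w t" by (auto simp: inj_on_def)
  define \<tau> where "\<tau> = (\<lambda>x. if x = s then t else if x = t then s else x)"
  have tt: "\<tau> (\<tau> x) = x" for x by (auto simp: \<tau>_def)
  have inj: "inj_on \<tau> A" for A by (metis inj_on_def tt)
  have tS: "\<tau> ` S = S" using st by (auto simp: \<tau>_def)
  have img: "\<tau> ` \<tau> ` e = e" for e by (auto simp: image_image tt)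
  have img2: "(`) \<tau> ` (`) \<tau> ` m = m" for m by (auto simp: image_image tt)
  define M where "M = {m. perfect_matching S m}"
  have tM: "(`) \<tau> ` m \<in> M" if "m \<in> M" for m
    using that perfect_matching_image[of S m \<tau>, OF _ inj] tS by (auto simp: M_def)
  have bij: "bij_betw ((`) ((`) \<tau>)) M M"
    by (rule bij_betw_byWitness[where f'="(`) ((`) \<tau>)"]) (use tM img2 in auto)
  have J0: "J a a = 0" for a using J[of a a] by (simp add: eq_neg_iff_add_eq_0)
  have neg: "P J ((`) \<tau> ` m \<union> f) w = - P J (m \<union> f) w" if m: "m \<in> M" for m
  proof -
    have pm: "perfect_matching S m" using m by (simp add: M_def)
    obtain lf where lf: "distinct (flat lf)" "match_of lf = f" "set (flat lf) = T"
      using perfect_matching_list S(2) f by metis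
    show ?thesis
    proof (cases "{s, t} \<in> m")
      \<comment> \<open>A matching with the arc \<open>{s, t}\<close> is fixed by the exchange, and
        its term contains a factor \<open>J a a\<close>, which is zero.\<close>
      case True
      have "perfect_matching (S - \<Union> {{s, t}}) (m - {{s, t}})"
        by (rule perfect_matching_Diff) (use True pm in auto)
      then obtain l where l: "distinct (flat l)" "match_of l = m - {{s, t}}" "set (flat l) = S - {s, t}"
        using perfect_matching_list[of "S - {s, t}"] S by auto
      have "\<tau> ` e = e" if "e \<in> m" for e
      proof (cases "e = {s, t}")
        case False
        then have "s \<notin> e" "t \<notin> e" using perfect_matching_disjoint[OF pm that True] by auto
        then show ?thesis by (auto simp: \<tau>_def)
      qed (auto simp: \<tau>_def)
      then have "(`) \<tau> ` m = m" by (simp add: image_def)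
      moreover have "distinct (flat ((s, t) # l @ lf))" using l lf st S(3) by auto
      moreover have "m \<union> f = match_of ((s, t) # l @ lf)" using True l lf by auto
      ultimately have "P J (m \<union> f) w = pval J ((s, t) # l @ lf) w" by (intro P_eq[of J, OF J])
      then show ?thesis using \<open>(`) \<tau> ` m = m\<close> st(4) J0 by (simp add: pval_def)
    next
      case False
      obtain s' where s': "{s, s'} \<in> m" "s' \<noteq> s" "s' \<in> S"
        using perfect_matching_edge[OF pm st(1)] by metis
      obtain t' where t': "{t, t'} \<in> m" "t' \<noteq> t" "t' \<in> S"
        using perfect_matching_edge[OF pm st(2)] by metis
      have ne: "s' \<noteq> t" "t' \<noteq> s" using False s' t' by (auto simp: insert_commute)
      have ne3: "s' \<noteq> t'" using perfect_matching_disjoint[OF pm s'(1) t'(1)] ne st by auto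
      have "perfect_matching (S - \<Union> {{s, s'}, {t, t'}}) (m - {{s, s'}, {t, t'}})"
        by (rule perfect_matching_Diff) (use s' t' pm in auto)
      then obtain l where l: "distinct (flat l)" "match_of l = m - {{s, s'}, {t, t'}}" "set (flat l) = S - {s, s', t, t'}"
        using perfect_matching_list[of "S - {s, s', t, t'}"] S by (auto simp: insert_commute)
      have dis: "distinct (flat ((s, s') # (t, t') # l @ lf))" using l lf st S(3) s' t' ne ne3 by auto
      then have dis2: "distinct (flat ((t, s') # (s, t') # l @ lf))" by auto
      have mm: "m \<union> f = match_of ((s, s') # (t, t') # l @ lf)" using l lf s' t' by auto
      have "(`) \<tau> ` match_of l = match_of l"
      proof -
        have "\<tau> ` e = e" if "e \<in> match_of l" for e
        proof -
          have "e \<subseteq> S - {s, s', t, t'}" using that l(3) by (auto simp: set_flat)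
          then show ?thesis by (auto simp: \<tau>_def)
        qed
        then show ?thesis by (simp add: image_def)
      qed
      moreover have "m = insert {s, s'} (insert {t, t'} (match_of l))" using l s' t' by auto
      moreover have "\<tau> ` {s, s'} = {t, s'}" "\<tau> ` {t, t'} = {s, t'}" using ne s' t' by (auto simp: \<tau>_def)
      ultimately have "(`) \<tau> ` m = insert {t, s'} (insert {s, t'} (match_of l))" by simp
      then have mm2: "(`) \<tau> ` m \<union> f = match_of ((t, s') # (s, t') # l @ lf)" using lf by auto
      have "lsgn (flat ((t, s') # (s, t') # l @ lf)) = - lsgn (flat ((s, s') # (t, t') # l @ lf))"
        using osgn_swap[of s t] osgn_swap[of s s'] osgn_swap[of t s'] st s' ne
        by (simp add: mult_ac)
      then have "pval J ((t, s') # (s, t') # l @ lf) w = - pval J ((s, s') # (t, t') # l @ lf) w"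
        using st(4) by (simp add: pval_def)
      then show ?thesis using P_eq[of J, OF J dis mm] P_eq[of J, OF J dis2 mm2] by simp
    qed
  qed
  have "(\<Sum>m\<in>M. P J (m \<union> f) w) = (\<Sum>m\<in>M. P J ((`) \<tau> ` m \<union> f) w)"
    using sum.reindex_bij_betw[OF bij, of "\<lambda>m. P J (m \<union> f) w"] by simp
  also have "\<dots> = - (\<Sum>m\<in>M. P J (m \<union> f) w)" using neg by (simp add: sum_negf)
  finally show ?thesis by (simp add: M_def eq_neg_iff_add_eq_0)
qed

text \<open>Source of multilinearity: only the factor of the arc at \<open>p\<close> sees the letter
  at \<open>p\<close>.\<close>

lemma P_slot:
  assumes J: "\<And>a b. J a b = - J b a" and Z: "finite Z" "perfect_matching Z z" "p \<in> Z"
  shows "\<exists>c q. q \<in> Z \<and> q \<noteq> p \<and> (\<forall>x. P J z (w(p := x)) = c * J x (w q))"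
proof -
  obtain q where q: "{p, q} \<in> z" "q \<noteq> p" "q \<in> Z"
    using perfect_matching_edge[OF Z(2,3)] by metis
  have "perfect_matching (Z - \<Union> {{p, q}}) (z - {{p, q}})"
    by (rule perfect_matching_Diff) (use q Z in auto)
  then obtain l where l: "distinct (flat l)" "match_of l = z - {{p, q}}" "set (flat l) = Z - {p, q}"
    using perfect_matching_list[of "Z - {p, q}"] Z by auto
  have d: "distinct (flat ((p, q) # l))" using l q by simp
  have m: "z = match_of ((p, q) # l)" using l(2) q by auto
  have "fst e \<noteq> p \<and> snd e \<noteq> p" if "e \<in> set l" for e
  proof -
    have "{fst e, snd e} \<subseteq> \<Union> (match_of l)" using that by (auto simp: match_of_def)
    then show ?thesis using l(3) by (auto simp: set_flat)
  qed
  then have pr: "map (\<lambda>e. J ((w(p := x)) (fst e)) ((w(p := x)) (snd e))) l = map (\<lambda>e. J (w (fst e)) (w (snd e))) l" for x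
    by auto
  have "P J z w' = lsgn (flat ((p, q) # l)) * (J (w' p) (w' q) * (\<Prod>e\<leftarrow>l. J (w' (fst e)) (w' (snd e))))" for w'
    using P_eq[of J, OF J d m] by (simp add: pval_def)
  from this[of "w(p := _)", unfolded pr]
  have "P J z (w(p := x)) = lsgn (flat ((p, q) # l)) * (\<Prod>e\<leftarrow>l. J (w (fst e)) (w (snd e))) * J x (w q)" for x
    using q(2) by (simp add: mult_ac)
  then show ?thesis using q by blast
qed

text \<open>The identity diagram becomes such a nested family. A further outer arc adds no sign: its
  left end precedes all points listed after it, and its right end follows an even number of
  them.\<close>

lemma P_nested:
  assumes J: "\<And>a b. J a b = - J b a" and "r \<le> c"
  shows "P J {{c - 1 - i, c + i} | i. i < r} w = (\<Prod>i<r. J (w (c - 1 - i)) (w (c + i)))"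
proof -
  define l where "l r = map (\<lambda>i. (c - 1 - i, c + i)) (rev [0..<r])" for r
  have l: "l (Suc r) = (c - 1 - r, c + r) # l r" for r by (simp add: l_def)
  have *: "r \<le> c \<Longrightarrow> set (flat (l r)) \<subseteq> {c - r..<c + r} \<and> distinct (flat (l r)) \<and> lsgn (flat (l r)) = 1" for r
  proof (induction r)
    case 0
    then show ?case by (simp add: l_def)
  next
    case (Suc r)
    then have IH: "set (flat (l r)) \<subseteq> {c - r..<c + r}" "distinct (flat (l r))" "lsgn (flat (l r)) = 1" by auto
    have a: "(\<Prod>y\<leftarrow>ys. osgn x y) = 1" if "\<forall>y \<in> set ys. x < y" for x ys
      using that by (induction ys) (auto simp: osgn_def)
    have b: "(\<Prod>y\<leftarrow>ys. osgn x y) = (- 1) ^ length ys" if "\<forall>y \<in> set ys. y < x" for x ys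
      using that by (induction ys) (auto simp: osgn_def)
    have "(\<Prod>y\<leftarrow>flat (l r). osgn (c - 1 - r) y) = 1" "(\<Prod>y\<leftarrow>flat (l r). osgn (c + r) y) = 1"
      using a[of "flat (l r)" "c - 1 - r"] b[of "flat (l r)" "c + r"] IH(1) Suc.prems by (force, force)
    then have "lsgn (flat (l (Suc r))) = 1" unfolding l using IH(3) Suc.prems by (simp add: osgn_def)
    moreover have "c - 1 - r \<notin> set (flat (l r))" "c + r \<notin> set (flat (l r))" using IH(1) Suc.prems by force+
    moreover have "set (flat (l (Suc r))) \<subseteq> {c - Suc r..<c + Suc r}"
      unfolding l using IH(1) Suc.prems by fastforce
    ultimately show ?case unfolding l using IH(2) Suc.prems by auto
  qed
  have "{{c - 1 - i, c + i} | i. i < r} = match_of (l r)" by (auto simp: match_of_def l_def image_image)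
  moreover have "distinct (flat (l r))" using *[OF assms(2)] by blast
  ultimately have "P J {{c - 1 - i, c + i} | i. i < r} w = pval J (l r) w" by (intro P_eq[of J, OF J])
  also have "\<dots> = (\<Prod>i\<leftarrow>rev [0..<r]. J (w (c - 1 - i)) (w (c + i)))"
    using * assms(2) by (simp add: pval_def l_def comp_def)
  also have "\<dots> = (\<Prod>i<r. J (w (c - 1 - i)) (w (c + i)))"
    by (subst prod_list_set) (auto simp: atLeast0LessThan)
  finally show ?thesis .
qed

text \<open>All spans are computed in the space of all functions; \<open>vspan_free\<close> later
  identifies them with the spans in the records.\<close>

interpretation fv: vector_space "\<lambda>(c :: complex) (f :: 'x \<Rightarrow> complex) x. c * f x"
  by unfold_locales (auto simp: algebra_simps fun_eq_iff)

section \<open>Gluing diagrams\<close>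

text \<open>The partition of \<open>Z\<close> into connected components of the graph with edge set \<open>E\<close>, characterised by
  saturated sets instead of paths.\<close>

definition is_components :: "'a set \<Rightarrow> 'a set set \<Rightarrow> 'a set set \<Rightarrow> bool" where
  "is_components Z E \<pi> \<longleftrightarrow> partition_on Z \<pi> \<and> (\<forall>e\<in>E. \<exists>K\<in>\<pi>. e \<subseteq> K) \<and>
     (\<forall>K\<in>\<pi>. \<forall>U. (\<forall>e\<in>E. e \<subseteq> U \<or> e \<inter> U = {}) \<longrightarrow> K \<subseteq> U \<or> K \<inter> U = {})"

lemma is_components_disjoint:
  "is_components Z E \<pi> \<Longrightarrow> K \<in> \<pi> \<Longrightarrow> K' \<in> \<pi> \<Longrightarrow> x \<in> K \<Longrightarrow> x \<in> K' \<Longrightarrow> K = K'"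
  by (auto simp: is_components_def partition_on_def disjoint_def)

lemma is_components_nonempty: "is_components Z E \<pi> \<Longrightarrow> K \<in> \<pi> \<Longrightarrow> K \<noteq> {}"
  by (auto simp: is_components_def partition_on_def)

lemma is_components_Union: "is_components Z E \<pi> \<Longrightarrow> \<Union> \<pi> = Z"
  by (auto simp: is_components_def partition_on_def)

lemma is_components_edge: "is_components Z E \<pi> \<Longrightarrow> e \<in> E \<Longrightarrow> \<exists>K\<in>\<pi>. e \<subseteq> K"
  by (simp add: is_components_def)

lemma is_components_saturated:
  "is_components Z E \<pi> \<Longrightarrow> K \<in> \<pi> \<Longrightarrow> (\<And>e. e \<in> E \<Longrightarrow> e \<subseteq> U \<or> e \<inter> U = {}) \<Longrightarrow> K \<subseteq> U \<or> K \<inter> U = {}"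
  by (simp add: is_components_def)

text \<open>The arcs are themselves saturated sets, so no component is larger than an arc.\<close>

lemma is_components_matching:
  assumes "perfect_matching Z z" "is_components Z z \<pi>"
  shows "\<pi> = z"
proof -
  have closed: "\<forall>e'\<in>z. e' \<subseteq> e \<or> e' \<inter> e = {}" if "e \<in> z" for e
    using perfect_matching_disjoint[OF assms(1)] that by blast
  have 1: "K \<in> z" if K: "K \<in> \<pi>" for K
  proof -
    obtain x where x: "x \<in> K" using is_components_nonempty[OF assms(2) K] by auto
    then have "x \<in> \<Union> z" using is_components_Union[OF assms(2)] perfect_matching_Union[OF assms(1)] K by auto
    then obtain e where e: "e \<in> z" "x \<in> e" by auto
    have "K \<subseteq> e \<or> K \<inter> e = {}"
      by (rule is_components_saturated[OF assms(2) K]) (use closed[OF e(1)] in blast)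
    then have "K \<subseteq> e" using x e(2) by blast
    moreover obtain K' where K': "K' \<in> \<pi>" "e \<subseteq> K'" using is_components_edge[OF assms(2) e(1)] by blast
    then have "x \<in> K'" using e by auto
    then have "e \<subseteq> K" using is_components_disjoint[OF assms(2) K K'(1) x] K'(2) by simp
    ultimately show ?thesis using e by simp
  qed
  moreover have "e \<in> \<pi>" if e: "e \<in> z" for e
  proof -
    obtain K where K: "K \<in> \<pi>" "e \<subseteq> K" using is_components_edge[OF assms(2) e] by blast
    have "e \<noteq> {}" using e assms(1) by (auto simp: perfect_matching_def)
    then obtain x where "x \<in> e" by auto
    then have "K = e" using perfect_matching_disjoint[OF assms(1) 1[OF K(1)] e] K by blast
    then show ?thesis using K by simp
  qed
  ultimately show ?thesis by blast
qed

text \<open>The effect of gluing \<open>p\<close> to \<open>q\<close>: an arc between them closes to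
  a loop and disappears, otherwise the two arcs that end there merge.\<close>

definition join_at :: "'a \<Rightarrow> 'a \<Rightarrow> 'a set set \<Rightarrow> 'a set set" where
  "join_at p q z = (if {p, q} \<in> z then z - {{p, q}}
     else {e \<in> z. p \<notin> e \<and> q \<notin> e} \<union> {\<Union> {e \<in> z. p \<in> e \<or> q \<in> e} - {p, q}})"

lemma join_at_cases:
  assumes z: "perfect_matching Z z" and pq: "p \<in> Z" "q \<in> Z" "p \<noteq> q" "{p, q} \<notin> z"
  obtains p' q' where "{p', p} \<in> z" "{q, q'} \<in> z" "p' \<in> Z" "q' \<in> Z" "p' \<noteq> q'" "p' \<notin> {p, q}" "q' \<notin> {p, q}"
    "join_at p q z = z - {{p', p}, {q, q'}} \<union> {{p', q'}}" "{e \<in> z. p \<notin> e \<and> q \<notin> e} = z - {{p', p}, {q, q'}}"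
proof -
  obtain p' where p': "{p', p} \<in> z" "p' \<noteq> p" "p' \<in> Z"
    using perfect_matching_edge[OF z pq(1)] by (metis insert_commute)
  obtain q' where q': "{q, q'} \<in> z" "q' \<noteq> q" "q' \<in> Z"
    using perfect_matching_edge[OF z pq(2)] by metis
  have ne: "p' \<noteq> q" "q' \<noteq> p" using pq(4) p' q' by (auto simp: insert_commute)
  have ne3: "p' \<noteq> q'" using perfect_matching_disjoint[OF z p'(1) q'(1), of p'] q' ne pq(3) by (auto simp: doubleton_eq_iff)
  have p1: "e = {p', p}" if "e \<in> z" "p \<in> e" for e using perfect_matching_disjoint[OF z that(1) p'(1) that(2)] by simp
  have q1: "e = {q, q'}" if "e \<in> z" "q \<in> e" for e using perfect_matching_disjoint[OF z that(1) q'(1) that(2)] by simp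
  have E: "{e \<in> z. p \<in> e \<or> q \<in> e} = {{p', p}, {q, q'}}"
  proof (intro equalityI subsetI)
    fix e assume "e \<in> {e \<in> z. p \<in> e \<or> q \<in> e}"
    then show "e \<in> {{p', p}, {q, q'}}" using p1 q1 by blast
  next
    fix e assume "e \<in> {{p', p}, {q, q'}}"
    then show "e \<in> {e \<in> z. p \<in> e \<or> q \<in> e}" using p'(1) q'(1) by blast
  qed
  then have E2: "{e \<in> z. p \<notin> e \<and> q \<notin> e} = z - {{p', p}, {q, q'}}" by blast
  have E3: "\<Union> {{p', p}, {q, q'}} - {p, q} = {p', q'}" using p' q' ne by auto
  show thesis
    by (rule that[OF p'(1) q'(1) p'(3) q'(3) ne3 _ _ _ E2])
      (use p' q' ne pq E E2 E3 in \<open>auto simp: join_at_def\<close>)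
qed

lemma join_at_matching:
  assumes z: "perfect_matching Z z" and pq: "p \<in> Z" "q \<in> Z" "p \<noteq> q"
  shows "perfect_matching (Z - {p, q}) (join_at p q z)"
proof (cases "{p, q} \<in> z")
  case True
  then show ?thesis using perfect_matching_Diff[OF z, of "{{p, q}}"] by (simp add: join_at_def)
next
  case False
  from z pq False show ?thesis
  proof (rule join_at_cases)
    fix p' q' assume pq': "{p', p} \<in> z" "{q, q'} \<in> z" "p' \<in> Z" "q' \<in> Z" "p' \<noteq> q'" "p' \<notin> {p, q}" "q' \<notin> {p, q}"
      and j: "join_at p q z = z - {{p', p}, {q, q'}} \<union> {{p', q'}}"
    have "perfect_matching (Z - \<Union> {{p', p}, {q, q'}} \<union> {p', q'}) (z - {{p', p}, {q, q'}} \<union> {{p', q'}})"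
      by (rule perfect_matching_Un[OF perfect_matching_Diff[OF z] perfect_matching_pair]) (use pq' in auto)
    moreover have "Z - \<Union> {{p', p}, {q, q'}} \<union> {p', q'} = Z - {p, q}" using pq' by auto
    ultimately show ?thesis using j by simp
  qed
qed

text \<open>One glue edge is absorbed into the matching. Away from \<open>p\<close> and
  \<open>q\<close> the components stay the same. Only \<open>{p, q}\<close> itself can disappear,
  and it is a component exactly when the arc \<open>{p, q}\<close> closes to a loop.\<close>

lemma is_components_join:
  assumes z: "perfect_matching Z z" and pq: "p \<in> Z" "q \<in> Z" "p \<noteq> q" and g: "\<And>e. e \<in> g \<Longrightarrow> p \<notin> e \<and> q \<notin> e \<and> e \<noteq> {}"
    and \<pi>: "is_components Z (z \<union> insert {p, q} g) \<pi>"
  shows "is_components (Z - {p, q}) (join_at p q z \<union> g) ((\<lambda>K. K - {p, q}) ` \<pi> - {{}})"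
    and "({p, q} \<in> \<pi>) = ({p, q} \<in> z)" and "\<exists>K\<in>\<pi>. {p, q} \<subseteq> K"
proof -
  let ?\<pi>1 = "(\<lambda>K. K - {p, q}) ` \<pi> - {{}}" and ?E = "z \<union> insert {p, q} g"
  have edge: "\<exists>K\<in>\<pi>. e \<subseteq> K" if "e \<in> ?E" for e by (rule is_components_edge[OF \<pi> that])
  have closed: "K \<subseteq> U \<or> K \<inter> U = {}" if "K \<in> \<pi>" "\<forall>e\<in>?E. e \<subseteq> U \<or> e \<inter> U = {}" for K U
    by (rule is_components_saturated[OF \<pi> that(1)]) (rule that(2)[rule_format])
  show ex: "\<exists>K\<in>\<pi>. {p, q} \<subseteq> K" using edge[of "{p, q}"] by simp
  have part: "partition_on (Z - {p, q}) ?\<pi>1"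
  proof (rule partition_onI)
    show "\<Union> ?\<pi>1 = Z - {p, q}" using is_components_Union[OF \<pi>] by auto
    fix A B assume "A \<in> ?\<pi>1" "B \<in> ?\<pi>1" "A \<noteq> B"
    then obtain K K' where K: "K \<in> \<pi>" "K' \<in> \<pi>" "A = K - {p, q}" "B = K' - {p, q}" by blast
    then have "K \<noteq> K'" using \<open>A \<noteq> B\<close> by auto
    then have "K \<inter> K' = {}" using is_components_disjoint[OF \<pi> K(1,2)] by blast
    then show "disjnt A B" using K by (auto simp: disjnt_def)
  qed auto
  have sub: "\<exists>K\<in>?\<pi>1. e \<subseteq> K" if "e \<subseteq> K" "K \<in> \<pi>" "p \<notin> e" "q \<notin> e" "e \<noteq> {}" for e K
    by (rule bexI[of _ "K - {p, q}"]) (use that in auto)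
  have gne: "e \<noteq> {}" if "e \<in> z" for e using z that by (auto simp: perfect_matching_def)
  show "({p, q} \<in> \<pi>) = ({p, q} \<in> z)"
  proof
    assume "{p, q} \<in> z"
    have cl: "\<forall>e\<in>?E. e \<subseteq> {p, q} \<or> e \<inter> {p, q} = {}"
      using perfect_matching_disjoint[OF z _ \<open>{p, q} \<in> z\<close>] g by blast
    obtain K where K: "K \<in> \<pi>" "{p, q} \<subseteq> K" using ex by blast
    then have "K = {p, q}" using closed[OF K(1) cl] by auto
    then show "{p, q} \<in> \<pi>" using K by simp
  next
    assume a: "{p, q} \<in> \<pi>"
    show "{p, q} \<in> z"
    proof (rule ccontr)
      assume "{p, q} \<notin> z"
      with z pq show False
      proof (rule join_at_cases)
        fix p' q' assume pq': "{p', p} \<in> z" "p' \<notin> {p, q}"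
        obtain K where K: "K \<in> \<pi>" "{p', p} \<subseteq> K" using edge pq' by blast
        then have "K = {p, q}" using is_components_disjoint[OF \<pi> K(1) a, of p] by auto
        then show False using K pq' by auto
      qed
    qed
  qed
  show "is_components (Z - {p, q}) (join_at p q z \<union> g) ?\<pi>1"
  proof (cases "{p, q} \<in> z")
    case True
    have j: "join_at p q z = z - {{p, q}}" using True by (simp add: join_at_def)
    have npq: "p \<notin> e \<and> q \<notin> e" if "e \<in> z" "e \<noteq> {p, q}" for e
      using perfect_matching_disjoint[OF z that(1) True] that(2) by blast
    show ?thesis unfolding is_components_def
    proof (intro conjI ballI allI impI part)
      fix e assume e: "e \<in> join_at p q z \<union> g"
      then have "p \<notin> e \<and> q \<notin> e \<and> e \<noteq> {}" using npq g gne j by auto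
      moreover obtain K where "K \<in> \<pi>" "e \<subseteq> K" using edge[of e] e j by auto
      ultimately show "\<exists>K\<in>?\<pi>1. e \<subseteq> K" using sub[of e K] by blast
    next
      fix K1 U assume K1: "K1 \<in> ?\<pi>1" and U: "\<forall>e\<in>join_at p q z \<union> g. e \<subseteq> U \<or> e \<inter> U = {}"
      then obtain K where K: "K \<in> \<pi>" "K1 = K - {p, q}" by auto
      \<comment> \<open>Without \<open>p\<close> and \<open>q\<close> the set \<open>U\<close> is
        saturated for the old graph, because \<open>{p, q}\<close> meets no other edge.\<close>
      have "\<forall>e\<in>?E. e \<subseteq> U - {p, q} \<or> e \<inter> (U - {p, q}) = {}"
      proof
        fix e assume "e \<in> ?E"
        then consider "e = {p, q}" | "e \<in> join_at p q z \<union> g" "p \<notin> e \<and> q \<notin> e" using npq g j by blast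
        then show "e \<subseteq> U - {p, q} \<or> e \<inter> (U - {p, q}) = {}" using U by cases blast+
      qed
      from closed[OF K(1) this] show "K1 \<subseteq> U \<or> K1 \<inter> U = {}" using K(2) by blast
    qed
  next
    case False
    from z pq False show ?thesis
    proof (rule join_at_cases)
      fix p' q' assume pq': "{p', p} \<in> z" "{q, q'} \<in> z" "p' \<in> Z" "q' \<in> Z" "p' \<noteq> q'" "p' \<notin> {p, q}" "q' \<notin> {p, q}"
        and j: "join_at p q z = z - {{p', p}, {q, q'}} \<union> {{p', q'}}" and r: "{e \<in> z. p \<notin> e \<and> q \<notin> e} = z - {{p', p}, {q, q'}}"
      show ?thesis unfolding is_components_def
      proof (intro conjI ballI allI impI part)
        fix e assume "e \<in> join_at p q z \<union> g"
        then consider "e \<in> z \<union> g" "p \<notin> e" "q \<notin> e" | "e = {p', q'}" using j r g by blast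
        then show "\<exists>K\<in>?\<pi>1. e \<subseteq> K"
        proof cases
          case 1
          then obtain K where "K \<in> \<pi>" "e \<subseteq> K" using edge[of e] by blast
          moreover have "e \<noteq> {}" using 1 g gne by auto
          ultimately show ?thesis using sub[of e K] 1 by blast
        next
          case 2
          obtain K1 where K1: "K1 \<in> \<pi>" "{p', p} \<subseteq> K1" using edge[of "{p', p}"] pq' by blast
          obtain K2 where K2: "K2 \<in> \<pi>" "{q, q'} \<subseteq> K2" using edge[of "{q, q'}"] pq' by blast
          obtain K3 where K3: "K3 \<in> \<pi>" "{p, q} \<subseteq> K3" using ex by blast
          have "K1 = K3" "K2 = K3" using is_components_disjoint[OF \<pi> K1(1) K3(1), of p]
            is_components_disjoint[OF \<pi> K2(1) K3(1), of q] K1 K2 K3 by auto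
          then show ?thesis using sub[of e K3] 2 K1 K2 K3 pq' by auto
        qed
      next
        fix K1 U assume K1: "K1 \<in> ?\<pi>1" and U: "\<forall>e\<in>join_at p q z \<union> g. e \<subseteq> U \<or> e \<inter> U = {}"
        then obtain K where K: "K \<in> \<pi>" "K1 = K - {p, q}" by auto
        \<comment> \<open>To be saturated in the old graph, the set has to treat \<open>p\<close>
          and \<open>q\<close> like their partners \<open>p'\<close> and \<open>q'\<close>, which
          the new arc keeps together.\<close>
        define U' where "U' = (U - {p, q}) \<union> (if p' \<in> U then {p, q} else {})"
        have pq2: "p' \<in> U \<longleftrightarrow> q' \<in> U" using U j by auto
        have "\<forall>e\<in>?E. e \<subseteq> U' \<or> e \<inter> U' = {}"
        proof
          fix e assume e: "e \<in> ?E"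
          have "p \<notin> e \<and> q \<notin> e \<and> e \<in> join_at p q z" if "e \<in> z" "e \<noteq> {p', p}" "e \<noteq> {q, q'}"
          proof -
            have "e \<in> z - {{p', p}, {q, q'}}" using that by simp
            then show ?thesis unfolding j using r by auto
          qed
          then consider "e = {p, q}" | "e = {p', p}" | "e = {q, q'}" | "e \<in> join_at p q z \<union> g" "p \<notin> e" "q \<notin> e"
            using e g by auto
          then show "e \<subseteq> U' \<or> e \<inter> U' = {}"
          proof cases
            case 4
            then have "e \<subseteq> U \<or> e \<inter> U = {}" using U by blast
            then show ?thesis using 4 by (auto simp: U'_def)
          qed (use pq2 pq' in \<open>auto simp: U'_def\<close>)
        qed
        from closed[OF K(1) this] show "K1 \<subseteq> U \<or> K1 \<inter> U = {}" using K(2) by (auto simp: U'_def split: if_splits)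
      qed
    qed
  qed
qed

section \<open>Contraction of nested pairs\<close>

definition contr :: "'l set \<Rightarrow> ('l \<Rightarrow> complex) \<Rightarrow> ('l \<Rightarrow> 'l) \<Rightarrow> nat \<Rightarrow> nat \<Rightarrow> ((nat \<Rightarrow> 'l) \<Rightarrow> complex) \<Rightarrow> (nat \<Rightarrow> 'l) \<Rightarrow> complex" where
  "contr Ls C d c j F w = (\<Sum>l\<in>Ls. C l * F (w(c - 1 - j := l, c + j := d l)))"

lemma fold_contr_scale: "fold (contr Ls C d c) js (\<lambda>w. a * F w) = (\<lambda>w. a * fold (contr Ls C d c) js F w)"
proof (induction js arbitrary: F)
  case (Cons j js)
  have "contr Ls C d c j (\<lambda>w. a * F w) = (\<lambda>w. a * contr Ls C d c j F w)"
    by (auto simp: contr_def sum_distrib_left mult_ac)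
  then show ?case using Cons by simp
qed simp

definition glue_points :: "nat \<Rightarrow> nat \<Rightarrow> nat \<Rightarrow> nat set" where
  "glue_points c k s = {c - s..<c - k} \<union> {c + k..<c + s}"

definition glue_edges :: "nat \<Rightarrow> nat \<Rightarrow> nat \<Rightarrow> nat set set" where
  "glue_edges c k s = (\<lambda>j. {c - 1 - j, c + j}) ` {k..<s}"

text \<open>Induction from the innermost pair outwards. Once the inner pairs are gone,
  \<open>Z \<inter> {c - k..<c + k} = {}\<close> makes the next two points neighbours, and
  \<open>P_contract\<close> applies without a sign. Each step either closes a loop, which yields the
  factor of the trace, or joins two arcs.\<close>

lemma glued_P:
  assumes J: "\<And>a b. J a b = - J b a" and inv: "\<And>a b. (\<Sum>l\<in>Ls. C l * J a l * J (d l) b) = J a b" and "s \<le> c"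
  shows "k \<le> s \<Longrightarrow> finite Z \<Longrightarrow> perfect_matching Z z \<Longrightarrow> glue_points c k s \<subseteq> Z \<Longrightarrow> Z \<inter> {c - k..<c + k} = {} \<Longrightarrow>
    is_components Z (z \<union> glue_edges c k s) \<pi> \<Longrightarrow>
    perfect_matching (Z - glue_points c k s) {K - glue_points c k s | K. K \<in> \<pi> \<and> \<not> K \<subseteq> glue_points c k s} \<and>
    fold (contr Ls C d c) [k..<s] (P J z) w = (\<Sum>l\<in>Ls. C l * J l (d l)) ^ card {K \<in> \<pi>. K \<subseteq> glue_points c k s} *
      P J {K - glue_points c k s | K. K \<in> \<pi> \<and> \<not> K \<subseteq> glue_points c k s} w"
proof (induction "s - k" arbitrary: k Z z \<pi>)
  case 0
  then have "k = s" by simp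
  then have G: "glue_points c k s = {}" "glue_edges c k s = {}" by (auto simp: glue_points_def glue_edges_def)
  have "\<pi> = z" using is_components_matching[OF 0(4)] 0(7) G by simp
  then have E: "{K \<in> \<pi>. K \<subseteq> glue_points c k s} = {}"
    "{K - glue_points c k s | K. K \<in> \<pi> \<and> \<not> K \<subseteq> glue_points c k s} = z"
    using 0(4) G by (auto simp: perfect_matching_def)
  show ?case unfolding E using 0(4) G \<open>k = s\<close> by simp
next
  case (Suc x)
  let ?p = "c - 1 - k" and ?q = "c + k" and ?G = "glue_points c k s" and ?G1 = "glue_points c (Suc k) s"
  let ?\<pi>1 = "(\<lambda>K. K - {?p, ?q}) ` \<pi> - {{}}" and ?g = "glue_edges c (Suc k) s"
  let ?D = "\<Sum>l\<in>Ls. C l * J l (d l)"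
  have ks: "k < s" "k < c" using Suc(2) assms(3) by auto
  have G: "?G = insert ?p (insert ?q ?G1)" "?p \<notin> ?G1" "?q \<notin> ?G1" using ks assms(3) by (auto simp: glue_points_def)
  have "{k..<s} = insert k {Suc k..<s}" using ks by auto
  then have E: "glue_edges c k s = insert {?p, ?q} ?g" by (simp add: glue_edges_def)
  have pq: "?p \<in> Z" "?q \<in> Z" "?p \<noteq> ?q" "?p < ?q" using Suc.prems(4) G ks by auto
  have g: "?p \<notin> e \<and> ?q \<notin> e \<and> e \<noteq> {}" if "e \<in> ?g" for e using that ks assms(3) by (auto simp: glue_edges_def)
  have \<pi>: "is_components Z (z \<union> insert {?p, ?q} ?g) \<pi>" using Suc.prems(6) E by simp
  note J1 = is_components_join[OF Suc.prems(3) pq(1-3) g \<pi>]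
  have pm: "perfect_matching (Z - {?p, ?q}) (join_at ?p ?q z)" by (rule join_at_matching[OF Suc.prems(3) pq(1-3)])
  have IH: "perfect_matching (Z - {?p, ?q} - ?G1) {K - ?G1 | K. K \<in> ?\<pi>1 \<and> \<not> K \<subseteq> ?G1} \<and>
    fold (contr Ls C d c) [Suc k..<s] (P J (join_at ?p ?q z)) w = ?D ^ card {K \<in> ?\<pi>1. K \<subseteq> ?G1} *
      P J {K - ?G1 | K. K \<in> ?\<pi>1 \<and> \<not> K \<subseteq> ?G1} w"
  proof (rule Suc.hyps(1)[OF _ _ _ pm _ _ J1(1)])
    show "?G1 \<subseteq> Z - {?p, ?q}" using Suc.prems(4) G by auto
    have "{c - Suc k..<c + Suc k} \<subseteq> insert ?p (insert ?q {c - k..<c + k})" using ks by auto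
    then show "(Z - {?p, ?q}) \<inter> {c - Suc k..<c + Suc k} = {}" using Suc.prems(5) by blast
  qed (use Suc.hyps(2) Suc.prems in auto)
  have adj: "(y < ?p) = (y < ?q)" if "y \<in> Z" "y \<noteq> ?p" "y \<noteq> ?q" for y
  proof -
    have "y \<notin> {c - k..<c + k}" using Suc.prems(5) that by blast
    then show ?thesis using that ks by auto
  qed
  have ctr: "contr Ls C d c k (P J z) = (\<lambda>w. (if {?p, ?q} \<in> z then ?D else 1) * P J (join_at ?p ?q z) w)"
  proof
    fix w
    show "contr Ls C d c k (P J z) w = (if {?p, ?q} \<in> z then ?D else 1) * P J (join_at ?p ?q z) w"
      using P_contract[where J=J and Ls=Ls and C=C and d=d and w=w, OF J inv Suc.prems(2,3) pq(4,1,2) adj]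
      by (simp add: contr_def join_at_def)
  qed
  have S1: "{K - ?G1 | K. K \<in> ?\<pi>1 \<and> \<not> K \<subseteq> ?G1} = {K - ?G | K. K \<in> \<pi> \<and> \<not> K \<subseteq> ?G}" (is "?L = ?R")
  proof (intro equalityI subsetI)
    fix A assume "A \<in> ?L"
    then obtain K where "K \<in> \<pi>" "A = (K - {?p, ?q}) - ?G1" "\<not> K - {?p, ?q} \<subseteq> ?G1" by blast
    then show "A \<in> ?R" using G(1) by (intro CollectI exI[of _ K]) auto
  next
    fix A assume "A \<in> ?R"
    then obtain K where "K \<in> \<pi>" "A = K - ?G" "\<not> K \<subseteq> ?G" by blast
    then show "A \<in> ?L" using G(1) by (intro CollectI exI[of _ "K - {?p, ?q}"]) auto
  qed
  have fin: "finite \<pi>" using finite_elements[OF Suc.prems(2)] \<pi> by (simp add: is_components_def)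
  have same: "K = {?p, ?q}" if K: "K \<in> \<pi>" "K \<subseteq> {?p, ?q}" for K
  proof -
    obtain K' where K': "K' \<in> \<pi>" "{?p, ?q} \<subseteq> K'" using J1(3) by blast
    obtain x where "x \<in> K" using is_components_nonempty[OF \<pi> K(1)] by auto
    then have "K = K'" using is_components_disjoint[OF \<pi> K(1) K'(1), of x] K(2) K'(2) by blast
    then show ?thesis using K' K by auto
  qed
  have bij: "bij_betw (\<lambda>K. K - {?p, ?q}) ({K \<in> \<pi>. K \<subseteq> ?G} - {{?p, ?q}}) {K \<in> ?\<pi>1. K \<subseteq> ?G1}"
    unfolding bij_betw_def
  proof
    show "inj_on (\<lambda>K. K - {?p, ?q}) ({K \<in> \<pi>. K \<subseteq> ?G} - {{?p, ?q}})"
    proof (rule inj_onI)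
      fix K K' assume K: "K \<in> {K \<in> \<pi>. K \<subseteq> ?G} - {{?p, ?q}}" "K' \<in> {K \<in> \<pi>. K \<subseteq> ?G} - {{?p, ?q}}" "K - {?p, ?q} = K' - {?p, ?q}"
      then have "K - {?p, ?q} \<noteq> {}" using same[of K] by auto
      then obtain x where "x \<in> K - {?p, ?q}" by auto
      then show "K = K'" using is_components_disjoint[OF \<pi>, of K K' x] K by blast
    qed
    show "(\<lambda>K. K - {?p, ?q}) ` ({K \<in> \<pi>. K \<subseteq> ?G} - {{?p, ?q}}) = {K \<in> ?\<pi>1. K \<subseteq> ?G1}" (is "?L = ?R")
    proof (intro equalityI subsetI)
      fix A assume "A \<in> ?L"
      then obtain K where K: "K \<in> \<pi>" "K \<subseteq> ?G" "K \<noteq> {?p, ?q}" "A = K - {?p, ?q}" by blast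
      then have "A \<noteq> {}" using same[of K] by auto
      then show "A \<in> ?R" using K G by auto
    next
      fix A assume "A \<in> ?R"
      then obtain K where K: "K \<in> \<pi>" "A = K - {?p, ?q}" "A \<noteq> {}" "A \<subseteq> ?G1" by blast
      then show "A \<in> ?L" using G by (intro image_eqI[of _ _ K]) auto
    qed
  qed
  \<comment> \<open>The loop that closes when the pair is already an arc is a component that the
    smaller graph no longer has.\<close>
  have "card {K \<in> \<pi>. K \<subseteq> ?G} = card {K \<in> ?\<pi>1. K \<subseteq> ?G1} + (if {?p, ?q} \<in> z then 1 else 0)"
  proof (cases "{?p, ?q} \<in> z")
    case True
    then have "{?p, ?q} \<in> {K \<in> \<pi>. K \<subseteq> ?G}" using J1(2) G by auto
    then have "card {K \<in> \<pi>. K \<subseteq> ?G} = Suc (card ({K \<in> \<pi>. K \<subseteq> ?G} - {{?p, ?q}}))"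
      by (rule card_Suc_Diff1[symmetric, rotated]) (use fin in simp)
    then show ?thesis using bij_betw_same_card[OF bij] True by simp
  next
    case False
    then have "{K \<in> \<pi>. K \<subseteq> ?G} - {{?p, ?q}} = {K \<in> \<pi>. K \<subseteq> ?G}" using J1(2) by auto
    then show ?thesis using bij_betw_same_card[OF bij] False by simp
  qed
  moreover have "fold (contr Ls C d c) [k..<s] (P J z) w =
      (if {?p, ?q} \<in> z then ?D else 1) * fold (contr Ls C d c) [Suc k..<s] (P J (join_at ?p ?q z)) w"
    using ks by (simp add: upt_conv_Cons ctr fold_contr_scale)
  moreover have "Z - {?p, ?q} - ?G1 = Z - ?G" using G by auto
  ultimately show ?case using IH S1 by simp
qed

lemma lists_Suc_snoc: "{u. length u = Suc s \<and> set u \<subseteq> Ls} = (\<lambda>(u, l). u @ [l]) ` ({u. length u = s \<and> set u \<subseteq> Ls} \<times> Ls)"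
proof (intro equalityI subsetI)
  fix u assume "u \<in> {u. length u = Suc s \<and> set u \<subseteq> Ls}"
  moreover from this have "u \<noteq> []" by auto
  then have "u = butlast u @ [last u]" "last u \<in> set u" by simp_all
  ultimately show "u \<in> (\<lambda>(u, l). u @ [l]) ` ({u. length u = s \<and> set u \<subseteq> Ls} \<times> Ls)"
    by (intro image_eqI[of _ _ "(butlast u, last u)"]) (auto dest: in_set_butlastD)
qed auto

text \<open>The letter \<open>u ! j\<close> labels the pair \<open>c - 1 - j\<close>,
  \<open>c + j\<close>. The word grows at its end because the outermost pair is contracted
  last.\<close>

lemma fold_contr_sum:
  assumes "finite Ls"
  shows "s \<le> c \<Longrightarrow> fold (contr Ls C d c) [0..<s] F w = (\<Sum>u\<in>{u. length u = s \<and> set u \<subseteq> Ls}. (\<Prod>l\<leftarrow>u. C l) *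
    F (\<lambda>x. if c - s \<le> x \<and> x < c then u ! (c - 1 - x) else if c \<le> x \<and> x < c + s then d (u ! (x - c)) else w x))"
proof (induction s arbitrary: w)
  case 0
  have W: "(\<lambda>x. if c - 0 \<le> x \<and> x < c then u ! (c - 1 - x) else if c \<le> x \<and> x < c + 0 then d (u ! (x - c)) else w x) = w" for u
    by (auto simp: fun_eq_iff)
  have E: "{u. length u = 0 \<and> set u \<subseteq> Ls} = {[]}" by auto
  show ?case unfolding E W by simp
next
  case (Suc s)
  let ?L = "\<lambda>s. {u. length u = s \<and> set u \<subseteq> Ls}"
  let ?W = "\<lambda>s u w x. if c - s \<le> x \<and> x < c then u ! (c - 1 - x) else if c \<le> x \<and> x < c + s then d (u ! (x - c)) else w x"
  have W: "?W s u (w(c - 1 - s := l, c + s := d l)) = ?W (Suc s) (u @ [l]) w" if "length u = s" for u l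
    using that Suc.prems by (auto simp: fun_eq_iff nth_append)
  have inj: "inj_on (\<lambda>(u, l). u @ [l]) (?L s \<times> Ls)" by (auto simp: inj_on_def)
  have "fold (contr Ls C d c) [0..<Suc s] F w = (\<Sum>l\<in>Ls. C l * fold (contr Ls C d c) [0..<s] F (w(c - 1 - s := l, c + s := d l)))"
    by (simp add: contr_def)
  also have "\<dots> = (\<Sum>l\<in>Ls. C l * (\<Sum>u\<in>?L s. (\<Prod>l\<leftarrow>u. C l) * F (?W s u (w(c - 1 - s := l, c + s := d l)))))"
    using Suc.prems by (simp only: Suc.IH Suc_leD)
  also have "\<dots> = (\<Sum>l\<in>Ls. \<Sum>u\<in>?L s. (\<Prod>l\<leftarrow>u @ [l]. C l) * F (?W (Suc s) (u @ [l]) w))"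
    by (intro sum.cong refl) (auto simp: sum_distrib_left W mult_ac intro!: sum.cong)
  also have "\<dots> = (\<Sum>u\<in>?L s. \<Sum>l\<in>Ls. (\<Prod>l\<leftarrow>u @ [l]. C l) * F (?W (Suc s) (u @ [l]) w))"
    by (rule sum.swap)
  also have "\<dots> = (\<Sum>(u, l)\<in>?L s \<times> Ls. (\<Prod>l\<leftarrow>u @ [l]. C l) * F (?W (Suc s) (u @ [l]) w))"
    using assms finite_lists_length_eq[OF assms, of s] by (subst sum.cartesian_product) (auto simp: conj_commute)
  also have "\<dots> = (\<Sum>u\<in>?L (Suc s). (\<Prod>l\<leftarrow>u. C l) * F (?W (Suc s) u w))"
    unfolding lists_Suc_snoc by (subst sum.reindex[OF inj]) (simp add: case_prod_unfold comp_def)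
  finally show ?case .
qed

text \<open>The points are numbered around the boundary: the bottom edge from left to right, then
  the top edge from right to left. If the positions of \<open>y\<close> come before those of
  \<open>x\<close>, the two copies of the \<open>i\<close>-th middle point are
  \<open>t + s - i\<close> and \<open>t + s + i - 1\<close>, so the glued pairs are nested around
  \<open>t + s\<close>.\<close>

definition posn :: "nat \<Rightarrow> nat \<Rightarrow> nat + nat \<Rightarrow> nat" where
  "posn r s = case_sum (\<lambda>i. s + r - i) (\<lambda>j. j - 1)"

lemma posn_inj: "inj_on (posn r s) (points r s)"
  by (auto simp: inj_on_def posn_def points_def)

lemma posn_image: "posn r s ` points r s = {..<s + r}"
proof (intro equalityI subsetI)
  fix p assume p: "p \<in> {..<s + r}"
  show "p \<in> posn r s ` points r s"
  proof (cases "p < s")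
    case True
    then show ?thesis by (intro image_eqI[of _ _ "Inr (Suc p)"]) (auto simp: posn_def points_def)
  next
    case False
    then have "Inl (s + r - p) \<in> points r s" using p by (auto simp: points_def intro!: imageI)
    then show ?thesis using p by (intro image_eqI[of _ _ "Inl (s + r - p)"]) (auto simp: posn_def)
  qed
qed (auto simp: posn_def points_def)

definition Pos :: "nat \<Rightarrow> nat \<Rightarrow> diagram \<Rightarrow> nat set set" where
  "Pos r s x = (`) (posn r s) ` x"

lemma Pos_matching: "x \<in> diagrams r s \<Longrightarrow> perfect_matching {..<s + r} (Pos r s x)"
  using perfect_matching_image[OF _ posn_inj] posn_image by (metis Pos_def diagrams_def mem_Collect_eq)

section \<open>Stacked diagrams in boundary positions\<close>

context
  fixes r s t :: nat and x y :: diagram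
  assumes x: "x \<in> diagrams r s" and y: "y \<in> diagrams s t"
begin

definition "cc = t + s"

text \<open>Not injective: the two positions of a glued pair share a value. The stacked picture
  identifies them, whereas \<open>glue_edges\<close> joins them by an edge.\<close>

definition stack_point :: "nat \<Rightarrow> stacked_point" where
  "stack_point p = (if p < t then Bot (p + 1) else if p < cc then Mid (cc - p)
     else if p < cc + s then Mid (p - cc + 1) else Top (cc + s + r - p))"

definition "ZZ = {..<t + s + s + r}"

definition "zz = Pos s t y \<union> (`) (\<lambda>p. cc + p) ` Pos r s x"

lemma stack_point_lower: "v \<in> points s t \<Longrightarrow> stack_point (posn s t v) = case_sum Mid Bot v"
  by (auto simp: stack_point_def posn_def points_def cc_def)

lemma stack_point_fibre:
  assumes "a < a'" "a' \<in> ZZ" "stack_point a = stack_point a'"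
  shows "a' - cc < s \<and> a = cc - 1 - (a' - cc) \<and> a' = cc + (a' - cc)"
proof -
  have "\<not> a < t" "a < cc" "\<not> a' < cc" "a' < cc + s"
    using assms by (auto simp: stack_point_def ZZ_def cc_def split: if_splits)
  moreover from this have "cc - a = a' - cc + 1" using assms(3) by (simp add: stack_point_def)
  ultimately show ?thesis by linarith
qed

lemma stack_point_upper: "v \<in> points r s \<Longrightarrow> stack_point (cc + posn r s v) = case_sum Top Mid v"
  by (auto simp: stack_point_def posn_def points_def cc_def)

lemma pm_x: "perfect_matching (points r s) x" and pm_y: "perfect_matching (points s t) y"
  using x y by (auto simp: diagrams_def)

lemma zz_upper: "perfect_matching {cc..<cc + s + r} ((`) (\<lambda>p. cc + p) ` Pos r s x)"
proof -
  have "(\<lambda>p. cc + p) ` {..<s + r} = {cc..<cc + s + r}"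
    by (auto simp: image_iff) (metis le_add_diff_inverse nat_add_left_cancel_less add.assoc lessThan_iff)
  then show ?thesis using perfect_matching_image[OF Pos_matching[OF x], of "\<lambda>p. cc + p"] by (simp add: inj_on_def)
qed

lemma zz_matching: "perfect_matching ZZ zz"
proof -
  have "perfect_matching ({..<t + s} \<union> {cc..<cc + s + r}) zz"
    unfolding zz_def by (rule perfect_matching_Un[OF Pos_matching[OF y] zz_upper]) (auto simp: cc_def)
  moreover have "{..<t + s} \<union> {cc..<cc + s + r} = ZZ" by (auto simp: cc_def ZZ_def)
  ultimately show ?thesis by simp
qed

lemma stack_eq: "stack x y = (`) stack_point ` zz"
proof -
  have "(`) stack_point ` Pos s t y = (`) (case_sum Mid Bot) ` y"
    unfolding Pos_def image_image
    by (intro image_cong refl) (use stack_point_lower perfect_matching_Union[OF pm_y] in blast)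
  moreover have "(`) stack_point ` (`) (\<lambda>p. cc + p) ` Pos r s x = (`) (case_sum Top Mid) ` x"
    unfolding Pos_def image_image
    by (intro image_cong refl) (use stack_point_upper perfect_matching_Union[OF pm_x] in blast)
  ultimately show ?thesis by (simp add: stack_def zz_def image_Un Un_commute)
qed

lemma Union_stack: "\<Union> (stack x y) = stack_point ` ZZ"
  unfolding stack_eq using perfect_matching_Union[OF zz_matching] by blast

definition "SR = Restr ({(p, q). {p, q} \<in> stack x y}\<^sup>*) (\<Union> (stack x y))"

lemma SR_equiv: "equiv (\<Union> (stack x y)) SR"
proof (rule equivI)
  have "sym {(p, q). {p, q} \<in> stack x y}" by (auto simp: sym_def insert_commute)
  then have "sym ({(p, q). {p, q} \<in> stack x y}\<^sup>*)" by (rule sym_rtrancl)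
  then show "sym SR" by (auto simp: SR_def sym_def)
  show "trans SR" using trans_rtrancl by (fastforce simp: SR_def trans_def)
qed (auto simp: SR_def refl_on_def)

lemma stack_components_eq: "stack_components x y = \<Union> (stack x y) // SR"
  by (simp add: stack_components_def SR_def Let_def)

lemma stack_components_partition: "partition_on (stack_point ` ZZ) (stack_components x y)"
  unfolding stack_components_eq Union_stack[symmetric] by (rule partition_on_quotient[OF SR_equiv])

definition "pull K = stack_point -` K \<inter> ZZ"

lemma pull_inj: "inj_on pull (stack_components x y)"
proof (rule inj_onI)
  fix K K' assume "K \<in> stack_components x y" "K' \<in> stack_components x y" "pull K = pull K'"
  moreover have "stack_point ` pull K = K" if "K \<in> stack_components x y" for K
  proof -
    have "K \<subseteq> stack_point ` ZZ" using stack_components_partition that by (auto simp: partition_on_def)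
    then show ?thesis unfolding pull_def by blast
  qed
  ultimately show "K = K'" by metis
qed

text \<open>Passage from components defined by paths between identified points to components of a
  graph in which the two copies of a middle point stay apart.\<close>

lemma stack_components_pull: "is_components ZZ (zz \<union> glue_edges cc 0 s) (pull ` stack_components x y)"
  unfolding is_components_def
proof (intro conjI ballI allI impI)
  note part = stack_components_partition
  show "partition_on ZZ (pull ` stack_components x y)"
  proof (rule partition_onI)
    show "\<Union> (pull ` stack_components x y) = ZZ" using part by (auto simp: pull_def partition_on_def)
    show "{} \<notin> pull ` stack_components x y"
    proof
      assume "{} \<in> pull ` stack_components x y"
      then obtain K where K: "K \<in> stack_components x y" "pull K = {}" by auto
      then have "K \<noteq> {}" "K \<subseteq> stack_point ` ZZ" using part by (auto simp: partition_on_def)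
      then show False using K(2) unfolding pull_def by blast
    qed
    show "disjnt p q" if pq: "p \<in> pull ` stack_components x y" "q \<in> pull ` stack_components x y" "p \<noteq> q" for p q
    proof -
      obtain K K' where K: "K \<in> stack_components x y" "K' \<in> stack_components x y" "p = pull K" "q = pull K'" using pq by auto
      moreover have "K \<noteq> K'" using pq(3) K by auto
      ultimately have "K \<inter> K' = {}" using part by (auto simp: partition_on_def disjoint_def)
      then show ?thesis unfolding K pull_def disjnt_def by blast
    qed
  qed
  have cls: "\<exists>K\<in>stack_components x y. P \<in> K \<and> Q \<in> K" if "(P, Q) \<in> SR" for P Q
  proof -
    have "P \<in> \<Union> (stack x y)" using that by (auto simp: SR_def)
    then have "SR `` {P} \<in> stack_components x y" unfolding stack_components_eq by (rule quotientI)
    moreover have "P \<in> SR `` {P}" using equiv_class_self[OF SR_equiv] \<open>P \<in> \<Union> (stack x y)\<close> by simp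
    ultimately show ?thesis using that by blast
  qed
  have mid: "stack_point (cc - 1 - j) = Mid (j + 1) \<and> stack_point (cc + j) = Mid (j + 1) \<and> cc - 1 - j \<in> ZZ \<and> cc + j \<in> ZZ" if "j < s" for j
    using that by (auto simp: stack_point_def cc_def ZZ_def)
  show "\<exists>K\<in>pull ` stack_components x y. e \<subseteq> K" if e: "e \<in> zz \<union> glue_edges cc 0 s" for e
  proof -
    have "\<exists>P Q. (P, Q) \<in> SR \<and> e \<subseteq> stack_point -` {P, Q} \<inter> ZZ"
      using e
    proof
      assume e: "e \<in> zz"
      then have eZ: "e \<subseteq> ZZ" using perfect_matching_Union[OF zz_matching] by auto
      have "card e = 2" using e zz_matching by (auto simp: perfect_matching_def)
      then obtain a b where ab: "e = {a, b}" by (auto simp: card_2_iff)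
      have "stack_point ` e \<in> stack x y" using e stack_eq by simp
      then have "(stack_point a, stack_point b) \<in> SR" using ab by (auto simp: SR_def)
      then show ?thesis using ab eZ by blast
    next
      assume "e \<in> glue_edges cc 0 s"
      then obtain j where j: "j < s" "e = {cc - 1 - j, cc + j}" by (auto simp: glue_edges_def)
      have "Mid (j + 1) \<in> \<Union> (stack x y)" unfolding Union_stack using mid[OF j(1)] by (metis image_eqI)
      then have "(Mid (j + 1), Mid (j + 1)) \<in> SR" by (auto simp: SR_def)
      then show ?thesis using mid[OF j(1)] j(2) by blast
    qed
    then obtain P Q where PQ: "(P, Q) \<in> SR" "e \<subseteq> stack_point -` {P, Q} \<inter> ZZ" by blast
    obtain K where K: "K \<in> stack_components x y" "P \<in> K" "Q \<in> K" using cls[OF PQ(1)] by blast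
    then have "e \<subseteq> pull K" using PQ(2) by (auto simp: pull_def)
    then show ?thesis using K(1) by blast
  qed
  show "K \<subseteq> U \<or> K \<inter> U = {}" if K: "K \<in> pull ` stack_components x y"
    and U: "\<forall>e\<in>zz \<union> glue_edges cc 0 s. e \<subseteq> U \<or> e \<inter> U = {}" for K U
  proof -
    \<comment> \<open>The glue edges make a saturated set a union of fibres of
      \<open>stack_point\<close>.\<close>
    have fib: "a' \<in> U" if "a \<in> ZZ" "a' \<in> ZZ" "stack_point a = stack_point a'" "a \<in> U" for a a'
    proof (cases "a = a'")
      case False
      define b b' where "b = min a a'" and "b' = max a a'"
      have b: "{a, a'} = {b, b'}" "b < b'" "b' \<in> ZZ" "stack_point b = stack_point b'"
        using False that by (auto simp: b_def b'_def min_def max_def)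
      from stack_point_fibre[OF b(2-4)] have "\<exists>j<s. {b, b'} = {cc - 1 - j, cc + j}" by metis
      then have "\<exists>j<s. {a, a'} = {cc - 1 - j, cc + j}" using b(1) by simp
      then obtain j where j: "j < s" "{a, a'} = {cc - 1 - j, cc + j}" by blast
      then have "{a, a'} \<in> glue_edges cc 0 s" unfolding glue_edges_def by (intro image_eqI[of _ _ j]) simp_all
      then have "{a, a'} \<subseteq> U \<or> {a, a'} \<inter> U = {}" by (intro bspec[OF U]) (rule UnI2)
      then show ?thesis using that(4) by simp
    qed (use that in simp)
    obtain K0 where K0: "K0 \<in> stack_components x y" "K = pull K0" using K by auto
    \<comment> \<open>Hence membership in \<open>U\<close> is carried along a path of the stacked
      picture, fibre by fibre.\<close>
    have reach: "\<forall>a\<in>ZZ. stack_point a = Q \<longrightarrow> a \<in> U"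
      if "(P, Q) \<in> {(p, q). {p, q} \<in> stack x y}\<^sup>*" "\<forall>a\<in>ZZ. stack_point a = P \<longrightarrow> a \<in> U" for P Q
      using that
    proof (induction rule: rtrancl_induct)
      case (step Q R)
      then have "{Q, R} \<in> (`) stack_point ` zz" using stack_eq by simp
      then obtain e where e: "e \<in> zz" "stack_point ` e = {Q, R}" by auto
      then have eZ: "e \<subseteq> ZZ" using perfect_matching_Union[OF zz_matching] by auto
      obtain a where a: "a \<in> e" "stack_point a = Q" using e(2) by (metis image_iff insertI1)
      obtain b where b: "b \<in> e" "stack_point b = R" using e(2) by (metis image_iff insertI1 insert_commute)
      have "a \<in> ZZ" "b \<in> ZZ" using eZ a(1) b(1) by auto
      then have "a \<in> U" using step.IH[OF step.prems] a(2) by simp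
      moreover have "e \<subseteq> U \<or> e \<inter> U = {}" using U e(1) by simp
      ultimately have "b \<in> U" using a b by auto
      show ?case
      proof (intro ballI impI)
        fix c assume "c \<in> ZZ" "stack_point c = R"
        then show "c \<in> U" using fib[OF \<open>b \<in> ZZ\<close> _ _ \<open>b \<in> U\<close>, of c] b(2) by simp
      qed
    qed
    show ?thesis
    proof (cases "K \<inter> U = {}")
      case False
      then obtain a where a: "a \<in> K" "a \<in> U" by auto
      have aZ: "a \<in> ZZ" "stack_point a \<in> K0" using a K0 by (auto simp: pull_def)
      have "b \<in> U" if "b \<in> K" for b
      proof -
        have b: "b \<in> ZZ" "stack_point b \<in> K0" using that K0 by (auto simp: pull_def)
        have "(stack_point a, stack_point b) \<in> SR"
          using quotient_eq_iff[OF SR_equiv K0(1)[unfolded stack_components_eq] K0(1)[unfolded stack_components_eq] aZ(2) b(2)] by simp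
        then have "(stack_point a, stack_point b) \<in> {(p, q). {p, q} \<in> stack x y}\<^sup>*" by (simp add: SR_def)
        moreover have "\<forall>c\<in>ZZ. stack_point c = stack_point a \<longrightarrow> c \<in> U"
          using fib[OF aZ(1) _ _ a(2)] by simp
        ultimately show ?thesis using reach b(1) by blast
      qed
      then show ?thesis by auto
    qed simp
  qed
qed

text \<open>Leaves a gap for the \<open>2 * s\<close> glued positions. The map is increasing, so it
  causes no sign in \<open>P\<close>.\<close>

definition "outer p = (if p < t then p else p + 2 * s)"

lemma outer_mono: "strict_mono_on A outer"
  by (auto simp: strict_mono_on_def outer_def)

lemma stack_point_outer: "v \<in> points r t \<Longrightarrow> stack_point (outer (posn r t v)) = case_sum Top Bot v
    \<and> outer (posn r t v) \<in> ZZ - glue_points cc 0 s"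
  by (auto simp: stack_point_def posn_def points_def cc_def outer_def ZZ_def glue_points_def)

lemma outer_image: "outer ` posn r t ` points r t = ZZ - glue_points cc 0 s"
proof -
  have "outer ` {..<t + r} = ZZ - glue_points cc 0 s" (is "?L = ?R")
  proof (intro equalityI subsetI)
    fix p assume p: "p \<in> ?R"
    show "p \<in> ?L"
    proof (cases "p < t")
      case True
      then show ?thesis by (intro image_eqI[of _ _ p]) (auto simp: outer_def)
    next
      case False
      then show ?thesis using p by (intro image_eqI[of _ _ "p - 2 * s"]) (auto simp: outer_def ZZ_def glue_points_def cc_def)
    qed
  qed (auto simp: outer_def ZZ_def glue_points_def cc_def)
  then show ?thesis by (simp add: posn_image)
qed

lemma pull_mid: "K \<in> stack_components x y \<Longrightarrow> pull K \<subseteq> glue_points cc 0 s \<longleftrightarrow> K \<subseteq> range Mid"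
proof -
  assume K: "K \<in> stack_components x y"
  have "p \<in> glue_points cc 0 s \<longleftrightarrow> stack_point p \<in> range Mid" if "p \<in> ZZ" for p
    using that by (auto simp: stack_point_def ZZ_def glue_points_def cc_def)
  moreover have "K \<subseteq> stack_point ` ZZ" using stack_components_partition K by (auto simp: partition_on_def)
  ultimately show ?thesis unfolding pull_def by blast
qed

lemma pull_outer:
  assumes K: "K \<in> stack_components x y"
  shows "pull K - glue_points cc 0 s = outer ` posn r t ` (case_sum Top Bot -` K)"
    and "case_sum Top Bot -` K \<subseteq> points r t"
proof -
  have sub: "K \<subseteq> stack_point ` ZZ" using stack_components_partition K by (auto simp: partition_on_def)
  have S: "stack_point ` ZZ \<subseteq> Top ` {1..r} \<union> range Mid \<union> Bot ` {1..t}"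
    by (auto simp: stack_point_def ZZ_def cc_def image_iff)
  have "v \<in> points r t" if "case_sum Top Bot v \<in> K" for v
  proof -
    have "case_sum Top Bot v \<in> Top ` {1..r} \<union> range Mid \<union> Bot ` {1..t}" using that sub S by blast
    then show ?thesis by (cases v) (auto simp: points_def)
  qed
  then show s2: "case_sum Top Bot -` K \<subseteq> points r t" by auto
  show "pull K - glue_points cc 0 s = outer ` posn r t ` (case_sum Top Bot -` K)"
  proof (intro equalityI subsetI)
    fix p assume p: "p \<in> pull K - glue_points cc 0 s"
    then have "p \<in> outer ` posn r t ` points r t" using outer_image by (auto simp: pull_def)
    then obtain v where v: "v \<in> points r t" "p = outer (posn r t v)" by auto
    then have "v \<in> case_sum Top Bot -` K" using stack_point_outer[OF v(1)] p by (auto simp: pull_def)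
    then show "p \<in> outer ` posn r t ` (case_sum Top Bot -` K)" using v by auto
  next
    fix p assume "p \<in> outer ` posn r t ` (case_sum Top Bot -` K)"
    then obtain v where "p = outer (posn r t v)" "v \<in> case_sum Top Bot -` K" by auto
    then show "p \<in> pull K - glue_points cc 0 s" using stack_point_outer[of v] s2 by (auto simp: pull_def)
  qed
qed

lemma glued_blocks: "{K - glue_points cc 0 s | K. K \<in> pull ` stack_components x y \<and> \<not> K \<subseteq> glue_points cc 0 s}
    = (`) outer ` Pos r t (diagram_comp x y)" (is "?L = ?R")
proof (intro equalityI subsetI)
  fix A assume "A \<in> ?L"
  then obtain K where K: "K \<in> stack_components x y" "A = pull K - glue_points cc 0 s" "\<not> pull K \<subseteq> glue_points cc 0 s" by auto
  then have "\<not> K \<subseteq> range Mid" using pull_mid by simp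
  then have "case_sum Top Bot -` K \<in> diagram_comp x y"
    unfolding diagram_comp_def using K(1) by (intro CollectI exI[of _ K]) simp
  moreover have "A = outer ` posn r t ` (case_sum Top Bot -` K)" using K(2) pull_outer(1)[OF K(1)] by simp
  ultimately show "A \<in> ?R" unfolding Pos_def by (intro image_eqI) auto
next
  fix A assume "A \<in> ?R"
  then obtain K where K: "K \<in> stack_components x y" "\<not> K \<subseteq> range Mid" "A = outer ` posn r t ` (case_sum Top Bot -` K)"
    by (auto simp: Pos_def diagram_comp_def)
  then have "A = pull K - glue_points cc 0 s" "\<not> pull K \<subseteq> glue_points cc 0 s" using pull_outer(1)[OF K(1)] pull_mid by auto
  then show "A \<in> ?L" using K(1) by blast
qed

lemma loops_eq: "loops x y = card {K \<in> pull ` stack_components x y. K \<subseteq> glue_points cc 0 s}"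
proof -
  have "{K \<in> pull ` stack_components x y. K \<subseteq> glue_points cc 0 s} = pull ` {K \<in> stack_components x y. K \<subseteq> range Mid}"
    using pull_mid by auto
  moreover have "card (pull ` {K \<in> stack_components x y. K \<subseteq> range Mid}) = card {K \<in> stack_components x y. K \<subseteq> range Mid}"
    by (rule card_image) (use pull_inj in \<open>auto simp: inj_on_def\<close>)
  ultimately show ?thesis by (simp add: loops_def)
qed

text \<open>The tensor of the composite as a contraction of those of \<open>x\<close> and
  \<open>y\<close>: \<open>u\<close> runs over the letters on the middle edge, and every loop
  contributes the trace of \<open>J\<close> against its inverse.\<close>

lemma diagram_comp_glue:
  assumes J: "\<And>a b. J a b = - J b a" and inv: "\<And>a b. (\<Sum>l\<in>Ls. C l * J a l * J (d l) b) = J a b" and "finite Ls"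
  shows "diagram_comp x y \<in> diagrams r t"
    and "(\<Sum>u\<in>{u. length u = s \<and> set u \<subseteq> Ls}. (\<Prod>l\<leftarrow>u. C l) *
      (P J (Pos s t y) (\<lambda>p. if p < t then w p else u ! (t + s - 1 - p)) *
       P J (Pos r s x) (\<lambda>p. if p < s then d (u ! p) else w (t + (p - s))))) =
      (\<Sum>l\<in>Ls. C l * J l (d l)) ^ loops x y * P J (Pos r t (diagram_comp x y)) w"
proof -
  \<comment> \<open>The word on the outer positions; its values at glued positions are overwritten
    by the contraction.\<close>
  define w' where "w' p = (if p < t then w p else w (p - 2 * s))" for p
  have G: "glue_points cc 0 s \<subseteq> ZZ" by (auto simp: glue_points_def ZZ_def cc_def)
  have "s \<le> cc" "finite ZZ" by (auto simp: cc_def ZZ_def)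
  note main = glued_P[where J=J and Ls=Ls and C=C and d=d and w=w', OF J inv \<open>s \<le> cc\<close> _ \<open>finite ZZ\<close> zz_matching G _ stack_components_pull,
      unfolded glued_blocks loops_eq[symmetric], simplified]
  have pm: "perfect_matching (ZZ - glue_points cc 0 s) ((`) outer ` Pos r t (diagram_comp x y))"
    using main by simp
  let ?h = "\<lambda>v. outer (posn r t v)"
  have hinj: "inj_on ?h (points r t)"
    using comp_inj_on[OF posn_inj strict_mono_on_imp_inj_on[OF outer_mono]] by (simp add: comp_def)
  have himg: "?h ` points r t = ZZ - glue_points cc 0 s" using outer_image by (simp add: image_image)
  have hD: "(`) outer ` Pos r t (diagram_comp x y) = (`) ?h ` diagram_comp x y" by (simp add: Pos_def image_image)
  \<comment> \<open>Transport back along the injective numbering \<open>?h\<close> turns the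
    matching of positions into a matching of \<open>points r t\<close>.\<close>
  have "perfect_matching (inv_into (points r t) ?h ` (ZZ - glue_points cc 0 s)) ((`) (inv_into (points r t) ?h) ` (`) ?h ` diagram_comp x y)"
    using perfect_matching_image[OF pm, of "inv_into (points r t) ?h"] inj_on_inv_into[of _ ?h "points r t"] himg hD by auto
  moreover have "inv_into (points r t) ?h ` (ZZ - glue_points cc 0 s) = points r t"
    unfolding himg[symmetric] by (simp add: hinj inv_into_image_cancel)
  moreover have "inv_into (points r t) ?h ` ?h ` A = A" if "A \<in> diagram_comp x y" for A
    using that pull_outer(2) hinj by (intro inv_into_image_cancel) (auto simp: diagram_comp_def)
  then have "(`) (inv_into (points r t) ?h) ` (`) ?h ` diagram_comp x y = diagram_comp x y"
    by (simp add: image_image)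
  ultimately have pmc: "perfect_matching (points r t) (diagram_comp x y)" by simp
  then show dc: "diagram_comp x y \<in> diagrams r t" by (simp add: diagrams_def)
  have "(\<Sum>l\<in>Ls. C l * J l (d l)) ^ loops x y * P J (Pos r t (diagram_comp x y)) w =
      (\<Sum>l\<in>Ls. C l * J l (d l)) ^ loops x y * P J ((`) outer ` Pos r t (diagram_comp x y)) w'"
  proof -
    have "P J ((`) outer ` Pos r t (diagram_comp x y)) w' = P J (Pos r t (diagram_comp x y)) (\<lambda>p. w' (outer p))"
      using P_relabel[where J=J, OF J _ Pos_matching[OF dc] outer_mono] by simp
    moreover have "(\<lambda>p. w' (outer p)) = w" by (auto simp: w'_def outer_def)
    ultimately show ?thesis by simp
  qed
  also have "\<dots> = fold (contr Ls C d cc) [0..<s] (P J zz) w'" using main by simp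
  also have "\<dots> = (\<Sum>u\<in>{u. length u = s \<and> set u \<subseteq> Ls}. (\<Prod>l\<leftarrow>u. C l) *
    P J zz (\<lambda>x. if cc - s \<le> x \<and> x < cc then u ! (cc - 1 - x) else if cc \<le> x \<and> x < cc + s then d (u ! (x - cc)) else w' x))"
    by (rule fold_contr_sum[OF assms(3) \<open>s \<le> cc\<close>])
  also have "\<dots> = (\<Sum>u\<in>{u. length u = s \<and> set u \<subseteq> Ls}. (\<Prod>l\<leftarrow>u. C l) *
      (P J (Pos s t y) (\<lambda>p. if p < t then w p else u ! (t + s - 1 - p)) *
       P J (Pos r s x) (\<lambda>p. if p < s then d (u ! p) else w (t + (p - s)))))"
  proof (intro sum.cong refl arg_cong2[where f="(*)"])
    fix u
    let ?W = "\<lambda>x. if cc - s \<le> x \<and> x < cc then u ! (cc - 1 - x) else if cc \<le> x \<and> x < cc + s then d (u ! (x - cc)) else w' x"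
    have "P J zz ?W = P J (Pos s t y) ?W * P J ((`) (\<lambda>p. cc + p) ` Pos r s x) ?W"
      unfolding zz_def by (rule P_Un[where J=J, OF J _ Pos_matching[OF y] _ zz_upper]) (auto simp: cc_def)
    also have "P J ((`) (\<lambda>p. cc + p) ` Pos r s x) ?W = P J (Pos r s x) (\<lambda>p. ?W (cc + p))"
      by (rule P_relabel[where J=J, OF J _ Pos_matching[OF x]]) (auto simp: strict_mono_on_def)
    also have "\<dots> = P J (Pos r s x) (\<lambda>p. if p < s then d (u ! p) else w (t + (p - s)))"
      by (rule P_cong[where J=J, OF J _ Pos_matching[OF x]]) (auto simp: cc_def w'_def intro!: arg_cong[where f=w])
    also have "P J (Pos s t y) ?W = P J (Pos s t y) (\<lambda>p. if p < t then w p else u ! (t + s - 1 - p))"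
      by (rule P_cong[where J=J, OF J _ Pos_matching[OF y]]) (auto simp: cc_def w'_def)
    finally show "P J zz ?W = P J (Pos s t y) (\<lambda>p. if p < t then w p else u ! (t + s - 1 - p)) *
       P J (Pos r s x) (\<lambda>p. if p < s then d (u ! p) else w (t + (p - s)))" .
  qed
  finally show "(\<Sum>u\<in>{u. length u = s \<and> set u \<subseteq> Ls}. (\<Prod>l\<leftarrow>u. C l) *
      (P J (Pos s t y) (\<lambda>p. if p < t then w p else u ! (t + s - 1 - p)) *
       P J (Pos r s x) (\<lambda>p. if p < s then d (u ! p) else w (t + (p - s))))) =
      (\<Sum>l\<in>Ls. C l * J l (d l)) ^ loops x y * P J (Pos r t (diagram_comp x y)) w" ..
qed

end

section \<open>Noncrossing matchings and dominant paths\<close>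

text \<open>\<open>growth x i j\<close> is the maximal weight of a weakly increasing chain in the array \<open>x\<close> restricted to
  \<open>[1,i] \<times> [1,j]\<close>, i.e. the first row of the shape that the Robinson-Schensted-Knuth correspondence
  attaches to this corner; the further rows are obtained by iterating the derived array.\<close>

fun growth :: "(nat \<Rightarrow> nat \<Rightarrow> nat) \<Rightarrow> nat \<Rightarrow> nat \<Rightarrow> nat" where
  "growth x 0 j = 0"
| "growth x (Suc i) 0 = 0"
| "growth x (Suc i) (Suc j) = max (growth x i (Suc j)) (growth x (Suc i) j) + x (Suc i) (Suc j)"

text \<open>What the local rule hands over to the next row of the shape: the amount by which both
  neighbours exceed the common corner. In Viennot's picture these are the corners of the shadow
  lines.\<close>

fun derived :: "(nat \<Rightarrow> nat \<Rightarrow> nat) \<Rightarrow> nat \<Rightarrow> nat \<Rightarrow> nat" where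
  "derived x 0 j = 0"
| "derived x (Suc i) 0 = 0"
| "derived x (Suc i) (Suc j) = min (growth x i (Suc j)) (growth x (Suc i) j) - growth x i j"

lemma growth_0 [simp]: "growth x i 0 = 0"
  by (cases i) auto

lemma derived_0 [simp]: "derived x i 0 = 0"
  by (cases i) auto

lemma growth_Suc_left: "growth x i j \<le> growth x (Suc i) j"
  by (cases j) auto

lemma growth_Suc_right: "growth x i j \<le> growth x i (Suc j)"
  by (cases i) auto

lemma growth_mono: "i \<le> i' \<Longrightarrow> j \<le> j' \<Longrightarrow> growth x i j \<le> growth x i' j'"
proof -
  assume "i \<le> i'" "j \<le> j'"
  have "growth x i j \<le> growth x i' j"
    by (rule lift_Suc_mono_le[of "\<lambda>i. growth x i j", OF growth_Suc_left \<open>i \<le> i'\<close>])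
  also have "\<dots> \<le> growth x i' j'"
    by (rule lift_Suc_mono_le[of "growth x i'", OF growth_Suc_right \<open>j \<le> j'\<close>])
  finally show ?thesis .
qed

definition transp :: "(nat \<Rightarrow> nat \<Rightarrow> nat) \<Rightarrow> nat \<Rightarrow> nat \<Rightarrow> nat" where
  "transp x i j = x j i"

lemma growth_transpose: "growth (transp x) i j = growth x j i"
proof (induction x j i rule: growth.induct)
  case (3 x i j)
  then show ?case by (simp add: max.commute transp_def)
qed auto

lemma derived_transpose: "derived (transp x) = transp (derived x)"
proof (intro ext)
  show "derived (transp x) i j = transp (derived x) i j" for i j
    unfolding transp_def[of "derived x"]
    by (cases i; cases j) (auto simp: growth_transpose min.commute)
qed

lemma derived_iter_transpose: "(derived ^^ k) (transp x) = transp ((derived ^^ k) x)"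
  by (induction k) (auto simp: derived_transpose)

text \<open>As maximum plus minimum is the sum, the mass of an array row is either kept in
  \<open>growth\<close> or handed over to the derived array.\<close>

lemma growth_row:
  "growth x (Suc i) j + (\<Sum>b=1..j. derived x (Suc i) b) = growth x i j + (\<Sum>b=1..j. x (Suc i) b)"
proof (induction j)
  case (Suc j)
  have "growth x i j \<le> min (growth x i (Suc j)) (growth x (Suc i) j)"
    by (simp add: growth_Suc_left growth_Suc_right)
  then have "growth x (Suc i) (Suc j) + derived x (Suc i) (Suc j) + growth x i j
      = growth x i (Suc j) + growth x (Suc i) j + x (Suc i) (Suc j)"
    by (simp add: max_def min_def)
  then show ?case using Suc by simp
qed simp

text \<open>Interlacing of neighbouring shapes. It is the reason why the rows of a shape decrease
  weakly, and so why the paths are dominant.\<close>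

lemma derived_interlace:
  "growth (derived x) (Suc i) (Suc j) \<le> min (growth x i (Suc j)) (growth x (Suc i) j)"
proof (induction "i + j" arbitrary: i j rule: less_induct)
  case less
  have "growth (derived x) i (Suc j) \<le> growth x i j"
  proof (cases i)
    case (Suc i')
    then show ?thesis using less[of i' j] by simp
  qed simp
  moreover have "growth (derived x) (Suc i) j \<le> growth x i j"
  proof (cases j)
    case (Suc j')
    then show ?thesis using less[of i j'] by simp
  qed simp
  moreover have "growth x i j \<le> min (growth x i (Suc j)) (growth x (Suc i) j)"
    by (simp add: growth_Suc_left growth_Suc_right)
  ultimately show ?case unfolding growth.simps(3) derived.simps(3) by linarith
qed

lemma growth_derived_le: "growth (derived x) i j \<le> growth x i j"
proof (cases i; cases j)
  fix i' j' assume ij: "i = Suc i'" "j = Suc j'"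
  have "growth (derived x) i j \<le> growth x i' j" using derived_interlace[of x i' j'] ij by simp
  also have "\<dots> \<le> growth x i j" using ij by (simp add: growth_Suc_left)
  finally show ?thesis .
qed auto

text \<open>In the coordinates of \<open>arc_array\<close> these are arcs whose left ends and right
  ends come in the same order.\<close>

definition antichain :: "(nat \<Rightarrow> nat \<Rightarrow> nat) \<Rightarrow> nat \<Rightarrow> (nat \<Rightarrow> nat) \<Rightarrow> (nat \<Rightarrow> nat) \<Rightarrow> bool" where
  "antichain x t I K \<longleftrightarrow> (\<forall>s<t. x (I s) (K s) \<ge> 1) \<and>
     (\<forall>s. Suc s < t \<longrightarrow> I (Suc s) < I s \<and> K s < K (Suc s))"

text \<open>\<open>c\<close> is the first column in which row \<open>i\<close> exceeds the value at
  the diagonal neighbour. The row before has not exceeded it there, so the jump comes from an entry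
  of \<open>x\<close>.\<close>

lemma derived_left:
  assumes "derived x i j \<ge> 1"
  obtains c where "c < j" "x i c \<ge> 1" "growth x i c \<ge> growth x (i - 1) (j - 1) + 1"
proof -
  obtain i0 j0 where ij: "i = Suc i0" "j = Suc j0" using assms by (cases i; cases j) auto
  let ?Q = "\<lambda>c. growth x i c \<ge> growth x i0 j0 + 1"
  have Q: "?Q j0" using assms ij by simp
  define c where "c = (LEAST c. ?Q c)"
  have Qc: "?Q c" "c \<le> j0" using LeastI[of ?Q, OF Q] Least_le[of ?Q, OF Q] by (auto simp: c_def)
  obtain c' where c': "c = Suc c'" using Qc(1) by (cases c) auto
  have "\<not> ?Q c'" using not_less_Least[of c' ?Q] c' by (simp add: c_def)
  moreover have "growth x i0 c \<le> growth x i0 j0" by (rule growth_mono) (use Qc in auto)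
  ultimately have "x i c \<ge> 1" using Qc(1) unfolding c' ij by simp
  then show ?thesis using that[of c] Qc ij by simp
qed

lemma derived_below:
  assumes "derived x i j \<ge> 1"
  obtains d where "d < i" "x d j \<ge> 1" "growth x d j \<ge> growth x (i - 1) (j - 1) + 1"
  using derived_left[of "transp x" j i] assms by (auto simp: derived_transpose growth_transpose transp_def)

text \<open>A point of \<open>x\<close> can be found between any two consecutive points of an antichain of the derived array:
  the obvious candidates on the two shadow lines only both fail if each line lies strictly below the other.\<close>

lemma antichain_derived:
  assumes a: "antichain (derived x) t I K" and "t \<ge> 1"
  shows "\<exists>I' K'. antichain x (Suc t) I' K' \<and> I' 0 \<le> I 0 \<and> K' t \<le> K (t - 1)"
proof -
  \<comment> \<open>Candidate \<open>s\<close> has to lie weakly between the points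
    \<open>s - 1\<close> and \<open>s\<close> of the given antichain. The conditions for
    \<open>s = 0\<close> and \<open>s = t\<close> keep the new antichain inside the same
    corner.\<close>
  let ?Y = "\<lambda>s i j. x i j \<ge> 1 \<and> (s < t \<longrightarrow> I s \<le> i \<and> j < K s) \<and> (s > 0 \<longrightarrow> i < I (s - 1) \<and> K (s - 1) \<le> j) \<and>
    (s = 0 \<longrightarrow> i \<le> I 0) \<and> (s = t \<longrightarrow> j \<le> K (t - 1))"
  have pt: "derived x (I s) (K s) \<ge> 1" if "s < t" for s using a that by (simp add: antichain_def)
  have "\<exists>i j. ?Y s i j" if "s \<le> t" for s
  proof -
    have "s = 0 \<or> (s = t \<and> s > 0) \<or> (\<exists>s'. s = Suc s' \<and> s < t)" using that by (cases s) auto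
    then consider "s = 0" | "s = t" "s > 0" | s' where "s = Suc s'" "s < t" by blast
    then show ?thesis
    proof cases
      case 1
      then obtain c where "c < K 0" "x (I 0) c \<ge> 1" using derived_left[OF pt[of 0]] assms(2) by auto
      then show ?thesis using 1 assms(2) by (intro exI[of _ "I 0"] exI[of _ c]) auto
    next
      case 2
      then obtain d where "d < I (t - 1)" "x d (K (t - 1)) \<ge> 1" using derived_below[OF pt[of "t - 1"]] by auto
      then show ?thesis using 2 by (intro exI[of _ d] exI[of _ "K (t - 1)"]) auto
    next
      case 3
      have lt: "I s < I s'" "K s' < K s" using a 3 by (auto simp: antichain_def)
      obtain d where d: "d < I s'" "x d (K s') \<ge> 1" "growth x d (K s') \<ge> growth x (I s' - 1) (K s' - 1) + 1"
        using derived_below[OF pt[of s']] 3 by auto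
      obtain c where c: "c < K s" "x (I s) c \<ge> 1" "growth x (I s) c \<ge> growth x (I s - 1) (K s - 1) + 1"
        using derived_left[OF pt[of s]] 3 by auto
      show ?thesis
      proof (cases "I s \<le> d \<or> K s' \<le> c")
        case True
        then show ?thesis
        proof
          assume "I s \<le> d"
          then show ?thesis using d lt 3 by (intro exI[of _ d] exI[of _ "K s'"]) auto
        next
          assume "K s' \<le> c"
          then show ?thesis using c lt 3 by (intro exI[of _ "I s"] exI[of _ c]) auto
        qed
      next
        case False
        have "growth x d (K s') \<le> growth x (I s - 1) (K s - 1)"
          by (rule growth_mono) (use False lt in auto)
        moreover have "growth x (I s) c \<le> growth x (I s' - 1) (K s' - 1)"
          by (rule growth_mono) (use False lt in auto)
        ultimately show ?thesis using c(3) d(3) by simp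
      qed
    qed
  qed
  then obtain I' K' where Y: "\<And>s. s \<le> t \<Longrightarrow> ?Y s (I' s) (K' s)" by metis
  have "I' (Suc s) < I' s \<and> K' s < K' (Suc s)" if "s < t" for s
    using Y[of s] Y[of "Suc s"] that by auto
  then have "antichain x (Suc t) I' K'" using Y by (auto simp: antichain_def)
  then show ?thesis using Y[of 0] Y[of t] by blast
qed

lemma antichain_derived_iter:
  assumes "antichain ((derived ^^ k) x) t I K" "t \<ge> 1"
  shows "\<exists>I' K'. antichain x (t + k) I' K' \<and> I' 0 \<le> I 0 \<and> K' (t + k - 1) \<le> K (t - 1)"
  using assms
proof (induction k arbitrary: t I K)
  case (Suc k)
  then obtain I1 K1 where 1: "antichain ((derived ^^ k) x) (Suc t) I1 K1" "I1 0 \<le> I 0" "K1 t \<le> K (t - 1)"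
    using antichain_derived[of "(derived ^^ k) x" t I K] by auto
  from Suc.IH[OF 1(1)] 1(2,3) show ?case by (auto intro: order_trans)
qed auto

section \<open>Shapes along an array row with at most one point\<close>

lemma growth_row_zero:
  assumes "(\<Sum>b=1..j. x (Suc i) b) = 0"
  shows "growth ((derived ^^ k) x) (Suc i) j = growth ((derived ^^ k) x) i j"
proof -
  have "(\<Sum>b=1..j. (derived ^^ k) x (Suc i) b) = 0" for k
  proof (induction k)
    case (Suc k)
    then have "(\<Sum>b=1..j. derived ((derived ^^ k) x) (Suc i) b) = 0"
      using growth_row[of "(derived ^^ k) x" i j] growth_Suc_left[of "(derived ^^ k) x" i j] by linarith
    then show ?case by simp
  qed (use assms in simp)
  from this[of k] this[of "Suc k"] show ?thesis using growth_row[of "(derived ^^ k) x" i j] by simp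
qed

text \<open>The unit is handed down through the derived arrays until level \<open>k\<close> keeps
  it: row \<open>k\<close> of the shape gains a box. The vanishing of the \<open>n\<close>-th
  derived row forces \<open>k < n\<close>.\<close>

lemma growth_row_one:
  assumes "(\<Sum>b=1..j. x (Suc i) b) = 1" "(\<Sum>b=1..j. (derived ^^ n) x (Suc i) b) = 0"
  shows "\<exists>k<n. \<forall>l<n. growth ((derived ^^ l) x) (Suc i) j = growth ((derived ^^ l) x) i j + (if l = k then 1 else 0)"
proof -
  define R where "R k = (\<Sum>b=1..j. (derived ^^ k) x (Suc i) b)" for k
  have row: "growth ((derived ^^ k) x) (Suc i) j + R (Suc k) = growth ((derived ^^ k) x) i j + R k" for k
    using growth_row[of "(derived ^^ k) x" i j] by (simp add: R_def)
  have anti: "R (Suc k) \<le> R k" for k using row[of k] growth_Suc_left[of "(derived ^^ k) x" i j] by linarith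
  have R0: "R 0 = 1" "R n = 0" using assms by (auto simp: R_def)
  define k where "k = (LEAST k. R k = 0)"
  have k: "R k = 0" "k \<le> n" using LeastI[of "\<lambda>k. R k = 0", OF R0(2)] Least_le[of "\<lambda>k. R k = 0", OF R0(2)] by (auto simp: k_def)
  obtain k' where k': "k = Suc k'" using k R0 by (cases k) auto
  have le1: "R l \<le> 1" for l using lift_Suc_antimono_le[of R 0 l] anti R0(1) by simp
  have one: "R l = 1" if "l \<le> k'" for l
  proof -
    have "R l \<noteq> 0" using not_less_Least[of l "\<lambda>k. R k = 0"] that k' by (simp add: k_def)
    then show ?thesis using le1[of l] by simp
  qed
  have zero: "R l = 0" if "k' < l" for l
    using lift_Suc_antimono_le[of R k l] anti k(1) that k' by simp
  show ?thesis
  proof (intro exI[of _ k'] conjI allI impI)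
    show "k' < n" using k k' by simp
    fix l assume "l < n"
    consider "l < k'" | "l = k'" | "l > k'" by linarith
    then show "growth ((derived ^^ l) x) (Suc i) j = growth ((derived ^^ l) x) i j + (if l = k' then 1 else 0)"
    proof cases
      case 1 then show ?thesis using row[of l] one[of l] one[of "Suc l"] by simp
    next
      case 2 then show ?thesis using row[of l] one[of l] zero[of "Suc l"] by simp
    next
      case 3 then show ?thesis using row[of l] zero[of l] zero[of "Suc l"] by simp
    qed
  qed
qed

text \<open>The local rule inverted: the value at a corner is the minimum of its two outer
  neighbours minus the derived entry, so the boundary diagonal determines everything below
  it.\<close>

lemma growth_recover:
  assumes diag: "\<And>i j. i + j \<le> N \<Longrightarrow> N \<le> Suc (i + j) \<Longrightarrow> growth x i j = growth y i j"
    and der: "\<And>i j. i + j \<le> N \<Longrightarrow> derived x i j = derived y i j" and "i + j \<le> N"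
  shows "growth x i j = growth y i j"
  using assms(3)
proof (induction "N - (i + j)" arbitrary: i j rule: less_induct)
  case less
  show ?case
  proof (cases "N \<le> Suc (i + j)")
    case False
    have "growth x i (Suc j) = growth y i (Suc j)" "growth x (Suc i) j = growth y (Suc i) j"
      using less(1)[of i "Suc j"] less(1)[of "Suc i" j] False by auto
    moreover have "derived x (Suc i) (Suc j) = derived y (Suc i) (Suc j)" by (rule der) (use False in simp)
    moreover have "growth z i j \<le> min (growth z i (Suc j)) (growth z (Suc i) j)" for z
      by (simp add: growth_Suc_left growth_Suc_right)
    from this[of x] this[of y] have "growth x i j \<le> min (growth x i (Suc j)) (growth x (Suc i) j)"
      "growth y i j \<le> min (growth y i (Suc j)) (growth y (Suc i) j)" .
    ultimately show ?thesis unfolding derived.simps(3) by linarith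
  qed (use diag less in auto)
qed

lemma array_recover:
  assumes diag: "\<And>i j. i + j \<le> N \<Longrightarrow> N \<le> Suc (i + j) \<Longrightarrow> growth x i j = growth y i j"
    and der: "\<And>i j. i + j \<le> N \<Longrightarrow> derived x i j = derived y i j" and "Suc i + Suc j \<le> N"
  shows "x (Suc i) (Suc j) = y (Suc i) (Suc j)"
proof -
  have r: "growth x i j = growth y i j" if "i + j \<le> N" for i j
    using growth_recover[of N x y, OF diag der that] .
  show ?thesis using r[of "Suc i" "Suc j"] r[of i "Suc j"] r[of "Suc i" j] assms(3) by simp
qed

text \<open>The arc from \<open>a\<close> to \<open>b > a\<close> is the point
  \<open>(a + 1, N - b)\<close>; the triangle \<open>i + j \<le> N\<close> expresses that the left
  end comes first, so every arc is recorded once.\<close>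

definition arc_array :: "nat \<Rightarrow> nat set set \<Rightarrow> nat \<Rightarrow> nat \<Rightarrow> nat" where
  "arc_array N m i j = (if 1 \<le> i \<and> 1 \<le> j \<and> i + j \<le> N \<and> {i - 1, N - j} \<in> m then 1 else 0)"

definition shape :: "nat \<Rightarrow> nat set set \<Rightarrow> nat \<Rightarrow> nat \<Rightarrow> nat \<Rightarrow> nat" where
  "shape N m k i j = growth ((derived ^^ k) (arc_array N m)) i j"

text \<open>The letters \<open>k\<close> and \<open>2n - 1 - k\<close> carry opposite weights, plus
  and minus the \<open>k\<close>-th coordinate of the maximal torus.\<close>

definition weight :: "nat \<Rightarrow> nat \<Rightarrow> (nat \<Rightarrow> nat) \<Rightarrow> nat \<Rightarrow> int" where
  "weight n k w g = (\<Sum>p<g. (if w p = k then 1 else 0) - (if w p = 2 * n - 1 - k then 1 else 0))"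

text \<open>Lattice paths in the Weyl chamber of type C, that is, oscillating tableaux with at most
  \<open>n\<close> rows.\<close>

definition dominant_path :: "nat \<Rightarrow> nat \<Rightarrow> (nat \<Rightarrow> nat) \<Rightarrow> bool" where
  "dominant_path n N w \<longleftrightarrow> w \<in> {..<N} \<rightarrow>\<^sub>E {..<2 * n} \<and>
     (\<forall>g\<le>N. (\<forall>k. Suc k < n \<longrightarrow> weight n (Suc k) w g \<le> weight n k w g) \<and> 0 \<le> weight n (n - 1) w g)"

lemma derived_iter_zero: "(derived ^^ k) (arc_array N m) 0 j = 0" "(derived ^^ k) (arc_array N m) j 0 = 0"
  by (cases k; simp add: arc_array_def)+

text \<open>A nonzero entry lifts to an antichain of \<open>n + 1\<close> arcs inside the rectangle
  below it. Its corner lies in the triangle, so all left ends precede all right ends and the arcs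
  cross mutually.\<close>

lemma noncrossing_shape:
  assumes m: "noncrossing (Suc n) m" and ij: "i + j \<le> N"
  shows "(derived ^^ n) (arc_array N m) i j = 0"
proof (rule ccontr)
  assume "(derived ^^ n) (arc_array N m) i j \<noteq> 0"
  then have "antichain ((derived ^^ n) (arc_array N m)) 1 (\<lambda>_. i) (\<lambda>_. j)" by (simp add: antichain_def)
  from antichain_derived_iter[OF this] obtain I K where
    a: "antichain (arc_array N m) (Suc n) I K" "I 0 \<le> i" "K n \<le> j" by auto
  have x: "1 \<le> I s \<and> 1 \<le> K s \<and> I s + K s \<le> N \<and> {I s - 1, N - K s} \<in> m" if "s \<le> n" for s
    using a(1) that by (auto simp: antichain_def arc_array_def less_Suc_eq_le split: if_splits)
  have st: "I (Suc s) < I s" "K s < K (Suc s)" if "Suc s \<le> n" for s using a(1) that by (auto simp: antichain_def)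
  have dec: "I t < I s" "K s < K t" if "s < t" "t \<le> n" for s t
    using that
  proof (induction t)
    case (Suc t)
    { case 1 then show ?case using Suc(1) st(1)[of t] by (cases "s = t") auto }
    { case 2 then show ?case using Suc(2) st(2)[of t] by (cases "s = t") auto }
  qed auto
  \<comment> \<open>The left ends decrease along the antichain, hence the reversed index; the shift
    by one undoes that of \<open>arc_array\<close>.\<close>
  define a where "a s = I (Suc n - s) - 1" for s
  define b where "b s = N - K (Suc n - s)" for s
  have "strict_mono_on {1..Suc n} a"
  proof (rule strict_mono_onI)
    fix r s assume rs: "r \<in> {1..Suc n}" "s \<in> {1..Suc n}" "r < s"
    have "I (Suc n - r) < I (Suc n - s)" by (rule dec(1)) (use rs in auto)
    moreover have "Suc n - r \<le> n" using rs by auto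
    then have "1 \<le> I (Suc n - r)" using x by blast
    ultimately show "a r < a s" unfolding a_def by linarith
  qed
  moreover have "strict_mono_on {1..Suc n} b"
  proof (rule strict_mono_onI)
    fix r s assume rs: "r \<in> {1..Suc n}" "s \<in> {1..Suc n}" "r < s"
    have "K (Suc n - s) < K (Suc n - r)" by (rule dec(2)) (use rs in auto)
    moreover have "Suc n - r \<le> n" using rs by auto
    then have "I (Suc n - r) + K (Suc n - r) \<le> N" using x by blast
    then have "K (Suc n - r) \<le> N" by simp
    ultimately show "b r < b s" unfolding b_def by linarith
  qed
  moreover have "a (Suc n) = I 0 - 1" "b 1 = N - K n" by (simp_all add: a_def b_def)
  then have "a (Suc n) < b 1" using \<open>I 0 \<le> i\<close> \<open>K n \<le> j\<close> ij x[of 0] by linarith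
  moreover have "\<forall>s\<in>{1..Suc n}. {a s, b s} \<in> m" using x by (auto simp: a_def b_def)
  ultimately show False using m unfolding noncrossing_def by blast
qed

text \<open>The diagonal corner \<open>(g, N - g)\<close> sees the arcs that are open after the first \<open>g\<close> points.\<close>

lemma shape_step:
  assumes m: "perfect_matching {..<N} m" "noncrossing (Suc n) m" and g: "g < N"
  obtains k where "k < n" "\<forall>l<n. shape N m l g (N - g) = shape N m l g (N - Suc g) \<and>
      shape N m l (Suc g) (N - Suc g) = shape N m l g (N - Suc g) + (if l = k then 1 else 0)"
  | k where "k < n" "\<forall>l<n. shape N m l (Suc g) (N - Suc g) = shape N m l g (N - Suc g) \<and>
      shape N m l g (N - g) = shape N m l g (N - Suc g) + (if l = k then 1 else 0)"
proof -
  let ?x = "arc_array N m" and ?j = "N - Suc g"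
  let ?y = "transp ?x"
  have Ng: "N - g = Suc ?j" using g by simp
  have dis: "e = e'" if "e \<in> m" "e' \<in> m" "g \<in> e" "g \<in> e'" for e e'
    using m(1) that unfolding perfect_matching_def partition_on_def disjoint_def by blast
  have "g \<in> \<Union> m" using m(1) g unfolding perfect_matching_def partition_on_def by auto
  then obtain e where e: "e \<in> m" "g \<in> e" by blast
  then have "card e = 2" "e \<subseteq> {..<N}" using m(1) unfolding perfect_matching_def partition_on_def by auto
  then obtain h where h: "e = {g, h}" "g \<noteq> h" "h < N" using e(2) by (auto simp: card_2_iff)
  have part: "{g, c} \<in> m \<longleftrightarrow> c = h" for c using dis[OF _ e(1), of "{g, c}"] e h by (auto simp: doubleton_eq_iff)
  have part': "{c, g} \<in> m \<longleftrightarrow> c = h" for c using part[of c] by (simp add: insert_commute)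
  have row: "?x (Suc g) b = (if b = N - h then 1 else 0)" if "b \<in> {1..?j}" "g < h" for b
    using that part[of "N - b"] h(3) by (auto simp: arc_array_def)
  have row0: "?x (Suc g) b = 0" if "b \<in> {1..?j}" "h < g" for b
    using that part[of "N - b"] h(3) by (auto simp: arc_array_def)
  have col: "?x a (N - g) = (if a = Suc h then 1 else 0)" if "a \<in> {1..g}" "h < g" for a
    using that part'[of "a - 1"] h(3) g by (auto simp: arc_array_def)
  have col0: "?x a (N - g) = 0" if "a \<in> {1..g}" "g < h" for a
    using that part'[of "a - 1"] h(3) g by (auto simp: arc_array_def)
  have nz: "(derived ^^ n) ?x i j = 0" if "i + j \<le> N" for i j using noncrossing_shape[OF m(2) that] .
  have tr: "growth ((derived ^^ l) ?y) j i = growth ((derived ^^ l) ?x) i j" for l i j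
    by (simp add: derived_iter_transpose growth_transpose)
  \<comment> \<open>If an arc opens at \<open>g\<close>, row \<open>g + 1\<close> contains its point
    and column \<open>N - g\<close> is empty inside the corner; if an arc closes, rows and columns
    change places, which \<open>transp\<close> takes care of.\<close>
  consider "g < h" | "h < g" using h by linarith
  then show thesis
  proof cases
    case 1
    have "(\<Sum>b=1..?j. ?x (Suc g) b) = (\<Sum>b=1..?j. if b = N - h then 1 else 0)"
      by (rule sum.cong) (use row 1 in auto)
    moreover have "N - h \<in> {1..?j}" using 1 h(3) by (auto; linarith)
    then have "(\<Sum>b=1..?j. if b = N - h then 1 else 0) = (1 :: nat)" by simp
    ultimately have r1: "(\<Sum>b=1..?j. ?x (Suc g) b) = 1" by simp
    have r2: "(\<Sum>b=1..?j. (derived ^^ n) ?x (Suc g) b) = 0"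
      by (intro sum.neutral ballI nz) (use g in auto)
    have "(\<Sum>b=1..g. ?y (Suc ?j) b) = 0" using col0 1 Ng by (simp add: transp_def)
    from growth_row_zero[of ?y ?j g, OF this] tr Ng
    have "\<forall>l<n. shape N m l g (N - g) = shape N m l g ?j" by (simp add: shape_def)
    with growth_row_one[OF r1 r2] that(1) show thesis by (auto simp: shape_def)
  next
    case 2
    have "(\<Sum>b=1..g. ?y (Suc ?j) b) = (\<Sum>a=1..g. if a = Suc h then 1 else 0)"
      by (rule sum.cong) (use col 2 Ng in \<open>auto simp: transp_def\<close>)
    also have "\<dots> = 1" using 2 by simp
    finally have r1: "(\<Sum>b=1..g. ?y (Suc ?j) b) = 1" .
    have r2: "(\<Sum>b=1..g. (derived ^^ n) ?y (Suc ?j) b) = 0"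
      unfolding derived_iter_transpose transp_def by (intro sum.neutral ballI nz) (use g in auto)
    have "(\<Sum>b=1..?j. ?x (Suc g) b) = 0" using row0 2 by simp
    from growth_row_zero[of ?x g ?j, OF this]
    have "\<forall>l<n. shape N m l (Suc g) ?j = shape N m l g ?j" by (simp add: shape_def)
    with growth_row_one[OF r1 r2] tr Ng that(2) show thesis by (auto simp: shape_def)
  qed
qed

definition step_letter :: "nat \<Rightarrow> nat \<Rightarrow> nat set set \<Rightarrow> nat \<Rightarrow> nat \<Rightarrow> bool" where
  "step_letter n N m g a \<longleftrightarrow> a < 2 * n \<and> (\<forall>l<n. int (shape N m l (Suc g) (N - Suc g)) =
     int (shape N m l g (N - g)) + ((if a = l then 1 else 0) - (if a = 2 * n - 1 - l then 1 else 0)))"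

lemma exists_letter:
  assumes m: "perfect_matching {..<N} m" "noncrossing (Suc n) m" and g: "g < N"
  shows "\<exists>a. step_letter n N m g a"
  using shape_step[OF m g]
proof cases
  case (1 k)
  have "k \<noteq> 2 * n - 1 - l" if "l < n" for l using 1(1) that by linarith
  then show ?thesis using 1 by (intro exI[of _ k]) (simp add: step_letter_def)
next
  case (2 k)
  have "2 * n - 1 - k \<noteq> l" "(2 * n - 1 - k = 2 * n - 1 - l) = (l = k)" if "l < n" for l
    using 2(1) that by linarith+
  then show ?thesis using 2 by (intro exI[of _ "2 * n - 1 - k"]) (simp add: step_letter_def)
qed

definition path_word :: "nat \<Rightarrow> nat \<Rightarrow> nat set set \<Rightarrow> nat \<Rightarrow> nat" where
  "path_word n N m = (\<lambda>g\<in>{..<N}. SOME a. step_letter n N m g a)"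

lemma path_word:
  assumes m: "perfect_matching {..<N} m" "noncrossing (Suc n) m"
  shows "path_word n N m \<in> {..<N} \<rightarrow>\<^sub>E {..<2 * n}"
    and "g \<le> N \<Longrightarrow> l < n \<Longrightarrow> weight n l (path_word n N m) g = int (shape N m l g (N - g))"
proof -
  let ?w = "path_word n N m"
  have "step_letter n N m g (?w g)" if "g < N" for g
    using someI_ex[OF exists_letter[OF m that]] that by (simp add: path_word_def)
  then have w: "?w g < 2 * n \<and> (\<forall>l<n. int (shape N m l (Suc g) (N - Suc g)) =
     int (shape N m l g (N - g)) + ((if ?w g = l then 1 else 0) - (if ?w g = 2 * n - 1 - l then 1 else 0)))" if "g < N" for g
    using that by (simp add: step_letter_def)
  then show "?w \<in> {..<N} \<rightarrow>\<^sub>E {..<2 * n}" by (auto simp: path_word_def)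
  show "g \<le> N \<Longrightarrow> l < n \<Longrightarrow> weight n l ?w g = int (shape N m l g (N - g))"
  proof (induction g)
    case 0
    then show ?case by (simp add: weight_def shape_def)
  next
    case (Suc g)
    then show ?case using w[of g] by (simp add: weight_def)
  qed
qed

lemma path_word_dominant:
  assumes m: "perfect_matching {..<N} m" "noncrossing (Suc n) m" and "n \<ge> 1"
  shows "dominant_path n N (path_word n N m)" "k < n \<Longrightarrow> weight n k (path_word n N m) N = 0"
proof -
  have "shape N m (Suc k) g (N - g) \<le> shape N m k g (N - g)" for k g
    by (simp add: shape_def growth_derived_le)
  then show "dominant_path n N (path_word n N m)"
    using path_word[OF m] assms(3) by (auto simp: dominant_path_def)
  show "k < n \<Longrightarrow> weight n k (path_word n N m) N = 0"
    using path_word(2)[OF m, of N k] by (simp add: shape_def)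
qed

text \<open>The correspondence is inverted from the \<open>n\<close>-th derived array, which
  vanishes, down to the array of arcs. The path gives the shapes at the corners
  \<open>(g, N - g)\<close>, and at the corners in between the shape is the smaller of its two
  neighbours.\<close>

lemma path_word_inj: "inj_on (path_word n N) {m. perfect_matching {..<N} m \<and> noncrossing (Suc n) m}"
proof (rule inj_onI)
  fix m m' assume m: "m \<in> {m. perfect_matching {..<N} m \<and> noncrossing (Suc n) m}"
    and m': "m' \<in> {m. perfect_matching {..<N} m \<and> noncrossing (Suc n) m}"
    and eq: "path_word n N m = path_word n N m'"
  let ?X = "\<lambda>m k. (derived ^^ k) (arc_array N m)"
  have d: "shape N m k g (N - g) = shape N m' k g (N - g)" if "g \<le> N" "k < n" for k g
    using path_word(2)[of N m n g k] path_word(2)[of N m' n g k] m m' eq that by simp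
  have sub: "shape N m k g (N - Suc g) = min (shape N m k g (N - g)) (shape N m k (Suc g) (N - Suc g))"
    if "g < N" "k < n" "perfect_matching {..<N} m" "noncrossing (Suc n) m" for k g m
    using shape_step[OF that(3,4,1)] that(2) by cases (auto simp: min_def)
  have s: "shape N m k i j = shape N m' k i j" if ij: "i + j \<le> N" "N \<le> Suc (i + j)" and k: "k < n" for k i j
  proof (cases "i + j = N")
    case True
    then show ?thesis using d[of i k] k by auto
  next
    case False
    then have j: "j = N - Suc i" "i < N" using ij by auto
    then show ?thesis using sub[of i k m] sub[of i k m'] m m' d[of i k] d[of "Suc i" k] k by auto
  qed
  have X: "k \<le> n \<Longrightarrow> \<forall>i j. i + j \<le> N \<longrightarrow> ?X m k i j = ?X m' k i j" for k
  proof (induction "n - k" arbitrary: k)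
    case 0
    then show ?case using noncrossing_shape[of n m] noncrossing_shape[of n m'] m m' by auto
  next
    case (Suc d)
    then have kn: "k < n" by simp
    have IH: "?X m (Suc k) i j = ?X m' (Suc k) i j" if "i + j \<le> N" for i j
      using Suc.hyps(1)[of "Suc k"] Suc.hyps(2) kn that by auto
    show ?case
    proof (intro allI impI)
      fix i j assume ij: "i + j \<le> N"
      show "?X m k i j = ?X m' k i j"
      proof (cases i; cases j)
        fix i' j' assume ij': "i = Suc i'" "j = Suc j'"
        show ?thesis unfolding ij'
          by (rule array_recover[where N=N]) (use s[OF _ _ kn] IH ij ij' in \<open>auto simp: shape_def\<close>)
      qed (auto simp: derived_iter_zero)
    qed
  qed
  have sub: "e \<in> m'" if e: "e \<in> m" and m: "perfect_matching {..<N} m"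
    and X: "\<forall>i j. i + j \<le> N \<longrightarrow> arc_array N m i j = arc_array N m' i j" for e m m'
  proof -
    have "card e = 2" "e \<subseteq> {..<N}" using m e unfolding perfect_matching_def partition_on_def by auto
    then obtain a0 b0 where e0: "e = {a0, b0}" "a0 \<noteq> b0" by (auto simp: card_2_iff)
    define a b where "a = min a0 b0" and "b = max a0 b0"
    then have ab: "e = {a, b}" "a < b" "b < N" using e0 \<open>e \<subseteq> {..<N}\<close> by (auto simp: min_def max_def)
    then have "1 \<le> N - b" "Suc a + (N - b) \<le> N" "N - (N - b) = b" by linarith+
    then have "arc_array N m (Suc a) (N - b) = 1" using e ab by (simp add: arc_array_def)
    then have "arc_array N m' (Suc a) (N - b) = 1" using X \<open>Suc a + (N - b) \<le> N\<close> by simp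
    then have "{Suc a - 1, N - (N - b)} \<in> m'" by (rule_tac ccontr) (simp add: arc_array_def)
    then show ?thesis using ab \<open>N - (N - b) = b\<close> by simp
  qed
  from X[of 0] have X0: "\<forall>i j. i + j \<le> N \<longrightarrow> arc_array N m i j = arc_array N m' i j" by simp
  then have X0': "\<forall>i j. i + j \<le> N \<longrightarrow> arc_array N m' i j = arc_array N m i j" by simp
  show "m = m'" using sub[OF _ _ X0] sub[OF _ _ X0'] m m' by blast
qed

section \<open>Straightening modulo Pfaffians\<close>

text \<open>For distance \<open>d\<close> this is \<open>d (2 B - d)\<close>, strictly concave in
  \<open>d\<close>. Concavity makes a crossing pair costlier than the nested pair on the same
  points, and a total span below \<open>2 B\<close> makes it costlier than the disjoint
  pair.\<close>

definition phi :: "int \<Rightarrow> int \<Rightarrow> int \<Rightarrow> int" where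
  "phi B x y = \<bar>x - y\<bar> * (2 * B - \<bar>x - y\<bar>)"

lemma phi_sym: "phi B x y = phi B y x"
  by (simp add: phi_def abs_minus_commute)

lemma phi_crossing:
  assumes "x1 < x2" "x2 < x3" "x3 < x4" "x4 - x1 < 2 * B"
  shows "phi B x1 x2 + phi B x3 x4 < phi B x1 x3 + phi B x2 x4"
    and "phi B x1 x4 + phi B x2 x3 < phi B x1 x3 + phi B x2 x4"
proof -
  define a b c where "a = x2 - x1" and "b = x3 - x2" and "c = x4 - x3"
  have pos: "a > 0" "b > 0" "c > 0" "a + b + c < 2 * B" using assms by (auto simp: a_def b_def c_def)
  have e: "\<bar>x1 - x2\<bar> = a" "\<bar>x3 - x4\<bar> = c" "\<bar>x1 - x3\<bar> = a + b" "\<bar>x2 - x4\<bar> = b + c" "\<bar>x1 - x4\<bar> = a + b + c" "\<bar>x2 - x3\<bar> = b"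
    using assms by (auto simp: a_def b_def c_def)
  \<comment> \<open>Exactly the difference of the two sides.\<close>
  have "0 < 2 * b * (2 * B - (a + b + c))" using pos by simp
  then show "phi B x1 x2 + phi B x3 x4 < phi B x1 x3 + phi B x2 x4"
    unfolding phi_def e by (simp add: algebra_simps)
  have "0 < 2 * a * c" using pos by simp
  then show "phi B x1 x4 + phi B x2 x3 < phi B x1 x3 + phi B x2 x4"
    unfolding phi_def e by (simp add: algebra_simps)
qed

definition cost :: "int \<Rightarrow> ('a \<Rightarrow> nat) \<Rightarrow> 'a set \<Rightarrow> int" where
  "cost B pos e = phi B (int (Min (pos ` e))) (int (Max (pos ` e)))"

lemma cost_pair: "cost B pos {a, b} = phi B (int (pos a)) (int (pos b))"
  using phi_sym by (auto simp: cost_def min_def max_def)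

definition crosses :: "('a \<Rightarrow> nat) \<Rightarrow> 'a set \<Rightarrow> 'a set \<Rightarrow> bool" where
  "crosses pos e e' \<longleftrightarrow> (\<exists>a b c d. pos a < pos b \<and> pos b < pos c \<and> pos c < pos d \<and>
      (e = {a, c} \<and> e' = {b, d} \<or> e' = {a, c} \<and> e = {b, d}))"

lemma crosses_sym: "crosses pos e e' \<Longrightarrow> crosses pos e' e"
  unfolding crosses_def by blast

lemma perfect_matching_card:
  assumes "finite S" "perfect_matching S m"
  shows "card S = 2 * card m"
proof -
  have "card S = card (\<Union> m)" using perfect_matching_Union[OF assms(2)] by simp
  also have "\<dots> = sum card m"
    by (rule card_Union_disjoint)
      (use assms(2) in \<open>auto simp: perfect_matching_def partition_on_def intro: card_ge_0_finite\<close>)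
  also have "\<dots> = 2 * card m" using assms(2) by (simp add: perfect_matching_def)
  finally show ?thesis .
qed

lemma perfect_matching_edge_ordered:
  assumes "perfect_matching S m" "inj_on pos S" "e \<in> m"
  obtains a b where "e = {a, b}" "pos a < (pos b :: nat)" "a \<in> S" "b \<in> S"
proof -
  have "card e = 2" using assms by (simp add: perfect_matching_def)
  then obtain a b where e: "e = {a, b}" "a \<noteq> b" by (auto simp: card_2_iff)
  have S: "a \<in> S" "b \<in> S" using perfect_matching_Union[OF assms(1)] assms(3) e by auto
  then have "pos a \<noteq> pos b" using assms(2) e by (auto simp: inj_on_def)
  then consider "pos a < pos b" | "pos b < pos a" by linarith
  then show thesis
  proof cases
    case 2
    have "e = {b, a}" using e by auto
    then show thesis using that[of b a] 2 S by simp
  qed (use that e S in blast)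
qed

text \<open>A disjoint or nested pair of arcs is replaced by the crossing pair on the same four
  points.\<close>

lemma uncross_improves:
  assumes S: "finite S" "inj_on pos S" and B: "\<And>x. x \<in> S \<Longrightarrow> int (pos x) < B" and m: "perfect_matching S m"
    and e: "e \<in> m" "e' \<in> m" "e \<noteq> e'" "\<not> crosses pos e e'"
  shows "\<exists>m'. perfect_matching S m' \<and> sum (cost B pos) m < sum (cost B pos) m'"
proof -
  have main: "\<exists>m'. perfect_matching S m' \<and> sum (cost B pos) m < sum (cost B pos) m'"
    if e: "{a, b} \<in> m" "{c, d} \<in> m" "{a, b} \<noteq> {c, d}" "\<not> crosses pos {a, b} {c, d}"
     and o: "pos a < pos b" "pos c < pos d" "pos a < pos c" for a b c d
  proof -
    have abcd: "a \<in> S" "b \<in> S" "c \<in> S" "d \<in> S" using perfect_matching_Union[OF m] e by auto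
    have "{a, b} \<inter> {c, d} = {}" using perfect_matching_disjoint[OF m e(1,2)] e(3) by blast
    then have ne: "a \<noteq> c" "a \<noteq> d" "b \<noteq> c" "b \<noteq> d" by auto
    then have "pos b \<noteq> pos c" "pos b \<noteq> pos d" using S(2) abcd by (auto simp: inj_on_def)
    moreover have "\<not> (pos c < pos b \<and> pos b < pos d)" using e(4) o unfolding crosses_def by blast
    ultimately consider "pos b < pos c" | "pos d < pos b" by linarith
    then show ?thesis
    proof cases
      case 1
      let ?new = "{{a, c}, {b, d}}" and ?old = "{{a, b}, {c, d}}"
      have pm: "perfect_matching (S - \<Union> ?old) (m - ?old)" by (rule perfect_matching_Diff) (use m e in auto)
      have "perfect_matching ((S - \<Union> ?old) \<union> (\<Union> ?new)) ((m - ?old) \<union> ?new)"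
        by (rule perfect_matching_Un[OF pm]) (use ne o 1 in \<open>auto intro!: perfect_matchingI\<close>)
      moreover have "(S - \<Union> ?old) \<union> (\<Union> ?new) = S" using abcd by auto
      moreover have "(m - ?old) \<inter> ?new = {}"
        using perfect_matching_Union[OF pm] by auto
      then have "sum (cost B pos) ((m - ?old) \<union> ?new) = sum (cost B pos) (m - ?old) + sum (cost B pos) ?new"
        using perfect_matching_finite[OF S(1) m] by (intro sum.union_disjoint) auto
      moreover have "sum (cost B pos) m = sum (cost B pos) (m - ?old) + sum (cost B pos) ?old"
        using perfect_matching_finite[OF S(1) m] e by (intro sum.subset_diff) auto
      moreover have "sum (cost B pos) ?old < sum (cost B pos) ?new"
      proof -
        have "{a, c} \<noteq> {b, d}" using ne o by (auto simp: doubleton_eq_iff)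
        then show ?thesis using phi_crossing(1)[of "int (pos a)" "int (pos b)" "int (pos c)" "int (pos d)" B]
          e(3) 1 o B[OF abcd(4)] by (simp add: cost_pair)
      qed
      ultimately show ?thesis by (intro exI[of _ "(m - ?old) \<union> ?new"]) simp
    next
      case 2
      let ?new = "{{a, d}, {c, b}}" and ?old = "{{a, b}, {c, d}}"
      have pm: "perfect_matching (S - \<Union> ?old) (m - ?old)" by (rule perfect_matching_Diff) (use m e in auto)
      have "perfect_matching ((S - \<Union> ?old) \<union> (\<Union> ?new)) ((m - ?old) \<union> ?new)"
        by (rule perfect_matching_Un[OF pm]) (use ne o 2 in \<open>auto intro!: perfect_matchingI\<close>)
      moreover have "(S - \<Union> ?old) \<union> (\<Union> ?new) = S" using abcd by auto
      moreover have "(m - ?old) \<inter> ?new = {}"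
        using perfect_matching_Union[OF pm] by auto
      then have "sum (cost B pos) ((m - ?old) \<union> ?new) = sum (cost B pos) (m - ?old) + sum (cost B pos) ?new"
        using perfect_matching_finite[OF S(1) m] by (intro sum.union_disjoint) auto
      moreover have "sum (cost B pos) m = sum (cost B pos) (m - ?old) + sum (cost B pos) ?old"
        using perfect_matching_finite[OF S(1) m] e by (intro sum.subset_diff) auto
      moreover have "sum (cost B pos) ?old < sum (cost B pos) ?new"
      proof -
        have "{a, d} \<noteq> {c, b}" using ne o by (auto simp: doubleton_eq_iff)
        then show ?thesis using phi_crossing(2)[of "int (pos a)" "int (pos c)" "int (pos d)" "int (pos b)" B]
          e(3) 2 o B[OF abcd(2)] by (simp add: cost_pair)
      qed
      ultimately show ?thesis by (intro exI[of _ "(m - ?old) \<union> ?new"]) simp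
    qed
  qed
  obtain a b where ab: "e = {a, b}" "pos a < pos b" "a \<in> S" by (rule perfect_matching_edge_ordered[OF m S(2) e(1)])
  obtain c d where cd: "e' = {c, d}" "pos c < pos d" "c \<in> S" by (rule perfect_matching_edge_ordered[OF m S(2) e(2)])
  have "a \<noteq> c" using perfect_matching_disjoint[OF m e(1,2)] e(3) ab cd by blast
  then have "pos a \<noteq> pos c" using S(2) ab cd by (auto simp: inj_on_def)
  then consider "pos a < pos c" | "pos c < pos a" by linarith
  then show ?thesis
  proof cases
    case 1
    then show ?thesis using main[of a b c d] ab cd e by simp
  next
    case 2
    then show ?thesis using main[of c d a b] ab cd e crosses_sym[of pos "{c, d}" "{a, b}"] by auto
  qed
qed

definition fully_crossing :: "('a \<Rightarrow> nat) \<Rightarrow> 'a set set \<Rightarrow> bool" where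
  "fully_crossing pos m \<longleftrightarrow> (\<forall>e\<in>m. \<forall>e'\<in>m. e \<noteq> e' \<longrightarrow> crosses pos e e')"

text \<open>Every other arc crosses \<open>{a, b}\<close>, so exactly one of its end points lies in
  between.\<close>

lemma fully_crossing_between:
  assumes S: "finite S" "inj_on pos S" and m: "perfect_matching S m" and f: "fully_crossing pos m"
    and e: "{a, b} \<in> m" "pos a < pos b"
  shows "Suc (card {s \<in> S. pos a < pos s \<and> pos s < pos b}) = card m"
proof -
  let ?W = "{s. pos a < pos s \<and> pos s < pos b}"
  have fin: "finite m" using perfect_matching_finite[OF S(1) m] .
  have "{s \<in> S. pos a < pos s \<and> pos s < pos b} = (\<Union>e'\<in>m. e' \<inter> ?W)"
    using perfect_matching_Union[OF m] by auto
  also have "card \<dots> = (\<Sum>e'\<in>m. card (e' \<inter> ?W))"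
  proof (rule card_UN_disjoint)
    show "\<forall>i\<in>m. finite (i \<inter> ?W)" using perfect_matching_Union[OF m] S(1) by (meson Union_upper finite_Int finite_subset)
    show "\<forall>i\<in>m. \<forall>j\<in>m. i \<noteq> j \<longrightarrow> i \<inter> ?W \<inter> (j \<inter> ?W) = {}"
      using perfect_matching_disjoint[OF m] by blast
  qed (rule fin)
  also have "\<dots> = (\<Sum>e'\<in>m. if e' = {a, b} then 0 else 1)"
  proof (rule sum.cong)
    fix e' assume e': "e' \<in> m"
    show "card (e' \<inter> ?W) = (if e' = {a, b} then 0 else 1)"
    proof (cases "e' = {a, b}")
      case False
      then have "crosses pos {a, b} e'" using f e e' by (auto simp: fully_crossing_def)
      then obtain a' b' c' d' where o: "pos a' < pos b'" "pos b' < pos c'" "pos c' < pos d'"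
        and "{a, b} = {a', c'} \<and> e' = {b', d'} \<or> e' = {a', c'} \<and> {a, b} = {b', d'}"
        unfolding crosses_def by blast
      then show ?thesis
      proof (elim disjE conjE)
        assume "{a, b} = {a', c'}" "e' = {b', d'}"
        then have "a' = a" "c' = b" using e(2) o by (auto simp: doubleton_eq_iff)
        then have "e' \<inter> ?W = {b'}" using \<open>e' = {b', d'}\<close> o by auto
        then show ?thesis using False by simp
      next
        assume "e' = {a', c'}" "{a, b} = {b', d'}"
        then have "b' = a" "d' = b" using e(2) o by (auto simp: doubleton_eq_iff)
        then have "e' \<inter> ?W = {c'}" using \<open>e' = {a', c'}\<close> o by auto
        then show ?thesis using False by simp
      qed
    qed (use e in auto)
  qed simp
  also have "\<dots> = card (m - {{a, b}})"
    using fin e(1) by (simp add: sum.If_cases Collect_neg_eq Diff_eq)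
  finally show ?thesis using fin e(1) by (metis card_Suc_Diff1)
qed

text \<open>The number of points between two partners is prescribed, so the partner of a point is
  determined by its side and its rank.\<close>

lemma fully_crossing_unique:
  assumes S: "finite S" "inj_on pos S" and m: "perfect_matching S m" "fully_crossing pos m"
    and m': "perfect_matching S m'" "fully_crossing pos m'"
  shows "m = m'"
proof -
  have sub: "e \<in> m'" if m: "perfect_matching S m" "fully_crossing pos m"
    and m': "perfect_matching S m'" "fully_crossing pos m'" and e: "e \<in> m" for e m m'
  proof -
    obtain a b where ab: "e = {a, b}" "pos a < pos b" "a \<in> S" "b \<in> S"
      by (rule perfect_matching_edge_ordered[OF m(1) S(2) e])
    obtain b' where b': "{a, b'} \<in> m'" "b' \<noteq> a" "b' \<in> S" using perfect_matching_edge[OF m'(1) ab(3)] by metis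
    let ?W = "\<lambda>a b. {s \<in> S. pos a < pos s \<and> pos s < pos b}"
    have cm: "card m = card m'" using perfect_matching_card[OF S(1) m(1)] perfect_matching_card[OF S(1) m'(1)] by simp
    have 1: "Suc (card (?W a b)) = card m" using fully_crossing_between[OF S m, of a b] e ab by simp
    have fin: "finite (?W x y)" for x y using S(1) by simp
    have "pos b' \<noteq> pos a" using b' ab S(2) by (auto simp: inj_on_def)
    then consider "pos a < pos b'" | "pos b' < pos a" by linarith
    then show ?thesis
    proof cases
      case 1
      have 2: "Suc (card (?W a b')) = card m'" using fully_crossing_between[OF S m', of a b'] b' 1 by simp
      have "\<not> pos b < pos b'"
      proof
        assume "pos b < pos b'"
        then have "?W a b \<subset> ?W a b'" using ab by (auto intro!: psubsetI)
        from psubset_card_mono[OF fin this] show False using \<open>Suc (card (?W a b)) = card m\<close> 2 cm by simp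
      qed
      moreover have "\<not> pos b' < pos b"
      proof
        assume "pos b' < pos b"
        then have "?W a b' \<subset> ?W a b" using b' 1 by (auto intro!: psubsetI)
        from psubset_card_mono[OF fin this] show False using \<open>Suc (card (?W a b)) = card m\<close> 2 cm by simp
      qed
      ultimately have "pos b = pos b'" by simp
      then have "b = b'" using S(2) ab b' by (auto simp: inj_on_def)
      then show ?thesis using b' ab by simp
    next
      case 2
      \<comment> \<open>With partners on opposite sides of \<open>a\<close> there would be
        \<open>2 (card m - 1) + 3\<close> points, more than
        \<open>card S = 2 * card m\<close>.\<close>
      have 3: "Suc (card (?W b' a)) = card m'"
        using fully_crossing_between[OF S m', of b' a] b' 2 by (simp add: insert_commute)
      have "card (?W a b \<union> ?W b' a \<union> {a, b, b'}) \<le> card S" by (rule card_mono) (use S ab b' in auto)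
      moreover have "card (?W a b \<union> ?W b' a \<union> {a, b, b'}) = card (?W a b) + card (?W b' a) + card {a, b, b'}"
        by (subst card_Un_disjoint; (subst card_Un_disjoint)?) (use fin 2 ab in auto)
      moreover have "a \<noteq> b" "a \<noteq> b'" "b \<noteq> b'" using 2 ab by auto
      then have "card {a, b, b'} = 3" by simp
      ultimately show ?thesis using \<open>Suc (card (?W a b)) = card m\<close> 3 cm perfect_matching_card[OF S(1) m(1)] by simp
    qed
  qed
  show ?thesis using sub[OF m m'] sub[OF m' m] by blast
qed

text \<open>A matching of maximal cost exists by finiteness, it cannot be improved, hence it is
  fully crossing, and there is only one such matching.\<close>

lemma fully_crossing_max:
  assumes S: "finite S" "inj_on pos S" and B: "\<And>x. x \<in> S \<Longrightarrow> int (pos x) < B"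
    and m: "perfect_matching S m" "fully_crossing pos m" and m': "perfect_matching S m'" "m' \<noteq> m"
  shows "sum (cost B pos) m' < sum (cost B pos) m"
proof -
  let ?M = "{m. perfect_matching S m}"
  have "?M \<subseteq> Pow (Pow S)" using perfect_matching_Union by blast
  then have fin: "finite ?M" using S(1) by (meson finite_Pow_iff finite_subset)
  have max_fc: "fully_crossing pos k" if "k \<in> ?M" "\<And>k'. k' \<in> ?M \<Longrightarrow> sum (cost B pos) k' \<le> sum (cost B pos) k" for k
  proof (rule ccontr)
    assume "\<not> fully_crossing pos k"
    then obtain e e' where "e \<in> k" "e' \<in> k" "e \<noteq> e'" "\<not> crosses pos e e'" by (auto simp: fully_crossing_def)
    then have "\<exists>k'. perfect_matching S k' \<and> sum (cost B pos) k < sum (cost B pos) k'"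
      by (intro uncross_improves[OF S, of B k e e']) (use B that(1) in auto)
    then obtain k' where "perfect_matching S k'" "sum (cost B pos) k < sum (cost B pos) k'" by blast
    then show False using that(2)[of k'] by simp
  qed
  have "Max (sum (cost B pos) ` ?M) \<in> sum (cost B pos) ` ?M" using fin m(1) by (intro Max_in) auto
  then obtain k where k: "k \<in> ?M" "sum (cost B pos) k = Max (sum (cost B pos) ` ?M)" by auto
  then have kmax: "sum (cost B pos) k' \<le> sum (cost B pos) k" if "k' \<in> ?M" for k' using that fin by simp
  have "k = m" using fully_crossing_unique[OF S _ max_fc[OF k(1) kmax] m] k(1) by simp
  moreover have "sum (cost B pos) m' \<noteq> sum (cost B pos) k"
  proof
    assume "sum (cost B pos) m' = sum (cost B pos) k"
    then have "fully_crossing pos m'" using max_fc[of m'] m'(1) kmax by simp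
    then show False using fully_crossing_unique[OF S m'(1) _ m] m'(2) by simp
  qed
  ultimately show ?thesis using kmax[of m'] m'(1) by simp
qed

lemma crossing_extract:
  assumes Z: "finite Z" "inj_on pos Z" and m: "perfect_matching Z m" and nc: "\<not> noncrossing k ((`) pos ` m)"
  obtains M0 where "M0 \<subseteq> m" "card M0 = k" "fully_crossing pos M0"
proof -
  obtain a b :: "nat \<Rightarrow> nat" where ab: "strict_mono_on {1..k} a" "strict_mono_on {1..k} b" "a k < b 1"
    "\<forall>i\<in>{1..k}. {a i, b i} \<in> (`) pos ` m" using nc unfolding noncrossing_def by blast
  have "\<forall>i\<in>{1..k}. \<exists>e. e \<in> m \<and> pos ` e = {a i, b i}"
  proof
    fix i assume "i \<in> {1..k}"
    then obtain e where "e \<in> m" "{a i, b i} = pos ` e" using ab(4) by blast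
    then show "\<exists>e. e \<in> m \<and> pos ` e = {a i, b i}" by metis
  qed
  from bchoice[OF this] obtain E where "\<forall>i\<in>{1..k}. E i \<in> m \<and> pos ` E i = {a i, b i}" by blast
  then have E: "E i \<in> m" "pos ` E i = {a i, b i}" if "i \<in> {1..k}" for i using that by blast+
  have lt: "a i < b j" if "i \<in> {1..k}" "j \<in> {1..k}" for i j
  proof -
    have "a i \<le> a k" using ab(1) that by (intro strict_mono_on_leD[OF ab(1)]) auto
    moreover have "b 1 \<le> b j" using ab(2) that by (intro strict_mono_on_leD[OF ab(2)]) auto
    ultimately show ?thesis using ab(3) by simp
  qed
  have pts: "\<exists>x y. E i = {x, y} \<and> pos x = a i \<and> pos y = b i" if i: "i \<in> {1..k}" for i
  proof -
    obtain x y where xy: "E i = {x, y}" "pos x < pos y"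
      using perfect_matching_edge_ordered[OF m Z(2) E(1)[OF i]] by metis
    then have "{pos x, pos y} = {a i, b i}" using E(2)[OF i] by simp
    then show ?thesis using xy lt[OF i i] by (auto simp: doubleton_eq_iff)
  qed
  have cr: "crosses pos (E i) (E j)" if ij: "i \<in> {1..k}" "j \<in> {1..k}" "i < j" for i j
  proof -
    obtain x y where xy: "E i = {x, y}" "pos x = a i" "pos y = b i" using pts ij by blast
    obtain x' y' where xy': "E j = {x', y'}" "pos x' = a j" "pos y' = b j" using pts ij by blast
    have "a i < a j" "b i < b j" using ab(1,2) ij by (auto simp: strict_mono_on_def)
    then have "pos x < pos x' \<and> pos x' < pos y \<and> pos y < pos y'" using lt[of j i] ij xy xy' by simp
    then show ?thesis unfolding crosses_def xy(1) xy'(1) by blast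
  qed
  have ne: "\<not> crosses pos e e" for e
    unfolding crosses_def by (auto simp: doubleton_eq_iff)
  have "E i \<noteq> E j" if "i \<in> {1..k}" "j \<in> {1..k}" "i < j" for i j
    using cr[OF that] ne by metis
  then have "inj_on E {1..k}" by (intro inj_onI) (metis linorder_neqE_nat)
  then have "card (E ` {1..k}) = k" by (simp add: card_image)
  moreover have "fully_crossing pos (E ` {1..k})"
    unfolding fully_crossing_def
  proof (intro ballI impI)
    fix e e' assume "e \<in> E ` {1..k}" "e' \<in> E ` {1..k}" "e \<noteq> e'"
    then obtain i j where ij: "i \<in> {1..k}" "j \<in> {1..k}" "e = E i" "e' = E j" "i \<noteq> j" by blast
    then consider "i < j" | "j < i" by linarith
    then show "crosses pos e e'" using cr[OF ij(1,2)] crosses_sym[OF cr[OF ij(2,1)]] ij(3,4) by cases auto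
  qed
  ultimately show thesis using that[of "E ` {1..k}"] E(1) by blast
qed

lemma straightening:
  assumes Z: "finite Z" "inj_on pos Z" and m: "perfect_matching Z m"
  shows "single m \<in> fv.span
     ({(\<Sum>m'\<in>{m'. perfect_matching S m'}. single (m' \<union> f)) | S f. S \<subseteq> Z \<and> card S = 2 * (n + 1) \<and> perfect_matching (Z - S) f}
      \<union> single ` {m. perfect_matching Z m \<and> noncrossing (n + 1) ((`) pos ` m)})" (is "_ \<in> fv.span (?Pf \<union> ?X)")
proof -
  define B where "B = int (Suc (Max (pos ` Z)))"
  have B: "int (pos x) < B" if "x \<in> Z" for x
  proof -
    have "pos x \<le> Max (pos ` Z)" by (rule Max_ge) (use that Z in auto)
    then show ?thesis by (simp add: B_def)
  qed
  let ?mu = "sum (cost B pos)"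
  let ?M = "{m. perfect_matching Z m}"
  have "?M \<subseteq> Pow (Pow Z)" using perfect_matching_Union by blast
  then have fin: "finite ?M" using Z(1) by (meson finite_Pow_iff finite_subset)
  show ?thesis using m
  \<comment> \<open>Costs are integers; the number of cheaper matchings provides a measure in the
    natural numbers.\<close>
  proof (induction "card {k \<in> ?M. ?mu k < ?mu m}" arbitrary: m rule: less_induct)
    case less
    show ?case
    proof (cases "noncrossing (n + 1) ((`) pos ` m)")
      case True
      then show ?thesis using less.prems by (intro fv.span_base) auto
    next
      case False
      then obtain M0 where M0: "M0 \<subseteq> m" "card M0 = n + 1" "fully_crossing pos M0"
        using crossing_extract[OF Z less.prems] by metis
      define S where "S = \<Union> M0"
      define f where "f = m - M0"
      have SZ: "S \<subseteq> Z" using M0(1) perfect_matching_Union[OF less.prems] by (auto simp: S_def)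
      have f: "perfect_matching (Z - S) f" unfolding S_def f_def by (rule perfect_matching_Diff[OF less.prems M0(1)])
      have "perfect_matching (Z - \<Union> f) (m - f)" by (rule perfect_matching_Diff[OF less.prems]) (auto simp: f_def)
      moreover have "Z - \<Union> f = S" using perfect_matching_Union[OF f] SZ by auto
      moreover have "m - f = M0" using M0(1) by (auto simp: f_def)
      ultimately have pM0: "perfect_matching S M0" by simp
      have finS: "finite S" using SZ Z(1) finite_subset by blast
      have cS: "card S = 2 * (n + 1)" using perfect_matching_card[OF finS pM0] M0(2) by simp
      let ?N = "{m'. perfect_matching S m'}"
      have "?N \<subseteq> Pow (Pow S)" using perfect_matching_Union by blast
      then have finN: "finite ?N" using finS by (meson finite_Pow_iff finite_subset)
      have finf: "finite f" using perfect_matching_finite[OF _ f] Z(1) by simp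
      have "single (m' \<union> f) \<in> fv.span (?Pf \<union> ?X)" if m': "m' \<in> ?N - {M0}" for m'
      proof (rule less.hyps)
        have pm': "perfect_matching S m'" using m' by simp
        show pmf: "perfect_matching Z (m' \<union> f)"
          using perfect_matching_Un[OF pm' f] SZ by (simp add: Un_absorb1)
        have dis: "k \<inter> f = {}" if "perfect_matching S k" for k
        proof -
          have "e \<notin> f" if "e \<in> k" for e
          proof
            assume "e \<in> f"
            then have "e \<subseteq> Z - S" "e \<subseteq> S" using perfect_matching_Union[OF f] perfect_matching_Union[OF \<open>perfect_matching S k\<close>] that by auto
            then have "e = {}" by auto
            then show False using f \<open>e \<in> f\<close> by (auto simp: perfect_matching_def)
          qed
          then show ?thesis by auto
        qed
        have mu: "?mu (k \<union> f) = ?mu k + ?mu f" if "perfect_matching S k" for k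
          using perfect_matching_finite[OF finS that] finf dis[OF that] by (rule sum.union_disjoint)
        have "?mu m' < ?mu M0"
          by (rule fully_crossing_max[OF finS _ _ pM0 M0(3) pm']) (use m' SZ Z(2) B in \<open>auto intro: inj_on_subset\<close>)
        moreover have "m = M0 \<union> f" using M0(1) by (auto simp: f_def)
        ultimately have lt: "?mu (m' \<union> f) < ?mu m" using mu[OF pm'] mu[OF pM0] by simp
        show "card {k \<in> ?M. ?mu k < ?mu (m' \<union> f)} < card {k \<in> ?M. ?mu k < ?mu m}"
          by (rule psubset_card_mono) (use fin lt pmf in auto)
      qed
      then have "(\<Sum>m'\<in>?N - {M0}. single (m' \<union> f)) \<in> fv.span (?Pf \<union> ?X)" by (rule fv.span_sum)
      moreover have "(\<Sum>m'\<in>?N. single (m' \<union> f)) \<in> fv.span (?Pf \<union> ?X)"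
        by (intro fv.span_base) (use SZ cS f in blast)
      ultimately have "(\<Sum>m'\<in>?N. single (m' \<union> f)) - (\<Sum>m'\<in>?N - {M0}. single (m' \<union> f)) \<in> fv.span (?Pf \<union> ?X)"
        by (rule fv.span_diff[rotated])
      moreover have "(\<Sum>m'\<in>?N. single (m' \<union> f)) = single (M0 \<union> f) + (\<Sum>m'\<in>?N - {M0}. single (m' \<union> f))"
        using finN pM0 by (simp add: sum.remove)
      moreover have "M0 \<union> f = m" using M0(1) by (auto simp: f_def)
      ultimately show ?thesis by simp
    qed
  qed
qed

section \<open>Highest weight tensors\<close>

lemma sum_apply: "(\<Sum>a\<in>A. f a) x = (\<Sum>a\<in>A. (f a x :: complex))"
  by (induction A rule: infinite_finite_induct) auto

text \<open>\<open>Jn n\<close> is the form in a hyperbolic basis, in which \<open>a\<close> is paired with \<open>2n - 1 - a\<close>; \<open>nu n i a\<close> is the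
  coefficient of the basis vector \<open>a + 1\<close> in the image of \<open>a\<close> under the \<open>i\<close>-th lowering operator.\<close>

definition Jn :: "nat \<Rightarrow> nat \<Rightarrow> nat \<Rightarrow> complex" where
  "Jn n a b = (if a < 2 * n \<and> b = 2 * n - 1 - a then (if a < n then 1 else - 1) else 0)"

lemma Jn_skew: "Jn n a b = - Jn n b a"
  by (auto simp: Jn_def)

definition nu :: "nat \<Rightarrow> nat \<Rightarrow> nat \<Rightarrow> complex" where
  "nu n i a = (if a = i then 1 else if a = 2 * n - 2 - i then - 1 else 0)"

lemma Jn_pos: "a < 2 * n \<Longrightarrow> b = 2 * n - 1 - a \<Longrightarrow> a < n \<Longrightarrow> Jn n a b = 1"
  by (simp add: Jn_def)

lemma Jn_neg: "a < 2 * n \<Longrightarrow> b = 2 * n - 1 - a \<Longrightarrow> \<not> a < n \<Longrightarrow> Jn n a b = - 1"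
  by (simp add: Jn_def)

lemma nu_pos: "a = i \<Longrightarrow> nu n i a = 1"
  by (simp add: nu_def)

lemma nu_neg: "a \<noteq> i \<Longrightarrow> a = 2 * n - 2 - i \<Longrightarrow> nu n i a = - 1"
  by (simp add: nu_def)

text \<open>Infinitesimal invariance of the form. Only \<open>a + b = 2n - 2\<close> matters. For
  \<open>i < n - 1\<close> the two coefficients of \<open>nu\<close> have opposite signs; for the
  long root \<open>i = n - 1\<close> the indices \<open>i\<close> and \<open>2n - 2 - i\<close>
  coincide, and the opposite signs come from \<open>Jn\<close>.\<close>

lemma Jn_nu:
  assumes "i < n"
  shows "nu n i a * Jn n (Suc a) b + nu n i b * Jn n a (Suc b) = 0"
proof (cases "a + b = 2 * n - 2")
  case True
  show ?thesis
  proof (cases "a = i \<or> b = i")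
    case True
    then consider "a = i" "Suc i < n" | "a = i" "Suc i = n" | "b = i" "Suc i < n" | "b = i" "Suc i = n"
      using assms by linarith
    then show ?thesis
    proof cases
      case 1
      then have "b \<noteq> i" "b = 2 * n - 2 - i" "Suc a < 2 * n" "b = 2 * n - 1 - Suc a" "Suc a < n" "a < 2 * n" "Suc b = 2 * n - 1 - a" "a < n"
        using \<open>a + b = 2 * n - 2\<close> by linarith+
      have "nu n i a = 1" by (rule nu_pos) fact+
      moreover have "nu n i b = - 1" by (rule nu_neg) fact+
      moreover have "Jn n (Suc a) b = 1" by (rule Jn_pos) fact+
      moreover have "Jn n a (Suc b) = 1" by (rule Jn_pos) fact+
      ultimately show ?thesis by simp
    next
      case 3
      then have "a \<noteq> i" "a = 2 * n - 2 - i" "Suc a < 2 * n" "b = 2 * n - 1 - Suc a" "\<not> Suc a < n" "a < 2 * n" "Suc b = 2 * n - 1 - a" "\<not> a < n"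
        using \<open>a + b = 2 * n - 2\<close> by linarith+
      have "nu n i a = - 1" by (rule nu_neg) fact+
      moreover have "nu n i b = 1" by (rule nu_pos) fact+
      moreover have "Jn n (Suc a) b = - 1" by (rule Jn_neg) fact+
      moreover have "Jn n a (Suc b) = - 1" by (rule Jn_neg) fact+
      ultimately show ?thesis by simp
    next
      case 2
      then have "b = i" "Suc a < 2 * n" "b = 2 * n - 1 - Suc a" "\<not> Suc a < n" "a < 2 * n" "Suc b = 2 * n - 1 - a" "a < n"
        using \<open>a + b = 2 * n - 2\<close> by linarith+
      have "nu n i a = 1" by (rule nu_pos) fact+
      moreover have "nu n i b = 1" by (rule nu_pos) fact+
      moreover have "Jn n (Suc a) b = - 1" by (rule Jn_neg) fact+
      moreover have "Jn n a (Suc b) = 1" by (rule Jn_pos) fact+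
      ultimately show ?thesis by simp
    next
      case 4
      then have "a = i" "Suc a < 2 * n" "b = 2 * n - 1 - Suc a" "\<not> Suc a < n" "a < 2 * n" "Suc b = 2 * n - 1 - a" "a < n"
        using \<open>a + b = 2 * n - 2\<close> by linarith+
      have "nu n i a = 1" by (rule nu_pos) fact+
      moreover have "nu n i b = 1" by (rule nu_pos) fact+
      moreover have "Jn n (Suc a) b = - 1" by (rule Jn_neg) fact+
      moreover have "Jn n a (Suc b) = 1" by (rule Jn_pos) fact+
      ultimately show ?thesis by simp
    qed
  next
    case False
    then have "a \<noteq> 2 * n - 2 - i" "b \<noteq> 2 * n - 2 - i" using True assms by auto
    then show ?thesis using False by (simp add: nu_def)
  qed
next
  case False
  then have "Jn n (Suc a) b = 0" "Jn n a (Suc b) = 0" using assms by (auto simp: Jn_def)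
  then show ?thesis by simp
qed

section \<open>Lowering and raising operators\<close>

abbreviation words :: "nat \<Rightarrow> nat \<Rightarrow> (nat \<Rightarrow> nat) set" where
  "words n N \<equiv> {..<N} \<rightarrow>\<^sub>E {..<2 * n}"

lemma finite_words: "finite (words n N)"
  by (simp add: finite_PiE)

definition lower :: "nat \<Rightarrow> nat \<Rightarrow> nat \<Rightarrow> ((nat \<Rightarrow> nat) \<Rightarrow> complex) \<Rightarrow> (nat \<Rightarrow> nat) \<Rightarrow> complex" where
  "lower n N i T w = (\<Sum>p<N. nu n i (w p) * T (w(p := Suc (w p))))"

text \<open>The entries of the transposed matrix. The letter \<open>0\<close> has its own case
  because \<open>0 - 1\<close> is \<open>0\<close>.\<close>

definition nu' :: "nat \<Rightarrow> nat \<Rightarrow> nat \<Rightarrow> complex" where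
  "nu' n i a = (if a = 0 then 0 else nu n i (a - 1))"

definition raise :: "nat \<Rightarrow> nat \<Rightarrow> nat \<Rightarrow> ((nat \<Rightarrow> nat) \<Rightarrow> complex) \<Rightarrow> (nat \<Rightarrow> nat) \<Rightarrow> complex" where
  "raise n N i T w = (\<Sum>p<N. nu' n i (w p) * T (w(p := w p - 1)))"

lemma nu_word: "i < n \<Longrightarrow> nu n i a \<noteq> 0 \<Longrightarrow> Suc a < 2 * n"
  by (auto simp: nu_def split: if_splits)

lemma words_Suc: "w \<in> words n N \<Longrightarrow> p < N \<Longrightarrow> Suc (w p) < 2 * n \<Longrightarrow> w(p := Suc (w p)) \<in> words n N"
  by (auto simp: PiE_iff extensional_def)

lemma words_pred: "w \<in> words n N \<Longrightarrow> p < N \<Longrightarrow> w(p := w p - 1) \<in> words n N"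
  by (auto simp: PiE_iff extensional_def) (metis less_imp_diff_less lessThan_iff)

text \<open>The coefficients are real, so the transpose is the adjoint for the Hermitian
  form.\<close>

lemma lower_raise_adjoint:
  assumes "i < n"
  shows "(\<Sum>w\<in>words n N. cnj (T w) * lower n N i f w) = (\<Sum>w\<in>words n N. cnj (raise n N i T w) * f w)"
proof -
  let ?W = "words n N"
  have p: "(\<Sum>w\<in>?W. cnj (T w) * (nu n i (w p) * f (w(p := Suc (w p))))) =
     (\<Sum>w\<in>?W. nu' n i (w p) * cnj (T (w(p := w p - 1))) * f w)" if p: "p < N" for p
  proof -
    let ?A = "{w \<in> ?W. nu n i (w p) \<noteq> 0}" and ?B = "{w \<in> ?W. nu' n i (w p) \<noteq> 0}"
    have bij: "bij_betw (\<lambda>w. w(p := Suc (w p))) ?A ?B"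
    proof (rule bij_betw_byWitness[where f' = "\<lambda>w. w(p := w p - 1)"])
      show "(\<lambda>w. w(p := Suc (w p))) ` ?A \<subseteq> ?B"
        using words_Suc[OF _ p] nu_word[OF assms] by (auto simp: nu'_def)
      show "(\<lambda>w. w(p := w p - 1)) ` ?B \<subseteq> ?A"
        using words_pred[OF _ p] by (auto simp: nu'_def split: if_splits)
    qed (auto simp: nu'_def split: if_splits)
    have "(\<Sum>w\<in>?W. cnj (T w) * (nu n i (w p) * f (w(p := Suc (w p))))) =
       (\<Sum>w\<in>?A. nu' n i ((w(p := Suc (w p))) p) * cnj (T ((w(p := Suc (w p)))(p := (w(p := Suc (w p))) p - 1))) * f (w(p := Suc (w p))))"
      by (rule sum.mono_neutral_cong_right) (auto simp: nu'_def intro: finite_words)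
    also have "\<dots> = (\<Sum>w\<in>?B. nu' n i (w p) * cnj (T (w(p := w p - 1))) * f w)"
      by (rule sum.reindex_bij_betw[OF bij])
    also have "\<dots> = (\<Sum>w\<in>?W. nu' n i (w p) * cnj (T (w(p := w p - 1))) * f w)"
      by (rule sum.mono_neutral_left) (auto intro: finite_words)
    finally show ?thesis .
  qed
  have nr: "cnj (nu' n i a) = nu' n i a" for a by (simp add: nu'_def nu_def)
  have "(\<Sum>w\<in>?W. cnj (T w) * lower n N i f w) = (\<Sum>p<N. \<Sum>w\<in>?W. cnj (T w) * (nu n i (w p) * f (w(p := Suc (w p)))))"
    unfolding lower_def sum_distrib_left by (rule sum.swap)
  also have "\<dots> = (\<Sum>p<N. \<Sum>w\<in>?W. nu' n i (w p) * cnj (T (w(p := w p - 1))) * f w)"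
    by (rule sum.cong[OF refl], rule p) simp
  also have "\<dots> = (\<Sum>w\<in>?W. cnj (raise n N i T w) * f w)"
    unfolding raise_def cnj_sum sum_distrib_right complex_cnj_mult nr by (rule sum.swap)
  finally show ?thesis .
qed

text \<open>Changes at different positions commute; the commutator is therefore diagonal, the action
  of the coroot.\<close>

lemma lower_raise_commute:
  "lower n N i (raise n N i T) w = raise n N i (lower n N i T) w + (\<Sum>p<N. (nu n i (w p))\<^sup>2 - (nu' n i (w p))\<^sup>2) * T w"
proof -
  let ?X = "\<lambda>p q. nu n i (w p) * nu' n i (w q) * T (w(p := Suc (w p), q := w q - 1))"
  have "lower n N i (raise n N i T) w =
    (\<Sum>p<N. \<Sum>q<N. nu n i (w p) * (nu' n i ((w(p := Suc (w p))) q) * T ((w(p := Suc (w p)))(q := (w(p := Suc (w p))) q - 1))))"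
    by (simp only: lower_def raise_def sum_distrib_left)
  also have "\<dots> = (\<Sum>p<N. \<Sum>q<N. (if p = q then 0 else ?X p q) + (if q = p then (nu n i (w p))\<^sup>2 * T w else 0))"
    by (intro sum.cong refl) (auto simp: nu'_def power2_eq_square)
  also have "\<dots> = (\<Sum>p<N. \<Sum>q<N. if p = q then 0 else ?X p q) + (\<Sum>p<N. (nu n i (w p))\<^sup>2 * T w)"
    by (simp add: sum.distrib)
  finally have 1: "lower n N i (raise n N i T) w =
    (\<Sum>p<N. \<Sum>q<N. if p = q then 0 else ?X p q) + (\<Sum>p<N. (nu n i (w p))\<^sup>2 * T w)" .
  have "raise n N i (lower n N i T) w =
    (\<Sum>q<N. \<Sum>p<N. nu' n i (w q) * (nu n i ((w(q := w q - 1)) p) * T ((w(q := w q - 1))(p := Suc ((w(q := w q - 1)) p)))))"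
    by (simp only: lower_def raise_def sum_distrib_left)
  also have "\<dots> = (\<Sum>q<N. \<Sum>p<N. (if p = q then 0 else ?X p q) + (if p = q then (nu' n i (w q))\<^sup>2 * T w else 0))"
    by (intro sum.cong refl) (auto simp: nu'_def power2_eq_square fun_upd_twist)
  also have "\<dots> = (\<Sum>q<N. \<Sum>p<N. if p = q then 0 else ?X p q) + (\<Sum>q<N. (nu' n i (w q))\<^sup>2 * T w)"
    by (simp add: sum.distrib)
  also have "(\<Sum>q<N. \<Sum>p<N. if p = q then 0 else ?X p q) = (\<Sum>p<N. \<Sum>q<N. if p = q then 0 else ?X p q)"
    by (rule sum.swap)
  finally show ?thesis unfolding 1 by (simp add: sum_subtractf left_diff_distrib flip: sum_distrib_right)
qed

definition killed :: "nat \<Rightarrow> nat \<Rightarrow> ((nat \<Rightarrow> nat) \<Rightarrow> complex) \<Rightarrow> bool" where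
  "killed n N T \<longleftrightarrow> (\<forall>i<n. \<forall>w\<in>words n N. lower n N i T w = 0)"

definition weighted :: "nat \<Rightarrow> nat \<Rightarrow> (nat \<Rightarrow> int) \<Rightarrow> ((nat \<Rightarrow> nat) \<Rightarrow> complex) \<Rightarrow> bool" where
  "weighted n N lam T \<longleftrightarrow> (\<forall>w\<in>words n N. T w \<noteq> 0 \<longrightarrow> (\<forall>k<n. weight n k w N = lam k))"

text \<open>Positivity of \<open>\<parallel>raise T\<parallel>\<^sup>2 = (lam i - lam (i + 1)) \<parallel>T\<parallel>\<^sup>2\<close> makes the weight of a highest weight vector dominant.\<close>

lemma highest_weight_dominant:
  assumes T: "killed n N T" "weighted n N lam T" and w: "w0 \<in> words n N" "T w0 \<noteq> 0" and i: "i < n"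
  shows "(if Suc i < n then lam (Suc i) else 0) \<le> lam i"
proof -
  let ?W = "words n N" and ?c = "lam i - (if Suc i < n then lam (Suc i) else 0)"
  \<comment> \<open>On one letter the diagonal term is the pairing with the coroot: a difference of
    two neighbouring coordinates, or the last coordinate alone for the long root.\<close>
  have h: "(nu n i a)\<^sup>2 - (nu' n i a)\<^sup>2 = of_int (((if a = i then 1 else 0) - (if a = 2 * n - 1 - i then 1 else 0)) -
    (if Suc i < n then (if a = Suc i then 1 else 0) - (if a = 2 * n - 1 - Suc i then 1 else 0) else 0))" if "a < 2 * n" for a
  proof -
    have "nu' n i a = (if a = Suc i then 1 else if a = 2 * n - 1 - i then - 1 else 0)"
      using i by (auto simp: nu'_def nu_def)
    moreover have "2 * n - 2 - i = 2 * n - 1 - Suc i" by simp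
    ultimately show ?thesis using i by (auto simp: nu_def)
  qed
  have hw: "(\<Sum>p<N. (nu n i (w p))\<^sup>2 - (nu' n i (w p))\<^sup>2) * T w = of_int ?c * T w" if "w \<in> ?W" for w
  proof (cases "T w = 0")
    case False
    have "(\<Sum>p<N. (nu n i (w p))\<^sup>2 - (nu' n i (w p))\<^sup>2) =
       (\<Sum>p<N. of_int (((if w p = i then 1 else 0) - (if w p = 2 * n - 1 - i then 1 else 0)) -
    (if Suc i < n then (if w p = Suc i then 1 else 0) - (if w p = 2 * n - 1 - Suc i then 1 else 0) else 0)))"
      by (rule sum.cong[OF refl], rule h) (use that in \<open>auto simp: PiE_iff\<close>)
    also have "\<dots> = of_int (weight n i w N - (if Suc i < n then weight n (Suc i) w N else 0))"
      unfolding weight_def of_int_sum[symmetric] by (cases "Suc i < n") (simp_all only: sum_subtractf if_True if_False sum.neutral_const)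
    also have "weight n i w N - (if Suc i < n then weight n (Suc i) w N else 0) = ?c"
      using T(2) that False i by (auto simp: weighted_def)
    finally show ?thesis by simp
  qed simp
  have "lower n N i T w = 0" if "w \<in> ?W" for w using T(1) i that by (simp add: killed_def)
  then have "raise n N i (lower n N i T) w = 0" if "w \<in> ?W" for w
    unfolding raise_def by (intro sum.neutral ballI) (use words_pred that in auto)
  then have lr: "lower n N i (raise n N i T) w = of_int ?c * T w" if "w \<in> ?W" for w
    using lower_raise_commute[of n N i T w] hw that by simp
  have "(\<Sum>w\<in>?W. cnj (raise n N i T w) * raise n N i T w) = (\<Sum>w\<in>?W. cnj (T w) * lower n N i (raise n N i T) w)"
    using lower_raise_adjoint[OF i, where N=N and T=T and f="raise n N i T"] by simp
  also have "\<dots> = of_int ?c * (\<Sum>w\<in>?W. cnj (T w) * T w)"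
    unfolding sum_distrib_left by (intro sum.cong refl) (simp add: lr mult_ac)
  finally have e: "(\<Sum>w\<in>?W. cnj (raise n N i T w) * raise n N i T w) = of_int ?c * (\<Sum>w\<in>?W. cnj (T w) * T w)" .
  have sq: "(\<Sum>w\<in>?W. cnj (f w) * f w) = of_real (\<Sum>w\<in>?W. (cmod (f w))\<^sup>2)" for f :: "(nat \<Rightarrow> nat) \<Rightarrow> complex"
    unfolding of_real_sum by (intro sum.cong refl) (metis complex_norm_square mult.commute)
  have "complex_of_real (\<Sum>w\<in>?W. (cmod (raise n N i T w))\<^sup>2) = of_real (real_of_int ?c * (\<Sum>w\<in>?W. (cmod (T w))\<^sup>2))"
    using e unfolding sq by simp
  then have "(\<Sum>w\<in>?W. (cmod (raise n N i T w))\<^sup>2) = real_of_int ?c * (\<Sum>w\<in>?W. (cmod (T w))\<^sup>2)"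
    using of_real_eq_iff by blast
  moreover have "(\<Sum>w\<in>?W. (cmod (T w))\<^sup>2) > 0"
    by (rule sum_pos2[OF finite_words w(1)]) (use w in auto)
  moreover have "(\<Sum>w\<in>?W. (cmod (raise n N i T w))\<^sup>2) \<ge> 0" by (simp add: sum_nonneg)
  ultimately have "real_of_int ?c \<ge> 0" by (metis zero_le_mult_iff not_le)
  then show ?thesis by linarith
qed

text \<open>Reverse lexicographic order as a number in base \<open>2n\<close>. The last position
  weighs most, since leading words are extended at their end.\<close>

definition val :: "nat \<Rightarrow> nat \<Rightarrow> (nat \<Rightarrow> nat) \<Rightarrow> nat" where
  "val n N w = (\<Sum>p<N. w p * (2 * n) ^ p)"

lemma val_Suc: "val n (Suc N) w = val n N w + w N * (2 * n) ^ N"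
  by (simp add: val_def)

lemma val_cong: "(\<And>p. p < N \<Longrightarrow> w p = w' p) \<Longrightarrow> val n N w = val n N w'"
  by (simp add: val_def)

lemma val_less: "(\<And>p. p < N \<Longrightarrow> w p < 2 * n) \<Longrightarrow> val n N w < (2 * n) ^ N"
proof (induction N)
  case (Suc N)
  then have "val n N w < (2 * n) ^ N" "w N + 1 \<le> 2 * n" by (auto simp: Suc_le_eq)
  then have "val n (Suc N) w < (w N + 1) * (2 * n) ^ N" by (simp add: val_Suc)
  also have "\<dots> \<le> 2 * n * (2 * n) ^ N" using \<open>w N + 1 \<le> 2 * n\<close> by (rule mult_le_mono1)
  finally show ?case by simp
qed (simp add: val_def)

lemma val_Suc_less:
  assumes "\<And>p. p < N \<Longrightarrow> w p < 2 * n" "w N < w' N"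
  shows "val n (Suc N) w < val n (Suc N) w'"
proof -
  have "val n (Suc N) w < (w N + 1) * (2 * n) ^ N" using val_less[OF assms(1)] by (simp add: val_Suc)
  also have "\<dots> \<le> w' N * (2 * n) ^ N" using assms(2) by (intro mult_le_mono1) simp
  also have "\<dots> \<le> val n (Suc N) w'" by (simp add: val_Suc)
  finally show ?thesis .
qed

lemma val_inj: "(\<And>p. p < N \<Longrightarrow> w p < 2 * n \<and> w' p < 2 * n) \<Longrightarrow> val n N w = val n N w' \<Longrightarrow> p < N \<Longrightarrow> w p = w' p"
proof (induction N)
  case (Suc N)
  have "w N = w' N"
  proof (rule ccontr)
    assume "w N \<noteq> w' N"
    then consider "w N < w' N" | "w' N < w N" by linarith
    then show False using val_Suc_less[of N w n w'] val_Suc_less[of N w' n w] Suc.prems by cases auto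
  qed
  moreover from this have "val n N w = val n N w'" using Suc.prems(2) by (simp add: val_Suc)
  ultimately show ?case using Suc.IH Suc.prems by (cases "p = N") auto
qed simp

lemma weight_cong: "(\<And>p. p < g \<Longrightarrow> w p = w' p) \<Longrightarrow> weight n k w g = weight n k w' g"
  unfolding weight_def by (intro sum.cong) auto

lemma weight_Suc: "weight n k w (Suc g) = weight n k w g + ((if w g = k then 1 else 0) - (if w g = 2 * n - 1 - k then 1 else 0))"
  by (simp add: weight_def)

definition lead :: "nat \<Rightarrow> nat \<Rightarrow> ((nat \<Rightarrow> nat) \<Rightarrow> complex) \<Rightarrow> (nat \<Rightarrow> nat) \<Rightarrow> bool" where
  "lead n N T w \<longleftrightarrow> T w \<noteq> 0 \<and> (\<forall>w'\<in>words n N. T w' \<noteq> 0 \<longrightarrow> val n N w' \<le> val n N w)"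

text \<open>Fixing the largest last letter \<open>j\<close> that occurs leaves a tensor of the same
  kind: lowering the last position leads to the letter \<open>j + 1\<close>, where \<open>T\<close>
  vanishes. Induction makes the proper prefixes dominant, and \<open>highest_weight_dominant\<close>
  the end point.\<close>

lemma highest_weight_lead:
  assumes "n \<ge> 1"
  shows "killed n N T \<Longrightarrow> weighted n N lam T \<Longrightarrow> w0 \<in> words n N \<Longrightarrow> T w0 \<noteq> 0 \<Longrightarrow>
    \<exists>w\<in>words n N. lead n N T w \<and> dominant_path n N w"
proof (induction N arbitrary: T lam w0)
  case 0
  then show ?case by (intro bexI[of _ w0]) (auto simp: lead_def dominant_path_def weight_def val_def)
next
  case (Suc N)
  let ?S = "{w \<in> words n (Suc N). T w \<noteq> 0}"
  define j where "j = Max ((\<lambda>w. w N) ` ?S)"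
  have fin: "finite ((\<lambda>w. w N) ` ?S)" using finite_words[where n=n and N="Suc N"] by simp
  have "w0 \<in> ?S" using Suc.prems by simp
  then have "j \<in> (\<lambda>w. w N) ` ?S" unfolding j_def by (intro Max_in[OF fin]) auto
  then obtain w1 where w1: "w1 \<in> words n (Suc N)" "T w1 \<noteq> 0" "w1 N = j" by auto
  have jmax: "w N \<le> j" if "w \<in> words n (Suc N)" "T w \<noteq> 0" for w
    unfolding j_def by (rule Max_ge[OF fin]) (use that in auto)
  have j2: "j < 2 * n" using w1 by (auto simp: PiE_iff)
  define Tj where "Tj w = T (w(N := j))" for w
  have up: "w(N := a) \<in> words n (Suc N)" if "w \<in> words n N" "a < 2 * n" for w a
    using that by (auto simp: PiE_iff extensional_def less_Suc_eq)
  have down: "w(N := undefined) \<in> words n N" if "w \<in> words n (Suc N)" for w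
    using that by (auto simp: PiE_iff extensional_def)
  have k: "killed n N Tj"
    unfolding killed_def
  proof (intro allI impI ballI)
    fix i w assume i: "i < n" and w: "w \<in> words n N"
    have "0 = lower n (Suc N) i T (w(N := j))" using Suc.prems(1) i up[OF w j2] by (simp add: killed_def)
    also have "\<dots> = (\<Sum>p<N. nu n i (w p) * T ((w(N := j))(p := Suc (w p)))) + nu n i j * T (w(N := Suc j))"
      unfolding lower_def by simp
    also have "nu n i j * T (w(N := Suc j)) = 0"
    proof (cases "nu n i j = 0")
      case False
      then have "w(N := Suc j) \<in> words n (Suc N)" using nu_word[OF i] up[OF w] by simp
      then show ?thesis using jmax[of "w(N := Suc j)"] by auto
    qed simp
    also have "(\<Sum>p<N. nu n i (w p) * T ((w(N := j))(p := Suc (w p)))) = lower n N i Tj w"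
      unfolding lower_def Tj_def by (intro sum.cong refl) (auto simp: fun_upd_twist)
    finally show "lower n N i Tj w = 0" by simp
  qed
  have wt: "weighted n N (\<lambda>k. lam k - ((if j = k then 1 else 0) - (if j = 2 * n - 1 - k then 1 else 0))) Tj"
    unfolding weighted_def
  proof (intro ballI impI allI)
    fix w k assume w: "w \<in> words n N" "Tj w \<noteq> 0" and k: "k < n"
    have "weight n k (w(N := j)) (Suc N) = lam k" using Suc.prems(2) up[OF w(1) j2] w(2) k by (simp add: weighted_def Tj_def)
    moreover have "weight n k (w(N := j)) N = weight n k w N" by (rule weight_cong) simp
    ultimately show "weight n k w N = lam k - ((if j = k then 1 else 0) - (if j = 2 * n - 1 - k then 1 else 0))"
      by (simp add: weight_Suc)
  qed
  have "Tj (w1(N := undefined)) \<noteq> 0" using w1 by (simp add: Tj_def fun_upd_idem)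
  then have "\<exists>w\<in>words n N. lead n N Tj w \<and> dominant_path n N w"
    by (rule Suc.IH[of Tj _ "w1(N := undefined)", OF k wt down[OF w1(1)]])
  then obtain v where v: "v \<in> words n N" "lead n N Tj v" "dominant_path n N v" by blast
  let ?v = "v(N := j)"
  have vW: "?v \<in> words n (Suc N)" by (rule up[OF v(1) j2])
  have Tv: "T ?v \<noteq> 0" using v(2) by (simp add: lead_def Tj_def)
  have "lead n (Suc N) T ?v"
    unfolding lead_def
  proof (intro conjI ballI impI Tv)
    fix w assume w: "w \<in> words n (Suc N)" "T w \<noteq> 0"
    show "val n (Suc N) w \<le> val n (Suc N) ?v"
    proof (cases "w N = j")
      case True
      then have "Tj (w(N := undefined)) \<noteq> 0" using w by (simp add: Tj_def fun_upd_idem)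
      then have "val n N (w(N := undefined)) \<le> val n N v" using v(2) down[OF w(1)] by (simp add: lead_def)
      moreover have "val n N (w(N := undefined)) = val n N w" "val n N v = val n N ?v" by (auto intro: val_cong)
      ultimately show ?thesis using True by (simp add: val_Suc)
    next
      case False
      then have "w N < ?v N" using jmax[OF w] by simp
      then show ?thesis using val_Suc_less[of N w n ?v] w(1) by (fastforce simp: PiE_iff)
    qed
  qed
  moreover have "dominant_path n (Suc N) ?v"
    unfolding dominant_path_def
  proof (intro conjI vW allI impI)
    have last: "(if Suc i < n then weight n (Suc i) ?v (Suc N) else 0) \<le> weight n i ?v (Suc N)" if "i < n" for i
      using highest_weight_dominant[where T=T and ?w0.0="?v", OF Suc.prems(1,2) vW Tv that] Suc.prems(2) vW Tv that by (auto simp: weighted_def)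
    have pre: "weight n k ?v g = weight n k v g" if "g \<le> N" for g k
      by (rule weight_cong) (use that in auto)
    fix g assume g: "g \<le> Suc N"
    show "weight n (Suc k) ?v g \<le> weight n k ?v g" if "Suc k < n" for k
      using last[of k] pre[of g] v(3) that g by (cases "g = Suc N") (auto simp: dominant_path_def)
    show "0 \<le> weight n (n - 1) ?v g"
      using last[of "n - 1"] pre[of g] v(3) assms g by (cases "g = Suc N") (auto simp: dominant_path_def)
  qed
  ultimately show ?case using vW by blast
qed

section \<open>The first fundamental theorem\<close>

lemma finite_perfect_matchings: "finite Z \<Longrightarrow> finite {m. perfect_matching Z m}"
  by (rule finite_subset[of _ "Pow (Pow Z)"]) (auto dest: perfect_matching_Union)

text \<open>The form \<open>e\<^sub>0 \<and> \<dots> \<and> e\<^sub>l\<^sub>-\<^sub>1\<close> evaluated on the letters at the positions listed in \<open>c\<close>.\<close>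

definition column_form :: "nat list \<Rightarrow> (nat \<Rightarrow> nat) \<Rightarrow> complex" where
  "column_form c w = det (mat (length c) (length c) (\<lambda>(t, s). if w (c ! t) = s then 1 else 0))"

lemma column_form_Nil [simp]: "column_form [] w = 1"
  by (simp add: column_form_def)

text \<open>Laplace expansion along the last row, which is either zero or the unit vector of the
  last column.\<close>

lemma column_form_snoc:
  assumes "w x \<ge> length c"
  shows "column_form (c @ [x]) w = (if w x = length c then column_form c w else 0)"
proof -
  let ?i = "length c"
  define A :: "complex mat" where "A = mat (Suc ?i) (Suc ?i) (\<lambda>(t, s). if w ((c @ [x]) ! t) = s then 1 else 0)"
  have A: "A \<in> carrier_mat (Suc ?i) (Suc ?i)" by (simp add: A_def)
  have d: "mat_delete A ?i ?i = mat ?i ?i (\<lambda>(t, s). if w (c ! t) = s then 1 else 0)"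
    unfolding mat_delete_def A_def by (rule eq_matI) (auto simp: nth_append)
  have "column_form (c @ [x]) w = det A" by (simp add: column_form_def A_def)
  also have "\<dots> = (\<Sum>j<Suc ?i. A $$ (?i, j) * cofactor A ?i j)"
    by (rule laplace_expansion_row[OF A]) simp
  also have "\<dots> = (\<Sum>j<Suc ?i. if j = ?i then (if w x = ?i then 1 else 0) * cofactor A ?i j else 0)"
    using assms by (intro sum.cong refl) (auto simp: A_def)
  also have "\<dots> = (if w x = ?i then 1 else 0) * cofactor A ?i ?i" by simp
  also have "cofactor A ?i ?i = column_form c w"
    unfolding cofactor_def d by (simp add: column_form_def)
  finally show ?thesis by simp
qed

definition remove_at :: "nat \<Rightarrow> 'a list \<Rightarrow> 'a list" where
  "remove_at t c = take t c @ drop (Suc t) c"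

lemma mset_remove_at: "t < length c \<Longrightarrow> mset c = add_mset (c ! t) (mset (remove_at t c))"
  using id_take_nth_drop[of t c] by (metis remove_at_def mset_append mset.simps(2) union_mset_add_mset_right)

text \<open>Laplace expansion along the last column, which is replaced by the indicator of the letter \<open>a\<close>.\<close>

lemma column_form_contract:
  assumes c: "length c = Suc i" and a: "a \<le> i"
  shows "(\<Sum>t<Suc i. (- 1) ^ (t + i) * ((if w (c ! t) = a then 1 else 0) * column_form (remove_at t c) w)) =
    (if a = i then column_form c w else 0)"
proof -
  define A :: "complex mat" where
    "A = mat (Suc i) (Suc i) (\<lambda>(t, s). if s = i then (if w (c ! t) = a then 1 else 0) else if w (c ! t) = s then 1 else 0)"
  have A: "A \<in> carrier_mat (Suc i) (Suc i)" by (simp add: A_def)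
  have d: "det (mat_delete A t i) = column_form (remove_at t c) w" if t: "t < Suc i" for t
  proof -
    have l: "length (remove_at t c) = i" using t c by (simp add: remove_at_def)
    have n: "remove_at t c ! r = c ! (if r < t then r else Suc r)" if "r < i" for r
      using t c that by (auto simp: remove_at_def nth_append min_def)
    have "mat_delete A t i = mat i i (\<lambda>(t', s). if w (remove_at t c ! t') = s then 1 else 0)"
      unfolding mat_delete_def A_def using t by (intro eq_matI) (auto simp: n)
    then show ?thesis by (simp add: column_form_def l)
  qed
  have "det A = (\<Sum>t<Suc i. A $$ (t, i) * cofactor A t i)"
    by (rule laplace_expansion_column[OF A]) simp
  also have "\<dots> = (\<Sum>t<Suc i. (- 1) ^ (t + i) * ((if w (c ! t) = a then 1 else 0) * column_form (remove_at t c) w))"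
    by (intro sum.cong refl) (auto simp: A_def cofactor_def d[unfolded A_def])
  finally have e: "(\<Sum>t<Suc i. (- 1) ^ (t + i) * ((if w (c ! t) = a then 1 else 0) * column_form (remove_at t c) w)) = det A" ..
  show ?thesis
  proof (cases "a = i")
    case True
    have "A = mat (Suc i) (Suc i) (\<lambda>(t, s). if w (c ! t) = s then 1 else 0)"
      unfolding A_def by (rule eq_matI) (auto simp: True)
    then show ?thesis using e True c by (simp add: column_form_def)
  next
    case False
    \<comment> \<open>For \<open>a < i\<close> the new last column repeats column
      \<open>a\<close>.\<close>
    have "det A = 0"
      by (rule det_identical_columns[OF A, of a i]) (use False a in \<open>auto simp: A_def intro!: eq_vecI\<close>)
    then show ?thesis using e False by simp
  qed
qed

text \<open>The signs of the matching tensors are left out; they are constant factors and return in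
  \<open>forms_zero\<close>.\<close>

definition form :: "nat \<Rightarrow> (nat \<times> nat) list \<Rightarrow> nat list list \<Rightarrow> (nat \<Rightarrow> nat) \<Rightarrow> complex" where
  "form n M cs w = (\<Prod>e\<leftarrow>M. Jn n (w (fst e)) (w (snd e))) * (\<Prod>c\<leftarrow>cs. column_form c w)"

definition row_length :: "nat list list \<Rightarrow> nat \<Rightarrow> nat" where
  "row_length cs k = length (filter (\<lambda>c. k < length c) cs)"

text \<open>Every position belongs to one arc or one column, and the columns are those of a Young
  diagram with row lengths \<open>lam\<close>.\<close>

definition forms :: "nat \<Rightarrow> nat \<Rightarrow> (nat \<Rightarrow> int) \<Rightarrow> ((nat \<Rightarrow> nat) \<Rightarrow> complex) set" where
  "forms n N lam = {form n M cs | M cs. mset (flat M @ concat cs) = mset [0..<N] \<and>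
     (\<forall>c\<in>set cs. length c \<le> n) \<and> (\<forall>k<n. int (row_length cs k) = lam k)}"

lemma row_length_split: "row_length (cs1 @ c # cs2) k = row_length cs1 k + row_length cs2 k + (if k < length c then 1 else 0)"
  by (simp add: row_length_def)

text \<open>A row longer than the next one ends in a removable corner of the diagram.\<close>

lemma find_column:
  assumes "i < n" "row_length cs i > (if Suc i < n then row_length cs (Suc i) else 0)" "\<forall>c\<in>set cs. length c \<le> n"
  shows "\<exists>c\<in>set cs. length c = Suc i"
proof (rule ccontr)
  assume a: "\<not> ?thesis"
  have "filter (\<lambda>c. i < length c) cs = filter (\<lambda>c. Suc i < length c) cs"
    by (rule filter_cong) (use a in \<open>auto simp: less_Suc_eq Suc_lessI\<close>)
  then have e: "row_length cs i = row_length cs (Suc i)" by (simp add: row_length_def)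
  then have "\<not> Suc i < n" using assms by auto
  then have "filter (\<lambda>c. Suc i < length c) cs = []" using assms by (auto simp: filter_empty_conv)
  then show False using e assms(2) by (auto simp: row_length_def split: if_splits)
qed

lemma form_local:
  assumes "mset (flat M @ concat cs) = mset [0..<N]" "\<And>p. p < N \<Longrightarrow> w p = w' p"
  shows "form n M cs w = form n M cs w'"
proof -
  have s: "set (flat M) \<union> set (concat cs) = {..<N}"
    using arg_cong[OF assms(1), of set_mset] by (auto simp: atLeast0LessThan)
  have "Jn n (w (fst e)) (w (snd e)) = Jn n (w' (fst e)) (w' (snd e))" if "e \<in> set M" for e
  proof -
    have "{fst e, snd e} \<subseteq> set (flat M)" unfolding set_flat using that by (auto simp: match_of_def)
    then have "fst e \<in> {..<N}" "snd e \<in> {..<N}" using s by blast+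
    then show ?thesis using assms(2) by simp
  qed
  moreover have "column_form c w = column_form c w'" if "c \<in> set cs" for c
  proof -
    have "w (c ! t) = w' (c ! t)" if "t < length c" for t
      using s assms(2) \<open>c \<in> set cs\<close> that by (metis UnI2 concat_eq_concat_iff nth_mem set_concat UN_I lessThan_iff)
    then show ?thesis unfolding column_form_def by (intro arg_cong[where f=det] eq_matI) auto
  qed
  ultimately show ?thesis unfolding form_def by (intro arg_cong2[where f="(*)"] arg_cong[where f=prod_list] map_cong) auto
qed

text \<open>The new position is appended to a column of length \<open>i\<close>, an empty one for
  \<open>i = 0\<close> and one from \<open>find_column\<close> otherwise. Only letters
  \<open>\<ge> i\<close> at this position are controlled, which is enough for leading words.\<close>

lemma forms_add_box:
  assumes G: "G \<in> forms n N lam" and i: "i < n" and dom: "i = 0 \<or> lam i < lam (i - 1)"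
    and lam': "\<And>k. k < n \<Longrightarrow> lam' k = lam k + (if k = i then 1 else 0)"
  shows "\<exists>G'\<in>forms n (Suc N) lam'. \<forall>w. w N \<ge> i \<longrightarrow> G' w = (if w N = i then G w else 0)"
proof -
  obtain M cs where M: "G = form n M cs" "mset (flat M @ concat cs) = mset [0..<N]"
    "\<forall>c\<in>set cs. length c \<le> n" "\<forall>k<n. int (row_length cs k) = lam k" using G by (auto simp: forms_def)
  have "\<exists>cs1 c cs2. length c = i \<and> G = form n M (cs1 @ c # cs2) \<and> mset (flat M @ concat (cs1 @ c # cs2)) = mset [0..<N] \<and>
    (\<forall>d\<in>set (cs1 @ c # cs2). length d \<le> n) \<and> (\<forall>k<n. int (row_length (cs1 @ c # cs2) k) = lam k)"
  proof (cases i)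
    case 0
    show ?thesis
      by (rule exI[of _ "[]"], rule exI[of _ "[]"], rule exI[of _ cs])
        (use M 0 in \<open>auto simp: row_length_def form_def fun_eq_iff\<close>)
  next
    case (Suc i')
    have "int (row_length cs i') = lam i'" "int (row_length cs (Suc i')) = lam (Suc i')" using M(4) i Suc by auto
    then have "\<exists>c\<in>set cs. length c = Suc i'"
      by (intro find_column[of i' n]) (use M(3) dom Suc i in auto)
    then obtain c cs1 cs2 where "cs = cs1 @ c # cs2" "length c = i" using Suc by (metis split_list)
    then show ?thesis using M by blast
  qed
  then obtain cs1 c cs2 where c: "length c = i" "G = form n M (cs1 @ c # cs2)" "mset (flat M @ concat (cs1 @ c # cs2)) = mset [0..<N]"
    "\<forall>d\<in>set (cs1 @ c # cs2). length d \<le> n" "\<forall>k<n. int (row_length (cs1 @ c # cs2) k) = lam k" by blast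
  let ?G = "form n M (cs1 @ (c @ [N]) # cs2)"
  have "?G \<in> forms n (Suc N) lam'"
    unfolding forms_def
  proof (intro CollectI exI conjI allI impI)
    show "mset (flat M @ concat (cs1 @ (c @ [N]) # cs2)) = mset [0..<Suc N]" using c(3) by simp
    show "\<forall>c\<in>set (cs1 @ (c @ [N]) # cs2). length c \<le> n" using c(1,4) i by auto
    fix k assume k: "k < n"
    then show "int (row_length (cs1 @ (c @ [N]) # cs2) k) = lam' k"
      using c(1,5) lam'[OF k] unfolding row_length_split by (auto simp: less_Suc_eq)
  qed (rule refl)
  moreover have "?G w = (if w N = i then G w else 0)" if "w N \<ge> i" for w
    using column_form_snoc[of c w N] that c(1,2) by (simp add: form_def)
  ultimately show ?thesis by blast
qed

text \<open>The new position is contracted with a column of length \<open>i + 1\<close>, by a signed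
  sum over the entry joined to it. For the dual letter \<open>a\<close> of the last one the bound
  \<open>w N \<ge> 2n - 1 - i\<close> reads \<open>a \<le> i\<close>, the range of
  \<open>column_form_contract\<close>.\<close>

lemma forms_remove_box:
  assumes G: "G \<in> forms n N lam" and i: "i < n" and dom: "(if Suc i < n then lam (Suc i) else 0) < lam i"
    and lam': "\<And>k. k < n \<Longrightarrow> lam' k = lam k - (if k = i then 1 else 0)"
  shows "\<exists>G'\<in>fv.span (forms n (Suc N) lam'). \<forall>w. w N \<ge> 2 * n - 1 - i \<longrightarrow> w N < 2 * n \<longrightarrow> G' w = (if w N = 2 * n - 1 - i then G w else 0)"
proof -
  obtain M cs where M: "G = form n M cs" "mset (flat M @ concat cs) = mset [0..<N]"
    "\<forall>c\<in>set cs. length c \<le> n" "\<forall>k<n. int (row_length cs k) = lam k" using G by (auto simp: forms_def)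
  have "int (row_length cs i) = lam i" "Suc i < n \<Longrightarrow> int (row_length cs (Suc i)) = lam (Suc i)" using M(4) i by auto
  then have "\<exists>c\<in>set cs. length c = Suc i"
    by (intro find_column[of i n]) (use M(3) dom i in \<open>auto split: if_splits\<close>)
  then obtain c cs1 cs2 where c: "cs = cs1 @ c # cs2" "length c = Suc i" by (metis split_list)
  define g where "g t = form n ((c ! t, N) # M) (cs1 @ remove_at t c # cs2)" for t
  have g: "g t \<in> forms n (Suc N) lam'" if t: "t < Suc i" for t
    unfolding g_def forms_def
  proof (intro CollectI exI conjI allI impI)
    have ms: "mset c = add_mset (c ! t) (mset (remove_at t c))" using mset_remove_at t c(2) by metis
    have l: "length (remove_at t c) = i" using t c by (simp add: remove_at_def)
    show "mset (flat ((c ! t, N) # M) @ concat (cs1 @ remove_at t c # cs2)) = mset [0..<Suc N]"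
      using M(2) ms unfolding c(1) by simp
    show "\<forall>c\<in>set (cs1 @ remove_at t c # cs2). length c \<le> n" using M(3) c(1) l i by auto
    fix k assume k: "k < n"
    then show "int (row_length (cs1 @ remove_at t c # cs2) k) = lam' k"
      using M(4) c(2) lam'[OF k] l unfolding c(1) row_length_split by (auto simp: less_Suc_eq)
  qed (rule refl)
  let ?G = "\<Sum>t<Suc i. (\<lambda>w. (- 1) ^ (t + i) * g t w)"
  have "?G \<in> fv.span (forms n (Suc N) lam')"
    by (intro fv.span_sum fv.span_scale fv.span_base) (use g in auto)
  moreover have "?G w = (if w N = 2 * n - 1 - i then G w else 0)" if w: "w N \<ge> 2 * n - 1 - i" "w N < 2 * n" for w
  proof -
    define a where "a = 2 * n - 1 - w N"
    have a: "a \<le> i" "w N = 2 * n - 1 - a" "a < n" using w i by (auto simp: a_def)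
    have Ja: "Jn n b (w N) = (if b = a then 1 else 0)" for b
      using a by (auto simp: Jn_def)
    let ?R = "(\<Prod>e\<leftarrow>M. Jn n (w (fst e)) (w (snd e))) * (\<Prod>c\<leftarrow>cs1. column_form c w) * (\<Prod>c\<leftarrow>cs2. column_form c w)"
    have "?G w = (\<Sum>t<Suc i. ?R * ((- 1) ^ (t + i) * ((if w (c ! t) = a then 1 else 0) * column_form (remove_at t c) w)))"
      unfolding sum_apply by (intro sum.cong refl) (simp add: g_def form_def Ja)
    also have "\<dots> = ?R * (if a = i then column_form c w else 0)"
      unfolding sum_distrib_left[symmetric] column_form_contract[OF c(2) a(1)] ..
    also have "\<dots> = (if w N = 2 * n - 1 - i then G w else 0)" using a i M(1) c(1) by (auto simp: form_def)
    finally show ?thesis .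
  qed
  ultimately show ?thesis by blast
qed

text \<open>The condition on the lift is linear, so lifts of generators suffice.\<close>

lemma span_lift:
  assumes lift: "\<And>G. G \<in> S \<Longrightarrow> \<exists>G'\<in>fv.span S'. \<forall>w. Q w \<longrightarrow> G' w = (if R w then G w else 0)" and u: "u \<in> fv.span S"
  shows "\<exists>u'\<in>fv.span S'. \<forall>w. Q w \<longrightarrow> u' w = (if R w then u w else (0 :: complex))"
proof -
  let ?T = "{u. \<exists>u'\<in>fv.span S'. \<forall>w. Q w \<longrightarrow> u' w = (if R w then u w else 0)}"
  have "fv.subspace ?T"
  proof (rule fv.subspaceI)
    show "0 \<in> ?T" by (auto intro!: bexI[of _ 0] fv.span_zero)
    fix x y assume "x \<in> ?T" "y \<in> ?T"
    then obtain x' y' where "x' \<in> fv.span S'" "y' \<in> fv.span S'" "\<forall>w. Q w \<longrightarrow> x' w = (if R w then x w else 0)"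
      "\<forall>w. Q w \<longrightarrow> y' w = (if R w then y w else 0)" by blast
    then show "x + y \<in> ?T" by (intro CollectI bexI[of _ "x' + y'"]) (auto intro: fv.span_add)
  next
    fix c x assume "x \<in> ?T"
    then obtain x' where "x' \<in> fv.span S'" "\<forall>w. Q w \<longrightarrow> x' w = (if R w then x w else 0)" by blast
    then show "(\<lambda>w. c * x w) \<in> ?T" by (intro CollectI bexI[of _ "\<lambda>w. c * x' w"]) (auto intro: fv.span_scale)
  qed
  moreover have "S \<subseteq> ?T" using lift by blast
  ultimately show ?thesis using fv.span_minimal u by blast
qed

text \<open>Each step of the path adds a box, for letters below \<open>n\<close>, or removes one;
  dominance of the next point supplies the corner required.\<close>

lemma path_form:
  assumes "n \<ge> 1"
  shows "dominant_path n N w \<Longrightarrow> \<exists>u\<in>fv.span (forms n N (\<lambda>k. weight n k w N)). lead n N u w"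
proof (induction N arbitrary: w)
  case 0
  have "form n [] [] \<in> forms n 0 (\<lambda>k. weight n k w 0)"
    unfolding forms_def by (intro CollectI exI[of _ "[]"] conjI) (auto simp: row_length_def weight_def)
  then show ?case
    by (intro bexI[of _ "form n [] []"]) (auto simp: lead_def form_def val_def intro: fv.span_base)
next
  case (Suc N)
  let ?v = "w(N := undefined)"
  have wW: "w \<in> words n (Suc N)" using Suc.prems by (simp add: dominant_path_def)
  have down: "w'(N := undefined) \<in> words n N" if "w' \<in> words n (Suc N)" for w'
    using that by (auto simp: PiE_iff extensional_def)
  have pre: "weight n k ?v g = weight n k w g" if "g \<le> N" for g k
    by (rule weight_cong) (use that in auto)
  have "dominant_path n N ?v"
    using Suc.prems down[OF wW] pre by (auto simp: dominant_path_def)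
  moreover have "(\<lambda>k. weight n k ?v N) = (\<lambda>k. weight n k w N)" using pre[of N] by simp
  ultimately obtain u where u: "u \<in> fv.span (forms n N (\<lambda>k. weight n k w N))" "lead n N u ?v"
    using Suc.IH[of ?v] by metis
  have dom: "(if Suc k < n then weight n (Suc k) w g else 0) \<le> weight n k w g" if "k < n" "g \<le> Suc N" for k g
  proof (cases "Suc k < n")
    case False
    then have "k = n - 1" using that by simp
    then show ?thesis using False Suc.prems that by (simp add: dominant_path_def)
  qed (use Suc.prems that in \<open>simp add: dominant_path_def\<close>)
  have wN: "w N < 2 * n" using wW by (auto simp: PiE_iff)
  have "\<exists>u'\<in>fv.span (forms n (Suc N) (\<lambda>k. weight n k w (Suc N))). \<forall>w'. w' N \<ge> w N \<and> w' N < 2 * n \<longrightarrow> u' w' = (if w' N = w N then u w' else 0)"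
  proof (cases "w N < n")
    case True
    show ?thesis
    proof (rule span_lift[OF _ u(1)])
      fix G assume G: "G \<in> forms n N (\<lambda>k. weight n k w N)"
      have "\<exists>G'\<in>forms n (Suc N) (\<lambda>k. weight n k w (Suc N)). \<forall>w'. w' N \<ge> w N \<longrightarrow> G' w' = (if w' N = w N then G w' else 0)"
      proof (rule forms_add_box[OF G True])
        show w': "weight n k w (Suc N) = weight n k w N + (if k = w N then 1 else 0)" if "k < n" for k
          using that True by (auto simp: weight_Suc)
        show "w N = 0 \<or> weight n (w N) w N < weight n (w N - 1) w N"
        proof (cases "w N")
          case (Suc j)
          then show ?thesis using dom[of j "Suc N"] w'[of j] w'[of "Suc j"] True by simp
        qed simp
      qed
      then show "\<exists>G'\<in>fv.span (forms n (Suc N) (\<lambda>k. weight n k w (Suc N))). \<forall>w'. w' N \<ge> w N \<and> w' N < 2 * n \<longrightarrow> G' w' = (if w' N = w N then G w' else 0)"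
        using fv.span_base by blast
    qed
  next
    case False
    define i where "i = 2 * n - 1 - w N"
    have i: "i < n" "w N = 2 * n - 1 - i" using False wN by (auto simp: i_def)
    show ?thesis
    proof (rule span_lift[OF _ u(1)])
      fix G assume G: "G \<in> forms n N (\<lambda>k. weight n k w N)"
      have "\<exists>G'\<in>fv.span (forms n (Suc N) (\<lambda>k. weight n k w (Suc N))). \<forall>w'. w' N \<ge> 2 * n - 1 - i \<longrightarrow> w' N < 2 * n \<longrightarrow> G' w' = (if w' N = 2 * n - 1 - i then G w' else 0)"
      proof (rule forms_remove_box[OF G i(1)])
        show w': "weight n k w (Suc N) = weight n k w N - (if k = i then 1 else 0)" if "k < n" for k
        proof -
          have "w N \<noteq> k" "(w N = 2 * n - 1 - k) = (k = i)" using that i by auto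
          then show ?thesis by (simp add: weight_Suc)
        qed
        show "(if Suc i < n then weight n (Suc i) w N else 0) < weight n i w N"
          using dom[of i "Suc N"] w'[of i] w'[of "Suc i"] i(1) by (simp split: if_splits)
      qed
      then show "\<exists>G'\<in>fv.span (forms n (Suc N) (\<lambda>k. weight n k w (Suc N))). \<forall>w'. w' N \<ge> w N \<and> w' N < 2 * n \<longrightarrow> G' w' = (if w' N = w N then G w' else 0)"
        unfolding i(2) by blast
    qed
  qed
  then obtain u' where u': "u' \<in> fv.span (forms n (Suc N) (\<lambda>k. weight n k w (Suc N)))"
    "\<And>w'. w' N \<ge> w N \<Longrightarrow> w' N < 2 * n \<Longrightarrow> u' w' = (if w' N = w N then u w' else 0)" by blast
  \<comment> \<open>Forms of length \<open>N\<close> do not read position \<open>N\<close>, so the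
    leading word of \<open>u\<close> among shorter words also governs the longer ones.\<close>
  have loc: "u x = u (x(N := undefined))" for x
  proof -
    have 1: "fv.subspace {u :: (nat \<Rightarrow> nat) \<Rightarrow> complex. \<forall>x. u x = u (x(N := undefined))}" by (rule fv.subspaceI) auto
    have "G x = G (x(N := undefined))" if G: "G \<in> forms n N lam" for G x lam
    proof -
      from G obtain M cs where "G = form n M cs" "mset (flat M @ concat cs) = mset [0..<N]" unfolding forms_def by blast
      then show ?thesis using form_local[where N=N and M=M and cs=cs and w=x and w'="x(N := undefined)"] by simp
    qed
    then have 2: "forms n N lam \<subseteq> {u. \<forall>x. u x = u (x(N := undefined))}" for lam by blast
    show ?thesis using subsetD[OF fv.span_minimal[OF 2 1] u(1)] by simp
  qed
  have "lead n (Suc N) u' w"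
    unfolding lead_def
  proof (intro conjI ballI impI)
    show "u' w \<noteq> 0" using u'(2)[of w] wN u(2) loc[of w] by (simp add: lead_def)
    fix x assume x: "x \<in> words n (Suc N)" "u' x \<noteq> 0"
    have xN: "x N < 2 * n" and xp: "\<And>p. p < N \<Longrightarrow> x p < 2 * n" using x(1) by (auto simp: PiE_iff)
    consider "x N < w N" | "x N = w N" | "x N > w N" by linarith
    then show "val n (Suc N) x \<le> val n (Suc N) w"
    proof cases
      case 1
      then show ?thesis using val_Suc_less[of N x n w] xp by simp
    next
      case 2
      then have "u (x(N := undefined)) \<noteq> 0" using u'(2)[of x] x(2) xN loc[of x] by simp
      then have "val n N (x(N := undefined)) \<le> val n N ?v" using u(2) down[OF x(1)] by (simp add: lead_def)
      moreover have "val n N (x(N := undefined)) = val n N x" "val n N ?v = val n N w" by (auto intro: val_cong)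
      ultimately show ?thesis using 2 by (simp add: val_Suc)
    next
      case 3
      then show ?thesis using u'(2)[of x] x(2) xN by simp
    qed
  qed
  then show ?case using u'(1) by blast
qed

lemma lsgn_cases: "lsgn xs = 1 \<or> lsgn xs = - 1"
proof (induction xs)
  case (Cons x xs)
  have "(\<Prod>y\<leftarrow>ys. osgn x y) = 1 \<or> (\<Prod>y\<leftarrow>ys. osgn x y) = - 1" for ys
    by (induction ys) (auto simp: osgn_def)
  then show ?case using Cons by (metis lsgn.simps(2) mult_1 mult_minus1 minus_minus)
qed simp

text \<open>Weight zero leaves only empty columns, hence just the arcs.\<close>

lemma forms_zero:
  assumes "n \<ge> 1" "G \<in> forms n N (\<lambda>_. 0)"
  shows "G \<in> fv.span (P (Jn n) ` {m. perfect_matching {..<N} m})"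
proof -
  obtain M cs where M: "G = form n M cs" "mset (flat M @ concat cs) = mset [0..<N]"
    "\<forall>k<n. row_length cs k = 0" using assms(2) by (auto simp: forms_def)
  have cs: "c = []" if "c \<in> set cs" for c
    using M(3) assms(1) that by (force simp: row_length_def filter_empty_conv)
  have "concat cs = []" using cs by auto
  have ms: "mset (flat M) = mset [0..<N]" using M(2) unfolding \<open>concat cs = []\<close> by simp
  then have d: "distinct (flat M)" "set (flat M) = {..<N}"
    using mset_eq_imp_distinct_iff[OF ms] mset_eq_setD[OF ms] by (auto simp: atLeast0LessThan)
  have pm: "perfect_matching {..<N} (match_of M)" using perfect_matching_match_of[OF d(1)] d(2) by simp
  have "column_form c w = 1" if "c \<in> set cs" for c w using cs[OF that] by simp
  then have "map (\<lambda>c. column_form c w) cs = map (\<lambda>c. 1) cs" for w by simp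
  then have "(\<Prod>c\<leftarrow>cs. column_form c w) = 1" for w by (simp only:) (induction cs, auto)
  then have "G w = lsgn (flat M) * P (Jn n) (match_of M) w" for w
    using P_eq[where J="Jn n", OF Jn_skew d(1) refl, of w] lsgn_cases[of "flat M"]
    by (auto simp: M(1) form_def pval_def)
  then have G: "G = (\<lambda>w. lsgn (flat M) * P (Jn n) (match_of M) w)" by auto
  show ?thesis unfolding G by (intro fv.span_scale fv.span_base imageI CollectI pm)
qed

text \<open>The contribution of an arc \<open>{a, b}\<close> to the derivation vanishes because the form is invariant.\<close>

lemma P_killed:
  assumes m: "perfect_matching {..<N} m"
  shows "killed n N (P (Jn n) m)" and "weighted n N (\<lambda>_. 0) (P (Jn n) m)"
proof -
  obtain l where l: "distinct (flat l)" "match_of l = m" "set (flat l) = {..<N}"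
    using perfect_matching_list[OF _ m] by auto
  have P: "P (Jn n) m w = lsgn (flat l) * (\<Prod>e\<leftarrow>l. Jn n (w (fst e)) (w (snd e)))" for w
    using P_eq[where J="Jn n", OF Jn_skew l(1)] l(2) by (metis pval_def)
  show "killed n N (P (Jn n) m)"
    unfolding killed_def
  proof (intro allI impI ballI)
    fix i and w :: "nat \<Rightarrow> nat" assume i: "i < n"
    let ?S = "\<lambda>l. \<Sum>p\<in>set (flat l). nu n i (w p) * (\<Prod>e\<leftarrow>l. Jn n ((w(p := Suc (w p))) (fst e)) ((w(p := Suc (w p))) (snd e)))"
    have "distinct (flat l) \<Longrightarrow> ?S l = 0" for l
    proof (induction l)
      case (Cons e l)
      obtain a b where e: "e = (a, b)" by force
      have ab: "a \<noteq> b" "a \<notin> set (flat l)" "b \<notin> set (flat l)" using Cons.prems e by auto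
      let ?F = "\<lambda>w. \<Prod>e\<leftarrow>l. Jn n (w (fst e)) (w (snd e))"
      have F: "?F (w(x := y)) = ?F w" if "x \<notin> set (flat l)" for x y
      proof -
        have "fst e \<noteq> x \<and> snd e \<noteq> x" if "e \<in> set l" for e
          using that \<open>x \<notin> set (flat l)\<close> unfolding set_flat by (auto simp: match_of_def)
        then show ?thesis by (intro arg_cong[where f=prod_list] map_cong) auto
      qed
      let ?g = "\<lambda>p. nu n i (w p) * (Jn n ((w(p := Suc (w p))) a) ((w(p := Suc (w p))) b) * ?F (w(p := Suc (w p))))"
      have "?S (e # l) = ?g a + (?g b + sum ?g (set (flat l)))"
        using ab unfolding e flat.simps fst_conv snd_conv list.map prod_list.Cons by simp
      also have "sum ?g (set (flat l)) = Jn n (w a) (w b) * ?S l"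
        unfolding sum_distrib_left by (intro sum.cong refl) (use ab in auto)
      also have "?S l = 0" using Cons by simp
      also have "?g a + (?g b + Jn n (w a) (w b) * 0) = (nu n i (w a) * Jn n (Suc (w a)) (w b) + nu n i (w b) * Jn n (w a) (Suc (w b))) * ?F w"
        unfolding F[OF ab(2)] F[OF ab(3)] using ab(1) by (simp add: algebra_simps)
      also have "\<dots> = 0" using Jn_nu[OF i] by simp
      finally show ?case .
    qed simp
    from this[OF l(1)] have "lsgn (flat l) * ?S l = 0" by simp
    then show "lower n N i (P (Jn n) m) w = 0"
      unfolding lower_def P l(3)[symmetric] by (simp add: sum_distrib_left mult_ac)
  qed
  show "weighted n N (\<lambda>_. 0) (P (Jn n) m)"
    unfolding weighted_def
  proof (intro ballI impI allI)
    fix w k assume w: "P (Jn n) m w \<noteq> 0" and k: "k < n"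
    let ?h = "\<lambda>p. (if w p = k then 1 else 0) - (if w p = 2 * n - 1 - k then 1 else 0) :: int"
    have "distinct (flat l) \<Longrightarrow> (\<Prod>e\<leftarrow>l. Jn n (w (fst e)) (w (snd e))) \<noteq> 0 \<Longrightarrow> sum ?h (set (flat l)) = 0" for l
    proof (induction l)
      case (Cons e l)
      then have "Jn n (w (fst e)) (w (snd e)) \<noteq> 0" by simp
      then have "w (fst e) < 2 * n" "w (snd e) = 2 * n - 1 - w (fst e)" by (auto simp: Jn_def split: if_splits)
      then have "?h (fst e) + ?h (snd e) = 0" using k by auto
      then show ?case using Cons by simp
    qed simp
    from this[OF l(1)] show "weight n k w N = 0" using w P[of w] l(3) by (simp add: weight_def)
  qed
qed

text \<open>Cut off outside the words, so that equality of functions means equality of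
  coefficients.\<close>

definition PW :: "nat \<Rightarrow> nat \<Rightarrow> nat set set \<Rightarrow> (nat \<Rightarrow> nat) \<Rightarrow> complex" where
  "PW n N m = (\<lambda>w. if w \<in> words n N then P (Jn n) m w else 0)"

abbreviation matching_span :: "nat \<Rightarrow> nat \<Rightarrow> ((nat \<Rightarrow> nat) \<Rightarrow> complex) set" where
  "matching_span n N \<equiv> fv.span (PW n N ` {m. perfect_matching {..<N} m})"

lemma lower_cong: "(\<And>w. w \<in> words n N \<Longrightarrow> T w = T' w) \<Longrightarrow> w \<in> words n N \<Longrightarrow> i < n \<Longrightarrow> lower n N i T w = lower n N i T' w"
  unfolding lower_def
proof (intro sum.cong refl)
  fix p assume T: "\<And>w. w \<in> words n N \<Longrightarrow> T w = T' w" and w: "w \<in> words n N" "i < n" "p \<in> {..<N}"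
  show "nu n i (w p) * T (w(p := Suc (w p))) = nu n i (w p) * T' (w(p := Suc (w p)))"
  proof (cases "nu n i (w p) = 0")
    case False
    then show ?thesis using T words_Suc[OF w(1)] nu_word[OF w(2)] w(3) by simp
  qed simp
qed

section \<open>Invariants are spanned by matchings\<close>

definition invariants :: "nat \<Rightarrow> nat \<Rightarrow> ((nat \<Rightarrow> nat) \<Rightarrow> complex) set" where
  "invariants n N = {T. (\<forall>w. w \<notin> words n N \<longrightarrow> T w = 0) \<and> killed n N T \<and> weighted n N (\<lambda>_. 0) T}"

lemma invariants_subspace: "fv.subspace (invariants n N)"
proof (rule fv.subspaceI)
  show "0 \<in> invariants n N" by (simp add: invariants_def killed_def weighted_def lower_def)
  fix x y assume xy: "x \<in> invariants n N" "y \<in> invariants n N"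
  have "lower n N i (x + y) w = lower n N i x w + lower n N i y w" for i w
    by (simp add: lower_def sum.distrib algebra_simps)
  then show "x + y \<in> invariants n N" using xy
    by (auto simp: invariants_def killed_def weighted_def)
next
  fix c x assume x: "x \<in> invariants n N"
  have "lower n N i (\<lambda>w. c * x w) w = c * lower n N i x w" for i w
    by (simp add: lower_def sum_distrib_left mult_ac)
  then show "(\<lambda>w. c * x w) \<in> invariants n N" using x
    by (auto simp: invariants_def killed_def weighted_def)
qed

lemma PW_invariant: "perfect_matching {..<N} m \<Longrightarrow> PW n N m \<in> invariants n N"
  using P_killed[of N m n] lower_cong[where n=n and N=N and T="PW n N m" and T'="P (Jn n) m"]
  by (auto simp: invariants_def PW_def killed_def weighted_def)

definition closed_paths :: "nat \<Rightarrow> nat \<Rightarrow> (nat \<Rightarrow> nat) set" where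
  "closed_paths n N = {w. dominant_path n N w \<and> (\<forall>k<n. weight n k w N = 0)}"

lemma closed_path_vector:
  assumes n: "n \<ge> 1" and w: "w \<in> closed_paths n N"
  shows "\<exists>u\<in>matching_span n N. lead n N u w \<and> (\<forall>w'. w' \<notin> words n N \<longrightarrow> u w' = 0)"
proof -
  have w: "dominant_path n N w" "\<And>k. k < n \<Longrightarrow> weight n k w N = 0" using w by (auto simp: closed_paths_def)
  have wW: "w \<in> words n N" using w by (simp add: dominant_path_def)
  obtain u where u: "u \<in> fv.span (forms n N (\<lambda>k. weight n k w N))" "lead n N u w" using path_form[OF n w(1)] by blast
  have "forms n N (\<lambda>k. weight n k w N) = forms n N (\<lambda>_. 0)" using w(2) by (auto simp: forms_def)
  then have "forms n N (\<lambda>k. weight n k w N) \<subseteq> fv.span (P (Jn n) ` {m. perfect_matching {..<N} m})"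
    using forms_zero[OF n] by auto
  then have "u \<in> fv.span (P (Jn n) ` {m. perfect_matching {..<N} m})"
    using u(1) fv.span_minimal[OF _ fv.subspace_span] by blast
  moreover have "\<exists>G'\<in>matching_span n N. \<forall>w. True \<longrightarrow> G' w = (if w \<in> words n N then G w else 0)"
    if "G \<in> P (Jn n) ` {m. perfect_matching {..<N} m}" for G
  proof -
    from that obtain m where "G = P (Jn n) m" "perfect_matching {..<N} m" by auto
    then show ?thesis by (intro bexI[of _ "PW n N m"]) (auto simp: PW_def intro!: fv.span_base imageI)
  qed
  ultimately obtain u' where "u' \<in> matching_span n N" "\<forall>w. u' w = (if w \<in> words n N then u w else 0)"
    using span_lift[of "P (Jn n) ` {m. perfect_matching {..<N} m}" "PW n N ` {m. perfect_matching {..<N} m}" "\<lambda>_. True" "\<lambda>w. w \<in> words n N" u] by auto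
  then show ?thesis using u(2) wW by (intro bexI[of _ u']) (auto simp: lead_def)
qed

lemma words_eqI:
  assumes "x \<in> words n N" "w \<in> words n N" "val n N x = val n N w"
  shows "x = w"
proof (rule PiE_ext[OF assms(1,2)])
  fix p assume "p \<in> {..<N}"
  then show "x p = w p" by (intro val_inj[OF _ assms(3)]) (use assms in \<open>auto simp: PiE_iff\<close>)
qed

text \<open>Elimination by leading words: that of \<open>T\<close> is a closed dominant path, hence
  also the leading word of a combination of matchings, and subtracting a multiple of the latter
  lowers the bound \<open>v\<close>.\<close>

theorem first_fundamental:
  assumes n: "n \<ge> 1"
  shows "invariants n N = matching_span n N"
proof
  show "matching_span n N \<subseteq> invariants n N"
    by (rule fv.span_minimal[OF _ invariants_subspace]) (use PW_invariant in auto)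
  show "invariants n N \<subseteq> matching_span n N"
  proof
    fix T assume "T \<in> invariants n N"
    moreover have "T \<in> invariants n N \<Longrightarrow> \<forall>w\<in>words n N. T w \<noteq> 0 \<longrightarrow> val n N w < v \<Longrightarrow> T \<in> matching_span n N" for v T
    proof (induction v arbitrary: T)
      case 0
      then have "T w = 0" for w by (cases "w \<in> words n N") (auto simp: invariants_def)
      then have "T = 0" by (simp add: fun_eq_iff)
      then show ?case by (simp only: fv.span_zero)
    next
      case (Suc v)
      show ?case
      proof (cases "\<forall>w\<in>words n N. T w = 0")
        case True
        then have "T w = 0" for w using Suc.prems(1) by (cases "w \<in> words n N") (auto simp: invariants_def)
        then have "T = 0" by (simp add: fun_eq_iff)
        then show ?thesis by (simp only: fv.span_zero)
      next
        case False
        then obtain w0 where w0: "w0 \<in> words n N" "T w0 \<noteq> 0" by (meson ballI)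
        have T: "killed n N T" "weighted n N (\<lambda>_. 0) T" using Suc.prems(1) by (auto simp: invariants_def)
        obtain w where w: "w \<in> words n N" "lead n N T w" "dominant_path n N w"
          using highest_weight_lead[where T=T and ?w0.0=w0, OF n T w0] by (elim bexE conjE)
        have "w \<in> closed_paths n N" using w T(2) by (auto simp: closed_paths_def weighted_def lead_def)
        from closed_path_vector[OF n this] obtain u where u: "u \<in> matching_span n N" "lead n N u w" by (elim bexE conjE)
        define c where "c = T w / u w"
        define T' where "T' = T - (\<lambda>x. c * u x)"
        have uI: "u \<in> invariants n N" by (rule subsetD[OF \<open>matching_span n N \<subseteq> invariants n N\<close> u(1)])
        have T'I: "T' \<in> invariants n N"
          unfolding T'_def by (intro fv.subspace_diff[OF invariants_subspace] fv.subspace_scale[OF invariants_subspace] Suc.prems(1) uI)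
        have "T' w = 0" using u(2) by (simp add: T'_def c_def lead_def)
        have "T' \<in> matching_span n N"
        proof (rule Suc.IH[OF T'I], intro ballI impI)
          fix x assume x: "x \<in> words n N" "T' x \<noteq> 0"
          have "T' x = T x - c * u x" by (simp add: T'_def)
          then have "T x \<noteq> 0 \<or> u x \<noteq> 0" using x(2) by (metis diff_0 minus_zero mult_zero_right)
          then have "val n N x \<le> val n N w" using w(2)[unfolded lead_def] u(2)[unfolded lead_def] x(1) by metis
          moreover have "val n N x \<noteq> val n N w"
          proof
            assume "val n N x = val n N w"
            then have "x = w" by (rule words_eqI[OF x(1) w(1)])
            then show False using x(2) \<open>T' w = 0\<close> by simp
          qed
          moreover have "val n N w < Suc v" using Suc.prems(2) w(1,2) by (simp add: lead_def)
          ultimately show "val n N x < v" by simp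
        qed
        then have "T' + (\<lambda>x. c * u x) \<in> matching_span n N" by (intro fv.span_add fv.span_scale u(1))
        then show ?thesis by (simp add: T'_def)
      qed
    qed
    moreover have "\<forall>w\<in>words n N. T w \<noteq> 0 \<longrightarrow> val n N w < (2 * n) ^ N"
      using val_less[where n=n and N=N] by (auto simp: PiE_iff)
    ultimately show "T \<in> matching_span n N" by blast
  qed
qed

text \<open>Vectors with distinct leading words are independent.\<close>

lemma closed_paths_le_spanning:
  assumes n: "n \<ge> 1" and B: "finite B" "matching_span n N \<subseteq> fv.span B"
  shows "card (closed_paths n N) \<le> card B"
proof -
  have "\<forall>w\<in>closed_paths n N. \<exists>u. u \<in> matching_span n N \<and> lead n N u w"
    using closed_path_vector[OF n] by blast
  from bchoice[OF this] obtain u where "\<forall>w\<in>closed_paths n N. u w \<in> matching_span n N \<and> lead n N (u w) w" by blast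
  then have u: "u w \<in> matching_span n N" "lead n N (u w) w" if "w \<in> closed_paths n N" for w using that by auto
  have cW: "w \<in> words n N" if "w \<in> closed_paths n N" for w using that by (simp add: closed_paths_def dominant_path_def)
  then have fin: "finite (closed_paths n N)" using finite_words by (meson finite_subset subsetI)
  have vinj: "x = w" if "x \<in> closed_paths n N" "w \<in> closed_paths n N" "val n N x = val n N w" for x w
    by (rule words_eqI[OF cW cW that(3)]) (use that in auto)
  have inj: "inj_on u (closed_paths n N)"
  proof (rule inj_onI)
    fix x y assume xy: "x \<in> closed_paths n N" "y \<in> closed_paths n N" "u x = u y"
    then have "val n N x \<le> val n N y" "val n N y \<le> val n N x"
      using u(2)[of x] u(2)[of y] cW by (auto simp: lead_def)
    then show "x = y" using vinj xy by simp
  qed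
  have "fv.independent (u ` closed_paths n N)"
  proof
    assume "fv.dependent (u ` closed_paths n N)"
    then obtain c where c: "\<exists>v\<in>u ` closed_paths n N. c v \<noteq> 0" "(\<Sum>v\<in>u ` closed_paths n N. (\<lambda>x. c v * v x)) = 0"
      using fv.dependent_finite[of "u ` closed_paths n N"] fin by auto
    let ?S = "{w \<in> closed_paths n N. c (u w) \<noteq> 0}"
    have "?S \<noteq> {}" using c(1) by auto
    have "finite ?S" using fin by simp
    note \<open>?S \<noteq> {}\<close> \<open>finite ?S\<close>
    then have "Max (val n N ` ?S) \<in> val n N ` ?S" by (intro Max_in) auto
    then obtain p where p: "p \<in> ?S" "val n N p = Max (val n N ` ?S)" by fastforce
    then have pmax: "\<forall>w\<in>?S. val n N w \<le> val n N p" using \<open>finite ?S\<close> by (auto intro: Max_ge)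
    \<comment> \<open>At the largest leading word with nonzero coefficient all other terms of the
      relation vanish.\<close>
    have "0 = (\<Sum>v\<in>u ` closed_paths n N. c v * v p)" using fun_cong[OF c(2), of p] by (simp add: sum_apply)
    also have "\<dots> = (\<Sum>w\<in>closed_paths n N. c (u w) * u w p)" by (simp add: sum.reindex[OF inj])
    also have "\<dots> = (\<Sum>w\<in>closed_paths n N. if w = p then c (u p) * u p p else 0)"
    proof (intro sum.cong refl)
      fix w assume w: "w \<in> closed_paths n N"
      show "c (u w) * u w p = (if w = p then c (u p) * u p p else 0)"
      proof (cases "w = p \<or> c (u w) = 0")
        case False
        then have "val n N w \<le> val n N p" using pmax w by simp
        moreover have "val n N w \<noteq> val n N p" using vinj[of w p] w p(1) False by auto
        moreover have "u w p \<noteq> 0 \<Longrightarrow> val n N p \<le> val n N w" using u(2)[OF w] cW[of p] p(1) by (simp add: lead_def)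
        ultimately have "u w p = 0" by auto
        then show ?thesis using False by simp
      qed auto
    qed
    also have "\<dots> = c (u p) * u p p" using fin p(1) by simp
    finally show False using p(1) u(2)[of p] by (simp add: lead_def)
  qed
  moreover have "u ` closed_paths n N \<subseteq> fv.span B" using u(1) B(2) by blast
  ultimately have "card (u ` closed_paths n N) \<le> card B" using fv.independent_span_bound[OF B(1)] by blast
  then show ?thesis using inj by (simp add: card_image)
qed

definition noncrossing_on :: "nat \<Rightarrow> nat \<Rightarrow> nat set set set" where
  "noncrossing_on n N = {m. perfect_matching {..<N} m \<and> noncrossing (Suc n) m}"

lemma noncrossing_spans:
  "matching_span n N \<subseteq> fv.span (PW n N ` noncrossing_on n N)"
proof (rule fv.span_minimal[OF _ fv.subspace_span], rule image_subsetI)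
  let ?M = "{m. perfect_matching {..<N} m}"
  fix m assume "m \<in> ?M"
  then have m: "perfect_matching {..<N} m" by simp
  have fin: "finite ?M" by (simp add: finite_perfect_matchings)
  \<comment> \<open>The linear map from formal combinations of matchings to tensors. It kills the
    Pfaffians, so straightening carries over to tensors.\<close>
  define L where "L f = (\<Sum>m\<in>?M. (\<lambda>w. f m * PW n N m w))" for f
  let ?Pf = "{(\<Sum>m'\<in>{m'. perfect_matching S m'}. single (m' \<union> f)) | S f. S \<subseteq> {..<N} \<and> card S = 2 * (n + 1) \<and> perfect_matching ({..<N} - S) f}"
  let ?X = "single ` {m. perfect_matching {..<N} m \<and> noncrossing (n + 1) ((`) (\<lambda>x. x) ` m)}"
  let ?T = "{f. L f \<in> fv.span (PW n N ` noncrossing_on n N)}"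
  have Ls: "L (single m) = PW n N m" if "m \<in> ?M" for m
  proof -
    have "L (single m) = (\<Sum>m'\<in>?M. if m' = m then PW n N m else 0)"
      unfolding L_def by (intro sum.cong refl) (auto simp: single_def)
    then show ?thesis using fin that by simp
  qed
  have La: "L (x + y) = L x + L y" for x y
    by (rule ext) (simp add: L_def sum_apply distrib_right sum.distrib)
  have Lc: "L (\<lambda>m. c * x m) = (\<lambda>w. c * L x w)" for c x
    unfolding L_def by (rule ext, unfold sum_apply sum_distrib_left, intro sum.cong refl, rule mult.assoc)
  have L0: "L 0 = 0" by (rule ext) (simp add: L_def sum_apply)
  have Lsum: "L (sum g A) = (\<Sum>a\<in>A. L (g a))" for g and A :: "nat set set set"
    by (induction A rule: infinite_finite_induct) (simp_all only: sum.infinite sum.empty sum.insert L0 La not_False_eq_True)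
  have "fv.subspace ?T"
    by (rule fv.subspaceI) (simp_all only: mem_Collect_eq La Lc L0 fv.span_zero fv.span_add fv.span_scale)
  moreover have "?Pf \<subseteq> ?T"
  proof
    fix x assume "x \<in> ?Pf"
    then obtain S f where S: "x = (\<Sum>m'\<in>{m'. perfect_matching S m'}. single (m' \<union> f))" "S \<subseteq> {..<N}" "card S = 2 * (n + 1)"
      "perfect_matching ({..<N} - S) f" by blast
    have finS: "finite S" using S(2) finite_subset by blast
    have mem: "m' \<union> f \<in> ?M" if "perfect_matching S m'" for m'
      using perfect_matching_Un[OF that S(4)] S(2) by (simp add: Un_absorb1)
    have "L x = (\<Sum>m'\<in>{m'. perfect_matching S m'}. PW n N (m' \<union> f))"
      unfolding S(1) Lsum by (intro sum.cong refl Ls mem) simp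
    also have "\<dots> = 0"
    proof
      fix w
      show "(\<Sum>m'\<in>{m'. perfect_matching S m'}. PW n N (m' \<union> f)) w = 0 w"
      proof (cases "w \<in> words n N")
        case True
        then have "(\<Sum>m'\<in>{m'. perfect_matching S m'}. P (Jn n) (m' \<union> f) w) = 0"
          using S finS by (intro P_pfaffian_zero[where J="Jn n" and Ls="{..<2 * n}", OF Jn_skew finS _ _ S(4)]) (auto simp: PiE_iff)
        then show ?thesis using True by (simp add: sum_apply PW_def)
      qed (simp add: sum_apply PW_def)
    qed
    finally show "x \<in> ?T" by (simp add: fv.span_zero)
  qed
  moreover have "?X \<subseteq> ?T" using Ls by (auto simp: noncrossing_on_def intro!: fv.span_base)
  ultimately have "fv.span (?Pf \<union> ?X) \<subseteq> ?T" by (intro fv.span_minimal) auto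
  moreover have "single m \<in> fv.span (?Pf \<union> ?X)"
    by (rule straightening[OF _ _ m]) (auto intro: inj_onI)
  ultimately have "single m \<in> ?T" by blast
  then show "PW n N m \<in> fv.span (PW n N ` noncrossing_on n N)" using Ls m by simp
qed

text \<open>A coefficient \<open>c m \<noteq> 0\<close> would allow \<open>m\<close> to be dropped,
  leaving a spanning set with fewer elements than there are closed dominant paths.\<close>

theorem noncrossing_independent:
  assumes n: "n \<ge> 1" and c: "(\<Sum>m\<in>noncrossing_on n N. (\<lambda>w. c m * PW n N m w)) = 0" and m: "m \<in> noncrossing_on n N"
  shows "c m = 0"
proof -
  let ?X = "noncrossing_on n N"
  have fin: "finite ?X"
    by (rule finite_subset[OF _ finite_perfect_matchings[of "{..<N}"]]) (auto simp: noncrossing_on_def)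
  have finc: "finite (closed_paths n N)"
    by (rule finite_subset[OF _ finite_words[where n=n and N=N]]) (auto simp: closed_paths_def dominant_path_def)
  have "card ?X \<le> card (closed_paths n N)"
  proof (rule card_inj_on_le[OF _ _ finc])
    show "inj_on (path_word n N) ?X" using path_word_inj[of n N] by (simp add: noncrossing_on_def)
    show "path_word n N ` ?X \<subseteq> closed_paths n N"
      using path_word_dominant[OF _ _ n] by (auto simp: noncrossing_on_def closed_paths_def)
  qed
  moreover have small: "card (closed_paths n N) \<le> card B" if "finite B" "PW n N ` ?X \<subseteq> fv.span B" for B
    by (rule closed_paths_le_spanning[OF n that(1) subset_trans[OF noncrossing_spans fv.span_minimal[OF that(2) fv.subspace_span]]])
  ultimately have ge: "card ?X \<le> card B" if "finite B" "PW n N ` ?X \<subseteq> fv.span B" for B using that by (meson le_trans)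
  show ?thesis
  proof (rule ccontr)
    assume cm: "c m \<noteq> 0"
    let ?B = "PW n N ` (?X - {m})"
    have "(\<Sum>m'\<in>?X. (\<lambda>w. c m' * PW n N m' w)) = (\<lambda>w. c m * PW n N m w) + (\<Sum>m'\<in>?X - {m}. (\<lambda>w. c m' * PW n N m' w))"
      by (rule sum.remove[OF fin m])
    then have "(\<lambda>w. c m * PW n N m w) = - (\<Sum>m'\<in>?X - {m}. (\<lambda>w. c m' * PW n N m' w))"
      using c by (simp add: eq_neg_iff_add_eq_0)
    moreover have "- (\<Sum>m'\<in>?X - {m}. (\<lambda>w. c m' * PW n N m' w)) \<in> fv.span ?B"
      by (intro fv.span_neg fv.span_sum fv.span_scale fv.span_base) auto
    ultimately have "(\<lambda>w. c m * PW n N m w) \<in> fv.span ?B" by simp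
    then have "(\<lambda>w. inverse (c m) * (c m * PW n N m w)) \<in> fv.span ?B" by (rule fv.span_scale)
    then have "PW n N m \<in> fv.span ?B" using cm by (simp flip: mult.assoc)
    then have "PW n N ` ?X \<subseteq> fv.span ?B" using fv.span_base[of _ ?B] by blast
    then have "card ?X \<le> card ?B" using ge fin by simp
    also have "\<dots> \<le> card (?X - {m})" by (rule card_image_le) (use fin in simp)
    also have "\<dots> < card ?X" using fin m by (rule card_Diff1_less)
    finally show False by simp
  qed
qed

section \<open>Spaces with coordinates\<close>

lemma complex_ring_simps [simp]:
  "carrier complex_ring = UNIV" "mult complex_ring = (*)" "add complex_ring = (+)" "one complex_ring = 1" "zero complex_ring = 0"
  by auto

text \<open>An injective linear map into a function space, so that axioms and equations of the
  record can be checked on coordinates. Instances are free spaces, quotients, tensor powers and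
  spaces of equivariant maps.\<close>

locale coords =
  fixes M :: "(complex, 'a) module" and h :: "'a \<Rightarrow> 'y \<Rightarrow> complex"
  assumes inj: "inj_on h (carrier M)"
    and zero_closed: "\<zero>\<^bsub>M\<^esub> \<in> carrier M" and h_zero: "h \<zero>\<^bsub>M\<^esub> = (\<lambda>_. 0)"
    and add_closed: "x \<in> carrier M \<Longrightarrow> y \<in> carrier M \<Longrightarrow> x \<oplus>\<^bsub>M\<^esub> y \<in> carrier M"
    and h_add: "x \<in> carrier M \<Longrightarrow> y \<in> carrier M \<Longrightarrow> h (x \<oplus>\<^bsub>M\<^esub> y) = (\<lambda>i. h x i + h y i)"
    and smult_closed: "x \<in> carrier M \<Longrightarrow> c \<odot>\<^bsub>M\<^esub> x \<in> carrier M"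
    and h_smult: "x \<in> carrier M \<Longrightarrow> h (c \<odot>\<^bsub>M\<^esub> x) = (\<lambda>i. c * h x i)"
begin

lemma h_eq_iff: "x \<in> carrier M \<Longrightarrow> y \<in> carrier M \<Longrightarrow> h x = h y \<longleftrightarrow> x = y"
  using inj by (auto simp: inj_on_def)

lemma eqI: "x \<in> carrier M \<Longrightarrow> y \<in> carrier M \<Longrightarrow> (\<And>i. h x i = h y i) \<Longrightarrow> x = y"
  using h_eq_iff by blast

lemmas cl = add_closed smult_closed zero_closed h_add h_smult h_zero

lemma is_vectorspace: "vectorspace complex_ring M"
proof -
  have neg: "\<exists>w\<in>carrier M. v \<oplus>\<^bsub>M\<^esub> w = \<zero>\<^bsub>M\<^esub>" if v: "v \<in> carrier M" for v
  proof
    show "v \<oplus>\<^bsub>M\<^esub> ((- 1) \<odot>\<^bsub>M\<^esub> v) = \<zero>\<^bsub>M\<^esub>"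
      by (rule eqI) (simp_all add: v cl)
  qed (rule smult_closed[OF v])
  have comm: "v \<oplus>\<^bsub>M\<^esub> w = w \<oplus>\<^bsub>M\<^esub> v" if "v \<in> carrier M" "w \<in> carrier M" for v w
    by (rule eqI) (simp_all add: that cl add.commute)
  have assoc: "(v \<oplus>\<^bsub>M\<^esub> w) \<oplus>\<^bsub>M\<^esub> x = v \<oplus>\<^bsub>M\<^esub> (w \<oplus>\<^bsub>M\<^esub> x)" if "v \<in> carrier M" "w \<in> carrier M" "x \<in> carrier M" for v w x
    by (rule eqI) (simp_all add: that cl add.assoc)
  have zero: "v \<oplus>\<^bsub>M\<^esub> \<zero>\<^bsub>M\<^esub> = v" if "v \<in> carrier M" for v
    by (rule eqI) (simp_all add: that cl)
  have compat: "(a * b) \<odot>\<^bsub>M\<^esub> v = a \<odot>\<^bsub>M\<^esub> (b \<odot>\<^bsub>M\<^esub> v)" if "v \<in> carrier M" for a b v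
    by (rule eqI) (simp_all only: that smult_closed h_smult mult.assoc)
  have one: "1 \<odot>\<^bsub>M\<^esub> v = v" if "v \<in> carrier M" for v
    by (rule eqI) (simp_all add: that cl)
  have dist1: "(a + b) \<odot>\<^bsub>M\<^esub> v = (a \<odot>\<^bsub>M\<^esub> v) \<oplus>\<^bsub>M\<^esub> (b \<odot>\<^bsub>M\<^esub> v)" if "v \<in> carrier M" for a b v
    by (rule eqI) (simp_all add: that cl distrib_right)
  have dist2: "a \<odot>\<^bsub>M\<^esub> (v \<oplus>\<^bsub>M\<^esub> w) = (a \<odot>\<^bsub>M\<^esub> v) \<oplus>\<^bsub>M\<^esub> (a \<odot>\<^bsub>M\<^esub> w)" if "v \<in> carrier M" "w \<in> carrier M" for a v w
    by (rule eqI) (simp_all add: that cl distrib_left)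
  show ?thesis
    by (rule vs_criteria[OF class_field];
      (simp add: neg assoc zero compat one dist1 dist2 zero_closed add_closed smult_closed; fail)?) (use comm in blast)
qed

sublocale VS: vectorspace complex_ring M
  by (rule is_vectorspace)

lemma finsum_closed: "(\<And>x. x \<in> A \<Longrightarrow> g x \<in> carrier M) \<Longrightarrow> (\<Oplus>\<^bsub>M\<^esub>x\<in>A. g x) \<in> carrier M"
  by (rule VS.module.M.finsum_closed) auto

lemma h_finsum: "finite A \<Longrightarrow> (\<And>x. x \<in> A \<Longrightarrow> g x \<in> carrier M) \<Longrightarrow> h (\<Oplus>\<^bsub>M\<^esub>x\<in>A. g x) i = (\<Sum>x\<in>A. h (g x) i)"
proof (induction A rule: finite_induct)
  case empty
  then show ?case by (simp add: h_zero)
next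
  case (insert x A)
  then have "(\<Oplus>\<^bsub>M\<^esub>x\<in>insert x A. g x) = g x \<oplus>\<^bsub>M\<^esub> (\<Oplus>\<^bsub>M\<^esub>x\<in>A. g x)"
    by (intro VS.module.M.finsum_insert) auto
  moreover have "(\<Oplus>\<^bsub>M\<^esub>x\<in>A. g x) \<in> carrier M" by (rule finsum_closed) (use insert in auto)
  ultimately show ?case using insert by (simp add: h_add)
qed

lemma h_lincomb: "finite A \<Longrightarrow> A \<subseteq> carrier M \<Longrightarrow> h (VS.lincomb a A) i = (\<Sum>v\<in>A. a v * h v i)"
  unfolding VS.lincomb_def by (subst h_finsum) (auto simp: smult_closed h_smult subset_iff)

lemma lin_ext_closed: "(\<And>x. f x \<noteq> 0 \<Longrightarrow> \<phi> x \<in> carrier M) \<Longrightarrow> lin_ext M \<phi> f \<in> carrier M"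
  unfolding lin_ext_def by (rule finsum_closed) (auto simp: smult_closed)

lemma h_lin_ext:
  assumes "finite Y" "{x. f x \<noteq> 0} \<subseteq> Y" "\<And>x. f x \<noteq> 0 \<Longrightarrow> \<phi> x \<in> carrier M"
  shows "h (lin_ext M \<phi> f) i = (\<Sum>x\<in>Y. f x * h (\<phi> x) i)"
proof -
  have "h (lin_ext M \<phi> f) i = (\<Sum>x\<in>{x. f x \<noteq> 0}. h (f x \<odot>\<^bsub>M\<^esub> \<phi> x) i)"
    unfolding lin_ext_def by (rule h_finsum) (use assms finite_subset in \<open>auto simp: smult_closed\<close>)
  also have "\<dots> = (\<Sum>x\<in>{x. f x \<noteq> 0}. f x * h (\<phi> x) i)" using assms(3) by (intro sum.cong) (auto simp: h_smult)
  also have "\<dots> = (\<Sum>x\<in>Y. f x * h (\<phi> x) i)" by (rule sum.mono_neutral_left) (use assms in auto)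
  finally show ?thesis .
qed

end

lemma linear_mapsI:
  assumes "\<And>x. x \<in> carrier M \<Longrightarrow> f x \<in> carrier N"
    and "\<And>x y. x \<in> carrier M \<Longrightarrow> y \<in> carrier M \<Longrightarrow> f (x \<oplus>\<^bsub>M\<^esub> y) = f x \<oplus>\<^bsub>N\<^esub> f y"
    and "\<And>c x. x \<in> carrier M \<Longrightarrow> f (c \<odot>\<^bsub>M\<^esub> x) = c \<odot>\<^bsub>N\<^esub> f x"
  shows "f \<in> linear_maps M N"
  using assms by (auto simp: LinearCombinations.module_hom_def)

lemma linear_mapsD:
  assumes "f \<in> linear_maps M N"
  shows "x \<in> carrier M \<Longrightarrow> f x \<in> carrier N"
    and "x \<in> carrier M \<Longrightarrow> y \<in> carrier M \<Longrightarrow> f (x \<oplus>\<^bsub>M\<^esub> y) = f x \<oplus>\<^bsub>N\<^esub> f y"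
    and "x \<in> carrier M \<Longrightarrow> f (c \<odot>\<^bsub>M\<^esub> x) = c \<odot>\<^bsub>N\<^esub> f x"
  using assms by (auto simp: LinearCombinations.module_hom_def)

lemma free_space_simps:
  "carrier (free_space X) = {f. finite {x. f x \<noteq> 0} \<and> {x. f x \<noteq> 0} \<subseteq> X}"
  "\<zero>\<^bsub>free_space X\<^esub> = (\<lambda>_. 0)" "f \<oplus>\<^bsub>free_space X\<^esub> g = f + g" "c \<odot>\<^bsub>free_space X\<^esub> f = (\<lambda>x. c * f x)"
  by (auto simp: free_space_def fun_eq_iff)

lemma free_space_subspace: "fv.subspace (carrier (free_space X))"
proof (rule fv.subspaceI)
  show "0 \<in> carrier (free_space X)" by (simp add: free_space_simps)
  fix f g assume fg: "f \<in> carrier (free_space X)" "g \<in> carrier (free_space X)"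
  have "{x. (f + g) x \<noteq> 0} \<subseteq> {x. f x \<noteq> 0} \<union> {x. g x \<noteq> 0}" by auto
  moreover have "finite ({x. f x \<noteq> 0} \<union> {x. g x \<noteq> 0})" "{x. f x \<noteq> 0} \<union> {x. g x \<noteq> 0} \<subseteq> X"
    using fg by (auto simp: free_space_simps)
  ultimately show "f + g \<in> carrier (free_space X)" unfolding free_space_simps using finite_subset by blast
next
  fix c f assume "f \<in> carrier (free_space X)"
  then show "(\<lambda>x. c * f x) \<in> carrier (free_space X)"
    by (cases "c = 0") (auto simp: free_space_simps)
qed

interpretation free: coords "free_space X" "\<lambda>f. f" for X
proof
  show "f \<oplus>\<^bsub>free_space X\<^esub> g \<in> carrier (free_space X)" if "f \<in> carrier (free_space X)" "g \<in> carrier (free_space X)" for f g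
    unfolding free_space_simps(3) using fv.subspace_add[OF free_space_subspace that] .
  show "c \<odot>\<^bsub>free_space X\<^esub> f \<in> carrier (free_space X)" if "f \<in> carrier (free_space X)" for f c
    unfolding free_space_simps(4) using fv.subspace_scale[OF free_space_subspace that] .
qed (auto simp: free_space_simps)

lemma single_free: "x \<in> X \<Longrightarrow> single x \<in> carrier (free_space X)"
  by (auto simp: free_space_simps single_def)

lemma free_expand:
  assumes "f \<in> carrier (free_space X)"
  shows "f = (\<Sum>x\<in>{x. f x \<noteq> 0}. (\<lambda>y. f x * single x y))"
proof
  fix y
  have fin: "finite {x. f x \<noteq> 0}" using assms by (simp add: free_space_simps)
  have "(\<Sum>x\<in>{x. f x \<noteq> 0}. f x * single x y) = (\<Sum>x\<in>{x. f x \<noteq> 0}. if x = y then f y else 0)"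
    by (intro sum.cong refl) (auto simp: single_def)
  also have "\<dots> = f y" using fin by simp
  finally show "f y = (\<Sum>x\<in>{x. f x \<noteq> 0}. (\<lambda>y. f x * single x y)) y" by (simp add: sum_apply)
qed

lemma free_in_span: "f \<in> carrier (free_space X) \<Longrightarrow> f \<in> fv.span (single ` X)"
  by (subst free_expand, assumption) (intro fv.span_sum fv.span_scale fv.span_base imageI, auto simp: free_space_simps)

lemma free_lincomb: "finite A \<Longrightarrow> A \<subseteq> carrier (free_space X) \<Longrightarrow>
    LinearCombinations.module.lincomb (free_space X) a A = (\<Sum>v\<in>A. (\<lambda>x. a v * v x))"
  by (rule ext) (simp add: free.h_lincomb sum_apply)

lemma vspan_free:
  assumes "S \<subseteq> carrier (free_space X)"
  shows "vspan (free_space X) S = fv.span S"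
proof (intro equalityI subsetI)
  fix x assume "x \<in> vspan (free_space X) S"
  then obtain a A where A: "finite A" "A \<subseteq> S" "x = LinearCombinations.module.lincomb (free_space X) a A"
    by (auto simp: free.VS.span_def)
  then have x: "x = (\<Sum>v\<in>A. (\<lambda>x. a v * v x))" using free_lincomb[of A X a] assms by auto
  show "x \<in> fv.span S" unfolding x by (intro fv.span_sum fv.span_scale fv.span_base) (use A in auto)
next
  fix x assume "x \<in> fv.span S"
  then obtain A a where A: "finite A" "A \<subseteq> S" "x = (\<Sum>v\<in>A. (\<lambda>x. a v * v x))" unfolding fv.span_explicit by auto
  then have "x = LinearCombinations.module.lincomb (free_space X) a A" using free_lincomb[of A X a] assms by auto
  then show "x \<in> vspan (free_space X) S" unfolding free.VS.span_def using A by auto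
qed

definition elem_image :: "('a \<Rightarrow> 'b) \<Rightarrow> 'a set \<Rightarrow> 'b" where
  "elem_image f A = the_elem (f ` A)"

lemma elem_image_eq: "A \<noteq> {} \<Longrightarrow> (\<And>a. a \<in> A \<Longrightarrow> f a = b) \<Longrightarrow> elem_image f A = b"
  unfolding elem_image_def by (metis image_constant_conv image_cong the_elem_eq)

text \<open>A linear \<open>\<kappa>\<close> with kernel \<open>U\<close> gives coordinates on the
  quotient. This is used for tensor powers, with pairings against basis tensors, and for diagrams
  modulo Pfaffians, with the tensor of a diagram.\<close>

locale coord_quot =
  fixes X :: "'b set" and U :: "('b \<Rightarrow> complex) set" and \<kappa> :: "('b \<Rightarrow> complex) \<Rightarrow> 'y \<Rightarrow> complex"
  assumes U: "fv.subspace U" and UX: "U \<subseteq> carrier (free_space X)"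
    and \<kappa>_add: "f \<in> carrier (free_space X) \<Longrightarrow> g \<in> carrier (free_space X) \<Longrightarrow> \<kappa> (f + g) = (\<lambda>i. \<kappa> f i + \<kappa> g i)"
    and \<kappa>_scale: "f \<in> carrier (free_space X) \<Longrightarrow> \<kappa> (\<lambda>x. c * f x) = (\<lambda>i. c * \<kappa> f i)"
    and \<kappa>_kernel: "f \<in> carrier (free_space X) \<Longrightarrow> \<kappa> f = (\<lambda>_. 0) \<longleftrightarrow> f \<in> U"
begin

abbreviation "F \<equiv> free_space X"
abbreviation "Q \<equiv> quot_space F U"
abbreviation "cls f \<equiv> U +>\<^bsub>F\<^esub> f"

lemma cls_eq: "cls f = (\<lambda>u. u + f) ` U"
  by (auto simp: a_r_coset_def r_coset_def free_space_simps)

lemma cls_self: "f \<in> cls f"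
  using fv.subspace_0[OF U] by (force simp: cls_eq)

lemma cls_sub: "f \<in> carrier F \<Longrightarrow> g \<in> cls f \<Longrightarrow> g \<in> carrier F"
  using UX fv.subspace_add[OF free_space_subspace] by (auto simp: cls_eq)

lemma cls_eqI:
  assumes "g - f \<in> U"
  shows "cls g = cls f"
proof -
  have "cls g \<subseteq> cls f" if d: "g - f \<in> U" for f g
  proof
    fix x assume "x \<in> cls g"
    then obtain u where u: "u \<in> U" "x = u + g" by (auto simp: cls_eq)
    have "x = (u + (g - f)) + f" by (rule ext) (simp add: u(2))
    moreover have "u + (g - f) \<in> U" using fv.subspace_add[OF U u(1) d] .
    ultimately show "x \<in> cls f" unfolding cls_eq by (rule image_eqI)
  qed
  moreover have "f - g \<in> U" using fv.subspace_neg[OF U assms] by simp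
  ultimately show ?thesis using assms by blast
qed

lemma \<kappa>_cls: "f \<in> carrier F \<Longrightarrow> g \<in> cls f \<Longrightarrow> \<kappa> g = \<kappa> f"
  unfolding cls_eq using UX \<kappa>_add \<kappa>_kernel by (force simp: fun_eq_iff)

lemma cls_eq_iff: "f \<in> carrier F \<Longrightarrow> g \<in> carrier F \<Longrightarrow> cls f = cls g \<longleftrightarrow> \<kappa> f = \<kappa> g"
proof
  assume f: "f \<in> carrier F" and g: "g \<in> carrier F"
  show "\<kappa> f = \<kappa> g" if "cls f = cls g" using \<kappa>_cls[OF g, of f] cls_self[of f] that by simp
  assume e: "\<kappa> f = \<kappa> g"
  have "(\<lambda>x. (- 1) * g x) \<in> carrier F" by (rule fv.subspace_scale[OF free_space_subspace g])
  then have "\<kappa> (f + (\<lambda>x. (- 1) * g x)) = (\<lambda>i. \<kappa> f i + (- 1) * \<kappa> g i)" using \<kappa>_add[OF f] \<kappa>_scale[OF g, of "- 1"] by simp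
  moreover have "f + (\<lambda>x. (- 1) * g x) = f - g" by (simp add: fun_eq_iff)
  ultimately have "\<kappa> (f - g) = (\<lambda>_. 0)" using e by simp
  moreover have "f - g \<in> carrier F" by (rule fv.subspace_diff[OF free_space_subspace f g])
  ultimately have "f - g \<in> U" using \<kappa>_kernel by blast
  then show "cls f = cls g" by (rule cls_eqI)
qed

lemma elem_\<kappa>:
  assumes "f \<in> carrier F"
  shows "elem_image \<kappa> (cls f) = \<kappa> f"
proof (rule elem_image_eq)
  show "cls f \<noteq> {}" using cls_self[of f] by (metis empty_iff)
qed (rule \<kappa>_cls[OF assms])

lemma carrier_Q: "carrier Q = cls ` carrier F"
  by (auto simp: quot_space_def A_RCOSETS_def RCOSETS_def a_r_coset_def)

lemma Q_zero: "\<zero>\<^bsub>Q\<^esub> = cls 0"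
  by (simp add: quot_space_def cls_eq)

lemma Q_add: "cls f \<oplus>\<^bsub>Q\<^esub> cls g = cls (f + g)"
proof -
  have "cls f \<oplus>\<^bsub>Q\<^esub> cls g = {u + f + (v + g) | u v. u \<in> U \<and> v \<in> U}"
    unfolding quot_space_def cls_eq by (auto simp: set_add_def set_mult_def free_space_simps)
  also have "\<dots> = cls (f + g)"
  proof (intro equalityI subsetI)
    fix x assume "x \<in> {u + f + (v + g) | u v. u \<in> U \<and> v \<in> U}"
    then obtain u v where "u \<in> U" "v \<in> U" "x = (u + v) + (f + g)" by (auto simp: algebra_simps)
    then show "x \<in> cls (f + g)" using fv.subspace_add[OF U] by (auto simp: cls_eq)
  next
    fix x assume "x \<in> cls (f + g)"
    then obtain u where "u \<in> U" "x = u + f + (0 + g)" by (auto simp: cls_eq algebra_simps)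
    then show "x \<in> {u + f + (v + g) | u v. u \<in> U \<and> v \<in> U}" using fv.subspace_0[OF U] by blast
  qed
  finally show ?thesis .
qed

lemma Q_smult: "c \<odot>\<^bsub>Q\<^esub> cls f = cls (\<lambda>x. c * f x)"
proof -
  have e: "cls (\<lambda>x. c * g x) = cls (\<lambda>x. c * f x)" if "g \<in> cls f" for g
  proof (rule cls_eqI)
    from that obtain u where "u \<in> U" "g = u + f" by (auto simp: cls_eq)
    have "(\<lambda>x. c * g x) - (\<lambda>x. c * f x) = (\<lambda>x. c * u x)"
      by (rule ext) (simp add: \<open>g = u + f\<close> distrib_left)
    then show "(\<lambda>x. c * g x) - (\<lambda>x. c * f x) \<in> U" using fv.subspace_scale[OF U \<open>u \<in> U\<close>] by simp
  qed
  have "c \<odot>\<^bsub>Q\<^esub> cls f = (\<Union>g\<in>cls f. cls (\<lambda>x. c * g x))" by (simp add: quot_space_def free_space_simps)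
  also have "\<dots> = (\<Union>g\<in>cls f. cls (\<lambda>x. c * f x))" using e by (rule SUP_cong[OF refl])
  also have "\<dots> = cls (\<lambda>x. c * f x)" using cls_self[of f] by auto
  finally show ?thesis .
qed

sublocale Q: coords Q "elem_image \<kappa>"
proof
  show "inj_on (elem_image \<kappa>) (carrier Q)"
  proof (rule inj_onI)
    fix x y assume "x \<in> carrier Q" "y \<in> carrier Q" and e: "elem_image \<kappa> x = elem_image \<kappa> y"
    then obtain f g where fg: "f \<in> carrier F" "g \<in> carrier F" "x = cls f" "y = cls g" by (auto simp: carrier_Q)
    then have "\<kappa> f = \<kappa> g" using e by (simp add: elem_\<kappa>)
    then show "x = y" using fg cls_eq_iff by simp
  qed
  have 0: "(\<lambda>x. 0) \<in> carrier F" using fv.subspace_0[OF free_space_subspace] by (simp add: zero_fun_def)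
  show "\<zero>\<^bsub>Q\<^esub> \<in> carrier Q" unfolding Q_zero carrier_Q using fv.subspace_0[OF free_space_subspace] by (rule imageI)
  show "elem_image \<kappa> \<zero>\<^bsub>Q\<^esub> = (\<lambda>_. 0)" unfolding Q_zero
    using elem_\<kappa>[OF fv.subspace_0[OF free_space_subspace]] \<kappa>_kernel[OF fv.subspace_0[OF free_space_subspace]] fv.subspace_0[OF U] by simp
  fix x y assume "x \<in> carrier Q" "y \<in> carrier Q"
  then obtain f g where fg: "f \<in> carrier F" "g \<in> carrier F" "x = cls f" "y = cls g" by (auto simp: carrier_Q)
  have s: "f + g \<in> carrier F" by (rule fv.subspace_add[OF free_space_subspace fg(1,2)])
  show "x \<oplus>\<^bsub>Q\<^esub> y \<in> carrier Q" unfolding fg Q_add carrier_Q using s by (rule imageI)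
  show "elem_image \<kappa> (x \<oplus>\<^bsub>Q\<^esub> y) = (\<lambda>i. elem_image \<kappa> x i + elem_image \<kappa> y i)"
    unfolding fg Q_add by (simp only: elem_\<kappa> s fg \<kappa>_add)
next
  fix x c assume "x \<in> carrier Q"
  then obtain f where f: "f \<in> carrier F" "x = cls f" by (auto simp: carrier_Q)
  have s: "(\<lambda>x. c * f x) \<in> carrier F" by (rule fv.subspace_scale[OF free_space_subspace f(1)])
  show "c \<odot>\<^bsub>Q\<^esub> x \<in> carrier Q" unfolding f Q_smult carrier_Q using s by (rule imageI)
  show "elem_image \<kappa> (c \<odot>\<^bsub>Q\<^esub> x) = (\<lambda>i. c * elem_image \<kappa> x i)"
    unfolding f Q_smult by (simp only: elem_\<kappa> s f \<kappa>_scale)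
qed

end

text \<open>Associativity and the unit laws of \<open>C\<close> are inherited along a faithful functor.\<close>

lemma isomorphic_lincatI:
  assumes D: "linear_category D" and C: "\<And>r s. vectorspace complex_ring (Hom C r s)"
    and G: "\<And>r s. G r s \<in> linear_maps (Hom C r s) (Hom D r s)"
      "\<And>r s. bij_betw (G r s) (carrier (Hom C r s)) (carrier (Hom D r s))"
    and Id: "\<And>r. Ident C r \<in> carrier (Hom C r r)" "\<And>r. G r r (Ident C r) = Ident D r"
    and Comp: "\<And>r s t f g. f \<in> carrier (Hom C r s) \<Longrightarrow> g \<in> carrier (Hom C s t) \<Longrightarrow> Comp C r s t f g \<in> carrier (Hom C r t)"
      "\<And>r s t f g. f \<in> carrier (Hom C r s) \<Longrightarrow> g \<in> carrier (Hom C s t) \<Longrightarrow>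
        G r t (Comp C r s t f g) = Comp D r s t (G r s f) (G s t g)"
  shows "isomorphic_lincat C D"
proof -
  interpret D: linear_category D by (rule D)
  have eq: "f = g" if "f \<in> carrier (Hom C r s)" "g \<in> carrier (Hom C r s)" "G r s f = G r s g" for r s f g
    using G(2)[of r s] that by (auto simp: bij_betw_def inj_on_def)
  note Gl = linear_mapsD[OF G(1)]
  have Cadd: "f \<oplus>\<^bsub>Hom C r s\<^esub> g \<in> carrier (Hom C r s)" if "f \<in> carrier (Hom C r s)" "g \<in> carrier (Hom C r s)" for r s f g
  proof -
    interpret vectorspace complex_ring "Hom C r s" by (rule C)
    show ?thesis using that by simp
  qed
  have Csm: "c \<odot>\<^bsub>Hom C r s\<^esub> f \<in> carrier (Hom C r s)" if "f \<in> carrier (Hom C r s)" for r s f c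
  proof -
    interpret vectorspace complex_ring "Hom C r s" by (rule C)
    show ?thesis using that by (intro smult_closed) auto
  qed
  have "linear_category C"
  proof (rule linear_category.intro)
    show "vectorspace complex_ring (Hom C r s)" for r s by (rule C)
    show "(\<lambda>f. Comp C r s t f g) \<in> linear_maps (Hom C r s) (Hom C r t)" if g: "g \<in> carrier (Hom C s t)" for g r s t
    proof (rule linear_mapsI)
      note Dl = linear_mapsD[OF D.Comp_linear_left[OF Gl(1)[OF g]]]
      fix x y c assume x: "x \<in> carrier (Hom C r s)"
      show "Comp C r s t x g \<in> carrier (Hom C r t)" by (rule Comp(1)[OF x g])
      show "Comp C r s t (c \<odot>\<^bsub>Hom C r s\<^esub> x) g = c \<odot>\<^bsub>Hom C r t\<^esub> Comp C r s t x g"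
        by (rule eq[of _ r t]) (simp_all add: Comp Csm Gl x g Dl)
      assume y: "y \<in> carrier (Hom C r s)"
      show "Comp C r s t (x \<oplus>\<^bsub>Hom C r s\<^esub> y) g = Comp C r s t x g \<oplus>\<^bsub>Hom C r t\<^esub> Comp C r s t y g"
        by (rule eq[of _ r t]) (simp_all add: Comp Cadd Gl x y g Dl)
    qed
    show "(\<lambda>g. Comp C r s t f g) \<in> linear_maps (Hom C s t) (Hom C r t)" if f: "f \<in> carrier (Hom C r s)" for f r s t
    proof (rule linear_mapsI)
      note Dl = linear_mapsD[OF D.Comp_linear_right[OF Gl(1)[OF f]]]
      fix x y c assume x: "x \<in> carrier (Hom C s t)"
      show "Comp C r s t f x \<in> carrier (Hom C r t)" by (rule Comp(1)[OF f x])
      show "Comp C r s t f (c \<odot>\<^bsub>Hom C s t\<^esub> x) = c \<odot>\<^bsub>Hom C r t\<^esub> Comp C r s t f x"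
        by (rule eq[of _ r t]) (simp_all add: Comp Csm Gl x f Dl)
      assume y: "y \<in> carrier (Hom C s t)"
      show "Comp C r s t f (x \<oplus>\<^bsub>Hom C s t\<^esub> y) = Comp C r s t f x \<oplus>\<^bsub>Hom C r t\<^esub> Comp C r s t f y"
        by (rule eq[of _ r t]) (simp_all add: Comp Cadd Gl x y f Dl)
    qed
    show "Comp C r t u (Comp C r s t f g) h = Comp C r s u f (Comp C s t u g h)"
      if "f \<in> carrier (Hom C r s)" "g \<in> carrier (Hom C s t)" "h \<in> carrier (Hom C t u)" for f g h r s t u
      by (rule eq[of _ r u]) (use that in \<open>simp_all add: Comp Gl D.Comp_assoc\<close>)
    show "Ident C r \<in> carrier (Hom C r r)" for r by (rule Id)
    show "Comp C r r s (Ident C r) f = f" if "f \<in> carrier (Hom C r s)" for f r s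
      by (rule eq[of _ r s]) (use that in \<open>simp_all add: Comp Id Gl D.Ident_left\<close>)
    show "Comp C r s s f (Ident C s) = f" if "f \<in> carrier (Hom C r s)" for f r s
      by (rule eq[of _ r s]) (use that in \<open>simp_all add: Comp Id Gl D.Ident_right\<close>)
  qed
  then show ?thesis unfolding isomorphic_lincat_def
    using D G Id(2) Comp(2) by (intro conjI exI[of _ id] exI[of _ G]) auto
qed

section \<open>Hyperbolic bases\<close>

locale symp_space =
  fixes n :: nat and V :: "(complex, 'v) module" and \<omega> :: "'v \<Rightarrow> 'v \<Rightarrow> complex"
  assumes n1: "n \<ge> 1" and V: "vectorspace complex_ring V"
    and fin_dim: "vectorspace.fin_dim complex_ring V" and dim: "vectorspace.dim complex_ring V = 2 * n"
    and form: "nondegenerate_skew_form V \<omega>"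
begin

sublocale VS: vectorspace complex_ring V
  by (rule V)

lemma addC: "x \<in> carrier V \<Longrightarrow> y \<in> carrier V \<Longrightarrow> x \<oplus>\<^bsub>V\<^esub> y \<in> carrier V"
  by (rule VS.module.M.a_closed)

lemma smC: "x \<in> carrier V \<Longrightarrow> c \<odot>\<^bsub>V\<^esub> x \<in> carrier V"
  by (rule VS.module.smult_closed) simp_all

lemma zeroC: "\<zero>\<^bsub>V\<^esub> \<in> carrier V"
  by (rule VS.module.M.zero_closed)

lemma form_add: "x \<in> carrier V \<Longrightarrow> y \<in> carrier V \<Longrightarrow> z \<in> carrier V \<Longrightarrow> \<omega> (x \<oplus>\<^bsub>V\<^esub> y) z = \<omega> x z + \<omega> y z"
  and form_smult: "x \<in> carrier V \<Longrightarrow> z \<in> carrier V \<Longrightarrow> \<omega> (c \<odot>\<^bsub>V\<^esub> x) z = c * \<omega> x z"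
  and form_skew: "x \<in> carrier V \<Longrightarrow> y \<in> carrier V \<Longrightarrow> \<omega> x y = - \<omega> y x"
  and form_nondeg: "x \<in> carrier V \<Longrightarrow> (\<And>y. y \<in> carrier V \<Longrightarrow> \<omega> x y = 0) \<Longrightarrow> x = \<zero>\<^bsub>V\<^esub>"
  using form unfolding nondegenerate_skew_form_def by blast+

lemma form_add_right: "x \<in> carrier V \<Longrightarrow> y \<in> carrier V \<Longrightarrow> z \<in> carrier V \<Longrightarrow> \<omega> z (x \<oplus>\<^bsub>V\<^esub> y) = \<omega> z x + \<omega> z y"
  and form_smult_right: "x \<in> carrier V \<Longrightarrow> z \<in> carrier V \<Longrightarrow> \<omega> z (c \<odot>\<^bsub>V\<^esub> x) = c * \<omega> z x"
  using form unfolding nondegenerate_skew_form_def by blast+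

lemma form_zero: "z \<in> carrier V \<Longrightarrow> \<omega> \<zero>\<^bsub>V\<^esub> z = 0"
  using form_add[OF zeroC zeroC, of z] VS.module.M.l_zero[OF zeroC] by simp

lemma smult_zero: "x \<in> carrier V \<Longrightarrow> 0 \<odot>\<^bsub>V\<^esub> x = \<zero>\<^bsub>V\<^esub>"
  by (rule form_nondeg) (simp_all add: smC form_smult)

text \<open>Nondegeneracy as a test for equality of vectors; linear identities in \<open>V\<close>
  are then checked on complex numbers.\<close>

lemma form_inj: "x \<in> carrier V \<Longrightarrow> y \<in> carrier V \<Longrightarrow> (\<And>z. z \<in> carrier V \<Longrightarrow> \<omega> x z = \<omega> y z) \<Longrightarrow> x = y"
proof -
  assume x: "x \<in> carrier V" and y: "y \<in> carrier V" and e: "\<And>z. z \<in> carrier V \<Longrightarrow> \<omega> x z = \<omega> y z"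
  have y': "(- 1) \<odot>\<^bsub>V\<^esub> y \<in> carrier V" by (rule smC[OF y])
  have 1: "x \<oplus>\<^bsub>V\<^esub> ((- 1) \<odot>\<^bsub>V\<^esub> y) = \<zero>\<^bsub>V\<^esub>"
    by (rule form_nondeg) (simp_all add: addC x y y' form_add form_smult e)
  have "y \<oplus>\<^bsub>V\<^esub> ((- 1) \<odot>\<^bsub>V\<^esub> y) = \<zero>\<^bsub>V\<^esub>"
    by (rule form_nondeg) (simp_all add: addC y y' form_add form_smult)
  then show "x = y" using 1 VS.module.M.a_assoc[OF x y y'] VS.module.M.a_assoc[OF x y' y] VS.module.M.a_comm[OF y' y]
      VS.module.M.r_zero[OF x] VS.module.M.l_zero[OF y] by simp
qed

primrec comb :: "(nat \<Rightarrow> complex) \<Rightarrow> (nat \<Rightarrow> 'v) \<Rightarrow> nat \<Rightarrow> 'v" where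
  "comb c b 0 = \<zero>\<^bsub>V\<^esub>"
| "comb c b (Suc k) = comb c b k \<oplus>\<^bsub>V\<^esub> c k \<odot>\<^bsub>V\<^esub> b k"

lemma comb_closed: "(\<And>i. i < k \<Longrightarrow> b i \<in> carrier V) \<Longrightarrow> comb c b k \<in> carrier V"
  by (induction k) (auto intro!: addC smC zeroC)

lemma form_comb: "(\<And>i. i < k \<Longrightarrow> b i \<in> carrier V) \<Longrightarrow> y \<in> carrier V \<Longrightarrow> \<omega> (comb c b k) y = (\<Sum>i<k. c i * \<omega> (b i) y)"
  by (induction k) (auto simp: form_zero form_add form_smult comb_closed smC)

lemma form_comb_right: "(\<And>i. i < k \<Longrightarrow> b i \<in> carrier V) \<Longrightarrow> y \<in> carrier V \<Longrightarrow> \<omega> y (comb c b k) = (\<Sum>i<k. c i * \<omega> y (b i))"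
proof -
  assume b: "\<And>i. i < k \<Longrightarrow> b i \<in> carrier V" and y: "y \<in> carrier V"
  have "\<omega> y (comb c b k) = - (\<Sum>i<k. c i * \<omega> (b i) y)"
    using form_skew[OF y comb_closed[OF b]] form_comb[OF b y] by simp
  also have "\<dots> = (\<Sum>i<k. c i * \<omega> y (b i))"
    unfolding sum_negf[symmetric] by (intro sum.cong refl) (use form_skew[OF y b] in simp)
  finally show ?thesis .
qed

definition hyperbolic :: "nat \<Rightarrow> (nat \<Rightarrow> 'v) \<Rightarrow> bool" where
  "hyperbolic k b \<longleftrightarrow> (\<forall>j<2 * k. b j \<in> carrier V) \<and> (\<forall>i<2 * k. \<forall>j<2 * k. \<omega> (b i) (b j) = Jn k i j)"

text \<open>The coordinate at \<open>b j\<close> is read off by its dual vector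
  \<open>b (2k - 1 - j)\<close>, up to the sign of their pairing.\<close>

definition coef :: "nat \<Rightarrow> (nat \<Rightarrow> 'v) \<Rightarrow> nat \<Rightarrow> 'v \<Rightarrow> complex" where
  "coef k b j v = Jn k j (2 * k - 1 - j) * \<omega> v (b (2 * k - 1 - j))"

lemma hyperbolicD: "hyperbolic k b \<Longrightarrow> j < 2 * k \<Longrightarrow> b j \<in> carrier V"
  "hyperbolic k b \<Longrightarrow> i < 2 * k \<Longrightarrow> j < 2 * k \<Longrightarrow> \<omega> (b i) (b j) = Jn k i j"
  by (auto simp: hyperbolic_def)

lemma form_comb_hyperbolic:
  assumes b: "hyperbolic k b" and j: "j < 2 * k"
  shows "\<omega> (comb c b (2 * k)) (b j) = c (2 * k - 1 - j) * Jn k (2 * k - 1 - j) j"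
proof -
  have "\<omega> (comb c b (2 * k)) (b j) = (\<Sum>i<2 * k. c i * \<omega> (b i) (b j))"
    using form_comb[of "2 * k" b "b j" c] hyperbolicD(1)[OF b] j by simp
  also have "\<dots> = (\<Sum>i<2 * k. if i = 2 * k - 1 - j then c i * Jn k i j else 0)"
  proof (intro sum.cong refl)
    fix i assume i: "i \<in> {..<2 * k}"
    have "j \<noteq> 2 * k - 1 - i" if "i \<noteq> 2 * k - 1 - j" using that i j by auto
    then show "c i * \<omega> (b i) (b j) = (if i = 2 * k - 1 - j then c i * Jn k i j else 0)"
      using hyperbolicD(2)[OF b, of i j] i j by (auto simp: Jn_def)
  qed
  also have "\<dots> = c (2 * k - 1 - j) * Jn k (2 * k - 1 - j) j" using j by simp
  finally show ?thesis .
qed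

lemma form_proj:
  assumes b: "hyperbolic k b" and j: "j < 2 * k"
  shows "\<omega> (comb (\<lambda>i. coef k b i v) b (2 * k)) (b j) = \<omega> v (b j)"
proof -
  let ?j = "2 * k - 1 - j"
  have jj: "2 * k - 1 - ?j = j" "?j < 2 * k" using j by auto
  have "Jn k ?j j * Jn k ?j j = 1" using jj by (auto simp: Jn_def)
  then show ?thesis unfolding form_comb_hyperbolic[OF b j] coef_def jj(1) by (simp add: mult_ac)
qed

lemma hyperbolic_indep:
  assumes b: "hyperbolic k b"
  shows "VS.lin_indpt (b ` {..<2 * k})" and "inj_on b {..<2 * k}"
proof -
  show inj: "inj_on b {..<2 * k}"
  proof (rule inj_onI)
    fix i j assume ij: "i \<in> {..<2 * k}" "j \<in> {..<2 * k}" "b i = b j"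
    have i: "2 * k - 1 - i < 2 * k" using ij by auto
    have "Jn k j (2 * k - 1 - i) = Jn k i (2 * k - 1 - i)"
      using hyperbolicD(2)[OF b _ i, of i] hyperbolicD(2)[OF b _ i, of j] ij by simp
    then have "Jn k j (2 * k - 1 - i) \<noteq> 0" using ij by (auto simp: Jn_def split: if_splits)
    then show "i = j" using ij by (auto simp: Jn_def split: if_splits)
  qed
  show "VS.lin_indpt (b ` {..<2 * k})"
  proof (rule VS.finite_lin_indpt2)
    show "b ` {..<2 * k} \<subseteq> carrier V" using hyperbolicD(1)[OF b] by auto
    fix a assume a: "VS.lincomb a (b ` {..<2 * k}) = \<zero>\<^bsub>V\<^esub>"
    have lin: "\<omega> (VS.lincomb a A) y = (\<Sum>v\<in>A. a v * \<omega> v y)" if "finite A" "A \<subseteq> carrier V" "y \<in> carrier V" for A y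
      using that
    proof (induction A rule: finite_induct)
      case empty
      then show ?case by (simp add: VS.lincomb_def form_zero)
    next
      case (insert x A)
      have "VS.lincomb a (insert x A) = a x \<odot>\<^bsub>V\<^esub> x \<oplus>\<^bsub>V\<^esub> VS.lincomb a A"
        unfolding VS.lincomb_def using insert by (intro VS.module.M.finsum_insert) (auto intro!: smC)
      moreover have "VS.lincomb a A \<in> carrier V" unfolding VS.lincomb_def
        by (rule VS.module.M.finsum_closed) (use insert smC in auto)
      ultimately show ?case using insert by (simp add: form_add form_smult smC)
    qed
    show "\<forall>v\<in>b ` {..<2 * k}. a v = \<zero>\<^bsub>complex_ring\<^esub>"
    proof
      fix v assume "v \<in> b ` {..<2 * k}"
      then obtain i where i: "i < 2 * k" "v = b i" by auto
      let ?i = "2 * k - 1 - i"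
      have ii: "?i < 2 * k" using i by auto
      have "0 = (\<Sum>v\<in>b ` {..<2 * k}. a v * \<omega> v (b ?i))"
        using lin[of "b ` {..<2 * k}" "b ?i"] a hyperbolicD(1)[OF b] ii form_zero by auto
      also have "\<dots> = (\<Sum>j<2 * k. a (b j) * \<omega> (b j) (b ?i))" by (simp add: sum.reindex[OF inj])
      also have "\<dots> = (\<Sum>j<2 * k. if j = i then a (b i) * Jn k i ?i else 0)"
      proof (intro sum.cong refl)
        fix j assume j: "j \<in> {..<2 * k}"
        have "?i \<noteq> 2 * k - 1 - j" if "j \<noteq> i" using that i j by auto
        then show "a (b j) * \<omega> (b j) (b ?i) = (if j = i then a (b i) * Jn k i ?i else 0)"
          using hyperbolicD(2)[OF b, of j ?i] j ii by (auto simp: Jn_def)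
      qed
      also have "\<dots> = a (b i) * Jn k i ?i" using i by simp
      finally show "a v = \<zero>\<^bsub>complex_ring\<^esub>" using i by (auto simp: Jn_def split: if_splits)
    qed
  qed auto
qed

lemma hyperbolic_le: "hyperbolic k b \<Longrightarrow> k \<le> n"
  using VS.li_le_dim(2)[OF fin_dim _ hyperbolic_indep(1)[of k b]] hyperbolic_indep(2)[of k b] hyperbolicD(1)[of k b] dim
  by (auto simp: card_image)

text \<open>A step of symplectic Gram-Schmidt: the part of \<open>v\<close> orthogonal to the given
  vectors, together with a normalised orthogonal partner, is a new hyperbolic pair.\<close>

lemma hyperbolic_extend:
  assumes b: "hyperbolic k b" and v: "v \<in> carrier V" "v \<noteq> comb (\<lambda>i. coef k b i v) b (2 * k)"
  shows "\<exists>b'. hyperbolic (Suc k) b'"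
proof -
  define proj where "proj v = comb (\<lambda>i. coef k b i v) b (2 * k)" for v
  have bC: "b j \<in> carrier V" if "j < 2 * k" for j using hyperbolicD(1)[OF b that] .
  have projC: "proj v \<in> carrier V" for v unfolding proj_def by (rule comb_closed) (rule bC)
  define orth where "orth v = v \<oplus>\<^bsub>V\<^esub> (- 1) \<odot>\<^bsub>V\<^esub> proj v" for v
  have orthC: "orth v \<in> carrier V" if "v \<in> carrier V" for v unfolding orth_def by (intro addC smC projC that)
  have o: "\<omega> (orth v) (b j) = 0" if "v \<in> carrier V" "j < 2 * k" for v j
    using that by (simp add: orth_def form_add form_smult smC projC bC) (simp add: proj_def form_proj[OF b])
  have o': "\<omega> (orth v) (proj y) = 0" if "v \<in> carrier V" for v y
    unfolding proj_def using form_comb_right[of "2 * k" b "orth v"] bC orthC[OF that] o[OF that] by simp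
  have "orth v \<noteq> \<zero>\<^bsub>V\<^esub>"
  proof
    assume z: "orth v = \<zero>\<^bsub>V\<^esub>"
    have "v = proj v"
    proof (rule form_inj[OF v(1) projC])
      fix y assume y: "y \<in> carrier V"
      have "0 = \<omega> (orth v) y" using z form_zero[OF y] by simp
      then show "\<omega> v y = \<omega> (proj v) y" using y v(1) by (simp add: orth_def form_add form_smult smC projC)
    qed
    then show False using v(2) by (simp add: proj_def)
  qed
  then obtain y where y: "y \<in> carrier V" "\<omega> (orth v) y \<noteq> 0" using form_nondeg[OF orthC[OF v(1)]] by blast
  define e where "e = orth v"
  define f where "f = inverse (\<omega> e y) \<odot>\<^bsub>V\<^esub> orth y"
  have eC: "e \<in> carrier V" unfolding e_def by (rule orthC[OF v(1)])
  have fC: "f \<in> carrier V" unfolding f_def by (rule smC[OF orthC[OF y(1)]])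
  have eb: "\<omega> e (b j) = 0" "\<omega> f (b j) = 0" if "j < 2 * k" for j
    using o[OF v(1) that] o[OF y(1) that] by (auto simp: e_def f_def form_smult orthC y bC that)
  have be: "\<omega> (b j) e = 0" "\<omega> (b j) f = 0" if "j < 2 * k" for j
    using eb[OF that] form_skew[OF bC[OF that] eC] form_skew[OF bC[OF that] fC] by auto
  have ee: "\<omega> e e = 0" "\<omega> f f = 0" using form_skew[OF eC eC] form_skew[OF fC fC] by (auto simp: eq_neg_iff_add_eq_0)
  have "\<omega> e (orth y) = \<omega> e y" unfolding orth_def[of y]
    using o'[OF v(1), of y] y(1) eC by (simp add: form_add_right form_smult_right smC projC e_def)
  then have ef: "\<omega> e f = 1" using y(2) orthC[OF y(1)] eC by (simp add: f_def form_smult_right e_def)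
  then have fe: "\<omega> f e = - 1" using form_skew[OF fC eC] by simp
  \<comment> \<open>The new pair goes into the middle: there the positions \<open>k\<close> and
    \<open>k + 1\<close> are dual to each other, and the old pairs remain dual.\<close>
  define b' where "b' j = (if j < k then b j else if j = k then e else if j = Suc k then f else b (j - 2))" for j
  have Jb: "Jn (Suc k) i j = (if i \<in> {k, Suc k} \<or> j \<in> {k, Suc k} then (if i = k \<and> j = Suc k then 1 else if i = Suc k \<and> j = k then - 1 else 0)
     else Jn k (if i < k then i else i - 2) (if j < k then j else j - 2))" if "i < 2 * Suc k" "j < 2 * Suc k" for i j
  proof -
    have k: "j = 2 * Suc k - 1 - i \<longleftrightarrow> i + j = 2 * k + 1" using that by arith
    define i' j' where "i' = (if i < k then i else i - 2)" and "j' = (if j < k then j else j - 2)"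
    show ?thesis
    proof (cases "i \<in> {k, Suc k} \<or> j \<in> {k, Suc k}")
      case True
      then show ?thesis using that unfolding Jn_def k by (elim disjE insertE emptyE) simp_all
    next
      case False
      have i': "i < k \<and> i' = i \<or> k + 2 \<le> i \<and> i' + 2 = i" and j': "j < k \<and> j' = j \<or> k + 2 \<le> j \<and> j' + 2 = j"
        using False by (auto simp: i'_def j'_def)
      have i'': "i' < 2 * k" using i' that by auto
      have "j' = 2 * k - 1 - i' \<longleftrightarrow> i' + j' + 1 = 2 * k" using i'' by arith
      also have "\<dots> \<longleftrightarrow> i + j = 2 * k + 1" using i' j' that by (elim disjE conjE; intro iffI; linarith)
      finally have e: "j' = 2 * k - 1 - i' \<longleftrightarrow> i + j = 2 * k + 1" .
      have f: "i' < k \<longleftrightarrow> i < Suc k" using i' that by (elim disjE conjE; intro iffI; linarith)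
      have "Jn (Suc k) i j = Jn k i' j'" unfolding Jn_def k e f using i'' that by simp
      then show ?thesis using False by (simp add: i'_def j'_def)
    qed
  qed
  have "hyperbolic (Suc k) b'"
    unfolding hyperbolic_def
  proof (intro conjI allI impI)
    show "b' j \<in> carrier V" if "j < 2 * Suc k" for j using that bC eC fC by (auto simp: b'_def)
    show "\<omega> (b' i) (b' j) = Jn (Suc k) i j" if ij: "i < 2 * Suc k" "j < 2 * Suc k" for i j
    proof -
      consider "i \<in> {k, Suc k}" "j \<in> {k, Suc k}" | "i \<in> {k, Suc k}" "j \<notin> {k, Suc k}" | "i \<notin> {k, Suc k}" "j \<in> {k, Suc k}"
        | "i \<notin> {k, Suc k}" "j \<notin> {k, Suc k}" by blast
      then show ?thesis
      proof cases
        case 1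
        then show ?thesis unfolding Jb[OF ij] using ee ef fe by (auto simp: b'_def)
      next
        case 2
        have "\<omega> (b' i) (b' j) = 0" using 2 ij eb by (auto simp: b'_def)
        then show ?thesis unfolding Jb[OF ij] using 2 by auto
      next
        case 3
        have "\<omega> (b' i) (b' j) = 0" using 3 ij be by (auto simp: b'_def)
        then show ?thesis unfolding Jb[OF ij] using 3 by auto
      next
        case 4
        let ?i = "if i < k then i else i - 2" and ?j = "if j < k then j else j - 2"
        have "b' i = b ?i" "b' j = b ?j" "?i < 2 * k" "?j < 2 * k" using 4 ij by (auto simp: b'_def)
        then show ?thesis unfolding Jb[OF ij] using 4 hyperbolicD(2)[OF b] by auto
      qed
    qed
  qed
  then show ?thesis by blast
qed

text \<open>A vector outside the span would give a hyperbolic family larger than the dimension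
  allows.\<close>

lemma hyperbolic_expand:
  assumes "hyperbolic n b" "v \<in> carrier V"
  shows "v = comb (\<lambda>i. coef n b i v) b (2 * n)"
  using hyperbolic_extend[OF assms] hyperbolic_le[of "Suc n"] by (metis Suc_n_not_le_n)

text \<open>If no extension existed, the \<open>2k\<close> vectors found so far would span
  \<open>V\<close>, and they are fewer than its dimension.\<close>

lemma hyperbolic_exists: "k \<le> n \<Longrightarrow> \<exists>b. hyperbolic k b"
proof (induction k)
  case 0
  then show ?case by (simp add: hyperbolic_def)
next
  case (Suc k)
  then obtain b where b: "hyperbolic k b" by auto
  let ?A = "b ` {..<2 * k}"
  have A: "?A \<subseteq> carrier V" using hyperbolicD(1)[OF b] by auto
  show ?case
  proof (rule ccontr)
    assume "\<nexists>b. hyperbolic (Suc k) b"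
    then have e: "v = comb (\<lambda>i. coef k b i v) b (2 * k)" if "v \<in> carrier V" for v
      using hyperbolic_extend[OF b that] by blast
    have sub: "submodule complex_ring (VS.span ?A) V" by (rule VS.span_is_submodule[OF A])
    have "comb c b m \<in> VS.span ?A" if "m \<le> 2 * k" for c m
      using that
    proof (induction m)
      case 0
      then show ?case using submodule.zero_closed[OF sub] by simp
    next
      case (Suc m)
      have "b m \<in> VS.span ?A" using VS.in_own_span[OF A] Suc.prems by auto
      then show ?case using Suc submodule.m_closed[OF sub] submodule.smult_closed[OF sub] by simp
    qed
    then have "carrier V \<subseteq> VS.span ?A" using e by (metis order_refl subsetI)
    then have "VS.span ?A = carrier V" using VS.span_is_subset2[OF A] by blast
    then have "VS.dim \<le> card ?A" unfolding VS.dim_def using A by (intro Least_le) blast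
    also have "card ?A \<le> 2 * k" using card_image_le[of "{..<2 * k}" b] by simp
    finally show False using dim Suc.prems by simp
  qed
qed

end

section \<open>Tensor powers\<close>

text \<open>The linear extension of \<open>g\<close>, evaluated at the formal combination
  \<open>f\<close>.\<close>

definition pair_sum :: "('b \<Rightarrow> complex) \<Rightarrow> ('b \<Rightarrow> complex) \<Rightarrow> complex" where
  "pair_sum f g = (\<Sum>x\<in>{x. f x \<noteq> 0}. f x * g x)"

lemma pair_sum_eq: "finite Y \<Longrightarrow> {x. f x \<noteq> 0} \<subseteq> Y \<Longrightarrow> pair_sum f g = (\<Sum>x\<in>Y. f x * g x)"
  unfolding pair_sum_def by (rule sum.mono_neutral_left) auto

lemma pair_sum_add:
  assumes "f \<in> carrier (free_space X)" "g \<in> carrier (free_space X)"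
  shows "pair_sum (f + g) h = pair_sum f h + pair_sum g h"
proof -
  let ?Y = "{x. f x \<noteq> 0} \<union> {x. g x \<noteq> 0}"
  have Y: "finite ?Y" using assms by (auto simp: free_space_simps)
  have "pair_sum (f + g) h = (\<Sum>x\<in>?Y. (f + g) x * h x)" by (rule pair_sum_eq[OF Y]) auto
  also have "\<dots> = (\<Sum>x\<in>?Y. f x * h x) + (\<Sum>x\<in>?Y. g x * h x)"
    by (simp add: distrib_right sum.distrib)
  also have "\<dots> = pair_sum f h + pair_sum g h" using pair_sum_eq[OF Y, of f h] pair_sum_eq[OF Y, of g h] by simp
  finally show ?thesis .
qed

lemma pair_sum_scale:
  assumes "f \<in> carrier (free_space X)"
  shows "pair_sum (\<lambda>x. c * f x) h = c * pair_sum f h"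
proof -
  let ?Y = "{x. f x \<noteq> 0}"
  have Y: "finite ?Y" using assms by (auto simp: free_space_simps)
  have "pair_sum (\<lambda>x. c * f x) h = (\<Sum>x\<in>?Y. c * f x * h x)" by (rule pair_sum_eq[OF Y]) auto
  then show ?thesis by (simp add: pair_sum_def sum_distrib_left mult.assoc)
qed

lemma pair_sum_single: "pair_sum (single x) h = h x"
  using pair_sum_eq[of "{x}" "single x" h] by (auto simp: single_def)

lemma pair_sum_zero: "pair_sum 0 h = 0"
  by (simp add: pair_sum_def)

lemma pair_sum_sum:
  "finite A \<Longrightarrow> (\<And>a. a \<in> A \<Longrightarrow> h a \<in> carrier (free_space X)) \<Longrightarrow>
    pair_sum (\<Sum>a\<in>A. (\<lambda>x. c a * h a x)) g = (\<Sum>a\<in>A. c a * pair_sum (h a) g)"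
proof (induction A rule: finite_induct)
  case (insert a A)
  have 2: "(\<lambda>x. c a * h a x) \<in> carrier (free_space X)"
    by (rule fv.subspace_scale[OF free_space_subspace]) (use insert in simp)
  have 3: "(\<Sum>a\<in>A. (\<lambda>x. c a * h a x)) \<in> carrier (free_space X)"
    by (intro fv.subspace_sum[OF free_space_subspace] fv.subspace_scale[OF free_space_subspace]) (use insert in simp)
  show ?case unfolding sum.insert[OF insert(1,2)] pair_sum_add[OF 2 3]
    using insert pair_sum_scale[of "h a" X "c a" g] by simp
qed (simp add: pair_sum_zero)

lemma span_image_finite:
  assumes "finite A" "y \<in> fv.span (g ` A)"
  shows "\<exists>a. y = (\<Sum>w\<in>A. (\<lambda>x. a w * g w x))"
proof -
  let ?S = "{y. \<exists>a. y = (\<Sum>w\<in>A. (\<lambda>x. a w * g w x))}"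
  have "fv.subspace ?S"
  proof (rule fv.subspaceI)
    show "0 \<in> ?S" by (rule CollectI, rule exI[of _ "\<lambda>_. 0"]) (simp add: fun_eq_iff sum_apply)
    fix x y assume "x \<in> ?S" "y \<in> ?S"
    then obtain a c where "x = (\<Sum>w\<in>A. (\<lambda>x. a w * g w x))" "y = (\<Sum>w\<in>A. (\<lambda>x. c w * g w x))" by blast
    then have "x + y = (\<Sum>w\<in>A. (\<lambda>x. (a w + c w) * g w x))"
      by (simp add: fun_eq_iff sum_apply distrib_right sum.distrib)
    then show "x + y \<in> ?S" by (intro CollectI exI)
  next
    fix d x assume "x \<in> ?S"
    then obtain a where a: "x = (\<Sum>w\<in>A. (\<lambda>x. a w * g w x))" by blast
    have "(\<lambda>i. d * x i) = (\<Sum>w\<in>A. (\<lambda>x. (d * a w) * g w x))"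
      by (rule ext) (simp only: a sum_apply sum_distrib_left mult.assoc)
    then show "(\<lambda>i. d * x i) \<in> ?S" by (intro CollectI exI)
  qed
  moreover have "g ` A \<subseteq> ?S"
  proof (rule image_subsetI, rule CollectI, rule exI)
    fix v assume v: "v \<in> A"
    show "g v = (\<Sum>w\<in>A. (\<lambda>x. (if w = v then 1 else 0) * g w x))"
    proof
      fix x
      have "(\<Sum>w\<in>A. (if w = v then 1 else 0) * g w x) = (\<Sum>w\<in>A. if w = v then g v x else 0)"
        by (intro sum.cong refl) simp
      also have "\<dots> = g v x" using v assms(1) by (simp only: sum.delta if_True)
      finally show "g v x = (\<Sum>w\<in>A. (\<lambda>x. (if w = v then 1 else 0) * g w x)) x" by (simp only: sum_apply)
    qed
  qed
  ultimately show ?thesis using assms(2) fv.span_minimal[of "g ` A" ?S] by blast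
qed

lemma (in coords) h_linear_finsum:
  assumes "finite A" "vectorspace complex_ring L" "\<phi> \<in> linear_maps L M" "\<And>x. x \<in> A \<Longrightarrow> g x \<in> carrier L"
  shows "h (\<phi> (\<Oplus>\<^bsub>L\<^esub>x\<in>A. c x \<odot>\<^bsub>L\<^esub> g x)) i = (\<Sum>x\<in>A. c x * h (\<phi> (g x)) i)"
proof -
  interpret L: vectorspace complex_ring L by (rule assms(2))
  have s: "a \<odot>\<^bsub>L\<^esub> v \<in> carrier L" if "v \<in> carrier L" for a v by (rule L.smult_closed) (use that in auto)
  note \<phi> = linear_mapsD[OF assms(3)]
  show ?thesis using assms(1,4)
  proof (induction A rule: finite_induct)
    case empty
    have "0 \<odot>\<^bsub>L\<^esub> \<zero>\<^bsub>L\<^esub> = \<zero>\<^bsub>L\<^esub>" using L.smult_l_null[of "\<zero>\<^bsub>L\<^esub>"] by simp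
    then have "h (\<phi> \<zero>\<^bsub>L\<^esub>) = (\<lambda>i. 0)" using \<phi>(3)[of "\<zero>\<^bsub>L\<^esub>" 0] h_smult[of "\<phi> \<zero>\<^bsub>L\<^esub>" 0] \<phi>(1)[of "\<zero>\<^bsub>L\<^esub>"] by simp
    then show ?case by simp
  next
    case (insert x A)
    have "(\<Oplus>\<^bsub>L\<^esub>x\<in>insert x A. c x \<odot>\<^bsub>L\<^esub> g x) = c x \<odot>\<^bsub>L\<^esub> g x \<oplus>\<^bsub>L\<^esub> (\<Oplus>\<^bsub>L\<^esub>x\<in>A. c x \<odot>\<^bsub>L\<^esub> g x)"
      using insert by (intro L.M.finsum_insert) (auto intro: s)
    moreover have "(\<Oplus>\<^bsub>L\<^esub>x\<in>A. c x \<odot>\<^bsub>L\<^esub> g x) \<in> carrier L" by (rule L.M.finsum_closed) (use insert s in auto)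
    ultimately show ?case using insert by (simp add: \<phi> s h_add h_smult)
  qed
qed

definition linear_form :: "(complex, 'v) module \<Rightarrow> ('v \<Rightarrow> complex) \<Rightarrow> bool" where
  "linear_form V f \<longleftrightarrow> (\<forall>x\<in>carrier V. \<forall>y\<in>carrier V. f (x \<oplus>\<^bsub>V\<^esub> y) = f x + f y) \<and>
     (\<forall>x\<in>carrier V. \<forall>c. f (c \<odot>\<^bsub>V\<^esub> x) = c * f x)"

definition multilinear :: "(complex, 'v) module \<Rightarrow> nat \<Rightarrow> ('v list \<Rightarrow> complex) \<Rightarrow> bool" where
  "multilinear V N f \<longleftrightarrow> (\<forall>us ws. Suc (length us + length ws) = N \<longrightarrow> set us \<union> set ws \<subseteq> carrier V \<longrightarrow>
     linear_form V (\<lambda>x. f (us @ [x] @ ws)))"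

lemma linear_formI: "(\<And>x y. x \<in> carrier V \<Longrightarrow> y \<in> carrier V \<Longrightarrow> f (x \<oplus>\<^bsub>V\<^esub> y) = f x + f y) \<Longrightarrow>
    (\<And>x c. x \<in> carrier V \<Longrightarrow> f (c \<odot>\<^bsub>V\<^esub> x) = c * f x) \<Longrightarrow> linear_form V f"
  by (simp add: linear_form_def)

lemma linear_formD: "linear_form V f \<Longrightarrow> x \<in> carrier V \<Longrightarrow> y \<in> carrier V \<Longrightarrow> f (x \<oplus>\<^bsub>V\<^esub> y) = f x + f y"
    "linear_form V f \<Longrightarrow> x \<in> carrier V \<Longrightarrow> f (c \<odot>\<^bsub>V\<^esub> x) = c * f x"
  by (simp_all add: linear_form_def)

lemma multilinearD: "multilinear V N f \<Longrightarrow> Suc (length us + length ws) = N \<Longrightarrow> set us \<subseteq> carrier V \<Longrightarrow> set ws \<subseteq> carrier V \<Longrightarrow>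
    linear_form V (\<lambda>x. f (us @ [x] @ ws))"
  by (simp add: multilinear_def)

lemma linear_form_scale: "linear_form V f \<Longrightarrow> linear_form V (\<lambda>x. c * f x)"
  by (simp add: linear_form_def algebra_simps)

lemma linear_form_sum: "(\<And>a. a \<in> A \<Longrightarrow> linear_form V (f a)) \<Longrightarrow> linear_form V (\<lambda>x. \<Sum>a\<in>A. f a x)"
  by (simp add: linear_form_def sum.distrib sum_distrib_left)

lemma tuples_append: "us @ x # ws \<in> tuples V r \<longleftrightarrow>
    Suc (length us + length ws) = r \<and> set us \<subseteq> carrier V \<and> x \<in> carrier V \<and> set ws \<subseteq> carrier V"
  by (auto simp: tuples_def)

lemma free_minus: "f \<in> carrier (free_space X) \<Longrightarrow> g \<in> carrier (free_space X) \<Longrightarrow> f \<ominus>\<^bsub>free_space X\<^esub> g = f - g"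
proof -
  assume f: "f \<in> carrier (free_space X)" and g: "g \<in> carrier (free_space X)"
  have g': "- g \<in> carrier (free_space X)" by (rule fv.subspace_neg[OF free_space_subspace g])
  have "\<ominus>\<^bsub>free_space X\<^esub> g = - g"
    by (rule free.VS.module.M.minus_equality[OF _ g g']) (simp add: free_space_simps fun_eq_iff)
  then show ?thesis by (simp add: a_minus_def free_space_simps fun_eq_iff)
qed

context symp_space
begin

abbreviation "F r \<equiv> free_space (tuples V r)"
abbreviation "T r \<equiv> tensor_power V r"
abbreviation "R r \<equiv> tensor_relations V r"

definition add_rel :: "'v list \<Rightarrow> 'v \<Rightarrow> 'v \<Rightarrow> 'v list \<Rightarrow> 'v list \<Rightarrow> complex" where
  "add_rel us x y ws = single (us @ [x \<oplus>\<^bsub>V\<^esub> y] @ ws) - (single (us @ [x] @ ws) + single (us @ [y] @ ws))"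

definition smult_rel :: "'v list \<Rightarrow> complex \<Rightarrow> 'v \<Rightarrow> 'v list \<Rightarrow> 'v list \<Rightarrow> complex" where
  "smult_rel us c x ws = single (us @ [c \<odot>\<^bsub>V\<^esub> x] @ ws) - (\<lambda>v. c * single (us @ [x] @ ws) v)"

definition rels :: "nat \<Rightarrow> ('v list \<Rightarrow> complex) set" where
  "rels r = {add_rel us x y ws | us x y ws. us @ [x] @ ws \<in> tuples V r \<and> y \<in> carrier V} \<union>
    {smult_rel us c x ws | us c x ws. us @ [x] @ ws \<in> tuples V r}"

lemma tuples_closed:
  assumes "us @ [x] @ ws \<in> tuples V r"
  shows "y \<in> carrier V \<Longrightarrow> us @ [y] @ ws \<in> tuples V r" "y \<in> carrier V \<Longrightarrow> us @ [x \<oplus>\<^bsub>V\<^esub> y] @ ws \<in> tuples V r"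
    "us @ [c \<odot>\<^bsub>V\<^esub> x] @ ws \<in> tuples V r"
  using assms by (auto simp: tuples_append addC smC)

lemma rels_cases:
  assumes "f \<in> rels r"
  obtains (add) us x y ws where "f = add_rel us x y ws" "us @ [x] @ ws \<in> tuples V r" "y \<in> carrier V"
    | (smult) us c x ws where "f = smult_rel us c x ws" "us @ [x] @ ws \<in> tuples V r"
proof -
  from assms show thesis unfolding rels_def
  proof (elim UnE CollectE exE conjE)
    fix us x y ws assume "f = add_rel us x y ws" "us @ [x] @ ws \<in> tuples V r" "y \<in> carrier V"
    then show thesis by (rule add)
  next
    fix us c x ws assume "f = smult_rel us c x ws" "us @ [x] @ ws \<in> tuples V r"
    then show thesis by (rule smult)
  qed
qed

lemma rels_closed: "rels r \<subseteq> carrier (F r)"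
proof
  fix f assume "f \<in> rels r"
  then show "f \<in> carrier (F r)"
  proof (cases rule: rels_cases)
    case 1: (add us x y ws)
    show ?thesis unfolding 1(1) add_rel_def
      by (intro fv.subspace_diff[OF free_space_subspace] fv.subspace_add[OF free_space_subspace] single_free tuples_closed[OF 1(2)] 1)
  next
    case 2: (smult us c x ws)
    show ?thesis unfolding 2(1) smult_rel_def
      by (rule fv.subspace_diff[OF free_space_subspace], rule single_free, rule tuples_closed[OF 2(2)],
        rule fv.subspace_scale[OF free_space_subspace], rule single_free, rule 2(2))
  qed
qed

lemma relations_span: "R r = fv.span (rels r)"
proof -
  have 1: "single (us @ [x \<oplus>\<^bsub>V\<^esub> y] @ ws) \<ominus>\<^bsub>F r\<^esub> (single (us @ [x] @ ws) \<oplus>\<^bsub>F r\<^esub> single (us @ [y] @ ws)) = add_rel us x y ws"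
    if "us @ [x] @ ws \<in> tuples V r" "y \<in> carrier V" for us x y ws
    unfolding add_rel_def free_space_simps(3)
    by (rule free_minus; intro fv.subspace_add[OF free_space_subspace] single_free tuples_closed[OF that(1)] that)
  have 2: "single (us @ [c \<odot>\<^bsub>V\<^esub> x] @ ws) \<ominus>\<^bsub>F r\<^esub> c \<odot>\<^bsub>F r\<^esub> single (us @ [x] @ ws) = smult_rel us c x ws"
    if "us @ [x] @ ws \<in> tuples V r" for us x c ws
    unfolding smult_rel_def free_space_simps(4)
    by (rule free_minus, rule single_free, rule tuples_closed[OF that],
        rule fv.subspace_scale[OF free_space_subspace], rule single_free, rule that)
  have e: "{A p q s t | p q s t. C p q s t} = {B p q s t | p q s t. C p q s t}" if "\<And>p q s t. C p q s t \<Longrightarrow> A p q s t = B p q s t"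
    for C and A B :: "'p \<Rightarrow> 'q \<Rightarrow> 's \<Rightarrow> 't \<Rightarrow> 'z" using that by (intro Collect_cong) metis
  have "R r = vspan (F r) (rels r)"
    unfolding tensor_relations_def Let_def rels_def
    by (rule arg_cong[of _ _ "vspan (F r)"], rule arg_cong2[of _ _ _ _ "(\<union>)"]; rule e) (simp_all only: 1 2)
  then show ?thesis using vspan_free[OF rels_closed] by simp
qed

lemma R_subspace: "fv.subspace (R r)" unfolding relations_span by (rule fv.subspace_span)

lemma R_carrier: "R r \<subseteq> carrier (F r)"
  unfolding relations_span by (rule fv.span_minimal[OF rels_closed free_space_subspace])

text \<open>One half of the universal property: multilinear functions are well defined on
  classes.\<close>

lemma pair_sum_relations:
  assumes g: "multilinear V r g" and f: "f \<in> R r"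
  shows "pair_sum f g = 0"
proof -
  let ?S = "{f \<in> carrier (F r). pair_sum f g = 0}"
  have "fv.subspace ?S"
    by (rule fv.subspaceI) (auto simp: pair_sum_add pair_sum_scale pair_sum_zero
      intro: fv.subspace_0[OF free_space_subspace] fv.subspace_add[OF free_space_subspace] fv.subspace_scale[OF free_space_subspace])
  moreover have "rels r \<subseteq> ?S"
  proof
    fix f assume f: "f \<in> rels r"
    then have "pair_sum f g = 0"
    proof (cases rule: rels_cases)
      case 1: (add us x y ws)
      have d: "f + (single (us @ [x] @ ws) + single (us @ [y] @ ws)) = single (us @ [x \<oplus>\<^bsub>V\<^esub> y] @ ws)"
        unfolding 1(1) add_rel_def by simp
      have c: "single (us @ [x] @ ws) \<in> carrier (F r)" "single (us @ [y] @ ws) \<in> carrier (F r)"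
        by (intro single_free tuples_closed[OF 1(2)] 1(2,3))+
      have "pair_sum f g + (g (us @ [x] @ ws) + g (us @ [y] @ ws)) = g (us @ [x \<oplus>\<^bsub>V\<^esub> y] @ ws)"
        using pair_sum_add[OF subsetD[OF rels_closed f] fv.subspace_add[OF free_space_subspace c], of g]
          pair_sum_add[OF c, of g] unfolding d pair_sum_single by simp
      moreover have "linear_form V (\<lambda>x. g (us @ [x] @ ws))"
        by (rule multilinearD[OF g]) (use 1(2) in \<open>auto simp: tuples_append\<close>)
      ultimately show ?thesis using 1 linear_formD(1)[of V "\<lambda>x. g (us @ [x] @ ws)" x y] by (auto simp: tuples_append)
    next
      case 2: (smult us c x ws)
      have d: "f + (\<lambda>v. c * single (us @ [x] @ ws) v) = single (us @ [c \<odot>\<^bsub>V\<^esub> x] @ ws)"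
        unfolding 2(1) smult_rel_def by simp
      have c: "single (us @ [x] @ ws) \<in> carrier (F r)" by (intro single_free 2(2))
      have "pair_sum f g + c * g (us @ [x] @ ws) = g (us @ [c \<odot>\<^bsub>V\<^esub> x] @ ws)"
        using pair_sum_add[OF subsetD[OF rels_closed f] fv.subspace_scale[OF free_space_subspace c], of c g]
          pair_sum_scale[OF c, of c g] unfolding d pair_sum_single by simp
      moreover have "linear_form V (\<lambda>x. g (us @ [x] @ ws))"
        by (rule multilinearD[OF g]) (use 2(2) in \<open>auto simp: tuples_append\<close>)
      ultimately show ?thesis using 2 linear_formD(2)[of V "\<lambda>x. g (us @ [x] @ ws)" x c] by (auto simp: tuples_append)
    qed
    then show "f \<in> ?S" using rels_closed f by auto
  qed
  ultimately show ?thesis using f fv.span_minimal[of "rels r" ?S] unfolding relations_span by blast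
qed

definition pr :: "'v list \<Rightarrow> 'v list \<Rightarrow> complex" where
  "pr ys vs = prod_list (map2 \<omega> ys vs)"

lemma pr_append: "length us = length us' \<Longrightarrow> pr (us @ ws) (us' @ ws') = pr us us' * pr ws ws'"
  by (simp add: pr_def zip_append)

lemma pr_split: "length us = length us' \<Longrightarrow> pr (us @ [x] @ ws) (us' @ [x'] @ ws') = pr us us' * \<omega> x x' * pr ws ws'"
  by (simp add: pr_append) (simp add: pr_def)

lemma pr_multilinear:
  assumes "ys \<in> tuples V r"
  shows "multilinear V r (pr ys)" "multilinear V r (\<lambda>vs. pr vs ys)"
proof -
  have *: "\<exists>ys1 y ys2. ys = ys1 @ [y] @ ys2 \<and> length ys1 = length us \<and> y \<in> carrier V" if "Suc (length us + length ws) = r" for us ws :: "'v list"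
  proof (intro exI conjI)
    have l: "length us < length ys" using that assms by (auto simp: tuples_def)
    then show "ys = take (length us) ys @ [ys ! length us] @ drop (Suc (length us)) ys" by (simp add: id_take_nth_drop)
    show "length (take (length us) ys) = length us" using l by simp
    show "ys ! length us \<in> carrier V" using l assms by (auto simp: tuples_def)
  qed
  show "multilinear V r (pr ys)" unfolding multilinear_def
  proof (intro allI impI)
    fix us ws :: "'v list" assume "Suc (length us + length ws) = r"
    from *[OF this] obtain ys1 y ys2 where y: "ys = ys1 @ [y] @ ys2" "length ys1 = length us" "y \<in> carrier V" by blast
    show "linear_form V (\<lambda>x. pr ys (us @ [x] @ ws))" unfolding y(1) pr_split[OF y(2)]
      by (rule linear_formI) (simp_all add: form_add_right form_smult_right y(3) algebra_simps)
  qed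
  show "multilinear V r (\<lambda>vs. pr vs ys)" unfolding multilinear_def
  proof (intro allI impI)
    fix us ws :: "'v list" assume "Suc (length us + length ws) = r"
    from *[OF this] obtain ys1 y ys2 where y: "ys = ys1 @ [y] @ ys2" "length ys1 = length us" "y \<in> carrier V" by blast
    show "linear_form V (\<lambda>x. pr (us @ [x] @ ws) ys)" unfolding y(1) pr_split[OF y(2)[symmetric]]
      by (rule linear_formI) (simp_all add: form_add form_smult y(3) algebra_simps)
  qed
qed

end

definition lists_below :: "nat \<Rightarrow> nat \<Rightarrow> nat list set" where
  "lists_below n r = {w. length w = r \<and> set w \<subseteq> {..<2 * n}}"

lemma finite_lists_below: "finite (lists_below n r)"
  unfolding lists_below_def using finite_lists_length_eq[of "{..<2 * n}" r] by (simp add: conj_commute)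

section \<open>Coordinates on tensor powers\<close>

locale symp_basis = symp_space n V \<omega> for n and V :: "(complex, 'v) module" and \<omega> +
  fixes b :: "nat \<Rightarrow> 'v"
  assumes b: "hyperbolic n b"
begin

abbreviation "Wl \<equiv> lists_below n"

definition dl :: "nat \<Rightarrow> nat" where "dl l = 2 * n - 1 - l"

lemma dl: "l < 2 * n \<Longrightarrow> dl l < 2 * n" "l < 2 * n \<Longrightarrow> dl (dl l) = l"
  by (auto simp: dl_def)

lemma Wl_dl: "w \<in> Wl r \<Longrightarrow> map dl w \<in> Wl r" "w \<in> Wl r \<Longrightarrow> map dl (map dl w) = w"
  by (auto simp: lists_below_def subset_iff dl intro: map_idI)

lemma Wl_b: "w \<in> Wl r \<Longrightarrow> map b w \<in> tuples V r"
  using hyperbolicD(1)[OF b] by (auto simp: lists_below_def tuples_def)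

text \<open>The sign in the duality between the basis tensors of \<open>w\<close> and of
  \<open>map dl w\<close>.\<close>

definition eps :: "nat list \<Rightarrow> complex" where
  "eps w = (\<Prod>l\<leftarrow>w. Jn n (dl l) l)"

lemma pr_Jn: "length u = length w \<Longrightarrow> set u \<subseteq> {..<2 * n} \<Longrightarrow> set w \<subseteq> {..<2 * n} \<Longrightarrow>
    pr (map b u) (map b w) = prod_list (map2 (Jn n) u w)"
  by (induction u w rule: list_induct2) (auto simp: pr_def hyperbolicD(2)[OF b])

lemma pr_dual: "u \<in> Wl r \<Longrightarrow> w \<in> Wl r \<Longrightarrow> pr (map b u) (map b w) = (if u = map dl w then eps w else 0)"
proof -
  have *: "prod_list (map2 (Jn n) u w) = (if u = map dl w then eps w else 0)"
    if "length u = length w" "set u \<subseteq> {..<2 * n}" "set w \<subseteq> {..<2 * n}" for u w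
    using that
  proof (induction u w rule: list_induct2)
    case (Cons x u y w)
    have "Jn n x y = 0" if "x \<noteq> dl y" using that Cons by (auto simp: Jn_def dl_def)
    then show ?case using Cons by (auto simp: eps_def)
  qed (simp add: eps_def)
  show "u \<in> Wl r \<Longrightarrow> w \<in> Wl r \<Longrightarrow> ?thesis" using * pr_Jn by (auto simp: lists_below_def)
qed

lemma eps_sq: "w \<in> Wl r \<Longrightarrow> eps w * eps w = 1"
proof -
  have "set w \<subseteq> {..<2 * n} \<Longrightarrow> eps w * eps w = 1"
  proof (induction w)
    case (Cons l w)
    then have "Jn n (dl l) l * Jn n (dl l) l = 1" by (auto simp: Jn_def dl_def)
    moreover have "eps (l # w) * eps (l # w) = (Jn n (dl l) l * Jn n (dl l) l) * (eps w * eps w)" by (simp add: eps_def mult_ac)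
    ultimately show ?case using Cons by simp
  qed (simp add: eps_def)
  then show "w \<in> Wl r \<Longrightarrow> ?thesis" by (simp add: lists_below_def)
qed

text \<open>The arguments are expanded in the basis from left to right; \<open>w\<close> records
  those already replaced.\<close>

lemma single_in_span:
  assumes "set vs \<subseteq> carrier V" "set w \<subseteq> {..<2 * n}" "length w + length vs = r"
  shows "single (map b w @ vs) \<in> fv.span (R r \<union> (\<lambda>w. single (map b w)) ` Wl r)"
  using assms
proof (induction vs arbitrary: w)
  case Nil
  then show ?case by (auto simp: lists_below_def intro!: fv.span_base)
next
  case (Cons x vs)
  let ?S = "fv.span (R r \<union> (\<lambda>w. single (map b w)) ` Wl r)"
  have base: "single (map b w @ [b j] @ vs) \<in> ?S" if "j < 2 * n" for j
    using Cons.IH[of "w @ [j]"] Cons.prems that by simp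
  have tup: "map b w @ [y] @ vs \<in> tuples V r" if "y \<in> carrier V" for y
    using that Cons.prems hyperbolicD(1)[OF b] by (auto simp: tuples_def)
  have rel: "f \<in> ?S" if "f \<in> rels r" for f
    using that fv.span_base[OF that] unfolding relations_span[symmetric] by (blast intro: fv.span_base)
  have "single (map b w @ [comb c b k] @ vs) \<in> ?S" if "k \<le> 2 * n" for c k
    using that
  proof (induction k)
    case 0
    \<comment> \<open>The zero vector is \<open>0\<close> times itself, so a tuple containing it is
      itself a relation.\<close>
    have "smult_rel (map b w) 0 \<zero>\<^bsub>V\<^esub> vs \<in> rels r" using tup[OF zeroC] unfolding rels_def by blast
    moreover have "smult_rel (map b w) 0 \<zero>\<^bsub>V\<^esub> vs = single (map b w @ [\<zero>\<^bsub>V\<^esub>] @ vs)"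
      unfolding smult_rel_def smult_zero[OF zeroC] by (simp add: fun_eq_iff)
    ultimately show ?case using rel by simp
  next
    case (Suc k)
    let ?x = "comb c b k" and ?y = "c k \<odot>\<^bsub>V\<^esub> b k"
    have C: "?x \<in> carrier V" "b k \<in> carrier V" using Suc.prems by (auto intro!: comb_closed hyperbolicD(1)[OF b])
    have 1: "smult_rel (map b w) (c k) (b k) vs \<in> ?S" by (rule rel) (use tup[OF C(2)] in \<open>unfold rels_def, blast\<close>)
    have "single (map b w @ [?y] @ vs) = smult_rel (map b w) (c k) (b k) vs + (\<lambda>v. c k * single (map b w @ [b k] @ vs) v)"
      by (simp add: smult_rel_def)
    then have y: "single (map b w @ [?y] @ vs) \<in> ?S"
      using fv.span_add[OF 1 fv.span_scale[OF base[of k], of "c k"]] Suc.prems by simp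
    have 2: "add_rel (map b w) ?x ?y vs \<in> ?S" by (rule rel) (use tup[OF C(1)] smC[OF C(2)] in \<open>unfold rels_def, blast\<close>)
    have "single (map b w @ [comb c b (Suc k)] @ vs) = add_rel (map b w) ?x ?y vs + (single (map b w @ [?x] @ vs) + single (map b w @ [?y] @ vs))"
      by (simp add: add_rel_def)
    moreover have "single (map b w @ [?x] @ vs) \<in> ?S" using Suc by simp
    ultimately show ?case using fv.span_add[OF 2 fv.span_add[OF _ y]] by (simp only:)
  qed
  from this[of "2 * n" "\<lambda>i. coef n b i x"] show ?case
    using hyperbolic_expand[OF b, of x] Cons.prems by simp
qed

definition \<kappa> :: "nat \<Rightarrow> ('v list \<Rightarrow> complex) \<Rightarrow> nat list \<Rightarrow> complex" where
  "\<kappa> r f u = (if u \<in> Wl r then pair_sum f (pr (map b u)) else 0)"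

lemma \<kappa>_relation: "f \<in> R r \<Longrightarrow> \<kappa> r f = (\<lambda>_. 0)"
  using pair_sum_relations[OF pr_multilinear(1)[OF Wl_b]] by (auto simp: \<kappa>_def)

lemma \<kappa>_linear:
  "f \<in> carrier (F r) \<Longrightarrow> g \<in> carrier (F r) \<Longrightarrow> \<kappa> r (f + g) = (\<lambda>i. \<kappa> r f i + \<kappa> r g i)"
  "f \<in> carrier (F r) \<Longrightarrow> \<kappa> r (\<lambda>x. c * f x) = (\<lambda>i. c * \<kappa> r f i)"
  by (auto simp: \<kappa>_def pair_sum_add pair_sum_scale)

text \<open>Modulo the relations only basis tensors remain, and pairing with the dual word reads off
  their coefficients. Hence the pairings determine a class, as \<open>coord_quot\<close>
  demands.\<close>

lemma tensor_decomp:
  assumes f: "f \<in> carrier (F r)"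
  shows "\<exists>\<rho>\<in>R r. f = \<rho> + (\<Sum>w\<in>Wl r. (\<lambda>x. (eps w * \<kappa> r f (map dl w)) * single (map b w) x))"
proof -
  have "single ` tuples V r \<subseteq> fv.span (R r \<union> (\<lambda>w. single (map b w)) ` Wl r)"
    using single_in_span[of _ "[]" r] by (auto simp: tuples_def)
  then have "f \<in> fv.span (R r \<union> (\<lambda>w. single (map b w)) ` Wl r)"
    using free_in_span[OF f] fv.span_minimal[OF _ fv.subspace_span] by blast
  then obtain \<rho> g where \<rho>: "\<rho> \<in> fv.span (R r)" and g: "g \<in> fv.span ((\<lambda>w. single (map b w)) ` Wl r)" and fg: "f = \<rho> + g"
    unfolding fv.span_Un by blast
  have \<rho>: "\<rho> \<in> R r" using \<rho> fv.span_eq_iff[THEN iffD2, OF R_subspace] by simp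
  obtain a where a: "g = (\<Sum>w\<in>Wl r. (\<lambda>x. a w * single (map b w) x))"
    using span_image_finite[OF finite_lists_below g] by blast
  have c: "single (map b w) \<in> carrier (F r)" if "w \<in> Wl r" for w using Wl_b[OF that] by (rule single_free)
  have gF: "g \<in> carrier (F r)" unfolding a
    by (intro fv.subspace_sum[OF free_space_subspace] fv.subspace_scale[OF free_space_subspace] c)
  have "\<kappa> r f (map dl w) = a w * eps w" if w: "w \<in> Wl r" for w
  proof -
    have "\<kappa> r f (map dl w) = \<kappa> r g (map dl w)"
      unfolding fg using \<kappa>_linear(1)[OF subsetD[OF R_carrier \<rho>] gF] \<kappa>_relation[OF \<rho>] by simp
    also have "\<dots> = (\<Sum>w'\<in>Wl r. a w' * pr (map b (map dl w)) (map b w'))"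
      using Wl_dl[OF w] unfolding \<kappa>_def a by (simp add: pair_sum_sum[OF finite_lists_below c] pair_sum_single)
    also have "\<dots> = (\<Sum>w'\<in>Wl r. if w' = w then a w * eps w else 0)"
    proof (intro sum.cong refl)
      fix w' assume w': "w' \<in> Wl r"
      have "map dl w = map dl w' \<longleftrightarrow> w' = w" using Wl_dl(2)[OF w] Wl_dl(2)[OF w'] by metis
      then show "a w' * pr (map b (map dl w)) (map b w') = (if w' = w then a w * eps w else 0)"
        using pr_dual[OF Wl_dl(1)[OF w] w'] by auto
    qed
    also have "\<dots> = a w * eps w" using w finite_lists_below by simp
    finally show ?thesis .
  qed
  then have "eps w * \<kappa> r f (map dl w) = a w" if "w \<in> Wl r" for w using that eps_sq[OF that] by (simp add: mult_ac)
  then have "g = (\<Sum>w\<in>Wl r. (\<lambda>x. (eps w * \<kappa> r f (map dl w)) * single (map b w) x))" unfolding a by (intro sum.cong refl) simp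
  then show ?thesis using \<rho> fg by blast
qed

sublocale tp: coord_quot "tuples V r" "R r" "\<kappa> r" for r
proof
  show "fv.subspace (R r)" by (rule R_subspace)
  show "R r \<subseteq> carrier (F r)" by (rule R_carrier)
  show "\<kappa> r f = (\<lambda>_. 0) \<longleftrightarrow> f \<in> R r" if f: "f \<in> carrier (F r)" for f
  proof
    assume z: "\<kappa> r f = (\<lambda>_. 0)"
    obtain \<rho> where \<rho>: "\<rho> \<in> R r" "f = \<rho> + (\<Sum>w\<in>Wl r. (\<lambda>x. (eps w * \<kappa> r f (map dl w)) * single (map b w) x))"
      using tensor_decomp[OF f] by blast
    have "f = \<rho>" by (subst \<rho>(2)) (simp add: z fun_eq_iff sum_apply)
    then show "f \<in> R r" using \<rho> by simp
  qed (rule \<kappa>_relation)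
qed (simp_all add: \<kappa>_linear)

lemma T_eq: "tensor_power V r = quot_space (F r) (R r)"
  by (simp add: tensor_power_def)

definition kq :: "nat \<Rightarrow> ('v list \<Rightarrow> complex) set \<Rightarrow> nat list \<Rightarrow> complex" where
  "kq r = elem_image (\<kappa> r)"

sublocale tc: coords "T r" "kq r" for r
  unfolding T_eq kq_def by (rule tp.Q.coords_axioms)

text \<open>The value of a multilinear function \<open>g\<close> at a tensor, written in the basis
  so that no representative has to be chosen.\<close>

definition ev :: "nat \<Rightarrow> ('v list \<Rightarrow> complex) set \<Rightarrow> ('v list \<Rightarrow> complex) \<Rightarrow> complex" where
  "ev r t g = (\<Sum>w\<in>Wl r. eps w * kq r t (map dl w) * g (map b w))"

lemma T_cases: "t \<in> carrier (T r) \<Longrightarrow> \<exists>f\<in>carrier (F r). t = R r +>\<^bsub>F r\<^esub> f"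
  unfolding T_eq tp.carrier_Q by blast

lemma cls_closed: "f \<in> carrier (F r) \<Longrightarrow> R r +>\<^bsub>F r\<^esub> f \<in> carrier (T r)"
  unfolding T_eq tp.carrier_Q by blast

lemma ev_cls:
  assumes f: "f \<in> carrier (F r)" and g: "multilinear V r g"
  shows "ev r (R r +>\<^bsub>F r\<^esub> f) g = pair_sum f g"
proof -
  obtain \<rho> where \<rho>: "\<rho> \<in> R r" "f = \<rho> + (\<Sum>w\<in>Wl r. (\<lambda>x. (eps w * \<kappa> r f (map dl w)) * single (map b w) x))"
    using tensor_decomp[OF f] by blast
  have c: "single (map b w) \<in> carrier (F r)" if "w \<in> Wl r" for w using Wl_b[OF that] by (rule single_free)
  let ?s = "\<Sum>w\<in>Wl r. (\<lambda>x. (eps w * \<kappa> r f (map dl w)) * single (map b w) x)"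
  have s: "?s \<in> carrier (F r)"
    by (intro fv.subspace_sum[OF free_space_subspace] fv.subspace_scale[OF free_space_subspace] c)
  have "pair_sum f g = pair_sum \<rho> g + pair_sum ?s g"
    using pair_sum_add[OF _ s, of \<rho> g] \<rho> R_carrier by auto
  also have "\<dots> = (\<Sum>w\<in>Wl r. (eps w * \<kappa> r f (map dl w)) * g (map b w))"
    by (simp add: pair_sum_relations[OF g \<rho>(1)] pair_sum_sum[OF finite_lists_below c] pair_sum_single)
  finally show ?thesis unfolding ev_def kq_def tp.elem_\<kappa>[OF f] by simp
qed

lemma kq_outside: "t \<in> carrier (T r) \<Longrightarrow> u \<notin> Wl r \<Longrightarrow> kq r t u = 0"
  using T_cases[of t r] by (auto simp: kq_def tp.elem_\<kappa> \<kappa>_def)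

lemma kq_ev: "t \<in> carrier (T r) \<Longrightarrow> u \<in> Wl r \<Longrightarrow> kq r t u = ev r t (pr (map b u))"
  using T_cases[of t r] by (auto simp: kq_def tp.elem_\<kappa> \<kappa>_def ev_cls pr_multilinear Wl_b)

lemma tensor_eq: "vs \<in> tuples V r \<Longrightarrow> tensor V vs = R r +>\<^bsub>F r\<^esub> single vs"
  by (simp add: tensor_def tuples_def)

lemma tensor_closed: "vs \<in> tuples V r \<Longrightarrow> tensor V vs \<in> carrier (T r)"
  by (simp add: tensor_eq cls_closed single_free)

lemma ev_tensor: "vs \<in> tuples V r \<Longrightarrow> multilinear V r g \<Longrightarrow> ev r (tensor V vs) g = g vs"
  by (simp add: tensor_eq ev_cls single_free pair_sum_single)

lemma kq_tensor: "vs \<in> tuples V r \<Longrightarrow> kq r (tensor V vs) u = (if u \<in> Wl r then pr (map b u) vs else 0)"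
  using kq_ev[OF tensor_closed] kq_outside[OF tensor_closed] ev_tensor[OF _ pr_multilinear(1)[OF Wl_b]] by simp

text \<open>The inverse of the coordinate map \<open>kq\<close> on functions supported on
  words.\<close>

definition mk :: "nat \<Rightarrow> (nat list \<Rightarrow> complex) \<Rightarrow> ('v list \<Rightarrow> complex) set" where
  "mk r h = (\<Oplus>\<^bsub>T r\<^esub>w\<in>Wl r. (eps w * h (map dl w)) \<odot>\<^bsub>T r\<^esub> tensor V (map b w))"

lemma mk_closed: "mk r h \<in> carrier (T r)"
  unfolding mk_def by (intro tc.finsum_closed tc.smult_closed tensor_closed Wl_b)

lemma kq_mk: "kq r (mk r h) u = (if u \<in> Wl r then h u else 0)"
proof (cases "u \<in> Wl r")
  case True
  have tb: "tensor V (map b w) \<in> carrier (T r)" if "w \<in> Wl r" for w by (rule tensor_closed[OF Wl_b[OF that]])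
  have "kq r (mk r h) u = (\<Sum>w\<in>Wl r. eps w * h (map dl w) * kq r (tensor V (map b w)) u)"
    unfolding mk_def by (subst tc.h_finsum) (auto simp: finite_lists_below tb tc.smult_closed tc.h_smult)
  also have "\<dots> = (\<Sum>w\<in>Wl r. if w = map dl u then h u else 0)"
  proof (intro sum.cong refl)
    fix w assume w: "w \<in> Wl r"
    have "u = map dl w \<longleftrightarrow> w = map dl u" using Wl_dl(2)[OF True] Wl_dl(2)[OF w] by metis
    then show "eps w * h (map dl w) * kq r (tensor V (map b w)) u = (if w = map dl u then h u else 0)"
      using pr_dual[OF True w] eps_sq[OF w] kq_tensor[OF Wl_b[OF w], of u] True by (auto simp: mult_ac)
  qed
  also have "\<dots> = h u" using Wl_dl[OF True] finite_lists_below by simp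
  finally show ?thesis using True by simp
qed (simp add: kq_outside mk_closed)

lemma mk_kq: "t \<in> carrier (T r) \<Longrightarrow> mk r (kq r t) = t"
  by (rule tc.eqI) (use kq_outside[of t r] in \<open>auto simp: mk_closed kq_mk\<close>)

lemma kq_linear_expand:
  assumes "\<phi> \<in> linear_maps (T r) (T s)" "t \<in> carrier (T r)"
  shows "kq s (\<phi> t) u = (\<Sum>w\<in>Wl r. eps w * kq r t (map dl w) * kq s (\<phi> (tensor V (map b w))) u)"
proof -
  have "kq s (\<phi> (mk r (kq r t))) u = (\<Sum>w\<in>Wl r. eps w * kq r t (map dl w) * kq s (\<phi> (tensor V (map b w))) u)"
    unfolding mk_def
    by (rule tc.h_linear_finsum[OF finite_lists_below tc.is_vectorspace assms(1)]) (rule tensor_closed[OF Wl_b])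
  then show ?thesis by (simp add: mk_kq assms)
qed

end

section \<open>Linear maps as multilinear forms\<close>

context symp_basis
begin

lemma SpD:
  assumes "g \<in> Sp V \<omega>"
  shows "x \<in> carrier V \<Longrightarrow> g x \<in> carrier V"
    and "x \<in> carrier V \<Longrightarrow> y \<in> carrier V \<Longrightarrow> g (x \<oplus>\<^bsub>V\<^esub> y) = g x \<oplus>\<^bsub>V\<^esub> g y"
    and "x \<in> carrier V \<Longrightarrow> g (c \<odot>\<^bsub>V\<^esub> x) = c \<odot>\<^bsub>V\<^esub> g x"
    and "x \<in> carrier V \<Longrightarrow> y \<in> carrier V \<Longrightarrow> \<omega> (g x) (g y) = \<omega> x y"
    and "g ` carrier V = carrier V"
  using assms linear_mapsD[of g V V] by (auto simp: Sp_def bij_betw_def)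

lemma tuples_map: "g \<in> Sp V \<omega> \<Longrightarrow> vs \<in> tuples V r \<Longrightarrow> map g vs \<in> tuples V r"
  using SpD(1)[of g] by (auto simp: tuples_def)

lemma tuples_map_surj:
  assumes "g \<in> Sp V \<omega>" "vs \<in> tuples V r"
  shows "\<exists>us\<in>tuples V r. map g us = vs"
proof
  have "inv_into (carrier V) g x \<in> carrier V" "g (inv_into (carrier V) g x) = x" if "x \<in> carrier V" for x
    using that SpD(5)[OF assms(1)] by (metis inv_into_into, metis f_inv_into_f)
  then show "map (inv_into (carrier V) g) vs \<in> tuples V r" "map g (map (inv_into (carrier V) g) vs) = vs"
    using assms(2) by (auto simp: tuples_def intro!: map_idI)
qed

lemma multilinear_map:
  assumes g: "g \<in> Sp V \<omega>" and f: "multilinear V r f"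
  shows "multilinear V r (\<lambda>vs. f (map g vs))"
  unfolding multilinear_def
proof (intro allI impI)
  fix us ws :: "'v list" assume l: "Suc (length us + length ws) = r" "set us \<union> set ws \<subseteq> carrier V"
  have "linear_form V (\<lambda>x. f (map g us @ [x] @ map g ws))"
    by (rule multilinearD[OF f]) (use l SpD(1)[OF g] in auto)
  then show "linear_form V (\<lambda>x. f (map g (us @ [x] @ ws)))"
    by (auto simp: linear_form_def SpD[OF g])
qed

lemma pr_map: "g \<in> Sp V \<omega> \<Longrightarrow> ys \<in> tuples V r \<Longrightarrow> vs \<in> tuples V r \<Longrightarrow> pr (map g ys) (map g vs) = pr ys vs"
proof -
  assume g: "g \<in> Sp V \<omega>" and "ys \<in> tuples V r" "vs \<in> tuples V r"
  then have "length ys = length vs" "set ys \<subseteq> carrier V" "set vs \<subseteq> carrier V" by (auto simp: tuples_def)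
  then show ?thesis by (induction ys vs rule: list_induct2) (auto simp: pr_def SpD[OF g])
qed

lemma ev_add: "t \<in> carrier (T r) \<Longrightarrow> t' \<in> carrier (T r) \<Longrightarrow> ev r (t \<oplus>\<^bsub>T r\<^esub> t') h = ev r t h + ev r t' h"
  by (simp add: ev_def tc.h_add distrib_left distrib_right sum.distrib)

lemma ev_smult: "t \<in> carrier (T r) \<Longrightarrow> ev r (c \<odot>\<^bsub>T r\<^esub> t) h = c * ev r t h"
  by (simp add: ev_def tc.h_smult sum_distrib_left mult_ac)

lemma ev_cong: "(\<And>vs. vs \<in> tuples V r \<Longrightarrow> h vs = h' vs) \<Longrightarrow> ev r t h = ev r t h'"
  unfolding ev_def using Wl_b by (intro sum.cong refl) simp

lemma ev_linear_form:
  assumes "\<And>vs. vs \<in> tuples V r \<Longrightarrow> linear_form V (\<lambda>x. h x vs)"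
  shows "linear_form V (\<lambda>x. ev r t (h x))"
  unfolding ev_def by (intro linear_form_sum linear_form_scale assms Wl_b)

lemma ev_lin_ext:
  assumes f: "f \<in> carrier (F r)" and \<phi>: "\<And>x. x \<in> tuples V r \<Longrightarrow> \<phi> x \<in> carrier (T r)"
  shows "ev r (lin_ext (T r) \<phi> f) h = pair_sum f (\<lambda>x. ev r (\<phi> x) h)"
proof -
  let ?Y = "{x. f x \<noteq> 0}"
  have Y: "finite ?Y" "?Y \<subseteq> tuples V r" using f by (auto simp: free_space_simps)
  have kq: "kq r (lin_ext (T r) \<phi> f) u = (\<Sum>x\<in>?Y. f x * kq r (\<phi> x) u)" for u
    by (rule tc.h_lin_ext[OF Y(1)]) (use Y(2) \<phi> in auto)
  have "ev r (lin_ext (T r) \<phi> f) h = (\<Sum>w\<in>Wl r. \<Sum>x\<in>?Y. f x * (eps w * kq r (\<phi> x) (map dl w) * h (map b w)))"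
    unfolding ev_def kq by (intro sum.cong refl) (simp add: sum_distrib_left sum_distrib_right mult_ac)
  also have "\<dots> = (\<Sum>x\<in>?Y. \<Sum>w\<in>Wl r. f x * (eps w * kq r (\<phi> x) (map dl w) * h (map b w)))" by (rule sum.swap)
  finally show ?thesis by (simp add: pair_sum_def ev_def sum_distrib_left)
qed

lemma T_eqI: "t \<in> carrier (T r) \<Longrightarrow> t' \<in> carrier (T r) \<Longrightarrow> (\<And>u. u \<in> Wl r \<Longrightarrow> ev r t (pr (map b u)) = ev r t' (pr (map b u))) \<Longrightarrow> t = t'"
proof -
  assume t: "t \<in> carrier (T r)" "t' \<in> carrier (T r)" and e: "\<And>u. u \<in> Wl r \<Longrightarrow> ev r t (pr (map b u)) = ev r t' (pr (map b u))"
  show "t = t'"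
  proof (rule tc.eqI[OF t])
    show "kq r t u = kq r t' u" for u using kq_ev[OF t(1)] kq_ev[OF t(2)] kq_outside[OF t(1)] kq_outside[OF t(2)] e by (cases "u \<in> Wl r") simp_all
  qed
qed

text \<open>A class is determined by the values of multilinear functions. On the transformed tensor
  these are values of \<open>h (map g x)\<close>, which is again multilinear; hence the linear
  extension is constant on cosets.\<close>

lemma tensor_map_cls:
  assumes g: "g \<in> Sp V \<omega>" and f: "f \<in> carrier (F r)"
  shows "tensor_map V r g (R r +>\<^bsub>F r\<^esub> f) = lin_ext (T r) (\<lambda>vs. tensor V (map g vs)) f"
    and "lin_ext (T r) (\<lambda>vs. tensor V (map g vs)) f \<in> carrier (T r)"
proof -
  let ?L = "lin_ext (T r) (\<lambda>vs. tensor V (map g vs))"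
  have c: "tensor V (map g vs) \<in> carrier (T r)" if "vs \<in> tuples V r" for vs
    by (rule tensor_closed[OF tuples_map[OF g that]])
  have L: "?L f \<in> carrier (T r)" if "f \<in> carrier (F r)" for f
    by (rule tc.lin_ext_closed, rule c) (use that in \<open>auto simp: free_space_simps\<close>)
  show "?L f \<in> carrier (T r)" by (rule L[OF f])
  have "elem_image ?L (R r +>\<^bsub>F r\<^esub> f) = ?L f"
  proof (rule elem_image_eq)
    show "R r +>\<^bsub>F r\<^esub> f \<noteq> {}" using tp.cls_self[where f=f] by (metis empty_iff)
    fix f' assume f': "f' \<in> R r +>\<^bsub>F r\<^esub> f"
    then have f'F: "f' \<in> carrier (F r)" by (rule tp.cls_sub[OF f])
    from f' obtain \<rho> where \<rho>: "\<rho> \<in> R r" "f' = \<rho> + f" unfolding tp.cls_eq by blast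
    have "pair_sum f' h = pair_sum f h" if "multilinear V r h" for h
      unfolding \<rho>(2) using pair_sum_add[OF subsetD[OF R_carrier \<rho>(1)] f] pair_sum_relations[OF that \<rho>(1)] by simp
    moreover have "pair_sum f (\<lambda>x. ev r (tensor V (map g x)) h) = pair_sum f (\<lambda>x. h (map g x))"
      if "f \<in> carrier (F r)" "multilinear V r h" for f h unfolding pair_sum_def
      by (intro sum.cong refl arg_cong2[of _ _ _ _ "(*)"] ev_tensor[OF tuples_map[OF g]] that(2)) (use that(1) in \<open>auto simp: free_space_simps\<close>)
    ultimately have "ev r (?L f') h = ev r (?L f) h" if "multilinear V r h" for h
      using ev_lin_ext[where \<phi>="\<lambda>vs. tensor V (map g vs)" and h=h, OF f c]
        ev_lin_ext[where \<phi>="\<lambda>vs. tensor V (map g vs)" and h=h, OF f'F c] that multilinear_map[OF g] f f'F by simp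
    then show "?L f' = ?L f" using T_eqI[OF L[OF f'F] L[OF f]] pr_multilinear(1)[OF Wl_b] by blast
  qed
  then show "tensor_map V r g (R r +>\<^bsub>F r\<^esub> f) = ?L f" by (simp add: tensor_map_def elem_image_def)
qed

lemma tensor_map_closed: "g \<in> Sp V \<omega> \<Longrightarrow> t \<in> carrier (T r) \<Longrightarrow> tensor_map V r g t \<in> carrier (T r)"
  using T_cases[of t r] tensor_map_cls by auto

lemma ev_tensor_map:
  assumes g: "g \<in> Sp V \<omega>" and t: "t \<in> carrier (T r)" and h: "multilinear V r h"
  shows "ev r (tensor_map V r g t) h = ev r t (\<lambda>vs. h (map g vs))"
proof -
  obtain f where f: "f \<in> carrier (F r)" "t = R r +>\<^bsub>F r\<^esub> f" using T_cases[OF t] by blast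
  have "ev r (tensor_map V r g t) h = pair_sum f (\<lambda>x. ev r (tensor V (map g x)) h)"
    unfolding f(2) tensor_map_cls[OF g f(1)] by (rule ev_lin_ext[OF f(1)]) (rule tensor_closed[OF tuples_map[OF g]])
  also have "\<dots> = pair_sum f (\<lambda>x. h (map g x))" unfolding pair_sum_def
    by (intro sum.cong refl arg_cong2[of _ _ _ _ "(*)"] ev_tensor[OF tuples_map[OF g]] h) (use f(1) in \<open>auto simp: free_space_simps\<close>)
  also have "\<dots> = ev r t (\<lambda>vs. h (map g vs))" unfolding f(2) by (rule ev_cls[OF f(1) multilinear_map[OF g h], symmetric])
  finally show ?thesis .
qed

lemma tensor_map_tensor:
  assumes "g \<in> Sp V \<omega>" "vs \<in> tuples V r"
  shows "tensor_map V r g (tensor V vs) = tensor V (map g vs)"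
  by (rule T_eqI[of _ r])
    (simp_all add: tensor_map_closed tensor_closed tuples_map assms ev_tensor_map pr_multilinear Wl_b ev_tensor multilinear_map)

lemma tensor_map_linear:
  assumes g: "g \<in> Sp V \<omega>"
  shows "tensor_map V r g \<in> linear_maps (T r) (T r)"
proof (rule linear_mapsI)
  fix x y c assume x: "x \<in> carrier (T r)"
  show "tensor_map V r g x \<in> carrier (T r)" by (rule tensor_map_closed[OF g x])
  show "tensor_map V r g (c \<odot>\<^bsub>T r\<^esub> x) = c \<odot>\<^bsub>T r\<^esub> tensor_map V r g x"
    by (rule T_eqI[of _ r]) (simp_all add: tensor_map_closed g x ev_tensor_map pr_multilinear Wl_b tc.smult_closed ev_smult)
  assume y: "y \<in> carrier (T r)"
  show "tensor_map V r g (x \<oplus>\<^bsub>T r\<^esub> y) = tensor_map V r g x \<oplus>\<^bsub>T r\<^esub> tensor_map V r g y"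
    by (rule T_eqI[of _ r]) (simp_all add: tensor_map_closed g x y ev_tensor_map pr_multilinear Wl_b tc.add_closed ev_add)
qed

lemma tensor_linear:
  assumes "Suc (length us + length ws) = r" "set us \<subseteq> carrier V" "set ws \<subseteq> carrier V" "x \<in> carrier V"
  shows "y \<in> carrier V \<Longrightarrow> tensor V (us @ [x \<oplus>\<^bsub>V\<^esub> y] @ ws) = tensor V (us @ [x] @ ws) \<oplus>\<^bsub>T r\<^esub> tensor V (us @ [y] @ ws)"
    and "tensor V (us @ [c \<odot>\<^bsub>V\<^esub> x] @ ws) = c \<odot>\<^bsub>T r\<^esub> tensor V (us @ [x] @ ws)"
proof -
  have t: "us @ [y] @ ws \<in> tuples V r" if "y \<in> carrier V" for y using assms that by (simp add: tuples_append)
  note lf = linear_formD[OF multilinearD[OF pr_multilinear(1)[OF Wl_b] assms(1-3)]]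
  show "tensor V (us @ [x \<oplus>\<^bsub>V\<^esub> y] @ ws) = tensor V (us @ [x] @ ws) \<oplus>\<^bsub>T r\<^esub> tensor V (us @ [y] @ ws)" if y: "y \<in> carrier V"
    using tensor_closed[OF t[OF assms(4)]] tensor_closed[OF t[OF y]] tensor_closed[OF t[OF addC[OF assms(4) y]]] lf(1)[OF _ assms(4) y]
    by (intro T_eqI[of _ r]) (simp_all only: ev_add tc.add_closed ev_tensor[OF t] addC assms(4) y pr_multilinear(1)[OF Wl_b])
  show "tensor V (us @ [c \<odot>\<^bsub>V\<^esub> x] @ ws) = c \<odot>\<^bsub>T r\<^esub> tensor V (us @ [x] @ ws)"
    using tensor_closed[OF t[OF assms(4)]] tensor_closed[OF t[OF smC[OF assms(4)]]] lf(2)[OF _ assms(4)]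
    by (intro T_eqI[of _ r]) (simp_all only: ev_smult tc.smult_closed ev_tensor[OF t] smC assms(4) pr_multilinear(1)[OF Wl_b])
qed

text \<open>A linear map \<open>T r \<rightarrow> T s\<close> is recorded as a multilinear form in \<open>s + r\<close> arguments; the \<open>r\<close> arguments
  of the source come last and in reversed order, matching the enumeration of the points of a diagram.\<close>

definition Bw :: "nat \<Rightarrow> (('v list \<Rightarrow> complex) set \<Rightarrow> ('v list \<Rightarrow> complex) set) \<Rightarrow> 'v list \<Rightarrow> complex" where
  "Bw s \<phi> xs = ev s (\<phi> (tensor V (rev (drop s xs)))) (pr (take s xs))"

lemma tuples_take_drop: "xs \<in> tuples V (s + r) \<Longrightarrow> take s xs \<in> tuples V s"
    "xs \<in> tuples V (s + r) \<Longrightarrow> rev (drop s xs) \<in> tuples V r"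
  by (auto simp: tuples_def dest: in_set_takeD in_set_dropD)

lemma Bw_multilinear:
  assumes \<phi>: "\<phi> \<in> linear_maps (T r) (T s)"
  shows "multilinear V (s + r) (Bw s \<phi>)"
  unfolding multilinear_def
proof (intro allI impI)
  fix us ws :: "'v list" assume l: "Suc (length us + length ws) = s + r" "set us \<union> set ws \<subseteq> carrier V"
  show "linear_form V (\<lambda>x. Bw s \<phi> (us @ [x] @ ws))"
  proof (cases "length us < s")
    case True
    define ws1 ws2 where "ws1 = take (s - 1 - length us) ws" and "ws2 = drop (s - 1 - length us) ws"
    have ws: "ws = ws1 @ ws2" "Suc (length us + length ws1) = s" using l True by (auto simp: ws1_def ws2_def)
    have e: "Bw s \<phi> (us @ [x] @ ws) = ev s (\<phi> (tensor V (rev ws2))) (pr (us @ [x] @ ws1))" for x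
    proof -
      have "us @ [x] @ ws = (us @ [x] @ ws1) @ ws2" "length (us @ [x] @ ws1) = s" using ws by auto
      then have "take s (us @ [x] @ ws) = us @ [x] @ ws1" "drop s (us @ [x] @ ws) = ws2" by (metis append_eq_conv_conj)+
      then show ?thesis by (simp only: Bw_def)
    qed
    show ?thesis unfolding e
      by (rule ev_linear_form, rule multilinearD[OF pr_multilinear(2)]) (use ws l in auto)
  next
    case False
    define us1 us2 where "us1 = take s us" and "us2 = drop s us"
    have us: "us = us1 @ us2" "length us1 = s" using False by (auto simp: us1_def us2_def)
    have e: "Bw s \<phi> (us @ [x] @ ws) = ev s (\<phi> (tensor V (rev ws @ [x] @ rev us2))) (pr us1)" for x
    proof -
      have "us @ [x] @ ws = us1 @ (us2 @ [x] @ ws)" using us by auto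
      then have "take s (us @ [x] @ ws) = us1" "drop s (us @ [x] @ ws) = us2 @ [x] @ ws" using us(2) by (metis append_eq_conv_conj)+
      then show ?thesis by (simp add: Bw_def)
    qed
    have C: "Suc (length (rev ws) + length (rev us2)) = r" "set (rev ws) \<subseteq> carrier V" "set (rev us2) \<subseteq> carrier V"
      using l us by auto
    have t: "tensor V (rev ws @ [x] @ rev us2) \<in> carrier (T r)" if "x \<in> carrier V" for x
      by (rule tensor_closed) (use C that in \<open>simp add: tuples_append\<close>)
    show ?thesis unfolding e
      by (rule linear_formI)
        (simp_all only: tensor_linear[OF C] linear_mapsD[OF \<phi>] t ev_add ev_smult)
  qed
qed

lemma equivariant_Bw:
  assumes \<phi>: "\<phi> \<in> equivariant_maps V \<omega> r s" and g: "g \<in> Sp V \<omega>" and xs: "xs \<in> tuples V (s + r)"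
  shows "Bw s \<phi> (map g xs) = Bw s \<phi> xs"
proof -
  have \<phi>l: "\<phi> \<in> linear_maps (T r) (T s)" using \<phi> by (simp add: equivariant_maps_def)
  let ?vs = "rev (drop s xs)" and ?us = "take s xs"
  have vs: "?vs \<in> tuples V r" and us: "?us \<in> tuples V s" by (rule tuples_take_drop[OF xs])+
  have "\<phi> (tensor V (map g ?vs)) = tensor_map V s g (\<phi> (tensor V ?vs))"
    unfolding tensor_map_tensor[OF g vs, symmetric] using \<phi> g tensor_closed[OF vs] unfolding equivariant_maps_def by blast
  then have "Bw s \<phi> (map g xs) = ev s (tensor_map V s g (\<phi> (tensor V ?vs))) (pr (map g ?us))"
    by (simp add: Bw_def take_map drop_map rev_map)
  also have "\<dots> = ev s (\<phi> (tensor V ?vs)) (\<lambda>ws. pr (map g ?us) (map g ws))"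
    by (rule ev_tensor_map[OF g linear_mapsD(1)[OF \<phi>l tensor_closed[OF vs]]]) (rule pr_multilinear(1)[OF tuples_map[OF g us]])
  also have "\<dots> = Bw s \<phi> xs" unfolding Bw_def by (rule ev_cong) (rule pr_map[OF g us])
  finally show ?thesis .
qed

text \<open>Equivariance is tested on basis tensors and against basis words, where it is the
  invariance of \<open>Bw\<close>.\<close>

lemma Bw_equivariant:
  assumes \<phi>: "\<phi> \<in> linear_maps (T r) (T s)" "\<phi> \<in> extensional (carrier (T r))"
    and inv: "\<And>g xs. g \<in> Sp V \<omega> \<Longrightarrow> xs \<in> tuples V (s + r) \<Longrightarrow> Bw s \<phi> (map g xs) = Bw s \<phi> xs"
  shows "\<phi> \<in> equivariant_maps V \<omega> r s"
proof -
  have "\<phi> (tensor_map V r g t) = tensor_map V s g (\<phi> t)" if g: "g \<in> Sp V \<omega>" and t: "t \<in> carrier (T r)" for g t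
  proof -
    note \<phi>l = linear_mapsD[OF \<phi>(1)]
    note gl = linear_mapsD[OF tensor_map_linear[OF g]]
    have l: "(\<lambda>t. \<phi> (tensor_map V r g t)) \<in> linear_maps (T r) (T s)" "(\<lambda>t. tensor_map V s g (\<phi> t)) \<in> linear_maps (T r) (T s)"
      by (rule linear_mapsI; simp only: \<phi>l gl)+
    have "kq s (\<phi> (tensor_map V r g (tensor V (map b w)))) u = kq s (tensor_map V s g (\<phi> (tensor V (map b w)))) u"
      if w: "w \<in> Wl r" and u: "u \<in> Wl s" for w u
    proof -
      let ?vs = "map b w"
      have vs: "?vs \<in> tuples V r" by (rule Wl_b[OF w])
      \<comment> \<open>The basis word is written as an image under \<open>g\<close>, so that
        \<open>g\<close> acts on all arguments of \<open>Bw\<close> at once.\<close>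
      obtain us where us: "us \<in> tuples V s" "map g us = map b u" using tuples_map_surj[OF g Wl_b[OF u]] by blast
      have xs: "us @ rev ?vs \<in> tuples V (s + r)" "length us = s" using us vs by (auto simp: tuples_def)
      have "kq s (\<phi> (tensor_map V r g (tensor V ?vs))) u = ev s (\<phi> (tensor V (map g ?vs))) (pr (map g us))"
        unfolding tensor_map_tensor[OF g vs] us(2)
        by (rule kq_ev[OF \<phi>l(1)[OF tensor_closed[OF tuples_map[OF g vs]]] u])
      also have "\<dots> = Bw s \<phi> (map g (us @ rev ?vs))" using xs(2) by (simp add: Bw_def rev_map)
      also have "\<dots> = Bw s \<phi> (us @ rev ?vs)" by (rule inv[OF g xs(1)])
      also have "\<dots> = ev s (\<phi> (tensor V ?vs)) (pr us)" using xs(2) by (simp add: Bw_def)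
      also have "\<dots> = ev s (\<phi> (tensor V ?vs)) (\<lambda>ws. pr (map g us) (map g ws))"
        by (rule ev_cong) (rule pr_map[OF g us(1), symmetric])
      also have "\<dots> = ev s (tensor_map V s g (\<phi> (tensor V ?vs))) (pr (map g us))"
        by (rule ev_tensor_map[OF g \<phi>l(1)[OF tensor_closed[OF vs]], symmetric]) (rule pr_multilinear(1)[OF tuples_map[OF g us(1)]])
      also have "\<dots> = kq s (tensor_map V s g (\<phi> (tensor V ?vs))) u"
        unfolding us(2) by (rule kq_ev[OF tensor_map_closed[OF g \<phi>l(1)[OF tensor_closed[OF vs]]] u, symmetric])
      finally show ?thesis .
    qed
    then have "kq s (\<phi> (tensor_map V r g t)) u = kq s (tensor_map V s g (\<phi> t)) u" if "u \<in> Wl s" for u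
      unfolding kq_linear_expand[OF l(1) t] kq_linear_expand[OF l(2) t] using that by (intro sum.cong refl) simp
    moreover have "kq s (\<phi> (tensor_map V r g t)) u = kq s (tensor_map V s g (\<phi> t)) u" if "u \<notin> Wl s" for u
      using kq_outside[OF _ that] linear_mapsD(1)[OF l(1) t] linear_mapsD(1)[OF l(2) t] by simp
    ultimately show ?thesis
      by (intro tc.eqI[OF linear_mapsD(1)[OF l(1) t] linear_mapsD(1)[OF l(2) t]]) blast
  qed
  then show ?thesis using \<phi> by (simp add: equivariant_maps_def)
qed

lemma multilinear_determined:
  assumes "multilinear V N f" "multilinear V N f'" "\<And>w. w \<in> Wl N \<Longrightarrow> f (map b w) = f' (map b w)" "xs \<in> tuples V N"
  shows "f xs = f' xs"
proof -
  have "ev N (tensor V xs) f = ev N (tensor V xs) f'" unfolding ev_def using assms(3) by (intro sum.cong refl) simp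
  then show ?thesis using ev_tensor[OF assms(4)] assms(1,2) by simp
qed

section \<open>Matrices of linear maps between tensor powers\<close>

definition Tm :: "nat \<Rightarrow> nat \<Rightarrow> (('v list \<Rightarrow> complex) set \<Rightarrow> ('v list \<Rightarrow> complex) set) \<Rightarrow> nat list \<Rightarrow> complex" where
  "Tm r s \<phi> xs = (if xs \<in> Wl (s + r) then kq s (\<phi> (tensor V (map b (rev (drop s xs))))) (take s xs) else 0)"

lemma Wl_append: "u \<in> Wl s \<Longrightarrow> w \<in> Wl r \<Longrightarrow> u @ rev w \<in> Wl (s + r)"
  by (auto simp: lists_below_def)

lemma Wl_split: "xs \<in> Wl (s + r) \<Longrightarrow> take s xs \<in> Wl s" "xs \<in> Wl (s + r) \<Longrightarrow> rev (drop s xs) \<in> Wl r"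
  by (auto simp: lists_below_def subset_iff dest: in_set_takeD in_set_dropD)

lemma Tm_append: "u \<in> Wl s \<Longrightarrow> w \<in> Wl r \<Longrightarrow> Tm r s \<phi> (u @ rev w) = kq s (\<phi> (tensor V (map b w))) u"
  using Wl_append[of u s w r] by (auto simp: Tm_def lists_below_def)

lemma Tm_Bw:
  assumes "\<phi> \<in> linear_maps (T r) (T s)" "xs \<in> Wl (s + r)"
  shows "Tm r s \<phi> xs = Bw s \<phi> (map b xs)"
  using kq_ev[OF linear_mapsD(1)[OF assms(1) tensor_closed[OF Wl_b[OF Wl_split(2)[OF assms(2)]]]] Wl_split(1)[OF assms(2)]] assms(2)
  by (simp add: Tm_def Bw_def take_map drop_map rev_map)

lemma Tm_inj:
  assumes \<phi>: "\<phi> \<in> linear_maps (T r) (T s)" "\<phi> \<in> extensional (carrier (T r))"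
    and \<psi>: "\<psi> \<in> linear_maps (T r) (T s)" "\<psi> \<in> extensional (carrier (T r))" and e: "Tm r s \<phi> = Tm r s \<psi>"
  shows "\<phi> = \<psi>"
proof (rule extensionalityI[OF \<phi>(2) \<psi>(2)])
  fix t assume t: "t \<in> carrier (T r)"
  show "\<phi> t = \<psi> t"
  proof (rule tc.eqI[OF linear_mapsD(1)[OF \<phi>(1) t] linear_mapsD(1)[OF \<psi>(1) t]])
    fix u show "kq s (\<phi> t) u = kq s (\<psi> t) u"
    proof (cases "u \<in> Wl s")
      case True
      show ?thesis unfolding kq_linear_expand[OF \<phi>(1) t] kq_linear_expand[OF \<psi>(1) t]
        by (intro sum.cong refl) (use Tm_append[OF True] e in metis)
    next
      case False
      then show ?thesis using kq_outside[OF linear_mapsD(1)[OF \<phi>(1) t]] kq_outside[OF linear_mapsD(1)[OF \<psi>(1) t]] by simp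
    qed
  qed
qed

definition mkmap :: "nat \<Rightarrow> nat \<Rightarrow> (nat list \<Rightarrow> complex) \<Rightarrow> ('v list \<Rightarrow> complex) set \<Rightarrow> ('v list \<Rightarrow> complex) set" where
  "mkmap r s X = (\<lambda>t\<in>carrier (T r). mk s (\<lambda>u. \<Sum>w\<in>Wl r. eps w * kq r t (map dl w) * X (u @ rev w)))"

lemma mkmap_extensional: "mkmap r s X \<in> extensional (carrier (T r))"
  by (simp add: mkmap_def)

lemma mkmap_linear: "mkmap r s X \<in> linear_maps (T r) (T s)"
proof (rule linear_mapsI)
  fix x y c assume x: "x \<in> carrier (T r)"
  show "mkmap r s X x \<in> carrier (T s)" by (simp add: mkmap_def x mk_closed)
  show "mkmap r s X (c \<odot>\<^bsub>T r\<^esub> x) = c \<odot>\<^bsub>T s\<^esub> mkmap r s X x"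
    by (rule tc.eqI[of _ s])
      (simp_all add: mkmap_def x tc.smult_closed mk_closed kq_mk tc.h_smult sum_distrib_left mult_ac)
  assume y: "y \<in> carrier (T r)"
  show "mkmap r s X (x \<oplus>\<^bsub>T r\<^esub> y) = mkmap r s X x \<oplus>\<^bsub>T s\<^esub> mkmap r s X y"
    by (rule tc.eqI[of _ s])
      (simp_all add: mkmap_def x y tc.add_closed mk_closed kq_mk tc.h_add distrib_left distrib_right sum.distrib)
qed

lemma Tm_mkmap: "xs \<in> Wl (s + r) \<Longrightarrow> Tm r s (mkmap r s X) xs = X xs"
proof -
  assume xs: "xs \<in> Wl (s + r)"
  let ?u = "take s xs" and ?w = "rev (drop s xs)"
  have u: "?u \<in> Wl s" and w: "?w \<in> Wl r" by (rule Wl_split[OF xs])+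
  have e: "xs = ?u @ rev ?w" by simp
  have "Tm r s (mkmap r s X) xs = kq s (mkmap r s X (tensor V (map b ?w))) ?u"
    by (subst e, rule Tm_append[OF u w])
  also have "\<dots> = (\<Sum>w'\<in>Wl r. eps w' * kq r (tensor V (map b ?w)) (map dl w') * X (?u @ rev w'))"
    using tensor_closed[OF Wl_b[OF w]] u by (simp add: mkmap_def kq_mk)
  also have "\<dots> = (\<Sum>w'\<in>Wl r. if w' = ?w then X (?u @ rev ?w) else 0)"
  proof (intro sum.cong refl)
    fix w' assume w': "w' \<in> Wl r"
    have "map dl w' = map dl ?w \<longleftrightarrow> w' = ?w" using Wl_dl(2)[OF w] Wl_dl(2)[OF w'] by metis
    then have "kq r (tensor V (map b ?w)) (map dl w') = (if w' = ?w then eps ?w else 0)"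
      using kq_tensor[OF Wl_b[OF w]] pr_dual[OF Wl_dl(1)[OF w'] w] Wl_dl(1)[OF w'] by simp
    then show "eps w' * kq r (tensor V (map b ?w)) (map dl w') * X (?u @ rev w') = (if w' = ?w then X (?u @ rev ?w) else 0)"
      using eps_sq[OF w'] by auto
  qed
  also have "\<dots> = X (?u @ rev ?w)" using w finite_lists_below by (simp only: sum.delta if_True)
  finally show ?thesis by simp
qed

text \<open>The middle tensor is expanded in the basis; the dual letters and signs of this expansion
  are those of the contraction in \<open>diagram_comp_glue\<close>.\<close>

lemma Tm_compose:
  assumes "\<phi> \<in> linear_maps (T r) (T s)" "\<psi> \<in> linear_maps (T s) (T t)" "v \<in> Wl t" "w \<in> Wl r"
  shows "Tm r t (compose (carrier (T r)) \<psi> \<phi>) (v @ rev w) =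
    (\<Sum>u\<in>Wl s. eps u * Tm r s \<phi> (map dl u @ rev w) * Tm s t \<psi> (v @ rev u))"
proof -
  have tw: "tensor V (map b w) \<in> carrier (T r)" by (rule tensor_closed[OF Wl_b[OF assms(4)]])
  have "Tm r t (compose (carrier (T r)) \<psi> \<phi>) (v @ rev w) = kq t (\<psi> (\<phi> (tensor V (map b w)))) v"
    unfolding Tm_append[OF assms(3,4)] by (simp add: compose_def tw)
  also have "\<dots> = (\<Sum>u\<in>Wl s. eps u * Tm r s \<phi> (map dl u @ rev w) * Tm s t \<psi> (v @ rev u))"
    unfolding kq_linear_expand[OF assms(2) linear_mapsD(1)[OF assms(1) tw]]
    by (intro sum.cong refl) (simp only: Tm_append assms(3,4) Wl_dl)
  finally show ?thesis .
qed

text \<open>Coordinates are pairings, so the identity has the matrix of the form and not the unit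
  matrix, in agreement with the strands of the identity diagram.\<close>

lemma Tm_id:
  assumes "v \<in> Wl r" "w \<in> Wl r"
  shows "Tm r r (\<lambda>t\<in>carrier (T r). t) (v @ rev w) = prod_list (map2 (Jn n) v w)"
  unfolding Tm_append[OF assms] using tensor_closed[OF Wl_b[OF assms(2)]] kq_tensor[OF Wl_b[OF assms(2)], of v] assms pr_Jn[of v w]
  by (simp add: lists_below_def)

end

section \<open>Symplectic invariance\<close>

lemma P_form_cong:
  assumes J: "\<And>a b. J a b = - J b a" "\<And>a b. J' a b = - J' b a" and Z: "finite Z" "perfect_matching Z z"
    and e: "\<And>p q. p \<in> Z \<Longrightarrow> q \<in> Z \<Longrightarrow> J (w p) (w q) = J' (w' p) (w' q)"
  shows "P J z w = P J' z w'"
proof -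
  obtain l where l: "distinct (flat l)" "match_of l = z" "set (flat l) = Z"
    using perfect_matching_list Z by metis
  have *: "J (w (fst e)) (w (snd e)) = J' (w' (fst e)) (w' (snd e))" if "e \<in> set l" for e
  proof -
    have "{fst e, snd e} \<subseteq> \<Union> (match_of l)" using that by (auto simp: match_of_def)
    then have "{fst e, snd e} \<subseteq> Z" using perfect_matching_Union[OF Z(2)] l(2) by simp
    then show ?thesis using e by simp
  qed
  have "map (\<lambda>e. J (w (fst e)) (w (snd e))) l = map (\<lambda>e. J' (w' (fst e)) (w' (snd e))) l"
    by (intro map_cong refl *)
  then have "pval J l w = pval J' l w'" unfolding pval_def by (simp only:)
  then show ?thesis using P_eq[of J, OF J(1) l(1) l(2)[symmetric]] P_eq[of J', OF J(2) l(1) l(2)[symmetric]] by simp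
qed

lemma two_powi_eq_1: "(2 :: complex) powi m = 1 \<Longrightarrow> m = 0"
proof -
  assume "(2 :: complex) powi m = 1"
  then have "(2 :: real) powi m = 1" using norm_power_int[of "2 :: complex" m] by simp
  moreover have "(2 :: real) powi m > 1" if "m > 0" using that by (simp add: power_int_def)
  moreover have "(2 :: real) powi m < 1" if "m < 0"
    using that power_strict_decreasing[of 0 "nat (- m)" "1 / 2 :: real"] by (simp add: power_int_def)
  ultimately show "m = 0" by (metis less_irrefl linorder_neqE)
qed

definition PL :: "nat \<Rightarrow> nat \<Rightarrow> nat set set \<Rightarrow> nat list \<Rightarrow> complex" where
  "PL n N m xs = (if xs \<in> lists_below n N then P (Jn n) m (\<lambda>p. xs ! p) else 0)"

abbreviation form_span :: "nat \<Rightarrow> nat \<Rightarrow> (nat list \<Rightarrow> complex) set" where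
  "form_span n N \<equiv> fv.span (PL n N ` {m. perfect_matching {..<N} m})"

context symp_space
begin

lemma multilinear_scale:
  assumes f: "multilinear V N f" and "length us + length is = N" "set us \<subseteq> carrier V" "\<And>i. i \<in> set is \<Longrightarrow> x i \<in> carrier V"
  shows "f (us @ map (\<lambda>i. z i \<odot>\<^bsub>V\<^esub> x i) is) = (\<Prod>i\<leftarrow>is. z i) * f (us @ map x is)"
  using assms(2-)
proof (induction "is" arbitrary: us)
  case (Cons i "is")
  have "linear_form V (\<lambda>y. f (us @ [y] @ map (\<lambda>i. z i \<odot>\<^bsub>V\<^esub> x i) is))"
    by (rule multilinearD[OF f]) (use Cons.prems smC in auto)
  then have "f (us @ map (\<lambda>i. z i \<odot>\<^bsub>V\<^esub> x i) (i # is)) = z i * f ((us @ [x i]) @ map (\<lambda>i. z i \<odot>\<^bsub>V\<^esub> x i) is)"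
    using linear_formD(2)[of V _ "x i" "z i"] Cons.prems by fastforce
  also have "f ((us @ [x i]) @ map (\<lambda>i. z i \<odot>\<^bsub>V\<^esub> x i) is) = (\<Prod>i\<leftarrow>is. z i) * f ((us @ [x i]) @ map x is)"
    by (rule Cons.IH) (use Cons.prems in auto)
  finally show ?case by simp
qed simp

text \<open>Restriction to a line of tuples. The linear coefficient is the derivative: one argument
  at a time is replaced by its direction.\<close>

lemma multilinear_poly:
  assumes f: "multilinear V N f" and "length us + length is = N" "set us \<subseteq> carrier V"
    "\<And>i. i \<in> set is \<Longrightarrow> x i \<in> carrier V" "\<And>i. i \<in> set is \<Longrightarrow> y i \<in> carrier V"
  shows "\<exists>p. (\<forall>t. f (us @ map (\<lambda>i. x i \<oplus>\<^bsub>V\<^esub> t \<odot>\<^bsub>V\<^esub> y i) is) = poly p t) \<and> coeff p 0 = f (us @ map x is) \<and>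
    coeff p 1 = (\<Sum>j<length is. f (us @ map x (take j is) @ [y (is ! j)] @ map x (drop (Suc j) is)))"
  using assms(2-)
proof (induction "is" arbitrary: us)
  case Nil
  show ?case by (rule exI[of _ "[:f us:]"]) simp
next
  case (Cons i "is")
  have C: "length (us @ [v]) + length is = N" "set (us @ [v]) \<subseteq> carrier V" if "v \<in> carrier V" for v
    using Cons.prems that by auto
  have xy: "x i \<in> carrier V" "y i \<in> carrier V" using Cons.prems by auto
  obtain p where p: "\<And>t. f ((us @ [x i]) @ map (\<lambda>i. x i \<oplus>\<^bsub>V\<^esub> t \<odot>\<^bsub>V\<^esub> y i) is) = poly p t"
    "coeff p 0 = f ((us @ [x i]) @ map x is)"
    "coeff p 1 = (\<Sum>j<length is. f ((us @ [x i]) @ map x (take j is) @ [y (is ! j)] @ map x (drop (Suc j) is)))"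
    using Cons.IH[OF C[OF xy(1)]] Cons.prems(3,4) by auto
  obtain q where q: "\<And>t. f ((us @ [y i]) @ map (\<lambda>i. x i \<oplus>\<^bsub>V\<^esub> t \<odot>\<^bsub>V\<^esub> y i) is) = poly q t"
    "coeff q 0 = f ((us @ [y i]) @ map x is)"
    using Cons.IH[OF C[OF xy(2)]] Cons.prems(3,4) by auto
  show ?case
  proof (intro exI[of _ "p + pCons 0 q"] conjI allI)
    fix t
    have "linear_form V (\<lambda>v. f (us @ [v] @ map (\<lambda>i. x i \<oplus>\<^bsub>V\<^esub> t \<odot>\<^bsub>V\<^esub> y i) is))"
      by (rule multilinearD[OF f]) (use Cons.prems smC addC in auto)
    from linear_formD(1)[OF this xy(1) smC[OF xy(2), of t]] linear_formD(2)[OF this xy(2), of t]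
    show "f (us @ map (\<lambda>i. x i \<oplus>\<^bsub>V\<^esub> t \<odot>\<^bsub>V\<^esub> y i) (i # is)) = poly (p + pCons 0 q) t"
      using p(1)[of t] q(1)[of t] by simp
  next
    show "coeff (p + pCons 0 q) 0 = f (us @ map x (i # is))" using p(2) by simp
    show "coeff (p + pCons 0 q) 1 = (\<Sum>j<length (i # is). f (us @ map x (take j (i # is)) @ [y ((i # is) ! j)] @ map x (drop (Suc j) (i # is))))"
      using p(3) q(2) by (simp add: sum.lessThan_Suc_shift del: sum.lessThan_Suc)
  qed
qed

end

context symp_basis
begin

section \<open>Symplectic maps from hyperbolic bases\<close>

definition from_basis :: "(nat \<Rightarrow> 'v) \<Rightarrow> 'v \<Rightarrow> 'v" where
  "from_basis G v = comb (\<lambda>i. coef n b i v) G (2 * n)"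

lemma comb_cong: "(\<And>i. i < k \<Longrightarrow> c i = d i) \<Longrightarrow> comb c G k = comb d G k"
  by (induction k) auto

lemma Jn_sq: "i < 2 * n \<Longrightarrow> Jn n i (2 * n - 1 - i) * Jn n i (2 * n - 1 - i) = 1"
  by (auto simp: Jn_def)

lemma coef_comb: "hyperbolic n G \<Longrightarrow> i < 2 * n \<Longrightarrow> coef n G i (comb c G (2 * n)) = c i"
proof -
  assume G: "hyperbolic n G" and i: "i < 2 * n"
  let ?j = "2 * n - 1 - i"
  have j: "?j < 2 * n" "2 * n - 1 - ?j = i" using i by auto
  show ?thesis unfolding coef_def form_comb_hyperbolic[OF G j(1)] j(2) using Jn_sq[OF i] by (simp add: mult_ac)
qed

lemma coef_basis: "i < 2 * n \<Longrightarrow> l < 2 * n \<Longrightarrow> coef n b i (b l) = (if i = l then 1 else 0)"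
proof -
  assume i: "i < 2 * n" and l: "l < 2 * n"
  let ?j = "2 * n - 1 - i"
  have j: "?j < 2 * n" using i by auto
  show ?thesis
  proof (cases "i = l")
    case True
    then show ?thesis unfolding coef_def hyperbolicD(2)[OF b l j] using Jn_sq[OF i] by simp
  next
    case False
    then have "?j \<noteq> 2 * n - 1 - l" using i l by auto
    then show ?thesis unfolding coef_def hyperbolicD(2)[OF b l j] using False by (simp add: Jn_def)
  qed
qed

lemma from_basis_closed: "hyperbolic n G \<Longrightarrow> from_basis G v \<in> carrier V"
  unfolding from_basis_def by (rule comb_closed) (rule hyperbolicD(1))

lemma form_from_basis: "hyperbolic n G \<Longrightarrow> y \<in> carrier V \<Longrightarrow> \<omega> (from_basis G v) y = (\<Sum>i<2 * n. coef n b i v * \<omega> (G i) y)"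
  unfolding from_basis_def using form_comb[of "2 * n" G y] hyperbolicD(1)[of n G] by blast

lemma from_basis_b: "hyperbolic n G \<Longrightarrow> l < 2 * n \<Longrightarrow> from_basis G (b l) = G l"
proof -
  assume G: "hyperbolic n G" and l: "l < 2 * n"
  show ?thesis
  proof (rule form_inj[OF from_basis_closed[OF G] hyperbolicD(1)[OF G l]])
    fix z assume z: "z \<in> carrier V"
    have "\<omega> (from_basis G (b l)) z = (\<Sum>i<2 * n. if i = l then \<omega> (G l) z else 0)"
      unfolding form_from_basis[OF G z] using coef_basis[OF _ l] by (intro sum.cong refl) auto
    also have "\<dots> = \<omega> (G l) z" using l by simp
    finally show "\<omega> (from_basis G (b l)) z = \<omega> (G l) z" .
  qed
qed

text \<open>Both sides are computed from the Gram matrix \<open>Jn\<close>, which the two bases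
  share.\<close>

lemma from_basis_form:
  assumes G: "hyperbolic n G" and x: "x \<in> carrier V" and y: "y \<in> carrier V"
  shows "\<omega> (from_basis G x) (from_basis G y) = \<omega> x y"
proof -
  have *: "\<omega> (comb c H (2 * n)) (comb d H (2 * n)) = (\<Sum>i<2 * n. c i * (\<Sum>j<2 * n. d j * Jn n i j))" if H: "hyperbolic n H" for c d H
  proof -
    have HC: "H i \<in> carrier V" if "i < 2 * n" for i by (rule hyperbolicD(1)[OF H that])
    have "\<omega> (comb c H (2 * n)) (comb d H (2 * n)) = (\<Sum>i<2 * n. c i * \<omega> (H i) (comb d H (2 * n)))"
      by (rule form_comb[OF HC comb_closed[OF HC]])
    also have "\<dots> = (\<Sum>i<2 * n. c i * (\<Sum>j<2 * n. d j * Jn n i j))"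
    proof (intro sum.cong refl arg_cong2[of _ _ _ _ "(*)"])
      fix i assume i: "i \<in> {..<2 * n}"
      have "\<omega> (H i) (comb d H (2 * n)) = (\<Sum>j<2 * n. d j * \<omega> (H i) (H j))"
        by (rule form_comb_right[OF HC]) (use HC i in auto)
      then show "\<omega> (H i) (comb d H (2 * n)) = (\<Sum>j<2 * n. d j * Jn n i j)" using hyperbolicD(2)[OF H] i by simp
    qed
    finally show ?thesis .
  qed
  have "\<omega> (from_basis G x) (from_basis G y) = \<omega> (comb (\<lambda>i. coef n b i x) b (2 * n)) (comb (\<lambda>i. coef n b i y) b (2 * n))"
    unfolding from_basis_def *[OF G] *[OF b] ..
  then show ?thesis using hyperbolic_expand[OF b x] hyperbolic_expand[OF b y] by simp
qed

lemma from_basis_Sp: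
  assumes G: "hyperbolic n G"
  shows "from_basis G \<in> Sp V \<omega>"
proof -
  have bC: "b (2 * n - 1 - i) \<in> carrier V" if "i < 2 * n" for i by (rule hyperbolicD(1)[OF b]) (use that in simp)
  have GC: "G i \<in> carrier V" if "i < 2 * n" for i by (rule hyperbolicD(1)[OF G that])
  have cs: "coef n b i (c \<odot>\<^bsub>V\<^esub> x) = c * coef n b i x" if "x \<in> carrier V" "i < 2 * n" for x c i
    unfolding coef_def form_smult[OF that(1) bC[OF that(2)]] by simp
  have ca: "coef n b i (x \<oplus>\<^bsub>V\<^esub> y) = coef n b i x + coef n b i y" if "x \<in> carrier V" "y \<in> carrier V" "i < 2 * n" for x y i
    unfolding coef_def form_add[OF that(1,2) bC[OF that(3)]] by (simp add: distrib_left)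
  note fC = from_basis_closed[OF G] and ff = form_from_basis[OF G] and fo = from_basis_form[OF G]
  have "from_basis G \<in> linear_maps V V"
  proof (rule linear_mapsI)
    fix x y c assume x: "x \<in> carrier V"
    show "from_basis G x \<in> carrier V" by (rule fC)
    show "from_basis G (c \<odot>\<^bsub>V\<^esub> x) = c \<odot>\<^bsub>V\<^esub> from_basis G x"
    proof (rule form_inj[OF fC smC[OF fC]])
      fix z assume z: "z \<in> carrier V"
      show "\<omega> (from_basis G (c \<odot>\<^bsub>V\<^esub> x)) z = \<omega> (c \<odot>\<^bsub>V\<^esub> from_basis G x) z"
        unfolding form_smult[OF fC z] ff[OF z] sum_distrib_left
        by (intro sum.cong refl) (simp only: lessThan_iff cs[OF x] mult_ac)
    qed
    assume y: "y \<in> carrier V"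
    show "from_basis G (x \<oplus>\<^bsub>V\<^esub> y) = from_basis G x \<oplus>\<^bsub>V\<^esub> from_basis G y"
    proof (rule form_inj[OF fC addC[OF fC fC]])
      fix z assume z: "z \<in> carrier V"
      show "\<omega> (from_basis G (x \<oplus>\<^bsub>V\<^esub> y)) z = \<omega> (from_basis G x \<oplus>\<^bsub>V\<^esub> from_basis G y) z"
        unfolding form_add[OF fC fC z] ff[OF z] sum.distrib[symmetric]
        by (intro sum.cong refl) (simp only: lessThan_iff ca[OF x y] distrib_right)
    qed
  qed
  moreover have "inj_on (from_basis G) (carrier V)"
  proof (rule inj_onI)
    fix x y assume x: "x \<in> carrier V" and y: "y \<in> carrier V" and e: "from_basis G x = from_basis G y"
    show "x = y" by (rule form_inj[OF x y]) (use fo[OF x] fo[OF y] e in metis)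
  qed
  moreover have "from_basis G ` carrier V = carrier V"
  proof (intro equalityI subsetI)
    fix v assume v: "v \<in> carrier V"
    let ?x = "comb (\<lambda>i. coef n G i v) b (2 * n)"
    have "?x \<in> carrier V" by (rule comb_closed) (rule hyperbolicD(1)[OF b])
    moreover have "from_basis G ?x = comb (\<lambda>i. coef n G i v) G (2 * n)"
      unfolding from_basis_def by (rule comb_cong) (rule coef_comb[OF b])
    ultimately show "v \<in> from_basis G ` carrier V" using hyperbolic_expand[OF G v] by (metis imageI)
  qed (use fC in auto)
  ultimately show ?thesis using fo by (simp add: Sp_def bij_betw_def)
qed

abbreviation bword :: "(nat \<Rightarrow> 'v) \<Rightarrow> nat \<Rightarrow> (nat \<Rightarrow> nat) \<Rightarrow> 'v list" where
  "bword G N w \<equiv> map (\<lambda>p. G (w p)) [0..<N]"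

text \<open>Group elements are supplied as hyperbolic bases: an invariant function takes the same
  value on corresponding words of all of them.\<close>

lemma invariant_hyperbolic:
  assumes inv: "\<And>g xs. g \<in> Sp V \<omega> \<Longrightarrow> xs \<in> tuples V N \<Longrightarrow> f (map g xs) = f xs"
    and G: "hyperbolic n G" and w: "w \<in> words n N"
  shows "f (bword G N w) = f (bword b N w)"
proof -
  have wp: "w p < 2 * n" if "p < N" for p using w that by (auto simp: PiE_def)
  have "bword b N w \<in> tuples V N" using hyperbolicD(1)[OF b wp] by (auto simp: tuples_def)
  then have "f (map (from_basis G) (bword b N w)) = f (bword b N w)" by (rule inv[OF from_basis_Sp[OF G]])
  moreover have "map (from_basis G) (bword b N w) = bword G N w" unfolding map_map comp_def
    by (intro map_cong refl from_basis_b[OF G] wp) simp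
  ultimately show ?thesis by (simp only:)
qed

text \<open>The torus element that scales \<open>b k\<close> by \<open>2\<close> and its dual by \<open>1/2\<close> sees the weight as an exponent of \<open>2\<close>.\<close>

lemma invariant_form_weighted:
  assumes f: "multilinear V N f"
    and inv: "\<And>g xs. g \<in> Sp V \<omega> \<Longrightarrow> xs \<in> tuples V N \<Longrightarrow> f (map g xs) = f xs"
    and w: "w \<in> words n N" "f (bword b N w) \<noteq> 0" and k: "k < n"
  shows "weight n k w N = 0"
proof -
  define z :: "nat \<Rightarrow> complex" where "z l = (if l = k then 2 else if l = 2 * n - 1 - k then 1 / 2 else 1)" for l
  define G where "G l = z l \<odot>\<^bsub>V\<^esub> b l" for l
  have bC: "b l \<in> carrier V" if "l < 2 * n" for l by (rule hyperbolicD(1)[OF b that])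
  have zJ: "z i * z j * Jn n i j = Jn n i j" if "i < 2 * n" for i j
    using that k by (auto simp: Jn_def z_def)
  have G: "hyperbolic n G" unfolding hyperbolic_def
  proof (intro conjI allI impI)
    show "G j \<in> carrier V" if "j < 2 * n" for j unfolding G_def by (rule smC[OF bC[OF that]])
    show "\<omega> (G i) (G j) = Jn n i j" if "i < 2 * n" "j < 2 * n" for i j
    proof -
      have "\<omega> (G i) (G j) = z i * z j * \<omega> (b i) (b j)" using that by (simp add: G_def form_smult form_smult_right bC smC)
      then show ?thesis using zJ[OF that(1), of j] hyperbolicD(2)[OF b that] by simp
    qed
  qed
  have wp: "w p < 2 * n" if "p < N" for p using w that by (auto simp: PiE_def)
  have prod: "(\<Prod>p\<leftarrow>[0..<M]. z (w p)) = 2 powi (weight n k w M)" for M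
  proof (induction M)
    case (Suc M)
    have "z (w M) = 2 powi ((if w M = k then 1 else 0) - (if w M = 2 * n - 1 - k then 1 else 0))"
      using k by (auto simp: z_def power_int_minus)
    then show ?case using Suc by (simp add: weight_Suc power_int_add)
  qed (simp add: weight_def)
  have "f (bword G N w) = f ([] @ map (\<lambda>p. z (w p) \<odot>\<^bsub>V\<^esub> b (w p)) [0..<N])" by (simp add: G_def)
  also have "\<dots> = (\<Prod>p\<leftarrow>[0..<N]. z (w p)) * f ([] @ bword b N w)"
    by (rule multilinear_scale[OF f]) (use bC[OF wp] in auto)
  finally have "2 powi (weight n k w N) * f (bword b N w) = f (bword b N w)"
    using invariant_hyperbolic[OF inv G w(1)] prod by simp
  then show ?thesis using w(2) two_powi_eq_1 by simp
qed

text \<open>Along a one-parameter unipotent group an invariant form is a constant polynomial, and the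
  linear coefficient of this polynomial is the action of the lowering operator.\<close>

lemma invariant_form_killed:
  assumes f: "multilinear V N f"
    and inv: "\<And>g xs. g \<in> Sp V \<omega> \<Longrightarrow> xs \<in> tuples V N \<Longrightarrow> f (map g xs) = f xs"
    and w: "w \<in> words n N" and i: "i < n"
  shows "lower n N i (\<lambda>w. if w \<in> words n N then f (bword b N w) else 0) w = 0"
proof -
  \<comment> \<open>The image of \<open>b l\<close> under the lowering operator. The separate zero
    case covers the last letter, for which \<open>b (Suc l)\<close> is no basis vector.\<close>
  define Y where "Y l = (if nu n i l = 0 then \<zero>\<^bsub>V\<^esub> else nu n i l \<odot>\<^bsub>V\<^esub> b (Suc l))" for l
  define G where "G t l = b l \<oplus>\<^bsub>V\<^esub> t \<odot>\<^bsub>V\<^esub> Y l" for t l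
  have bC: "b l \<in> carrier V" if "l < 2 * n" for l by (rule hyperbolicD(1)[OF b that])
  have S: "Suc l < 2 * n" if "nu n i l \<noteq> 0" for l by (rule nu_word[OF i that])
  have YC: "Y l \<in> carrier V" for l unfolding Y_def using bC[OF S] smC zeroC by auto
  have Yb: "\<omega> (Y l) (b j) = nu n i l * Jn n (Suc l) j" if "j < 2 * n" for l j
    using bC[OF that] bC[OF S] hyperbolicD(2)[OF b S that] by (auto simp: Y_def form_zero form_smult)
  have bY: "\<omega> (b j) (Y l) = nu n i l * Jn n j (Suc l)" if "j < 2 * n" for l j
    using form_skew[OF bC[OF that] YC] Yb[OF that] Jn_skew[of n j "Suc l"] by simp
  \<comment> \<open>The images are orthogonal to each other: \<open>l\<close> and \<open>m\<close>
    have the parity of \<open>i\<close>, whereas dual letters have different parities. This removes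
    the quadratic term, so \<open>G t\<close> is hyperbolic for every \<open>t\<close>.\<close>
  have YY: "\<omega> (Y l) (Y m) = 0" for l m
  proof (cases "nu n i l = 0 \<or> nu n i m = 0")
    case True
    then have "Y l = \<zero>\<^bsub>V\<^esub> \<or> Y m = \<zero>\<^bsub>V\<^esub>" by (auto simp: Y_def)
    then show ?thesis using form_zero[OF YC, of m] form_skew[OF YC zeroC, of l] form_zero[OF YC, of l] by auto
  next
    case False
    then have lm: "nu n i l \<noteq> 0" "nu n i m \<noteq> 0" by auto
    have "\<omega> (Y l) (Y m) = nu n i m * (nu n i l * Jn n (Suc l) (Suc m))"
      using Yb[OF S[OF lm(2)], of l] lm by (simp add: Y_def[of m] form_smult_right YC bC S)
    moreover have "Jn n (Suc l) (Suc m) = 0"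
    proof -
      have "l = i \<or> l = 2 * n - 2 - i" "m = i \<or> m = 2 * n - 2 - i" using lm by (auto simp: nu_def split: if_splits)
      then have "even (l + m)" using i by auto
      then have "Suc (l + m) \<noteq> 2 * n - 2" by presburger
      then show ?thesis using i by (auto simp: Jn_def)
    qed
    ultimately show ?thesis by simp
  qed
  have G: "hyperbolic n (G t)" for t unfolding hyperbolic_def
  proof (intro conjI allI impI)
    show "G t j \<in> carrier V" if "j < 2 * n" for j unfolding G_def by (intro addC smC YC bC that)
    fix l m assume lm: "l < 2 * n" "m < 2 * n"
    have "\<omega> (G t l) (G t m) = \<omega> (b l) (b m) + t * (\<omega> (Y l) (b m) + \<omega> (b l) (Y m)) + t * t * \<omega> (Y l) (Y m)"
      using lm by (simp add: G_def form_add form_add_right form_smult form_smult_right addC smC YC bC algebra_simps)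
    also have "\<dots> = Jn n l m"
      using Jn_nu[OF i, of l m] by (simp add: Yb bY YY lm hyperbolicD(2)[OF b])
    finally show "\<omega> (G t l) (G t m) = Jn n l m" .
  qed
  have wp: "w p < 2 * n" if "p < N" for p using w that by (auto simp: PiE_def)
  obtain p where p: "\<And>t. f ([] @ map (\<lambda>p. b (w p) \<oplus>\<^bsub>V\<^esub> t \<odot>\<^bsub>V\<^esub> Y (w p)) [0..<N]) = poly p t"
      "coeff p 1 = (\<Sum>j<length [0..<N]. f ([] @ map (\<lambda>p. b (w p)) (take j [0..<N]) @ [Y (w ([0..<N] ! j))] @ map (\<lambda>p. b (w p)) (drop (Suc j) [0..<N])))"
    using multilinear_poly[OF f, of "[]" "[0..<N]" "\<lambda>p. b (w p)" "\<lambda>p. Y (w p)"] bC[OF wp] YC by auto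
  have "poly p t = poly [:f (bword b N w):] t" for t
    using p(1)[of t] invariant_hyperbolic[OF inv G w, of t] by (simp add: G_def)
  then have "p = [:f (bword b N w):]" using poly_eq_poly_eq_iff by blast
  then have "coeff p 1 = 0" by simp
  moreover have "f (map (\<lambda>p. b (w p)) (take j [0..<N]) @ [Y (w ([0..<N] ! j))] @ map (\<lambda>p. b (w p)) (drop (Suc j) [0..<N])) =
      nu n i (w j) * (if w(j := Suc (w j)) \<in> words n N then f (bword b N (w(j := Suc (w j)))) else 0)" if j: "j < N" for j
  proof -
    let ?us = "bword b j w" and ?ws = "map (\<lambda>p. b (w p)) [Suc j..<N]"
    have s: "[0..<N] = [0..<j] @ [j] @ [Suc j..<N]"
      using j upt_add_eq_append[of 0 j "N - j"] upt_conv_Cons[of j N] by simp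
    have td: "take j [0..<N] = [0..<j]" "[0..<N] ! j = j" "drop (Suc j) [0..<N] = [Suc j..<N]" using j by (auto simp: take_upt)
    have lf: "linear_form V (\<lambda>x. f (?us @ [x] @ ?ws))"
      by (rule multilinearD[OF f]) (use j bC[OF wp] in auto)
    show ?thesis
    proof (cases "nu n i (w j) = 0")
      case True
      have "f (?us @ [\<zero>\<^bsub>V\<^esub>] @ ?ws) = 0" using linear_formD(2)[OF lf zeroC, of 0] smult_zero[OF zeroC] by simp
      then show ?thesis unfolding td using True by (simp add: Y_def)
    next
      case False
      have "bword b N (w(j := Suc (w j))) = ?us @ [b (Suc (w j))] @ ?ws" by (subst s) simp
      moreover have "w(j := Suc (w j)) \<in> words n N" using words_Suc[OF w j] S[OF False] .
      ultimately show ?thesis unfolding td using linear_formD(2)[OF lf bC[OF S[OF False]], of "nu n i (w j)"] False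
        by (simp add: Y_def)
    qed
  qed
  ultimately show ?thesis unfolding lower_def p(2) by simp
qed

lemma invariant_form_invariants:
  assumes "multilinear V N f" "\<And>g xs. g \<in> Sp V \<omega> \<Longrightarrow> xs \<in> tuples V N \<Longrightarrow> f (map g xs) = f xs"
  shows "(\<lambda>w. if w \<in> words n N then f (bword b N w) else 0) \<in> invariants n N"
  unfolding invariants_def killed_def weighted_def
  using invariant_form_weighted[OF assms] invariant_form_killed[OF assms] by auto

text \<open>Set to zero outside the carrier, since the lemmas on \<open>P\<close> ask for skew
  symmetry at all arguments.\<close>

definition omh :: "'v \<Rightarrow> 'v \<Rightarrow> complex" where
  "omh x y = (if x \<in> carrier V \<and> y \<in> carrier V then \<omega> x y else 0)"

lemma omh_skew: "omh x y = - omh y x"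
  unfolding omh_def using form_skew[of x y] by auto

text \<open>By \<open>P_slot\<close> each argument enters through a single factor of the
  form.\<close>

lemma matching_form_multilinear:
  assumes m: "perfect_matching {..<N} m"
  shows "multilinear V N (\<lambda>xs. P omh m (\<lambda>p. xs ! p))"
  unfolding multilinear_def
proof (intro allI impI)
  fix us ws :: "'v list" assume l: "Suc (length us + length ws) = N" "set us \<union> set ws \<subseteq> carrier V"
  let ?p = "length us" and ?w = "\<lambda>p. (us @ [\<zero>\<^bsub>V\<^esub>] @ ws) ! p"
  have p: "?p \<in> {..<N}" using l by auto
  obtain c q where q: "q \<in> {..<N}" "q \<noteq> ?p" "\<And>x. P omh m (?w(?p := x)) = c * omh x (?w q)"
    using P_slot[of omh, OF omh_skew finite_lessThan m p] by metis
  have e: "P omh m (\<lambda>p. (us @ [x] @ ws) ! p) = c * omh x (?w q)" for x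
  proof -
    have u: "us @ [x] @ ws = (us @ [\<zero>\<^bsub>V\<^esub>] @ ws)[?p := x]" by simp
    show ?thesis unfolding q(3)[symmetric]
    proof (rule P_cong[of omh, OF omh_skew finite_lessThan m])
      fix p assume "p \<in> {..<N}"
      then have "(us @ [x] @ ws) ! p = (if ?p = p then x else ?w p)"
        unfolding u by (intro nth_list_update) (use l(1) in simp)
      then show "(us @ [x] @ ws) ! p = (?w(?p := x)) p" by (simp only: fun_upd_apply eq_commute[of ?p p])
    qed
  qed
  have "?w q \<in> set (us @ [\<zero>\<^bsub>V\<^esub>] @ ws)" by (rule nth_mem) (use q l in simp)
  then have "?w q \<in> carrier V" using l(2) zeroC by auto
  then show "linear_form V (\<lambda>x. P omh m (\<lambda>p. (us @ [x] @ ws) ! p))"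
    unfolding e by (intro linear_form_scale linear_formI) (simp_all add: omh_def addC smC form_add form_smult)
qed

lemma matching_form_invariant:
  assumes m: "perfect_matching {..<N} m" and g: "g \<in> Sp V \<omega>" and xs: "xs \<in> tuples V N"
  shows "P omh m (\<lambda>p. map g xs ! p) = P omh m (\<lambda>p. xs ! p)"
proof (rule P_form_cong[of omh omh, OF omh_skew omh_skew finite_lessThan m])
  fix p q assume "p \<in> {..<N}" "q \<in> {..<N}"
  then have "p < length xs" "q < length xs" "xs ! p \<in> carrier V" "xs ! q \<in> carrier V" using xs by (auto simp: tuples_def)
  then show "omh (map g xs ! p) (map g xs ! q) = omh (xs ! p) (xs ! q)"
    using SpD[OF g] by (simp add: omh_def)
qed

lemma matching_form_word:
  assumes m: "perfect_matching {..<N} m" and w: "w \<in> Wl N"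
  shows "P omh m (\<lambda>p. map b w ! p) = P (Jn n) m (\<lambda>p. w ! p)"
proof (rule P_form_cong[of omh "Jn n", OF omh_skew Jn_skew finite_lessThan m])
  fix p q assume "p \<in> {..<N}" "q \<in> {..<N}"
  then have l: "p < length w" "q < length w" "set w \<subseteq> {..<2 * n}" using w by (auto simp: lists_below_def)
  then have "w ! p < 2 * n" "w ! q < 2 * n" using subsetD[OF l(3) nth_mem[OF l(1)]] subsetD[OF l(3) nth_mem[OF l(2)]] by simp_all
  with l(1,2) show "omh (map b w ! p) (map b w ! q) = Jn n (w ! p) (w ! q)"
    by (simp add: omh_def hyperbolicD[OF b])
qed

text \<open>The fundamental theorem for maps. In one direction \<open>Bw s \<phi>\<close> is an
  invariant form, to which \<open>first_fundamental\<close> applies. In the other, a combination of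
  matching forms in \<omega> is invariant and agrees with \<open>Bw s \<phi>\<close> on basis words,
  hence everywhere.\<close>

lemma equivariant_iff:
  assumes \<phi>: "\<phi> \<in> linear_maps (T r) (T s)" "\<phi> \<in> extensional (carrier (T r))"
  shows "\<phi> \<in> equivariant_maps V \<omega> r s \<longleftrightarrow> Tm r s \<phi> \<in> form_span n (s + r)"
proof
  let ?N = "s + r"
  have fin: "finite {m. perfect_matching {..<?N} m}" by (rule finite_perfect_matchings) simp
  note ml = Bw_multilinear[OF \<phi>(1)]
  assume "\<phi> \<in> equivariant_maps V \<omega> r s"
  then have inv: "Bw s \<phi> (map g xs) = Bw s \<phi> xs" if "g \<in> Sp V \<omega>" "xs \<in> tuples V ?N" for g xs
    using equivariant_Bw that by blast
  have "(\<lambda>w. if w \<in> words n ?N then Bw s \<phi> (bword b ?N w) else 0) \<in> matching_span n ?N"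
    using invariant_form_invariants[OF ml inv] first_fundamental[OF n1] by blast
  from span_image_finite[OF fin this] obtain a where
    a: "(\<lambda>w. if w \<in> words n ?N then Bw s \<phi> (bword b ?N w) else 0) = (\<Sum>m\<in>{m. perfect_matching {..<?N} m}. (\<lambda>w. a m * PW n ?N m w))" by blast
  have "Tm r s \<phi> = (\<Sum>m\<in>{m. perfect_matching {..<?N} m}. (\<lambda>w. a m * PL n ?N m w))"
  proof
    fix xs show "Tm r s \<phi> xs = (\<Sum>m\<in>{m. perfect_matching {..<?N} m}. (\<lambda>w. a m * PL n ?N m w)) xs"
    proof (cases "xs \<in> Wl ?N")
      case True
      define w where "w = restrict (\<lambda>p. xs ! p) {..<?N}"
      have w: "w \<in> words n ?N" using True by (auto simp: w_def lists_below_def subset_iff)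
      have "bword b ?N w = map b xs" using True by (intro nth_equalityI) (auto simp: w_def lists_below_def)
      then have "Tm r s \<phi> xs = Bw s \<phi> (bword b ?N w)" using Tm_Bw[OF \<phi>(1) True] by simp
      also have "\<dots> = (\<Sum>m\<in>{m. perfect_matching {..<?N} m}. a m * PW n ?N m w)" using fun_cong[OF a, of w] w by (simp add: sum_apply)
      also have "\<dots> = (\<Sum>m\<in>{m. perfect_matching {..<?N} m}. a m * PL n ?N m xs)"
      proof (intro sum.cong refl arg_cong2[of _ _ _ _ "(*)"])
        fix m assume "m \<in> {m. perfect_matching {..<?N} m}"
        then have "P (Jn n) m w = P (Jn n) m (\<lambda>p. xs ! p)"
          by (intro P_cong[of "Jn n", OF Jn_skew finite_lessThan]) (auto simp: w_def)
        then show "PW n ?N m w = PL n ?N m xs" using w True by (simp add: PW_def PL_def)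
      qed
      finally show ?thesis by (simp add: sum_apply)
    qed (simp add: Tm_def PL_def sum_apply)
  qed
  then show "Tm r s \<phi> \<in> form_span n ?N" by (simp only:) (intro fv.span_sum fv.span_scale fv.span_base imageI)
next
  let ?N = "s + r"
  have fin: "finite {m. perfect_matching {..<?N} m}" by (rule finite_perfect_matchings) simp
  assume "Tm r s \<phi> \<in> form_span n ?N"
  from span_image_finite[OF fin this] obtain a where a: "Tm r s \<phi> = (\<Sum>m\<in>{m. perfect_matching {..<?N} m}. (\<lambda>w. a m * PL n ?N m w))" by blast
  define f where "f xs = (\<Sum>m\<in>{m. perfect_matching {..<?N} m}. a m * P omh m (\<lambda>p. xs ! p))" for xs
  have f: "multilinear V ?N f"
    unfolding f_def multilinear_def
    by (intro allI impI linear_form_sum linear_form_scale multilinearD[OF matching_form_multilinear]) auto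
  have "Bw s \<phi> (map b w) = f (map b w)" if w: "w \<in> Wl ?N" for w
  proof -
    have "Bw s \<phi> (map b w) = (\<Sum>m\<in>{m. perfect_matching {..<?N} m}. a m * PL n ?N m w)"
      using Tm_Bw[OF \<phi>(1) w] a by (simp add: sum_apply)
    also have "\<dots> = f (map b w)" unfolding f_def
      by (intro sum.cong refl arg_cong2[of _ _ _ _ "(*)"]) (use matching_form_word[OF _ w] w in \<open>simp add: PL_def\<close>)
    finally show ?thesis .
  qed
  then have e: "Bw s \<phi> xs = f xs" if "xs \<in> tuples V ?N" for xs
    using multilinear_determined[OF Bw_multilinear[OF \<phi>(1)] f _ that] by blast
  show "\<phi> \<in> equivariant_maps V \<omega> r s"
  proof (rule Bw_equivariant[OF \<phi>])
    fix g xs assume g: "g \<in> Sp V \<omega>" and xs: "xs \<in> tuples V ?N"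
    have "f (map g xs) = f xs" unfolding f_def
      by (intro sum.cong refl arg_cong2[of _ _ _ _ "(*)"] matching_form_invariant[OF _ g xs]) simp
    then show "Bw s \<phi> (map g xs) = Bw s \<phi> xs" using e[OF xs] e[OF tuples_map[OF g xs]] by simp
  qed
qed

end

section \<open>The category of invariant tensors in coordinates\<close>

context symp_basis
begin

lemma T_Sp_simps:
  "carrier (Hom (T_Sp V \<omega>) r s) = equivariant_maps V \<omega> r s"
  "\<zero>\<^bsub>Hom (T_Sp V \<omega>) r s\<^esub> = (\<lambda>t\<in>carrier (T r). \<zero>\<^bsub>T s\<^esub>)"
  "\<phi> \<oplus>\<^bsub>Hom (T_Sp V \<omega>) r s\<^esub> \<psi> = (\<lambda>t\<in>carrier (T r). \<phi> t \<oplus>\<^bsub>T s\<^esub> \<psi> t)"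
  "c \<odot>\<^bsub>Hom (T_Sp V \<omega>) r s\<^esub> \<phi> = (\<lambda>t\<in>carrier (T r). c \<odot>\<^bsub>T s\<^esub> \<phi> t)"
  "Comp (T_Sp V \<omega>) r s t \<phi> \<psi> = compose (carrier (T r)) \<psi> \<phi>"
  "Ident (T_Sp V \<omega>) r = (\<lambda>t\<in>carrier (T r). t)"
  by (simp_all add: T_Sp_def)

lemma equivariantD:
  assumes "\<phi> \<in> equivariant_maps V \<omega> r s"
  shows "\<phi> \<in> linear_maps (T r) (T s)" "\<phi> \<in> extensional (carrier (T r))"
    "\<And>g t. g \<in> Sp V \<omega> \<Longrightarrow> t \<in> carrier (T r) \<Longrightarrow> \<phi> (tensor_map V r g t) = tensor_map V s g (\<phi> t)"
  using assms by (simp_all add: equivariant_maps_def)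

lemma Tm_span: "\<phi> \<in> equivariant_maps V \<omega> r s \<Longrightarrow> Tm r s \<phi> \<in> form_span n (s + r)"
  using equivariant_iff equivariantD(1,2) by blast

text \<open>Closure of the equivariant maps under sums and multiples is inherited from
  \<open>form_span\<close> by means of \<open>equivariant_iff\<close>.\<close>

sublocale hom: coords "Hom (T_Sp V \<omega>) r s" "Tm r s" for r s
proof
  show "inj_on (Tm r s) (carrier (Hom (T_Sp V \<omega>) r s))"
    unfolding T_Sp_simps by (rule inj_onI) (rule Tm_inj; simp only: equivariantD)
  have tw: "tensor V (map b w) \<in> carrier (T r)" if "w \<in> Wl r" for w by (rule tensor_closed[OF Wl_b[OF that]])
  let ?z = "\<zero>\<^bsub>Hom (T_Sp V \<omega>) r s\<^esub>"
  show z: "Tm r s ?z = (\<lambda>_. 0)"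
    unfolding T_Sp_simps by (rule ext) (simp add: Tm_def Wl_split tw tc.h_zero)
  have "?z \<in> linear_maps (T r) (T s)" unfolding T_Sp_simps
    by (rule linear_mapsI) (simp_all add: tc.zero_closed tc.add_closed tc.smult_closed tc.eqI[of _ s] tc.h_add tc.h_smult tc.h_zero)
  then have "?z \<in> equivariant_maps V \<omega> r s"
    using equivariant_iff[of ?z r s] z fv.span_zero by (auto simp: T_Sp_simps zero_fun_def)
  then show "?z \<in> carrier (Hom (T_Sp V \<omega>) r s)" unfolding T_Sp_simps .
  {
    fix \<phi> \<psi> assume "\<phi> \<in> carrier (Hom (T_Sp V \<omega>) r s)" "\<psi> \<in> carrier (Hom (T_Sp V \<omega>) r s)"
    then have e: "\<phi> \<in> equivariant_maps V \<omega> r s" "\<psi> \<in> equivariant_maps V \<omega> r s" unfolding T_Sp_simps by auto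
    note \<phi> = linear_mapsD[OF equivariantD(1)[OF e(1)]] and \<psi> = linear_mapsD[OF equivariantD(1)[OF e(2)]]
    let ?s = "\<lambda>t\<in>carrier (T r). \<phi> t \<oplus>\<^bsub>T s\<^esub> \<psi> t"
    have s: "Tm r s ?s = (\<lambda>i. Tm r s \<phi> i + Tm r s \<psi> i)"
      by (rule ext) (simp add: Tm_def Wl_split tw tc.h_add \<phi> \<psi>)
    then show "Tm r s (\<phi> \<oplus>\<^bsub>Hom (T_Sp V \<omega>) r s\<^esub> \<psi>) = (\<lambda>i. Tm r s \<phi> i + Tm r s \<psi> i)" unfolding T_Sp_simps .
    have "?s \<in> linear_maps (T r) (T s)"
      by (rule linear_mapsI; (rule tc.eqI[of _ s])?)
        (simp_all add: tc.zero_closed tc.add_closed tc.smult_closed \<phi> \<psi> tc.h_add tc.h_smult distrib_left)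
    moreover have "Tm r s ?s \<in> form_span n (s + r)"
      using fv.span_add[OF Tm_span[OF e(1)] Tm_span[OF e(2)]] unfolding s by (simp add: plus_fun_def)
    ultimately have "?s \<in> equivariant_maps V \<omega> r s" using equivariant_iff[of ?s r s] by auto
    then show "\<phi> \<oplus>\<^bsub>Hom (T_Sp V \<omega>) r s\<^esub> \<psi> \<in> carrier (Hom (T_Sp V \<omega>) r s)" unfolding T_Sp_simps .
  }
  {
    fix \<phi> c assume "\<phi> \<in> carrier (Hom (T_Sp V \<omega>) r s)"
    then have e: "\<phi> \<in> equivariant_maps V \<omega> r s" unfolding T_Sp_simps by auto
    note \<phi> = linear_mapsD[OF equivariantD(1)[OF e(1)]]
    let ?s = "\<lambda>t\<in>carrier (T r). c \<odot>\<^bsub>T s\<^esub> \<phi> t"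
    have s: "Tm r s ?s = (\<lambda>i. c * Tm r s \<phi> i)"
      by (rule ext) (simp add: Tm_def Wl_split tw tc.h_smult \<phi>)
    then show "Tm r s (c \<odot>\<^bsub>Hom (T_Sp V \<omega>) r s\<^esub> \<phi>) = (\<lambda>i. c * Tm r s \<phi> i)" unfolding T_Sp_simps .
    have "?s \<in> linear_maps (T r) (T s)"
      by (rule linear_mapsI; (rule tc.eqI[of _ s])?)
        (simp_all add: tc.zero_closed tc.add_closed tc.smult_closed \<phi> tc.h_add tc.h_smult distrib_left)
    moreover have "Tm r s ?s \<in> form_span n (s + r)"
      using fv.span_scale[OF Tm_span[OF e]] unfolding s .
    ultimately have "?s \<in> equivariant_maps V \<omega> r s" using equivariant_iff[of ?s r s] by auto
    then show "c \<odot>\<^bsub>Hom (T_Sp V \<omega>) r s\<^esub> \<phi> \<in> carrier (Hom (T_Sp V \<omega>) r s)" unfolding T_Sp_simps .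
  }
qed

text \<open>\<open>mkmap\<close> realises every matrix supported on words, and
  \<open>equivariant_iff\<close> shows that those in the span come from equivariant maps.\<close>

lemma Tm_image: "Tm r s ` carrier (Hom (T_Sp V \<omega>) r s) = form_span n (s + r)"
proof (intro equalityI subsetI)
  fix X assume X: "X \<in> form_span n (s + r)"
  have "fv.subspace {X. \<forall>xs. xs \<notin> Wl (s + r) \<longrightarrow> X xs = 0}" by (rule fv.subspaceI) auto
  then have "form_span n (s + r) \<subseteq> {X. \<forall>xs. xs \<notin> Wl (s + r) \<longrightarrow> X xs = 0}"
    by (intro fv.span_minimal) (auto simp: PL_def)
  then have "Tm r s (mkmap r s X) = X" using X Tm_mkmap by (intro ext) (auto simp: Tm_def)
  moreover have "mkmap r s X \<in> equivariant_maps V \<omega> r s"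
    using equivariant_iff[OF mkmap_linear mkmap_extensional] X calculation by simp
  ultimately show "X \<in> Tm r s ` carrier (Hom (T_Sp V \<omega>) r s)" unfolding T_Sp_simps by (metis imageI)
qed (use Tm_span in \<open>auto simp: T_Sp_simps\<close>)

lemma T_Sp_linear_category: "linear_category (T_Sp V \<omega>)"
proof (rule linear_category.intro)
  show "vectorspace complex_ring (Hom (T_Sp V \<omega>) r s)" for r s by (rule hom.is_vectorspace)
  have comp: "compose (carrier (T r)) \<psi> \<phi> \<in> equivariant_maps V \<omega> r t"
    if "\<phi> \<in> equivariant_maps V \<omega> r s" "\<psi> \<in> equivariant_maps V \<omega> s t" for r s t \<phi> \<psi>
  proof -
    note \<phi> = linear_mapsD[OF equivariantD(1)[OF that(1)]] and \<psi> = linear_mapsD[OF equivariantD(1)[OF that(2)]]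
    have "compose (carrier (T r)) \<psi> \<phi> \<in> linear_maps (T r) (T t)"
      by (rule linear_mapsI) (simp_all add: compose_def \<phi> \<psi> tc.add_closed tc.smult_closed)
    moreover have "compose (carrier (T r)) \<psi> \<phi> (tensor_map V r g x) = tensor_map V t g (compose (carrier (T r)) \<psi> \<phi> x)"
      if g: "g \<in> Sp V \<omega>" and x: "x \<in> carrier (T r)" for g x
      using equivariantD(3)[OF \<open>\<phi> \<in> _\<close> g x] equivariantD(3)[OF \<open>\<psi> \<in> _\<close> g \<phi>(1)[OF x]] tensor_map_closed[OF g x] x
      by (simp add: compose_def)
    ultimately show ?thesis unfolding equivariant_maps_def by (simp add: compose_extensional)
  qed
  show "(\<lambda>\<phi>. Comp (T_Sp V \<omega>) r s t \<phi> \<psi>) \<in> linear_maps (Hom (T_Sp V \<omega>) r s) (Hom (T_Sp V \<omega>) r t)"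
    if "\<psi> \<in> carrier (Hom (T_Sp V \<omega>) s t)" for r s t \<psi>
  proof (rule linear_mapsI; unfold T_Sp_simps)
    have \<psi>: "\<psi> \<in> equivariant_maps V \<omega> s t" using that by (simp add: T_Sp_simps)
    note \<psi>l = linear_mapsD[OF equivariantD(1)[OF \<psi>]]
    fix \<phi> \<phi>' c assume \<phi>: "\<phi> \<in> equivariant_maps V \<omega> r s"
    note \<phi>l = linear_mapsD[OF equivariantD(1)[OF \<phi>]]
    show "compose (carrier (T r)) \<psi> \<phi> \<in> equivariant_maps V \<omega> r t" by (rule comp[OF \<phi> \<psi>])
    show "compose (carrier (T r)) \<psi> (\<lambda>x\<in>carrier (T r). c \<odot>\<^bsub>T s\<^esub> \<phi> x) = (\<lambda>x\<in>carrier (T r). c \<odot>\<^bsub>T t\<^esub> compose (carrier (T r)) \<psi> \<phi> x)"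
      unfolding compose_def by (rule restrict_ext) (simp add: \<phi>l \<psi>l)
    assume \<phi>': "\<phi>' \<in> equivariant_maps V \<omega> r s"
    note \<phi>'l = linear_mapsD[OF equivariantD(1)[OF \<phi>']]
    show "compose (carrier (T r)) \<psi> (\<lambda>x\<in>carrier (T r). \<phi> x \<oplus>\<^bsub>T s\<^esub> \<phi>' x) =
        (\<lambda>x\<in>carrier (T r). compose (carrier (T r)) \<psi> \<phi> x \<oplus>\<^bsub>T t\<^esub> compose (carrier (T r)) \<psi> \<phi>' x)"
      unfolding compose_def by (rule restrict_ext) (simp add: \<phi>l \<phi>'l \<psi>l)
  qed
  show "(\<lambda>\<psi>. Comp (T_Sp V \<omega>) r s t \<phi> \<psi>) \<in> linear_maps (Hom (T_Sp V \<omega>) s t) (Hom (T_Sp V \<omega>) r t)"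
    if "\<phi> \<in> carrier (Hom (T_Sp V \<omega>) r s)" for r s t \<phi>
  proof (rule linear_mapsI; unfold T_Sp_simps)
    have \<phi>: "\<phi> \<in> equivariant_maps V \<omega> r s" using that by (simp add: T_Sp_simps)
    note \<phi>l = linear_mapsD[OF equivariantD(1)[OF \<phi>]]
    fix \<psi> \<psi>' c assume \<psi>: "\<psi> \<in> equivariant_maps V \<omega> s t"
    show "compose (carrier (T r)) \<psi> \<phi> \<in> equivariant_maps V \<omega> r t" by (rule comp[OF \<phi> \<psi>])
    show "compose (carrier (T r)) (\<lambda>x\<in>carrier (T s). c \<odot>\<^bsub>T t\<^esub> \<psi> x) \<phi> = (\<lambda>x\<in>carrier (T r). c \<odot>\<^bsub>T t\<^esub> compose (carrier (T r)) \<psi> \<phi> x)"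
      unfolding compose_def by (rule restrict_ext) (simp add: \<phi>l)
    show "compose (carrier (T r)) (\<lambda>x\<in>carrier (T s). \<psi> x \<oplus>\<^bsub>T t\<^esub> \<psi>' x) \<phi> =
        (\<lambda>x\<in>carrier (T r). compose (carrier (T r)) \<psi> \<phi> x \<oplus>\<^bsub>T t\<^esub> compose (carrier (T r)) \<psi>' \<phi> x)"
      unfolding compose_def by (rule restrict_ext) (simp add: \<phi>l)
  qed
  show "Comp (T_Sp V \<omega>) r t u (Comp (T_Sp V \<omega>) r s t f g) h = Comp (T_Sp V \<omega>) r s u f (Comp (T_Sp V \<omega>) s t u g h)"
    if "f \<in> carrier (Hom (T_Sp V \<omega>) r s)" "g \<in> carrier (Hom (T_Sp V \<omega>) s t)" "h \<in> carrier (Hom (T_Sp V \<omega>) t u)" for r s t u f g h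
    using that linear_mapsD(1)[OF equivariantD(1), of f r s] unfolding T_Sp_simps compose_def by (intro restrict_ext) simp
  show "Ident (T_Sp V \<omega>) r \<in> carrier (Hom (T_Sp V \<omega>) r r)" for r
  proof -
    have "(\<lambda>t\<in>carrier (T r). t) \<in> linear_maps (T r) (T r)"
      by (rule linear_mapsI) (simp_all add: tc.add_closed tc.smult_closed)
    then show ?thesis unfolding T_Sp_simps equivariant_maps_def by (simp add: tensor_map_closed)
  qed
  fix f r s assume "f \<in> carrier (Hom (T_Sp V \<omega>) r s)"
  then have f: "f \<in> equivariant_maps V \<omega> r s" by (simp add: T_Sp_simps)
  show "Comp (T_Sp V \<omega>) r r s (Ident (T_Sp V \<omega>) r) f = f" unfolding T_Sp_simps
    by (rule extensionalityI[OF compose_extensional equivariantD(2)[OF f]]) (simp add: compose_def)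
  show "Comp (T_Sp V \<omega>) r s s f (Ident (T_Sp V \<omega>) s) = f" unfolding T_Sp_simps
    by (rule extensionalityI[OF compose_extensional equivariantD(2)[OF f]])
      (simp add: compose_def linear_mapsD(1)[OF equivariantD(1)[OF f]])
qed

end

section \<open>The tensor of a diagram\<close>

lemma image_matching_bij:
  assumes h: "inj_on h S"
  shows "bij_betw (\<lambda>m. (`) h ` m) {m. perfect_matching S m} {m. perfect_matching (h ` S) m}"
proof -
  have sub: "m \<subseteq> Pow S" if "perfect_matching S m" for m
    using perfect_matching_Union[OF that] by blast
  have "inj_on (\<lambda>m. (`) h ` m) {m. perfect_matching S m}"
    using inj_on_subset[OF inj_on_image_Pow[OF inj_on_image_Pow[OF h]]] sub by (metis (mono_tags, lifting) PowI mem_Collect_eq subsetI)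
  moreover have "(\<lambda>m. (`) h ` m) ` {m. perfect_matching S m} = {m. perfect_matching (h ` S) m}"
  proof (intro equalityI subsetI)
    fix m' assume "m' \<in> {m. perfect_matching (h ` S) m}"
    then have m': "perfect_matching (h ` S) m'" by simp
    let ?m = "(`) (inv_into S h) ` m'"
    have "perfect_matching (inv_into S h ` (h ` S)) ?m"
      by (rule perfect_matching_image[OF m']) (rule inj_on_inv_into[OF subset_refl])
    moreover have "inv_into S h ` (h ` S) = S" using h by (simp add: inv_into_image_cancel)
    moreover have "(`) h ` ?m = m'"
    proof -
      have "h ` inv_into S h ` e = e" if "e \<in> m'" for e
        by (rule image_inv_into_cancel[OF refl]) (use perfect_matching_Union[OF m'] that in blast)
      then show ?thesis by (simp add: image_image)
    qed
    ultimately show "m' \<in> (\<lambda>m. (`) h ` m) ` {m. perfect_matching S m}" by (intro image_eqI[of _ _ ?m]) auto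
  qed (use perfect_matching_image[OF _ h] in auto)
  ultimately show ?thesis by (simp add: bij_betw_def)
qed

lemma Pos_bij: "bij_betw (Pos r s) (diagrams r s) {m. perfect_matching {..<s + r} m}"
  using image_matching_bij[OF posn_inj[of r s]] posn_image[of r s] unfolding diagrams_def Pos_def[abs_def] by simp

lemma finite_points: "finite (points r s)"
  by (simp add: points_def)

lemma finite_diagrams: "finite (diagrams r s)"
  unfolding diagrams_def by (rule finite_perfect_matchings[OF finite_points])

lemma diagrams_carrier: "f \<in> carrier (free_space (diagrams r s)) \<longleftrightarrow> (\<forall>x. x \<notin> diagrams r s \<longrightarrow> f x = 0)"
  using finite_subset[OF _ finite_diagrams[of r s], of "{x. f x \<noteq> 0}"] by (auto simp: free_space_simps)

text \<open>The functor in coordinates: the matrix of the linear map that belongs to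
  \<open>f\<close>.\<close>

definition theta :: "nat \<Rightarrow> nat \<Rightarrow> nat \<Rightarrow> (diagram \<Rightarrow> complex) \<Rightarrow> nat list \<Rightarrow> complex" where
  "theta n r s f = (\<lambda>xs. \<Sum>x\<in>diagrams r s. f x * PL n (s + r) (Pos r s x) xs)"

lemma theta_add: "theta n r s (f + g) = (\<lambda>i. theta n r s f i + theta n r s g i)"
  by (simp add: theta_def distrib_right sum.distrib)

lemma theta_scale: "theta n r s (\<lambda>x. c * f x) = (\<lambda>i. c * theta n r s f i)"
  by (simp add: theta_def sum_distrib_left mult.assoc)

lemma theta_zero: "theta n r s 0 = 0"
  by (simp add: theta_def fun_eq_iff)

lemma theta_sum: "theta n r s (\<Sum>a\<in>A. g a) = (\<Sum>a\<in>A. theta n r s (g a))"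
  by (rule ext) (simp only: theta_def sum_apply sum_distrib_right, rule sum.swap)

lemma theta_single: "x \<in> diagrams r s \<Longrightarrow> theta n r s (single x) = PL n (s + r) (Pos r s x)"
proof
  fix xs assume x: "x \<in> diagrams r s"
  have "theta n r s (single x) xs = (\<Sum>y\<in>diagrams r s. if y = x then PL n (s + r) (Pos r s x) xs else 0)"
    unfolding theta_def by (intro sum.cong refl) (simp add: single_def)
  then show "theta n r s (single x) xs = PL n (s + r) (Pos r s x) xs" using x finite_diagrams by simp
qed

text \<open>The same span as in \<open>Tm_image\<close>, which makes the functor full.\<close>

lemma theta_image: "theta n r s ` carrier (free_space (diagrams r s)) = form_span n (s + r)"
proof (intro equalityI subsetI)
  fix X assume "X \<in> theta n r s ` carrier (free_space (diagrams r s))"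
  then obtain f where "X = theta n r s f" by blast
  then have "X = (\<Sum>x\<in>diagrams r s. (\<lambda>xs. f x * PL n (s + r) (Pos r s x) xs))" by (simp add: theta_def fun_eq_iff sum_apply)
  then show "X \<in> form_span n (s + r)"
    by (simp only:) (intro fv.span_sum fv.span_scale fv.span_base imageI CollectI Pos_matching)
next
  fix X assume "X \<in> form_span n (s + r)"
  then obtain a where a: "X = (\<Sum>m\<in>{m. perfect_matching {..<s + r} m}. (\<lambda>xs. a m * PL n (s + r) m xs))"
    using span_image_finite[OF finite_perfect_matchings[of "{..<s + r}"]] by blast
  define f where "f x = (if x \<in> diagrams r s then a (Pos r s x) else 0)" for x
  have "theta n r s f = X"
  proof
    fix xs
    have "theta n r s f xs = (\<Sum>x\<in>diagrams r s. a (Pos r s x) * PL n (s + r) (Pos r s x) xs)"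
      unfolding theta_def by (intro sum.cong refl) (simp add: f_def)
    also have "\<dots> = (\<Sum>m\<in>{m. perfect_matching {..<s + r} m}. a m * PL n (s + r) m xs)"
      by (rule sum.reindex_bij_betw[OF Pos_bij])
    finally show "theta n r s f xs = X xs" by (simp add: a sum_apply)
  qed
  moreover have "f \<in> carrier (free_space (diagrams r s))" by (simp add: diagrams_carrier f_def)
  ultimately show "X \<in> theta n r s ` carrier (free_space (diagrams r s))" by (metis imageI)
qed

lemma matching_Un_diagram:
  assumes "S \<subseteq> points r s" "perfect_matching (points r s - S) f" "perfect_matching S m"
  shows "m \<union> f \<in> diagrams r s"
  using perfect_matching_Un[OF assms(3,2)] assms(1) by (simp add: diagrams_def Un_absorb1)

text \<open>\<open>P_pfaffian_zero\<close> applies, since the \<open>2n + 2\<close> positions of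
  \<open>S\<close> carry at most \<open>2n\<close> different letters.\<close>

lemma theta_pfaffian:
  assumes S: "S \<subseteq> points r s" "card S = 2 * (n + 1)" and f: "perfect_matching (points r s - S) f"
  shows "theta n r s (\<Sum>m\<in>{m. perfect_matching S m}. single (m \<union> f)) = 0"
proof
  fix xs
  let ?h = "posn r s"
  have hS: "inj_on ?h S" "inj_on ?h (points r s - S)" using posn_inj inj_on_subset S(1) by blast+
  have finS: "finite S" using S(1) finite_points finite_subset by blast
  have e: "theta n r s (\<Sum>m\<in>{m. perfect_matching S m}. single (m \<union> f)) xs = (\<Sum>m\<in>{m. perfect_matching S m}. PL n (s + r) (Pos r s (m \<union> f)) xs)"
    unfolding theta_sum sum_apply
    by (intro sum.cong refl) (simp add: theta_single matching_Un_diagram[OF S(1) f])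
  show "theta n r s (\<Sum>m\<in>{m. perfect_matching S m}. single (m \<union> f)) xs = 0 xs"
  proof (cases "xs \<in> lists_below n (s + r)")
    case True
    have "(\<Sum>m\<in>{m. perfect_matching S m}. PL n (s + r) (Pos r s (m \<union> f)) xs) =
        (\<Sum>m\<in>{m. perfect_matching S m}. P (Jn n) ((`) ?h ` m \<union> Pos r s f) (\<lambda>p. xs ! p))"
      by (intro sum.cong refl) (simp add: PL_def True Pos_def image_Un)
    also have "\<dots> = (\<Sum>m\<in>{m. perfect_matching (?h ` S) m}. P (Jn n) (m \<union> Pos r s f) (\<lambda>p. xs ! p))"
      by (rule sum.reindex_bij_betw[OF image_matching_bij[OF hS(1)]])
    also have "\<dots> = 0"
    proof (rule P_pfaffian_zero[where J="Jn n" and Ls="{..<2 * n}" and T="?h ` (points r s - S)", OF Jn_skew])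
      show "finite (?h ` S)" "finite (?h ` (points r s - S))" using finS finite_points by auto
      show "?h ` S \<inter> ?h ` (points r s - S) = {}"
        using posn_inj[of r s] S(1) by (auto simp: inj_on_def)
      show "perfect_matching (?h ` (points r s - S)) (Pos r s f)"
        unfolding Pos_def by (rule perfect_matching_image[OF f hS(2)])
      have "?h ` S \<subseteq> {..<s + r}" using posn_image[of r s] S(1) by blast
      moreover have "xs ! p < 2 * n" if "p < s + r" for p
      proof -
        have l: "p < length xs" "set xs \<subseteq> {..<2 * n}" using True that by (auto simp: lists_below_def)
        show ?thesis using subsetD[OF l(2) nth_mem[OF l(1)]] by simp
      qed
      ultimately show "(\<lambda>p. xs ! p) ` ?h ` S \<subseteq> {..<2 * n}" by blast
      show "finite {..<2 * n}" "card {..<2 * n} < card (?h ` S)" using S(2) card_image[OF hS(1)] by auto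
    qed
    finally show ?thesis using e by simp
  qed (simp add: e PL_def)
qed

section \<open>Noncrossing diagrams and the kernel of the functor\<close>

definition ncd :: "nat \<Rightarrow> nat \<Rightarrow> nat \<Rightarrow> diagram set" where
  "ncd n r s = {x \<in> diagrams r s. noncrossing (n + 1) (Pos r s x)}"

lemma finite_ncd: "finite (ncd n r s)"
  by (rule finite_subset[OF _ finite_diagrams[of r s]]) (auto simp: ncd_def)

lemma ncd_bij: "bij_betw (Pos r s) (ncd n r s) (noncrossing_on n (s + r))"
  unfolding bij_betw_def
proof
  show "inj_on (Pos r s) (ncd n r s)"
    by (rule inj_on_subset[OF bij_betw_imp_inj_on[OF Pos_bij]]) (auto simp: ncd_def)
  have "Pos r s ` diagrams r s = {m. perfect_matching {..<s + r} m}" by (rule bij_betw_imp_surj_on[OF Pos_bij])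
  moreover have "Pos r s ` {x \<in> diagrams r s. Q (Pos r s x)} = {m \<in> Pos r s ` diagrams r s. Q m}" for Q by blast
  ultimately show "Pos r s ` ncd n r s = noncrossing_on n (s + r)" unfolding ncd_def noncrossing_on_def by simp
qed

lemma ncd_independent:
  assumes n: "n \<ge> 1" and c: "\<And>xs. (\<Sum>x\<in>ncd n r s. c x * PL n (s + r) (Pos r s x) xs) = 0" and x: "x \<in> ncd n r s"
  shows "c x = 0"
proof -
  let ?N = "s + r"
  define d where "d m = c (inv_into (ncd n r s) (Pos r s) m)" for m
  have d: "d (Pos r s x) = c x" if "x \<in> ncd n r s" for x
    unfolding d_def using inv_into_f_f[OF bij_betw_imp_inj_on[OF ncd_bij] that] by simp
  have "(\<Sum>m\<in>noncrossing_on n ?N. (\<lambda>w. d m * PW n ?N m w)) = 0"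
  proof
    fix w
    show "(\<Sum>m\<in>noncrossing_on n ?N. (\<lambda>w. d m * PW n ?N m w)) w = 0 w"
    proof (cases "w \<in> words n ?N")
      case True
      let ?xs = "map w [0..<?N]"
      have xs: "?xs \<in> lists_below n ?N" using True by (auto simp: lists_below_def PiE_def)
      have PL: "PW n ?N m w = PL n ?N m ?xs" if "m \<in> noncrossing_on n ?N" for m
      proof -
        have "P (Jn n) m w = P (Jn n) m (\<lambda>p. ?xs ! p)"
          by (rule P_cong[of "Jn n", OF Jn_skew finite_lessThan]) (use that in \<open>auto simp: noncrossing_on_def\<close>)
        then show ?thesis using True xs by (simp add: PW_def PL_def)
      qed
      have "(\<Sum>m\<in>noncrossing_on n ?N. (\<lambda>w. d m * PW n ?N m w)) w = (\<Sum>m\<in>noncrossing_on n ?N. d m * PL n ?N m ?xs)"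
        unfolding sum_apply by (intro sum.cong refl) (simp only: PL)
      also have "\<dots> = (\<Sum>x\<in>ncd n r s. d (Pos r s x) * PL n ?N (Pos r s x) ?xs)"
        by (rule sum.reindex_bij_betw[OF ncd_bij, symmetric])
      also have "\<dots> = (\<Sum>x\<in>ncd n r s. c x * PL n ?N (Pos r s x) ?xs)" using d by (intro sum.cong refl) simp
      finally show ?thesis using c[of ?xs] by simp
    qed (simp add: sum_apply PW_def)
  qed
  moreover have "Pos r s x \<in> noncrossing_on n ?N" using bij_betwE[OF ncd_bij] x by blast
  ultimately have "d (Pos r s x) = 0" by (rule noncrossing_independent[OF n])
  then show ?thesis using d[OF x] by simp
qed

lemma pfaffian_eq:
  assumes "S \<subseteq> points r s" "perfect_matching (points r s - S) f"
  shows "pfaffian r s S f = (\<Sum>m\<in>{m. perfect_matching S m}. single (m \<union> f))"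
proof
  fix x
  have "finite {m. perfect_matching S m}"
    by (rule finite_perfect_matchings) (use assms(1) finite_points finite_subset in blast)
  then show "pfaffian r s S f x = (\<Sum>m\<in>{m. perfect_matching S m}. single (m \<union> f)) x"
    unfolding pfaffian_def sum_apply
    by (rule free.h_finsum) (auto intro!: single_free matching_Un_diagram[OF assms])
qed

abbreviation pf_gens :: "nat \<Rightarrow> nat \<Rightarrow> nat \<Rightarrow> (diagram \<Rightarrow> complex) set" where
  "pf_gens n r s \<equiv> {(\<Sum>m\<in>{m. perfect_matching S m}. single (m \<union> f)) | S f.
     S \<subseteq> points r s \<and> card S = 2 * (n + 1) \<and> perfect_matching (points r s - S) f}"

lemma pf_gens_carrier: "pf_gens n r s \<subseteq> carrier (free_space (diagrams r s))"
proof
  fix g assume "g \<in> pf_gens n r s"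
  then obtain S f where S: "g = (\<Sum>m\<in>{m. perfect_matching S m}. single (m \<union> f))" "S \<subseteq> points r s"
    "perfect_matching (points r s - S) f" by blast
  show "g \<in> carrier (free_space (diagrams r s))" unfolding S(1)
    by (intro fv.subspace_sum[OF free_space_subspace] single_free matching_Un_diagram[OF S(2,3)]) simp
qed

lemma pfaffian_ideal_span: "pfaffian_ideal n r s = fv.span (pf_gens n r s)"
proof -
  have "{pfaffian r s S f | S f. S \<subseteq> points r s \<and> card S = 2 * (n + 1) \<and> perfect_matching (points r s - S) f} = pf_gens n r s"
    by (intro Collect_cong) (metis pfaffian_eq)
  then show ?thesis unfolding pfaffian_ideal_def by (simp only: vspan_free[OF pf_gens_carrier])
qed

lemma ideal_subspace: "fv.subspace (pfaffian_ideal n r s)"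
  unfolding pfaffian_ideal_span by (rule fv.subspace_span)

lemma ideal_carrier: "pfaffian_ideal n r s \<subseteq> carrier (free_space (diagrams r s))"
  unfolding pfaffian_ideal_span by (rule fv.span_minimal[OF pf_gens_carrier free_space_subspace])

lemma theta_ideal: "f \<in> pfaffian_ideal n r s \<Longrightarrow> theta n r s f = 0"
proof -
  have "fv.subspace {f. theta n r s f = 0}"
    by (rule fv.subspaceI) (simp_all only: mem_Collect_eq theta_zero theta_add theta_scale zero_fun_apply add_0 mult_zero_right, simp_all add: zero_fun_def)
  moreover have "pf_gens n r s \<subseteq> {f. theta n r s f = 0}"
  proof
    fix g assume "g \<in> pf_gens n r s"
    then obtain S f where S: "g = (\<Sum>m\<in>{m. perfect_matching S m}. single (m \<union> f))" "S \<subseteq> points r s"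
      "card S = 2 * (n + 1)" "perfect_matching (points r s - S) f" by blast
    show "g \<in> {f. theta n r s f = 0}" using theta_pfaffian[OF S(2-4)] unfolding S(1)[symmetric] by simp
  qed
  ultimately have "fv.span (pf_gens n r s) \<subseteq> {f. theta n r s f = 0}" using fv.span_minimal by blast
  then show "f \<in> pfaffian_ideal n r s \<Longrightarrow> theta n r s f = 0" unfolding pfaffian_ideal_span by blast
qed

lemma straighten_diagrams:
  assumes f: "f \<in> carrier (free_space (diagrams r s))"
  shows "\<exists>a. \<exists>\<rho>\<in>pfaffian_ideal n r s. f = \<rho> + (\<Sum>x\<in>ncd n r s. (\<lambda>y. a x * single x y))"
proof -
  have "single x \<in> fv.span (pf_gens n r s \<union> single ` ncd n r s)" if "x \<in> diagrams r s" for x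
    using straightening[OF finite_points posn_inj, of r s x n] that unfolding diagrams_def ncd_def Pos_def by simp
  then have "single ` diagrams r s \<subseteq> fv.span (pf_gens n r s \<union> single ` ncd n r s)" by blast
  then have "f \<in> fv.span (pf_gens n r s \<union> single ` ncd n r s)"
    using free_in_span[OF f] fv.span_minimal[OF _ fv.subspace_span] by blast
  then obtain \<rho> g where \<rho>: "\<rho> \<in> fv.span (pf_gens n r s)" and g: "g \<in> fv.span (single ` ncd n r s)" and fg: "f = \<rho> + g"
    unfolding fv.span_Un by blast
  obtain a where "g = (\<Sum>x\<in>ncd n r s. (\<lambda>y. a x * single x y))" using span_image_finite[OF finite_ncd g] by blast
  then show ?thesis using \<rho> fg unfolding pfaffian_ideal_span by blast
qed

lemma theta_combination:
  "theta n r s (\<Sum>x\<in>ncd n r s. (\<lambda>y. a x * single x y)) xs = (\<Sum>x\<in>ncd n r s. a x * PL n (s + r) (Pos r s x) xs)"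
  unfolding theta_sum sum_apply theta_scale
  by (intro sum.cong refl) (simp add: theta_single ncd_def)

text \<open>The second fundamental theorem: straightening leaves a combination of noncrossing
  diagrams, and as their tensors are independent it has to be zero.\<close>

lemma theta_kernel:
  assumes n: "n \<ge> 1" and f: "f \<in> carrier (free_space (diagrams r s))"
  shows "theta n r s f = (\<lambda>_. 0) \<longleftrightarrow> f \<in> pfaffian_ideal n r s"
proof
  assume z: "theta n r s f = (\<lambda>_. 0)"
  obtain a \<rho> where \<rho>: "\<rho> \<in> pfaffian_ideal n r s" and f: "f = \<rho> + (\<Sum>x\<in>ncd n r s. (\<lambda>y. a x * single x y))"
    using straighten_diagrams[OF f] by blast
  have "(\<Sum>x\<in>ncd n r s. a x * PL n (s + r) (Pos r s x) xs) = 0" for xs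
    using fun_cong[OF z, of xs] unfolding f theta_add theta_combination theta_ideal[OF \<rho>] by simp
  then have "a x = 0" if "x \<in> ncd n r s" for x using ncd_independent[OF n _ that] by blast
  then have "f = \<rho>" unfolding f by (simp add: fun_eq_iff sum_apply)
  then show "f \<in> pfaffian_ideal n r s" using \<rho> by simp
qed (simp add: theta_ideal zero_fun_def)

lemma theta_quot: "n \<ge> 1 \<Longrightarrow> coord_quot (diagrams r s) (pfaffian_ideal n r s) (theta n r s)"
  by unfold_locales (auto simp: ideal_subspace theta_add theta_scale theta_kernel dest: subsetD[OF ideal_carrier])

section \<open>Compatibility with composition and identities\<close>

abbreviation du :: "nat \<Rightarrow> nat \<Rightarrow> nat" where
  "du n l \<equiv> 2 * n - 1 - l"

text \<open>The inverse form in the shape of the hypothesis \<open>inv\<close> of the gluing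
  lemmas.\<close>

lemma Jn_inverse: "(\<Sum>l<2 * n. Jn n (du n l) l * Jn n a l * Jn n (du n l) c) = Jn n a c"
proof (cases "a < 2 * n")
  case True
  have "(\<Sum>l<2 * n. Jn n (du n l) l * Jn n a l * Jn n (du n l) c) = (\<Sum>l<2 * n. if l = du n a then Jn n a c else 0)"
  proof (intro sum.cong refl)
    fix l assume l: "l \<in> {..<2 * n}"
    show "Jn n (du n l) l * Jn n a l * Jn n (du n l) c = (if l = du n a then Jn n a c else 0)"
    proof (cases "l = du n a")
      case True
      then have "du n l = a" using \<open>a < 2 * n\<close> by simp
      moreover have "Jn n a l * Jn n a l = 1" using True \<open>a < 2 * n\<close> by (simp add: Jn_def)
      ultimately show ?thesis using True by simp
    qed (use l in \<open>simp add: Jn_def\<close>)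
  qed
  also have "\<dots> = Jn n a c" using True by simp
  finally show ?thesis .
qed (simp add: Jn_def)

text \<open>The value of a loop. The two factors of each of the \<open>2n\<close> summands have
  opposite orientation, so that each summand is \<open>-1\<close>; this is the origin of the
  parameter \<open>-2n\<close>.\<close>

lemma Jn_loop: "(\<Sum>l<2 * n. Jn n (du n l) l * Jn n l (du n l)) = - of_nat (2 * n)"
proof -
  have "(\<Sum>l<2 * n. Jn n (du n l) l * Jn n l (du n l)) = (\<Sum>l<2 * n. - 1)"
  proof (intro sum.cong refl)
    fix l assume "l \<in> {..<2 * n}"
    then have "Jn n l (du n l) * Jn n l (du n l) = 1" by (simp add: Jn_def)
    then show "Jn n (du n l) l * Jn n l (du n l) = - 1" using Jn_skew[of n "du n l" l] by simp
  qed
  then show ?thesis by simp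
qed

abbreviation (input) wt :: "nat \<Rightarrow> nat list \<Rightarrow> complex" where
  "wt n u \<equiv> (\<Prod>l\<leftarrow>u. Jn n (du n l) l)"

text \<open>Translation of \<open>diagram_comp_glue\<close> into lists: the middle word
  \<open>u\<close> is reversed in the slots of \<open>y\<close> and replaced by its dual letters in
  those of \<open>x\<close>.\<close>

lemma PL_glue:
  assumes x: "x \<in> diagrams r s" and y: "y \<in> diagrams s t" and v: "v \<in> lists_below n t" and w: "w \<in> lists_below n r"
  shows "diagram_comp x y \<in> diagrams r t"
    and "(\<Sum>u\<in>lists_below n s. wt n u * PL n (s + r) (Pos r s x) (map (du n) u @ rev w) * PL n (t + s) (Pos s t y) (v @ rev u)) =
      (- of_nat (2 * n)) ^ loops x y * PL n (t + r) (Pos r t (diagram_comp x y)) (v @ rev w)"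
proof -
  let ?J = "Jn n" and ?W = "\<lambda>p. (v @ rev w) ! p"
  note glue = diagram_comp_glue[where J="Jn n" and Ls="{..<2 * n}" and C="\<lambda>l. Jn n (du n l) l" and d="du n",
      OF x y Jn_skew Jn_inverse finite_lessThan]
  show c: "diagram_comp x y \<in> diagrams r t" by (rule glue(1))
  have lv: "length v = t" and lw: "length w = r" using v w by (auto simp: lists_below_def)
  have vw: "v @ rev w \<in> lists_below n (t + r)" using v w by (auto simp: lists_below_def)
  have "(\<Sum>u\<in>lists_below n s. wt n u * PL n (s + r) (Pos r s x) (map (du n) u @ rev w) * PL n (t + s) (Pos s t y) (v @ rev u)) =
    (\<Sum>u\<in>{u. length u = s \<and> set u \<subseteq> {..<2 * n}}. wt n u *
      (P ?J (Pos s t y) (\<lambda>p. if p < t then ?W p else u ! (t + s - 1 - p)) *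
       P ?J (Pos r s x) (\<lambda>p. if p < s then du n (u ! p) else ?W (t + (p - s)))))"
    unfolding lists_below_def[of n s]
  proof (intro sum.cong refl)
    fix u assume u: "u \<in> {u. length u = s \<and> set u \<subseteq> {..<2 * n}}"
    have "set (map (du n) u) \<subseteq> {..<2 * n}" using u by auto
    then have 1: "map (du n) u @ rev w \<in> lists_below n (s + r)" "v @ rev u \<in> lists_below n (t + s)"
      using u v w by (auto simp: lists_below_def)
    have "P ?J (Pos r s x) (\<lambda>p. (map (du n) u @ rev w) ! p) = P ?J (Pos r s x) (\<lambda>p. if p < s then du n (u ! p) else ?W (t + (p - s)))"
    proof (rule P_cong[of ?J, OF Jn_skew finite_lessThan Pos_matching[OF x]])
      show "(map (du n) u @ rev w) ! p = (if p < s then du n (u ! p) else ?W (t + (p - s)))" for p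
        using u nth_append_length_plus[of v "rev w" "p - s"] unfolding lv by (simp only: nth_append[of "map (du n) u"]) simp
    qed
    moreover have "P ?J (Pos s t y) (\<lambda>p. (v @ rev u) ! p) = P ?J (Pos s t y) (\<lambda>p. if p < t then ?W p else u ! (t + s - 1 - p))"
    proof (rule P_cong[of ?J, OF Jn_skew finite_lessThan Pos_matching[OF y]])
      fix p assume p: "p \<in> {..<t + s}"
      show "(v @ rev u) ! p = (if p < t then ?W p else u ! (t + s - 1 - p))"
      proof (cases "p < t")
        case False
        then have "s - Suc (p - t) = t + s - 1 - p" using p by auto
        then show ?thesis using False p u lv by (simp add: nth_append rev_nth)
      qed (use lv in \<open>simp add: nth_append\<close>)
    qed
    ultimately show "wt n u * PL n (s + r) (Pos r s x) (map (du n) u @ rev w) * PL n (t + s) (Pos s t y) (v @ rev u) =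
      wt n u * (P ?J (Pos s t y) (\<lambda>p. if p < t then ?W p else u ! (t + s - 1 - p)) *
       P ?J (Pos r s x) (\<lambda>p. if p < s then du n (u ! p) else ?W (t + (p - s))))"
      using 1 by (simp add: PL_def mult_ac)
  qed
  also have "\<dots> = (- of_nat (2 * n)) ^ loops x y * PL n (t + r) (Pos r t (diagram_comp x y)) (v @ rev w)"
    unfolding glue(2) Jn_loop using vw by (simp add: PL_def)
  finally show "(\<Sum>u\<in>lists_below n s. wt n u * PL n (s + r) (Pos r s x) (map (du n) u @ rev w) * PL n (t + s) (Pos s t y) (v @ rev u)) =
      (- of_nat (2 * n)) ^ loops x y * PL n (t + r) (Pos r t (diagram_comp x y)) (v @ rev w)" .
qed

lemma D_Sp_simps:
  "Hom (D_Sp n) r s = free_space (diagrams r s)"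
  "Ident (D_Sp n) r = single (diagram_id r)"
  by (simp_all add: D_Sp_def brauer_category_def)

lemma diagram_comp_closed: "x \<in> diagrams r s \<Longrightarrow> y \<in> diagrams s t \<Longrightarrow> diagram_comp x y \<in> diagrams r t"
  by (rule diagram_comp_glue(1)[where J="Jn n" and Ls="{..<2 * n}" and C="\<lambda>l. Jn n (du n l) l" and d="du n" for n,
      OF _ _ Jn_skew Jn_inverse finite_lessThan])

lemma D_Sp_Comp:
  assumes f: "f \<in> carrier (free_space (diagrams r s))" and g: "g \<in> carrier (free_space (diagrams s t))"
  shows "Comp (D_Sp n) r s t f g \<in> carrier (free_space (diagrams r t))"
    and "Comp (D_Sp n) r s t f g = (\<Sum>x\<in>diagrams r s. \<Sum>y\<in>diagrams s t.
      (\<lambda>z. (f x * (g y * (- of_nat (2 * n)) ^ loops x y)) * single (diagram_comp x y) z))"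
proof -
  let ?H = "free_space (diagrams r t)"
  let ?\<phi> = "\<lambda>x y. (- of_nat (2 * n)) ^ loops x y \<odot>\<^bsub>?H\<^esub> single (diagram_comp x y)"
  have e: "Comp (D_Sp n) r s t f g = lin_ext ?H (\<lambda>x. lin_ext ?H (?\<phi> x) g) f"
    by (simp add: D_Sp_def brauer_category_def Let_def)
  have \<phi>: "?\<phi> x y \<in> carrier ?H" if "x \<in> diagrams r s" "y \<in> diagrams s t" for x y
    by (rule free.smult_closed[OF single_free[OF diagram_comp_closed[OF that]]])
  have fx: "x \<in> diagrams r s" if "f x \<noteq> 0" for x using f that by (auto simp: diagrams_carrier)
  have gy: "y \<in> diagrams s t" if "g y \<noteq> 0" for y using g that by (auto simp: diagrams_carrier)
  have in1: "lin_ext ?H (?\<phi> x) g \<in> carrier ?H" if "x \<in> diagrams r s" for x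
    by (rule free.lin_ext_closed) (rule \<phi>[OF that gy])
  show "Comp (D_Sp n) r s t f g \<in> carrier ?H" unfolding e by (rule free.lin_ext_closed) (rule in1[OF fx])
  show "Comp (D_Sp n) r s t f g = (\<Sum>x\<in>diagrams r s. \<Sum>y\<in>diagrams s t.
      (\<lambda>z. (f x * (g y * (- of_nat (2 * n)) ^ loops x y)) * single (diagram_comp x y) z))"
  proof
    fix z
    have "Comp (D_Sp n) r s t f g z = (\<Sum>x\<in>diagrams r s. f x * lin_ext ?H (?\<phi> x) g z)"
      unfolding e by (rule free.h_lin_ext[OF finite_diagrams]) (use fx in1 in auto)
    also have "\<dots> = (\<Sum>x\<in>diagrams r s. f x * (\<Sum>y\<in>diagrams s t. g y * ?\<phi> x y z))"
    proof (intro sum.cong refl arg_cong2[of _ _ _ _ "(*)"])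
      fix x assume x: "x \<in> diagrams r s"
      show "lin_ext ?H (?\<phi> x) g z = (\<Sum>y\<in>diagrams s t. g y * ?\<phi> x y z)"
        by (rule free.h_lin_ext[OF finite_diagrams]) (use gy \<phi>[OF x] in auto)
    qed
    finally show "Comp (D_Sp n) r s t f g z = (\<Sum>x\<in>diagrams r s. \<Sum>y\<in>diagrams s t.
      (\<lambda>z. (f x * (g y * (- of_nat (2 * n)) ^ loops x y)) * single (diagram_comp x y) z)) z"
      unfolding sum_apply free_space_simps(4) sum_distrib_left by (simp only: mult.assoc)
  qed
qed

lemma theta_Comp:
  assumes f: "f \<in> carrier (free_space (diagrams r s))" and g: "g \<in> carrier (free_space (diagrams s t))"
    and v: "v \<in> lists_below n t" and w: "w \<in> lists_below n r"
  shows "theta n r t (Comp (D_Sp n) r s t f g) (v @ rev w) =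
    (\<Sum>u\<in>lists_below n s. wt n u * theta n r s f (map (du n) u @ rev w) * theta n s t g (v @ rev u))"
proof -
  have shuffle: "a * c * (d * A * B) = d * (a * A) * (c * B)" for a c d A B :: complex by simp
  let ?A = "\<lambda>x u. PL n (s + r) (Pos r s x) (map (du n) u @ rev w)" and ?B = "\<lambda>y u. PL n (t + s) (Pos s t y) (v @ rev u)"
  have "theta n r t (Comp (D_Sp n) r s t f g) (v @ rev w) =
    (\<Sum>x\<in>diagrams r s. \<Sum>y\<in>diagrams s t. (f x * g y) * ((- of_nat (2 * n)) ^ loops x y * PL n (t + r) (Pos r t (diagram_comp x y)) (v @ rev w)))"
    unfolding D_Sp_Comp(2)[OF f g] theta_sum sum_apply theta_scale
    by (intro sum.cong refl) (simp add: theta_single diagram_comp_closed)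
  also have "\<dots> = (\<Sum>x\<in>diagrams r s. \<Sum>y\<in>diagrams s t. (f x * g y) * (\<Sum>u\<in>lists_below n s. wt n u * ?A x u * ?B y u))"
    by (intro sum.cong refl) (simp only: PL_glue(2)[OF _ _ v w])
  also have "\<dots> = (\<Sum>x\<in>diagrams r s. \<Sum>y\<in>diagrams s t. \<Sum>u\<in>lists_below n s. wt n u * (f x * ?A x u) * (g y * ?B y u))"
    unfolding sum_distrib_left by (intro sum.cong refl) (rule shuffle)
  also have "\<dots> = (\<Sum>x\<in>diagrams r s. \<Sum>u\<in>lists_below n s. \<Sum>y\<in>diagrams s t. wt n u * (f x * ?A x u) * (g y * ?B y u))"
    by (rule sum.cong[OF refl]) (rule sum.swap)
  also have "\<dots> = (\<Sum>u\<in>lists_below n s. \<Sum>x\<in>diagrams r s. \<Sum>y\<in>diagrams s t. wt n u * (f x * ?A x u) * (g y * ?B y u))"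
    by (rule sum.swap)
  also have "\<dots> = (\<Sum>u\<in>lists_below n s. wt n u * theta n r s f (map (du n) u @ rev w) * theta n s t g (v @ rev u))"
  proof (rule sum.cong[OF refl])
    fix u
    show "(\<Sum>x\<in>diagrams r s. \<Sum>y\<in>diagrams s t. wt n u * (f x * ?A x u) * (g y * ?B y u)) =
        wt n u * theta n r s f (map (du n) u @ rev w) * theta n s t g (v @ rev u)"
      unfolding theta_def sum_distrib_left[of "wt n u"] sum_product ..
  qed
  finally show ?thesis .
qed

lemma diagram_id_image: "diagram_id r = (\<lambda>i. {Inl i, Inr i}) ` {1..r}"
  by (auto simp: diagram_id_def)

lemma diagram_id_closed: "diagram_id r \<in> diagrams r r"
proof -
  have "partition_on (points r r) (diagram_id r)"
    by (rule partition_onI) (auto simp: diagram_id_image points_def disjnt_def)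
  then show ?thesis by (auto simp: diagrams_def perfect_matching_def diagram_id_image)
qed

lemma theta_id:
  assumes v: "v \<in> lists_below n r" and w: "w \<in> lists_below n r"
  shows "theta n r r (single (diagram_id r)) (v @ rev w) = prod_list (map2 (Jn n) v w)"
proof -
  have l: "length v = r" "length w = r" and vw: "v @ rev w \<in> lists_below n (r + r)" using v w by (auto simp: lists_below_def)
  \<comment> \<open>The \<open>i\<close>-th strand joins the positions \<open>i - 1\<close> and
    \<open>2r - i\<close>, which are nested around \<open>r\<close>.\<close>
  have Pos: "Pos r r (diagram_id r) = {{r - 1 - i, r + i} | i. i < r}"
  proof -
    have "Pos r r (diagram_id r) = (\<lambda>i. {r + r - i, i - 1}) ` {1..r}"
      unfolding Pos_def diagram_id_image posn_def image_image by simp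
    also have "\<dots> = (\<lambda>i. {r - 1 - i, r + i}) ` {..<r}"
    proof (intro equalityI subsetI; elim imageE)
      fix e i assume "e = {r + r - i, i - 1}" "i \<in> {1..r}"
      then show "e \<in> (\<lambda>i. {r - 1 - i, r + i}) ` {..<r}" by (intro image_eqI[of _ _ "r - i"]) auto
    next
      fix e i assume "e = {r - 1 - i, r + i}" "i \<in> {..<r}"
      then show "e \<in> (\<lambda>i. {r + r - i, i - 1}) ` {1..r}" by (intro image_eqI[of _ _ "r - i"]) auto
    qed
    finally show ?thesis by auto
  qed
  have "theta n r r (single (diagram_id r)) (v @ rev w) = P (Jn n) {{r - 1 - i, r + i} | i. i < r} (\<lambda>p. (v @ rev w) ! p)"
    using vw by (simp add: theta_single diagram_id_closed PL_def Pos)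
  also have "\<dots> = (\<Prod>i<r. Jn n ((v @ rev w) ! (r - 1 - i)) ((v @ rev w) ! (r + i)))"
    by (rule P_nested[of "Jn n", OF Jn_skew]) simp
  also have "\<dots> = (\<Prod>i<r. Jn n (v ! (r - Suc i)) (w ! (r - Suc i)))"
    using l by (intro prod.cong refl) (simp add: nth_append rev_nth)
  also have "\<dots> = (\<Prod>i<r. Jn n (v ! i) (w ! i))" by (rule prod.nat_diff_reindex)
  also have "\<dots> = prod_list (map2 (Jn n) v w)"
    using l by (simp add: prod.list_conv_set_nth atLeast0LessThan)
  finally show ?thesis .
qed

section \<open>The isomorphism\<close>

lemma noncrossing_image:
  assumes h: "strict_mono_on Z h" "\<Union>m \<subseteq> Z" and k: "k \<ge> 1" and nc: "noncrossing k ((`) h ` m)"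
  shows "noncrossing k m"
  unfolding noncrossing_def
proof
  assume "\<exists>a b :: nat \<Rightarrow> nat. strict_mono_on {1..k} a \<and> strict_mono_on {1..k} b \<and> a k < b 1 \<and> (\<forall>i\<in>{1..k}. {a i, b i} \<in> m)"
  then obtain a b :: "nat \<Rightarrow> nat" where ab: "strict_mono_on {1..k} a" "strict_mono_on {1..k} b" "a k < b 1"
    "\<And>i. i \<in> {1..k} \<Longrightarrow> {a i, b i} \<in> m" by blast
  have Z: "a i \<in> Z" "b i \<in> Z" if "i \<in> {1..k}" for i using ab(4)[OF that] h(2) by auto
  have "strict_mono_on {1..k} (h \<circ> a)" "strict_mono_on {1..k} (h \<circ> b)"
    using ab(1,2) Z h(1) by (auto simp: strict_mono_on_def)
  moreover have "(h \<circ> a) k < (h \<circ> b) 1" using h(1) Z[of k] Z[of 1] ab(3) k by (auto simp: strict_mono_on_def)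
  moreover have "\<forall>i\<in>{1..k}. {(h \<circ> a) i, (h \<circ> b) i} \<in> (`) h ` m"
  proof
    fix i assume "i \<in> {1..k}"
    then show "{(h \<circ> a) i, (h \<circ> b) i} \<in> (`) h ` m" using ab(4) by (intro image_eqI[of _ _ "{a i, b i}"]) auto
  qed
  ultimately show False using nc unfolding noncrossing_def by blast
qed

text \<open>In a diagram from \<open>0\<close> to \<open>2r\<close> the point \<open>j\<close> has
  position \<open>j - 1\<close>, and a shift respects the order.\<close>

lemma noncrossing_matchings_ncd: "(\<lambda>m. (`) Inr ` m) ` noncrossing_matchings r n = ncd n 0 (2 * r)"
proof -
  have pts: "points 0 (2 * r) = Inr ` {1..2 * r}" by (simp add: points_def)
  have bij: "(\<lambda>m. (`) Inr ` m) ` {m. perfect_matching {1..2 * r} m} = diagrams 0 (2 * r)"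
    unfolding diagrams_def pts by (rule bij_betw_imp_surj_on[OF image_matching_bij]) simp
  have Pos: "Pos 0 (2 * r) ((`) Inr ` m) = (`) (\<lambda>j. j - 1) ` m" for m
    by (simp add: Pos_def posn_def image_image)
  have "noncrossing (n + 1) ((`) (\<lambda>j. j - 1) ` m) \<longleftrightarrow> noncrossing (n + 1) m" if m: "perfect_matching {1..2 * r} m" for m
  proof
    have U: "\<Union>m = {1..2 * r}" by (rule perfect_matching_Union[OF m])
    show "noncrossing (n + 1) m" if "noncrossing (n + 1) ((`) (\<lambda>j. j - 1) ` m)"
      by (rule noncrossing_image[where Z="{1..2 * r}", OF _ _ _ that]) (use U in \<open>auto simp: strict_mono_on_def\<close>)
    have "Suc ` (\<lambda>j. j - 1) ` e = e" if e: "e \<in> m" for e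
    proof -
      have "Suc (j - 1) = j" if "j \<in> e" for j using UnionI[OF e that] unfolding U by simp
      then show ?thesis by (simp add: image_image)
    qed
    then have "(`) Suc ` (`) (\<lambda>j. j - 1) ` m = m" by (simp add: image_image)
    then show "noncrossing (n + 1) ((`) (\<lambda>j. j - 1) ` m)" if "noncrossing (n + 1) m"
      using noncrossing_image[of UNIV Suc "(`) (\<lambda>j. j - 1) ` m" "n + 1"] that by (simp add: strict_mono_on_def)
  qed
  then show ?thesis unfolding noncrossing_matchings_def ncd_def bij[symmetric] by (auto simp: Pos)
qed

lemma sum_single: "finite A \<Longrightarrow> x \<in> A \<Longrightarrow> (\<Sum>z\<in>A. single x z * h z) = h x"
proof -
  assume A: "finite A" "x \<in> A"
  have "(\<Sum>z\<in>A. single x z * h z) = (\<Sum>z\<in>A. if z = x then h x else 0)"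
    by (intro sum.cong refl) (simp add: single_def)
  then show ?thesis using A by simp
qed

context symp_basis
begin

sublocale q: coord_quot "diagrams r s" "pfaffian_ideal n r s" "theta n r s" for r s
  by (rule theta_quot[OF n1])

abbreviation "C \<equiv> quot_cat (D_Sp n) (pfaffian_ideal n)"
abbreviation "cl r s f \<equiv> pfaffian_ideal n r s +>\<^bsub>free_space (diagrams r s)\<^esub> f"

lemma C_simps:
  "Hom C r s = quot_space (free_space (diagrams r s)) (pfaffian_ideal n r s)"
  "Comp C r s t A B = (\<Union>f\<in>A. \<Union>g\<in>B. cl r t (Comp (D_Sp n) r s t f g))"
  "Ident C r = cl r r (single (diagram_id r))"
  by (simp_all add: quot_cat_def D_Sp_simps)

lemma theta_outside: "xs \<notin> Wl (s + r) \<Longrightarrow> theta n r s f xs = 0"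
  by (simp add: theta_def PL_def)

lemma theta_eqI:
  assumes "\<And>xs. xs \<notin> Wl (s + r) \<Longrightarrow> X xs = 0"
    and "\<And>v w. v \<in> Wl s \<Longrightarrow> w \<in> Wl r \<Longrightarrow> theta n r s f (v @ rev w) = X (v @ rev w)"
  shows "theta n r s f = X"
proof
  fix xs
  show "theta n r s f xs = X xs"
  proof (cases "xs \<in> Wl (s + r)")
    case True
    show ?thesis using assms(2)[OF Wl_split[OF True]] by simp
  qed (use assms(1) theta_outside in simp)
qed

lemma theta_Comp':
  assumes "f \<in> carrier (free_space (diagrams r s))" "g \<in> carrier (free_space (diagrams s t))" "v \<in> Wl t" "w \<in> Wl r"
  shows "theta n r t (Comp (D_Sp n) r s t f g) (v @ rev w) =
    (\<Sum>u\<in>Wl s. eps u * theta n r s f (map dl u @ rev w) * theta n s t g (v @ rev u))"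
proof -
  have "dl = du n" by (rule ext) (simp add: dl_def)
  then show ?thesis using theta_Comp[OF assms] by (simp only: eps_def)
qed

text \<open>The matrix of a composite depends only on the matrices of its factors, and a class is
  determined by its matrix; so composition is well defined on classes.\<close>

lemma C_Comp:
  assumes f: "f \<in> carrier (free_space (diagrams r s))" and g: "g \<in> carrier (free_space (diagrams s t))"
  shows "Comp C r s t (cl r s f) (cl s t g) = cl r t (Comp (D_Sp n) r s t f g)"
proof -
  have e: "cl r t (Comp (D_Sp n) r s t f' g') = cl r t (Comp (D_Sp n) r s t f g)" if "f' \<in> cl r s f" "g' \<in> cl s t g" for f' g'
  proof -
    have f': "f' \<in> carrier (free_space (diagrams r s))" "theta n r s f' = theta n r s f"
      using q.cls_sub[OF f that(1)] q.\<kappa>_cls[OF f that(1)] by auto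
    have g': "g' \<in> carrier (free_space (diagrams s t))" "theta n s t g' = theta n s t g"
      using q.cls_sub[OF g that(2)] q.\<kappa>_cls[OF g that(2)] by auto
    have "theta n r t (Comp (D_Sp n) r s t f' g') = theta n r t (Comp (D_Sp n) r s t f g)"
      by (rule theta_eqI, rule theta_outside, assumption)
        (simp only: theta_Comp'[OF f'(1) g'(1)] theta_Comp'[OF f g] f'(2) g'(2))
    then show ?thesis using q.cls_eq_iff D_Sp_Comp(1)[OF f'(1) g'(1)] D_Sp_Comp(1)[OF f g] by blast
  qed
  have ne: "cl r s f \<noteq> {}" "cl s t g \<noteq> {}" using q.cls_self by blast+
  have "Comp C r s t (cl r s f) (cl s t g) = (\<Union>f'\<in>cl r s f. \<Union>g'\<in>cl s t g. cl r t (Comp (D_Sp n) r s t f g))"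
    unfolding C_simps by (intro SUP_cong refl e)
  also have "\<dots> = cl r t (Comp (D_Sp n) r s t f g)" using ne by simp
  finally show ?thesis .
qed

text \<open>The equivariant map with the same matrix as the class.\<close>

definition G :: "nat \<Rightarrow> nat \<Rightarrow> (diagram \<Rightarrow> complex) set \<Rightarrow> ('v list \<Rightarrow> complex) set \<Rightarrow> ('v list \<Rightarrow> complex) set" where
  "G r s A = inv_into (carrier (Hom (T_Sp V \<omega>) r s)) (Tm r s) (elem_image (theta n r s) A)"

lemma G_cl:
  assumes f: "f \<in> carrier (free_space (diagrams r s))"
  shows "G r s (cl r s f) \<in> carrier (Hom (T_Sp V \<omega>) r s)" "Tm r s (G r s (cl r s f)) = theta n r s f"
proof -
  have "theta n r s f \<in> Tm r s ` carrier (Hom (T_Sp V \<omega>) r s)"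
    using theta_image[of n r s] Tm_image[of r s] f by blast
  then show "G r s (cl r s f) \<in> carrier (Hom (T_Sp V \<omega>) r s)" "Tm r s (G r s (cl r s f)) = theta n r s f"
    unfolding G_def q.elem_\<kappa>[OF f] by (rule inv_into_into, rule f_inv_into_f)
qed

lemma C_cases:
  assumes "A \<in> carrier (Hom C r s)"
  obtains f where "f \<in> carrier (free_space (diagrams r s))" "A = cl r s f"
  using assms unfolding C_simps q.carrier_Q by blast

lemma cl_closed: "f \<in> carrier (free_space (diagrams r s)) \<Longrightarrow> cl r s f \<in> carrier (Hom C r s)"
  unfolding C_simps q.carrier_Q by blast

lemma G_linear: "G r s \<in> linear_maps (Hom C r s) (Hom (T_Sp V \<omega>) r s)"
proof (rule linear_mapsI)
  fix x y c assume "x \<in> carrier (Hom C r s)"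
  then obtain f where f: "f \<in> carrier (free_space (diagrams r s))" "x = cl r s f" by (rule C_cases)
  show "G r s x \<in> carrier (Hom (T_Sp V \<omega>) r s)" unfolding f by (rule G_cl[OF f(1)])
  have cf: "(\<lambda>x. c * f x) \<in> carrier (free_space (diagrams r s))" by (rule fv.subspace_scale[OF free_space_subspace f(1)])
  show "G r s (c \<odot>\<^bsub>Hom C r s\<^esub> x) = c \<odot>\<^bsub>Hom (T_Sp V \<omega>) r s\<^esub> G r s x"
    unfolding f C_simps(1) q.Q_smult
    by (rule hom.eqI[OF G_cl(1)[OF cf] hom.smult_closed[OF G_cl(1)[OF f(1)]]])
      (simp only: G_cl[OF cf] hom.h_smult[OF G_cl(1)[OF f(1)]] G_cl(2)[OF f(1)] theta_scale)
  assume "y \<in> carrier (Hom C r s)"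
  then obtain g where g: "g \<in> carrier (free_space (diagrams r s))" "y = cl r s g" by (rule C_cases)
  have fg: "f + g \<in> carrier (free_space (diagrams r s))" by (rule fv.subspace_add[OF free_space_subspace f(1) g(1)])
  show "G r s (x \<oplus>\<^bsub>Hom C r s\<^esub> y) = G r s x \<oplus>\<^bsub>Hom (T_Sp V \<omega>) r s\<^esub> G r s y"
    unfolding f g C_simps(1) q.Q_add
    by (rule hom.eqI[OF G_cl(1)[OF fg] hom.add_closed[OF G_cl(1)[OF f(1)] G_cl(1)[OF g(1)]]])
      (simp only: G_cl(2)[OF fg] hom.h_add[OF G_cl(1)[OF f(1)] G_cl(1)[OF g(1)]] G_cl(2)[OF f(1)] G_cl(2)[OF g(1)] theta_add)
qed

lemma G_bij: "bij_betw (G r s) (carrier (Hom C r s)) (carrier (Hom (T_Sp V \<omega>) r s))"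
  unfolding bij_betw_def
proof (intro conjI equalityI subsetI)
  show "inj_on (G r s) (carrier (Hom C r s))"
  proof (rule inj_onI)
    fix x y assume x: "x \<in> carrier (Hom C r s)" and y: "y \<in> carrier (Hom C r s)" and e: "G r s x = G r s y"
    obtain f where f: "f \<in> carrier (free_space (diagrams r s))" "x = cl r s f" by (rule C_cases[OF x])
    obtain g where g: "g \<in> carrier (free_space (diagrams r s))" "y = cl r s g" by (rule C_cases[OF y])
    have "theta n r s f = theta n r s g" using e G_cl(2)[OF f(1)] G_cl(2)[OF g(1)] f(2) g(2) by metis
    then show "x = y" using q.cls_eq_iff[OF f(1) g(1)] f(2) g(2) by blast
  qed
  fix \<phi>
  show "\<phi> \<in> carrier (Hom (T_Sp V \<omega>) r s)" if "\<phi> \<in> G r s ` carrier (Hom C r s)"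
    using that linear_mapsD(1)[OF G_linear] by blast
  assume \<phi>: "\<phi> \<in> carrier (Hom (T_Sp V \<omega>) r s)"
  then have "Tm r s \<phi> \<in> theta n r s ` carrier (free_space (diagrams r s))"
    using theta_image[of n r s] Tm_image[of r s] by blast
  then obtain f where f: "f \<in> carrier (free_space (diagrams r s))" "Tm r s \<phi> = theta n r s f" by blast
  have "G r s (cl r s f) = \<phi>" using hom.h_eq_iff[OF G_cl(1)[OF f(1)] \<phi>] G_cl(2)[OF f(1)] f(2) by simp
  then show "\<phi> \<in> G r s ` carrier (Hom C r s)" using cl_closed[OF f(1)] by (metis imageI)
qed

lemma G_Ident: "G r r (Ident C r) = Ident (T_Sp V \<omega>) r"
proof -
  interpret L: linear_category "T_Sp V \<omega>" by (rule T_Sp_linear_category)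
  have s: "single (diagram_id r) \<in> carrier (free_space (diagrams r r))" by (rule single_free[OF diagram_id_closed])
  have "theta n r r (single (diagram_id r)) = Tm r r (Ident (T_Sp V \<omega>) r)"
    by (rule theta_eqI) (simp_all add: T_Sp_simps(6) theta_id Tm_id, simp add: Tm_def)
  then show ?thesis unfolding C_simps
    using hom.h_eq_iff[OF G_cl(1)[OF s] L.Ident_closed] G_cl(2)[OF s] by simp
qed

text \<open>In both categories matrices are composed by the same contraction over the middle
  word.\<close>

lemma G_Comp:
  assumes A: "A \<in> carrier (Hom C r s)" and B: "B \<in> carrier (Hom C s t)"
  shows "G r t (Comp C r s t A B) = Comp (T_Sp V \<omega>) r s t (G r s A) (G s t B)"
proof -
  interpret L: linear_category "T_Sp V \<omega>" by (rule T_Sp_linear_category)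
  obtain f where f: "f \<in> carrier (free_space (diagrams r s))" "A = cl r s f" by (rule C_cases[OF A])
  obtain g where g: "g \<in> carrier (free_space (diagrams s t))" "B = cl s t g" by (rule C_cases[OF B])
  note Gf = G_cl[OF f(1)] and Gg = G_cl[OF g(1)] and Gfg = G_cl[OF D_Sp_Comp(1)[OF f(1) g(1)]]
  have lin: "G r s A \<in> linear_maps (T r) (T s)" "G s t B \<in> linear_maps (T s) (T t)"
    using Gf(1) Gg(1) unfolding f(2) g(2) T_Sp_simps by (auto dest: equivariantD(1))
  have c: "Comp (T_Sp V \<omega>) r s t (G r s A) (G s t B) \<in> carrier (Hom (T_Sp V \<omega>) r t)"
    using linear_mapsD(1)[OF L.Comp_linear_left[OF Gg(1)] Gf(1)] unfolding f(2) g(2) .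
  have "theta n r t (Comp (D_Sp n) r s t f g) = Tm r t (Comp (T_Sp V \<omega>) r s t (G r s A) (G s t B))"
  proof (rule theta_eqI)
    fix v w assume "v \<in> Wl t" "w \<in> Wl r"
    then show "theta n r t (Comp (D_Sp n) r s t f g) (v @ rev w) = Tm r t (Comp (T_Sp V \<omega>) r s t (G r s A) (G s t B)) (v @ rev w)"
      unfolding T_Sp_simps(5) by (simp only: theta_Comp'[OF f(1) g(1)] Tm_compose[OF lin]) (simp only: f(2) g(2) Gf(2) Gg(2))
  qed (simp add: Tm_def)
  then have "Tm r t (G r t (Comp C r s t A B)) = Tm r t (Comp (T_Sp V \<omega>) r s t (G r s A) (G s t B))"
    using Gfg(2) unfolding f(2) g(2) C_Comp[OF f(1) g(1)] by simp
  then show ?thesis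
    using hom.h_eq_iff[OF Gfg(1) c[unfolded f(2) g(2)]] unfolding f(2) g(2) C_Comp[OF f(1) g(1)] by simp
qed

theorem quotient_isomorphic: "isomorphic_lincat C (T_Sp V \<omega>)"
proof (rule isomorphic_lincatI[where G=G, OF T_Sp_linear_category])
  show "vectorspace complex_ring (Hom C r s)" for r s unfolding C_simps by (rule q.Q.is_vectorspace)
  show "Ident C r \<in> carrier (Hom C r r)" for r
    unfolding C_simps(3) by (rule cl_closed[OF single_free[OF diagram_id_closed]])
  show "Comp C r s t A B \<in> carrier (Hom C r t)" if A: "A \<in> carrier (Hom C r s)" and B: "B \<in> carrier (Hom C s t)" for r s t A B
  proof -
    obtain f where f: "f \<in> carrier (free_space (diagrams r s))" "A = cl r s f" by (rule C_cases[OF A])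
    obtain g where g: "g \<in> carrier (free_space (diagrams s t))" "B = cl s t g" by (rule C_cases[OF B])
    show ?thesis unfolding f(2) g(2) C_Comp[OF f(1) g(1)] by (rule cl_closed[OF D_Sp_Comp(1)[OF f(1) g(1)]])
  qed
qed (rule G_linear G_bij G_Ident G_Comp; assumption?)+

section \<open>The basis of noncrossing matchings\<close>

lemma matching_class_eq: "matching_class n r m = cl 0 (2 * r) (single ((`) Inr ` m))"
  by (simp add: matching_class_def D_Sp_simps)

lemma class_closed: "x \<in> ncd n r s \<Longrightarrow> cl r s (single x) \<in> carrier (quot_space (free_space (diagrams r s)) (pfaffian_ideal n r s))"
  unfolding q.carrier_Q by (intro imageI single_free) (simp add: ncd_def)

lemma class_theta: "x \<in> ncd n r s \<Longrightarrow> elem_image (theta n r s) (cl r s (single x)) = PL n (s + r) (Pos r s x)"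
  by (simp add: q.elem_\<kappa> single_free theta_single ncd_def)

text \<open>Distinct diagrams with equal classes would satisfy a linear relation with coefficients
  \<open>1\<close> and \<open>-1\<close>.\<close>

lemma class_inj: "inj_on (\<lambda>x. cl r s (single x)) (ncd n r s)"
proof (rule inj_onI)
  fix x y assume x: "x \<in> ncd n r s" and y: "y \<in> ncd n r s" and e: "cl r s (single x) = cl r s (single y)"
  have "PL n (s + r) (Pos r s x) = PL n (s + r) (Pos r s y)" using class_theta[OF x] class_theta[OF y] e by simp
  then have "(\<Sum>z\<in>ncd n r s. (single x z - single y z) * PL n (s + r) (Pos r s z) xs) = 0" for xs
    using sum_single[OF finite_ncd x] sum_single[OF finite_ncd y] by (simp add: left_diff_distrib sum_subtractf)
  then have "single x x - single y x = 0" by (rule ncd_independent[OF n1 _ x])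
  then show "x = y" by (simp add: single_def split: if_splits)
qed

lemma h_lincomb_class:
  "elem_image (theta n r s) (q.Q.VS.lincomb r s a ((\<lambda>x. cl r s (single x)) ` ncd n r s)) xs =
    (\<Sum>x\<in>ncd n r s. a (cl r s (single x)) * PL n (s + r) (Pos r s x) xs)"
proof -
  have "elem_image (theta n r s) (q.Q.VS.lincomb r s a ((\<lambda>x. cl r s (single x)) ` ncd n r s)) xs =
    (\<Sum>v\<in>(\<lambda>x. cl r s (single x)) ` ncd n r s. a v * elem_image (theta n r s) v xs)"
    by (rule q.Q.h_lincomb) (auto simp: finite_ncd class_closed)
  also have "\<dots> = (\<Sum>x\<in>ncd n r s. a (cl r s (single x)) * PL n (s + r) (Pos r s x) xs)"
    unfolding sum.reindex[OF class_inj] by (intro sum.cong refl) (simp add: class_theta)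
  finally show ?thesis .
qed

text \<open>The classes span by straightening, and they are independent because their matrices
  are.\<close>

lemma ncd_basis: "vectorspace.basis complex_ring (Hom C r s) ((\<lambda>x. cl r s (single x)) ` ncd n r s)"
proof -
  let ?A = "(\<lambda>x. cl r s (single x)) ` ncd n r s"
  have A: "finite ?A" "?A \<subseteq> carrier (quot_space (free_space (diagrams r s)) (pfaffian_ideal n r s))"
    using finite_ncd class_closed by auto
  have "q.Q.VS.lin_indpt r s ?A"
  proof (rule q.Q.VS.finite_lin_indpt2[OF A])
    fix a assume z: "q.Q.VS.lincomb r s a ?A = \<zero>\<^bsub>quot_space (free_space (diagrams r s)) (pfaffian_ideal n r s)\<^esub>"
    have "(\<Sum>x\<in>ncd n r s. a (cl r s (single x)) * PL n (s + r) (Pos r s x) xs) = 0" for xs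
      using h_lincomb_class[of r s a xs] unfolding z q.Q.h_zero by simp
    then have "a (cl r s (single x)) = 0" if "x \<in> ncd n r s" for x
      by (rule ncd_independent[where c="\<lambda>x. a (cl r s (single x))", OF n1 _ that])
    then show "\<forall>v\<in>?A. a v = \<zero>\<^bsub>complex_ring\<^esub>" by auto
  qed
  moreover have "carrier (quot_space (free_space (diagrams r s)) (pfaffian_ideal n r s)) \<subseteq> q.Q.VS.span r s ?A"
  proof
    fix v assume "v \<in> carrier (quot_space (free_space (diagrams r s)) (pfaffian_ideal n r s))"
    then obtain f where f: "f \<in> carrier (free_space (diagrams r s))" "v = cl r s f" unfolding q.carrier_Q by blast
    obtain a \<rho> where \<rho>: "\<rho> \<in> pfaffian_ideal n r s" and fa: "f = \<rho> + (\<Sum>x\<in>ncd n r s. (\<lambda>y. a x * single x y))"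
      using straighten_diagrams[OF f(1)] by blast
    define d where "d v = a (inv_into (ncd n r s) (\<lambda>x. cl r s (single x)) v)" for v
    have d: "d (cl r s (single x)) = a x" if "x \<in> ncd n r s" for x
      unfolding d_def using inv_into_f_f[OF class_inj that] by simp
    have "v = q.Q.VS.lincomb r s d ?A"
    proof (rule q.Q.eqI)
      show "v \<in> carrier (quot_space (free_space (diagrams r s)) (pfaffian_ideal n r s))" by fact
      show "q.Q.VS.lincomb r s d ?A \<in> carrier (quot_space (free_space (diagrams r s)) (pfaffian_ideal n r s))"
        by (rule q.Q.VS.lincomb_closed[OF A(2)]) simp
      fix xs
      have "elem_image (theta n r s) v xs = (\<Sum>x\<in>ncd n r s. a x * PL n (s + r) (Pos r s x) xs)"
        unfolding f(2) q.elem_\<kappa>[OF f(1)] unfolding fa theta_add theta_combination theta_ideal[OF \<rho>] by simp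
      also have "\<dots> = elem_image (theta n r s) (q.Q.VS.lincomb r s d ?A) xs"
        unfolding h_lincomb_class by (intro sum.cong refl) (simp add: d)
      finally show "elem_image (theta n r s) v xs = elem_image (theta n r s) (q.Q.VS.lincomb r s d ?A) xs" .
    qed
    then show "v \<in> q.Q.VS.span r s ?A" unfolding q.Q.VS.span_def using A(1) by auto
  qed
  ultimately show ?thesis unfolding C_simps q.Q.VS.basis_def
    using A(2) q.Q.VS.span_is_subset2[OF A(2)] by blast
qed

theorem noncrossing_basis:
  "inj_on (matching_class n r) (noncrossing_matchings r n) \<and>
    vectorspace.basis complex_ring (Hom C 0 (2 * r)) (matching_class n r ` noncrossing_matchings r n)"
proof
  have "inj ((`) (Inr :: nat \<Rightarrow> nat + nat))" by (rule injI) (simp add: inj_image_eq_iff)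
  then have "inj (\<lambda>m. (`) (Inr :: nat \<Rightarrow> nat + nat) ` m)" by (intro injI) (simp add: inj_image_eq_iff)
  then have inj: "inj_on (\<lambda>m. (`) (Inr :: nat \<Rightarrow> nat + nat) ` m) (noncrossing_matchings r n)" by (rule inj_on_subset) simp
  have m: "matching_class n r = (\<lambda>x. cl 0 (2 * r) (single x)) \<circ> (\<lambda>m. (`) Inr ` m)"
    by (rule ext) (simp add: matching_class_eq)
  show "inj_on (matching_class n r) (noncrossing_matchings r n)"
    unfolding m by (rule comp_inj_on[OF inj]) (unfold noncrossing_matchings_ncd, rule class_inj)
  show "vectorspace.basis complex_ring (Hom C 0 (2 * r)) (matching_class n r ` noncrossing_matchings r n)"
    unfolding m image_comp[symmetric] noncrossing_matchings_ncd by (rule ncd_basis)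
qed

end

theorem mainTheorem2:
  fixes n :: nat and V :: "(complex, 'v) module" and \<omega> :: "'v \<Rightarrow> 'v \<Rightarrow> complex"
  assumes "n \<ge> 1"
    and "vectorspace complex_ring V"
    and "vectorspace.fin_dim complex_ring V"
    and "vectorspace.dim complex_ring V = 2 * n"
    and "nondegenerate_skew_form V \<omega>"
  shows "isomorphic_lincat (quot_cat (D_Sp n) (pfaffian_ideal n)) (T_Sp V \<omega>) \<and>
    (\<forall>r. inj_on (matching_class n r) (noncrossing_matchings r n) \<and>
         vectorspace.basis complex_ring (Hom (quot_cat (D_Sp n) (pfaffian_ideal n)) 0 (2 * r))
           (matching_class n r ` noncrossing_matchings r n))"
proof -
  interpret symp_space n V \<omega> by (rule symp_space.intro[OF assms])
  obtain b where "hyperbolic n b" using hyperbolic_exists[OF order_refl] by blast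
  then interpret symp_basis n V \<omega> b by unfold_locales
  show ?thesis using quotient_isomorphic noncrossing_basis by blast
qed

end
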